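(* Let $k$ be a commutative unital ring and let $\mathcal C$ be a small dg-category over $k$. Then its templicial dg-nerve $N^{dg}_k(\mathcal C)$ is a quasi-category in modules.
   Context: Quivers. For a set $S$, $k\mathrm{Quiv}_S$ is the category of families $Q=(Q(a,b))_{a,b\in S}$ of $k$-modules with componentwise morphisms; it is monoidal with $(Q\otimes_S P)(a,b)=\bigoplus_{c\in S}Q(a,c)\otimes P(c,b)$ and unit $k_S$, where $k_S(a,b)=k$ if $a=b$ and $0$ otherwise. Finite intervals. $\mathbf{\Delta}_f$ has objects $[n]=\{0,\dots,n\}$, $n\ge 0$, and morphisms the order-preserving maps $f:[m]\to[n]$ with $f(0)=0$, $f(m)=n$; it is monoidal with $[m]+[n]=[m+n]$, unit $[0]$, $(f+g)(i)=f(i)$ for $i\le m$ and $m'+g(i-m)$ for $i\ge m$ (where $f:[m]\to[m']$). Templicial modules. A templicial $k$-module is a pair $(X,S)$ with $S$ a set and $X:\mathbf{\Delta}_f^{op}\to k\mathrm{Quiv}_S$ a colax monoidal functor, with comultiplications $\mu_{p,q}:X_{p+q}\to X_p\otimes_S X_q$ and counit $\epsilon:X_0\to k_S$ an isomorphism. For a simplicial set $K$, $\tilde F(K)$ is the templicial $k$-module with vertex set $K_0$, $\tilde F(K)_n(a,b)$ the free $k$-module on the $n$-simplices of $K$ with first vertex $a$ and last vertex $b$, inner faces and degeneracies those of $K$, and $\mu_{p,q}$ induced by $x\mapsto x|_{\{0,\dots,p\}}\otimes x|_{\{p,\dots,p+q\}}$. Necklaces. $\mathcal Nec$ has objects $(T,p)$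 with $p\ge0$ and $T\subseteq[p]$ containing $0$ and $p$; a morphism $(T,p)\to(U,q)$ is $f:[p]\to[q]$ in $\mathbf{\Delta}_f$ with $U\subseteq f(T)$. For $T=\{0=t_0<\dots<t_k=p\}$ put $X_T=X_{t_1}\otimes_S X_{t_2-t_1}\otimes_S\cdots\otimes_S X_{p-t_{k-1}}$ ($k_S$ if $p=0$), and let $\mu_T:X_p\to X_T$ be the iterated comultiplication ($\epsilon$ if $p=0$, identity if $k=1$). This extends to a functor $X_\bullet:\mathcal Nec^{op}\to k\mathrm{Quiv}_S$: each $f:(T,p)\to(U,q)$ factors uniquely as the active map $f:(T,p)\to(f(T),q)$ followed by the inert map $\mathrm{id}_{[q]}:(f(T),q)\to(U,q)$. For an inert map $(T,p)\to(U,p)$, $U=\{0=u_0<\dots<u_l=p\}\subseteq T$, $X_U\to X_T$ is $\mu_{T_1}\otimes\cdots\otimes\mu_{T_l}$ with $T_i=\{t-u_{i-1}: t\in T, u_{i-1}\le t\le u_i\}$. For an active map $f$, write uniquely $f=f_1+\dots+f_k$ with $f_i:[t_i-t_{i-1}]\to[f(t_i)-f(t_{i-1})]$ in $\mathbf{\Delta}_f$; then $X_{f(T)}\to X_T$ is $X_{f(T)}\simeq X_{f(t_1)}\otimes_S\cdots\otimes_S X_{q-f(t_{k-1})}\xrightarrow{X(f_1)\otimes\cdots\otimes X(f_k)}X_T$, the isomorphism using $X_0\simeq k_S$. Evaluating at $a,b\in S$ gives $X_\bullet(a,b):\mathcal Nec^{op}\to\mathrm{Mod}(k)$. Quasi-categories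 in modules. A functor $Y:\mathcal Nec^{op}\to\mathrm{Mod}(k)$ lifts inner horns if for all $0<j<n$ every natural transformation $\tilde F(\Lambda^n_j)_\bullet(0,n)\to Y$ extends along the map $\tilde F(\Lambda^n_j)_\bullet(0,n)\to\tilde F(\Delta^n)_\bullet(0,n)$ induced by the $j$th horn inclusion. A templicial $k$-module $(X,S)$ is a quasi-category in modules if $X_\bullet(a,b)$ lifts inner horns for all $a,b\in S$. Templicial dg-nerve. A dg-category is a category enriched in (unbounded, homologically graded) chain complexes over $k$, with composition written $m:\mathcal C(A,B)\otimes\mathcal C(B,C)\to\mathcal C(A,C)$. $\mathbf{\Delta}_+$ is the category of ordinals $[n]$, $n\ge -1$, and order maps, with join $[p]\star[q]=[p+q+1]$; $S^+\mathrm{Mod}(k)=\mathrm{Fun}(\mathbf{\Delta}_+^{op},\mathrm{Mod}(k))$ with Day convolution $(A\star B)_n=\bigoplus_{k+l+1=n}A_k\otimes B_l$. For a category $\mathcal D$ enriched in it with object set $S$ and finite linearly ordered $J$ write $\mathcal D_J=\mathcal D_{|J|-1}\in k\mathrm{Quiv}_S$; $\mathcal D$ has maps $\mathcal D(g):\mathcal D_J\to\mathcal D_I$ for order maps $g:I\to J$, compositions $m_{I,J}:\mathcal D_I\otimes_S\mathcal D_J\to\mathcal D_{I\sqcup J}$ ($\sqcup$ ordered disjoint union) and unit $u:k_S\to\mathcal D_\emptyset$; iterated compositions are $m_{I_1,\dots,I_p}$ ($u$ if $p=0$, identity if $p=1$). For a chain complex $C$ and finite linearly ordered $J$, $\Gamma^+(C)_J$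 is the module of families $(a_I)_{I\subseteq J}$, $a_I\in C_{|I|}$, with $\partial(a_I)=\sum_{j=1}^p(-1)^{j-1}a_{I\setminus\{i_j\}}$ for $I=\{i_1<\dots<i_p\}$; an order map $h:J'\to J$ acts by $(a_I)\mapsto(b_{I'})$, $b_{I'}=a_{h(I')}$ if $h|_{I'}$ is injective, $0$ otherwise. It is lax monoidal via $(a_I)\otimes(b_I)\mapsto(a_{K\cap J_1}\otimes b_{K\cap J_2})_{K\subseteq J_1\sqcup J_2}$; applied to hom-complexes it turns a dg-category $\mathcal C$ into an $S^+\mathrm{Mod}(k)$-category $\Gamma^+(\mathcal C)$. For a necklace $(T,n)$, $T=\{0=t_0<\dots<t_k=n\}$, put $T^c_i=\{t_{i-1}+1,\dots,t_i-1\}$ and $\mathcal D^\otimes_T=\mathcal D_{T^c_1}\otimes_S\cdots\otimes_S\mathcal D_{T^c_k}$ ($k_S$ if $n=0$). $\mathcal T(\mathcal D)$ is the templicial module with vertex set $S$, $\mathcal T(\mathcal D)_n=\bigoplus_{(T,n)}\mathcal D^\otimes_T$; for $f:[m]\to[n]$ in $\mathbf{\Delta}_f$, $\mathcal T(\mathcal D)(f)$ maps the summand $T$ to the summand $U=f^{-1}(T)=\{0=u_0<\dots<u_l=m\}$ by $\bigotimes_{j=1}^l\mathcal D(f|_{U^c_j})\,m_{T^c_{p_{j-1}+1},\dots,T^c_{p_j}}$ where $f(u_j)=t_{p_j}$; $\mu_{k,l}$ is the projection onto $\bigoplus_{(T,k+l),\,k\in T}\mathcal D^\otimes_T\simeq\mathcal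 T(\mathcal D)_k\otimes_S\mathcal T(\mathcal D)_l$. Finally $N^{dg}_k(\mathcal C)=\mathcal T(\Gamma^+(\mathcal C))$. *)

theory Defs
  imports "HOL.Hull" "HOL-Algebra.Module" "HOL-Algebra.AbelCoset"
begin

section \<open>Modules over a commutative ring\<close>

text \<open>
  Modules are the records of \<^locale>\<open>module\<close>. Their ring fields \<open>mult\<close> and \<open>one\<close> play no role
  and are left \<open>undefined\<close>.
\<close>

definition lin_maps ::
  "('k,'r) ring_scheme \<Rightarrow> ('k,'m) module \<Rightarrow> ('k,'n) module \<Rightarrow> ('m \<Rightarrow> 'n) set" where
  "lin_maps R M N = {h \<in> carrier M \<rightarrow> carrier N.
     (\<forall>x\<in>carrier M. \<forall>y\<in>carrier M. h (x \<oplus>\<^bsub>M\<^esub> y) = h x \<oplus>\<^bsub>N\<^esub> h y) \<and>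
     (\<forall>r\<in>carrier R. \<forall>x\<in>carrier M. h (r \<odot>\<^bsub>M\<^esub> x) = r \<odot>\<^bsub>N\<^esub> h x)}"

definition free_module :: "('k,'r) ring_scheme \<Rightarrow> 'b set \<Rightarrow> ('k, 'b \<Rightarrow> 'k) module" where
  "free_module R B = \<lparr>
     carrier = {f. finite {x. f x \<noteq> \<zero>\<^bsub>R\<^esub>} \<and> (\<forall>x. f x \<in> carrier R) \<and> (\<forall>x. x \<notin> B \<longrightarrow> f x = \<zero>\<^bsub>R\<^esub>)},
     mult = undefined, one = undefined,
     zero = (\<lambda>x. \<zero>\<^bsub>R\<^esub>), add = (\<lambda>f g x. f x \<oplus>\<^bsub>R\<^esub> g x), smult = (\<lambda>r f x. r \<otimes>\<^bsub>R\<^esub> f x)\<rparr>"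

definition single :: "('k,'r) ring_scheme \<Rightarrow> 'b \<Rightarrow> 'b \<Rightarrow> 'k" where
  "single R b = (\<lambda>x. if x = b then \<one>\<^bsub>R\<^esub> else \<zero>\<^bsub>R\<^esub>)"

text \<open>The linear extension to a free module of a map \<open>\<phi>\<close> given on its basis.\<close>

definition lin_ext ::
  "('k,'r) ring_scheme \<Rightarrow> ('k,'m) module \<Rightarrow> ('b \<Rightarrow> 'm) \<Rightarrow> ('b \<Rightarrow> 'k) \<Rightarrow> 'm" where
  "lin_ext R M \<phi> f = finsum M (\<lambda>x. f x \<odot>\<^bsub>M\<^esub> \<phi> x) {x. f x \<noteq> \<zero>\<^bsub>R\<^esub>}"

definition quot_module :: "('k,'m) module \<Rightarrow> 'm set \<Rightarrow> ('k, 'm set) module" where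
  "quot_module M N = \<lparr>
     carrier = a_rcosets\<^bsub>M\<^esub> N, mult = undefined, one = undefined,
     zero = N, add = (\<lambda>A B. A <+>\<^bsub>M\<^esub> B), smult = (\<lambda>r A. N <+>\<^bsub>M\<^esub> ((\<lambda>x. r \<odot>\<^bsub>M\<^esub> x) ` A))\<rparr>"

text \<open>The direct sum over a finite index set.\<close>

definition direct_sum :: "'i set \<Rightarrow> ('i \<Rightarrow> ('k,'m) module) \<Rightarrow> ('k, 'i \<Rightarrow> 'm) module" where
  "direct_sum I M = \<lparr>
     carrier = (\<Pi>\<^sub>E i\<in>I. carrier (M i)), mult = undefined, one = undefined,
     zero = (\<lambda>i\<in>I. \<zero>\<^bsub>M i\<^esub>), add = (\<lambda>f g. \<lambda>i\<in>I. f i \<oplus>\<^bsub>M i\<^esub> g i),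
     smult = (\<lambda>r f. \<lambda>i\<in>I. r \<odot>\<^bsub>M i\<^esub> f i)\<rparr>"

definition summand_incl :: "'i set \<Rightarrow> ('i \<Rightarrow> ('k,'m) module) \<Rightarrow> 'i \<Rightarrow> 'm \<Rightarrow> 'i \<Rightarrow> 'm" where
  "summand_incl I M i x = (\<lambda>j\<in>I. if j = i then x else \<zero>\<^bsub>M j\<^esub>)"


section \<open>Quivers and their tensor products\<close>

type_synonym ('k,'o,'m) quiver = "'o \<Rightarrow> 'o \<Rightarrow> ('k,'m) module"

type_synonym ('k,'o,'m) tens = "('o list \<times> 'm list \<Rightarrow> 'k) set"

text \<open>
  The tensor product over \<open>S\<close> of a list of quivers is taken in one step, so that no bracketing
  occurs. Its component at \<open>(a,b)\<close> is generated by the pairs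
  \<open>([c\<^sub>0,\<dots>,c\<^sub>l], [x\<^sub>1,\<dots>,x\<^sub>l])\<close> with \<open>c\<^sub>0 = a\<close>, \<open>c\<^sub>l = b\<close> and \<open>x\<^sub>i \<in> Q\<^sub>i(c\<^sub>i\<^sub>-\<^sub>1,c\<^sub>i)\<close>, subject to
  multilinearity in the \<open>x\<^sub>i\<close>. This is the direct sum over all \<open>c\<^sub>1,\<dots>,c\<^sub>l\<^sub>-\<^sub>1\<close> of the modules
  \<open>Q\<^sub>1(a,c\<^sub>1) \<otimes> \<dots> \<otimes> Q\<^sub>l(c\<^sub>l\<^sub>-\<^sub>1,b)\<close>; for \<open>l = 0\<close> it is the unit quiver, for \<open>l = 1\<close> it is \<open>Q\<^sub>1\<close>.
\<close>

definition paths :: "'o set \<Rightarrow> ('k,'o,'m) quiver list \<Rightarrow> 'o \<Rightarrow> 'o \<Rightarrow> ('o list \<times> 'm list) set" where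
  "paths S Qs a b = {(cs,xs).
     length cs = Suc (length Qs) \<and> length xs = length Qs \<and> set cs \<subseteq> S \<and> hd cs = a \<and> last cs = b \<and>
     (\<forall>i<length Qs. xs ! i \<in> carrier ((Qs ! i) (cs ! i) (cs ! Suc i)))}"

definition multilin_rels ::
  "('k,'r) ring_scheme \<Rightarrow> 'o set \<Rightarrow> ('k,'o,'m) quiver list \<Rightarrow> 'o \<Rightarrow> 'o \<Rightarrow> ('o list \<times> 'm list \<Rightarrow> 'k) set"
  where
  "multilin_rels R S Qs a b = (let F = free_module R (paths S Qs a b) in
     {single R (cs, xs[i := x \<oplus>\<^bsub>(Qs ! i) (cs ! i) (cs ! Suc i)\<^esub> y])
        \<ominus>\<^bsub>F\<^esub> (single R (cs, xs[i := x]) \<oplus>\<^bsub>F\<^esub> single R (cs, xs[i := y])) | cs xs i x y.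
        (cs,xs) \<in> paths S Qs a b \<and> i < length Qs \<and>
        x \<in> carrier ((Qs ! i) (cs ! i) (cs ! Suc i)) \<and> y \<in> carrier ((Qs ! i) (cs ! i) (cs ! Suc i))} \<union>
     {single R (cs, xs[i := r \<odot>\<^bsub>(Qs ! i) (cs ! i) (cs ! Suc i)\<^esub> x])
        \<ominus>\<^bsub>F\<^esub> (r \<odot>\<^bsub>F\<^esub> single R (cs, xs[i := x])) | cs xs i r x.
        (cs,xs) \<in> paths S Qs a b \<and> i < length Qs \<and> r \<in> carrier R \<and>
        x \<in> carrier ((Qs ! i) (cs ! i) (cs ! Suc i))})"

definition multilin_submod ::
  "('k,'r) ring_scheme \<Rightarrow> 'o set \<Rightarrow> ('k,'o,'m) quiver list \<Rightarrow> 'o \<Rightarrow> 'o \<Rightarrow> ('o list \<times> 'm list \<Rightarrow> 'k) set"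
  where
  "multilin_submod R S Qs a b =
     (\<lambda>N. submodule N R (free_module R (paths S Qs a b))) hull multilin_rels R S Qs a b"

definition tensor ::
  "('k,'r) ring_scheme \<Rightarrow> 'o set \<Rightarrow> ('k,'o,'m) quiver list \<Rightarrow> ('k, 'o, ('k,'o,'m) tens) quiver" where
  "tensor R S Qs a b = quot_module (free_module R (paths S Qs a b)) (multilin_submod R S Qs a b)"

definition pure ::
  "('k,'r) ring_scheme \<Rightarrow> 'o set \<Rightarrow> ('k,'o,'m) quiver list \<Rightarrow> 'o list \<Rightarrow> 'm list \<Rightarrow> ('k,'o,'m) tens" where
  "pure R S Qs cs xs =
     multilin_submod R S Qs (hd cs) (last cs)
       +>\<^bsub>free_module R (paths S Qs (hd cs) (last cs))\<^esub> single R (cs,xs)"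

text \<open>The linear map on a tensor product that a multilinear map \<open>\<phi>\<close> on generators induces.\<close>

definition tensor_lift ::
  "('k,'r) ring_scheme \<Rightarrow> ('k,'n) module \<Rightarrow> ('o list \<times> 'm list \<Rightarrow> 'n) \<Rightarrow> ('k,'o,'m) tens \<Rightarrow> 'n" where
  "tensor_lift R M \<phi> A = the_elem (lin_ext R M \<phi> ` A)"

text \<open>
  \<open>tensor_append\<close> is the canonical map from \<open>(\<Otimes>Qs)(a,c) \<otimes> (\<Otimes>Ps)(c,b)\<close> to \<open>(\<Otimes>(Qs @ Ps))(a,b)\<close>,
  and \<open>tensor_concat\<close> its iteration along the vertices \<open>cs\<close>.
\<close>

definition tensor_append ::
  "('k,'r) ring_scheme \<Rightarrow> 'o set \<Rightarrow> ('k,'o,'m) quiver list \<Rightarrow> ('k,'o,'m) quiver list \<Rightarrow> 'o \<Rightarrow> 'o \<Rightarrow>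
    ('k,'o,'m) tens \<Rightarrow> ('k,'o,'m) tens \<Rightarrow> ('k,'o,'m) tens" where
  "tensor_append R S Qs Ps a b A B =
     tensor_lift R (tensor R S (Qs @ Ps) a b) (\<lambda>(cs,xs).
       tensor_lift R (tensor R S (Qs @ Ps) a b) (\<lambda>(ds,ys).
         pure R S (Qs @ Ps) (cs @ tl ds) (xs @ ys)) B) A"

fun tensor_concat ::
  "('k,'r) ring_scheme \<Rightarrow> 'o set \<Rightarrow> ('k,'o,'m) quiver list list \<Rightarrow> 'o list \<Rightarrow>
    ('k,'o,'m) tens list \<Rightarrow> ('k,'o,'m) tens" where
  "tensor_concat R S [] cs As = pure R S [] cs []"
| "tensor_concat R S (Qs # Qss) cs As =
     tensor_append R S Qs (concat Qss) (hd cs) (last cs) (hd As) (tensor_concat R S Qss (tl cs) (tl As))"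

text \<open>
  The linear map from \<open>(Q\<^sub>1 \<otimes> \<dots> \<otimes> Q\<^sub>l)(a,b)\<close> to \<open>(\<Otimes>(concat Qss))(a,b)\<close> that quiver morphisms
  \<open>h\<^sub>i\<close> from \<open>Q\<^sub>i\<close> to \<open>\<Otimes>(Qss ! i)\<close> induce.
\<close>

definition tensor_maps ::
  "('k,'r) ring_scheme \<Rightarrow> 'o set \<Rightarrow> ('k,'o,'n) quiver list list \<Rightarrow>
    ('o \<Rightarrow> 'o \<Rightarrow> 'm \<Rightarrow> ('k,'o,'n) tens) list \<Rightarrow> 'o \<Rightarrow> 'o \<Rightarrow> ('k,'o,'m) tens \<Rightarrow> ('k,'o,'n) tens" where
  "tensor_maps R S Qss hs a b =
     tensor_lift R (tensor R S (concat Qss) a b) (\<lambda>(cs,xs).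
       tensor_concat R S Qss cs (map (\<lambda>i. (hs ! i) (cs ! i) (cs ! Suc i) (xs ! i)) [0..<length xs]))"

definition to_tensor ::
  "('k,'r) ring_scheme \<Rightarrow> 'o set \<Rightarrow> ('k,'o,'m) quiver \<Rightarrow> 'o \<Rightarrow> 'o \<Rightarrow> 'm \<Rightarrow> ('k,'o,'m) tens" where
  "to_tensor R S Q a b x = pure R S [Q] [a,b] [x]"

definition unit_quiver :: "('k,'r) ring_scheme \<Rightarrow> ('k,'o,'k) quiver" where
  "unit_quiver R a b = \<lparr>
     carrier = (if a = b then carrier R else {\<zero>\<^bsub>R\<^esub>}), mult = undefined, one = undefined,
     zero = \<zero>\<^bsub>R\<^esub>, add = (\<lambda>x y. x \<oplus>\<^bsub>R\<^esub> y), smult = (\<lambda>x y. x \<otimes>\<^bsub>R\<^esub> y)\<rparr>"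

text \<open>The identification of the unit quiver with the empty tensor product.\<close>

definition unit_to_tensor :: "('k,'r) ring_scheme \<Rightarrow> 'o set \<Rightarrow> 'o \<Rightarrow> 'o \<Rightarrow> 'k \<Rightarrow> ('k,'o,'m) tens" where
  "unit_to_tensor R S a b r =
     (if a = b then r \<odot>\<^bsub>tensor R S [] a b\<^esub> pure R S [] [a] [] else \<zero>\<^bsub>tensor R S [] a b\<^esub>)"


section \<open>Finite intervals and templicial modules\<close>

definition order_maps :: "nat set \<Rightarrow> nat set \<Rightarrow> (nat \<Rightarrow> nat) set" where
  "order_maps I J = {f \<in> I \<rightarrow>\<^sub>E J. mono_on I f}"

definition interval_maps :: "nat \<Rightarrow> nat \<Rightarrow> (nat \<Rightarrow> nat) set" where
  "interval_maps m n = {f \<in> order_maps {..m} {..n}. f 0 = 0 \<and> f m = n}"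

definition interval_sum :: "nat \<Rightarrow> nat \<Rightarrow> nat \<Rightarrow> (nat \<Rightarrow> nat) \<Rightarrow> (nat \<Rightarrow> nat) \<Rightarrow> nat \<Rightarrow> nat" where
  "interval_sum m m' n f g = (\<lambda>i\<in>{..m + n}. if i \<le> m then f i else m' + g (i - m))"

text \<open>
  The module \<open>tmod X n a b\<close> is \<open>X\<^sub>n(a,b)\<close>; for \<open>f : [m] \<rightarrow> [n]\<close>, \<open>tmap X m n f\<close> is
  \<open>X(f) : X\<^sub>n \<rightarrow> X\<^sub>m\<close>; and \<open>tcomult X p q\<close> is \<open>\<mu>\<^sub>p\<^sub>,\<^sub>q\<close>.
\<close>

record ('k,'o,'x) templicial =
  tvert :: "'o set"
  tmod :: "nat \<Rightarrow> ('k,'o,'x) quiver"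
  tmap :: "nat \<Rightarrow> nat \<Rightarrow> (nat \<Rightarrow> nat) \<Rightarrow> 'o \<Rightarrow> 'o \<Rightarrow> 'x \<Rightarrow> 'x"
  tcomult :: "nat \<Rightarrow> nat \<Rightarrow> 'o \<Rightarrow> 'o \<Rightarrow> 'x \<Rightarrow> ('k,'o,'x) tens"
  tcounit :: "'o \<Rightarrow> 'o \<Rightarrow> 'x \<Rightarrow> 'k"

abbreviation tsingle ::
  "('k,'r) ring_scheme \<Rightarrow> ('k,'o,'x) templicial \<Rightarrow> nat \<Rightarrow> 'o \<Rightarrow> 'o \<Rightarrow> 'x \<Rightarrow> ('k,'o,'x) tens" where
  "tsingle R X n \<equiv> to_tensor R (tvert X) (tmod X n)"

abbreviation tcounit_tensor ::
  "('k,'r) ring_scheme \<Rightarrow> ('k,'o,'x) templicial \<Rightarrow> 'o \<Rightarrow> 'o \<Rightarrow> 'x \<Rightarrow> ('k,'o,'x) tens" where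
  "tcounit_tensor R X a b x \<equiv> unit_to_tensor R (tvert X) a b (tcounit X a b x)"

locale templicial_module = cring R for R :: "('k,'r) ring_scheme" (structure) +
  fixes X :: "('k,'o,'x) templicial"
  assumes tmod_module:
      "\<lbrakk>a \<in> tvert X; b \<in> tvert X\<rbrakk> \<Longrightarrow> module R (tmod X n a b)"
    and tmap_linear:
      "\<lbrakk>f \<in> interval_maps m n; a \<in> tvert X; b \<in> tvert X\<rbrakk>
        \<Longrightarrow> tmap X m n f a b \<in> lin_maps R (tmod X n a b) (tmod X m a b)"
    and tmap_id:
      "\<lbrakk>a \<in> tvert X; b \<in> tvert X; x \<in> carrier (tmod X n a b)\<rbrakk>
        \<Longrightarrow> tmap X n n (\<lambda>i\<in>{..n}. i) a b x = x"
    and tmap_comp: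
      "\<lbrakk>f \<in> interval_maps l m; g \<in> interval_maps m n; a \<in> tvert X; b \<in> tvert X;
        x \<in> carrier (tmod X n a b)\<rbrakk>
        \<Longrightarrow> tmap X l n (compose {..l} g f) a b x = tmap X l m f a b (tmap X m n g a b x)"
    and tcomult_linear:
      "\<lbrakk>a \<in> tvert X; b \<in> tvert X\<rbrakk> \<Longrightarrow> tcomult X p q a b
        \<in> lin_maps R (tmod X (p + q) a b) (tensor R (tvert X) [tmod X p, tmod X q] a b)"
    and tcomult_natural:
      "\<lbrakk>f \<in> interval_maps p p'; g \<in> interval_maps q q'; a \<in> tvert X; b \<in> tvert X;
        x \<in> carrier (tmod X (p' + q') a b)\<rbrakk>
        \<Longrightarrow> tcomult X p q a b (tmap X (p + q) (p' + q') (interval_sum p p' q f g) a b x)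
          = tensor_maps R (tvert X) [[tmod X p], [tmod X q]]
              [\<lambda>c d y. tsingle R X p c d (tmap X p p' f c d y),
               \<lambda>c d y. tsingle R X q c d (tmap X q q' g c d y)] a b (tcomult X p' q' a b x)"
    and tcounit_linear:
      "\<lbrakk>a \<in> tvert X; b \<in> tvert X\<rbrakk> \<Longrightarrow> tcounit X a b \<in> lin_maps R (tmod X 0 a b) (unit_quiver R a b)"
    and tcounit_iso:
      "\<lbrakk>a \<in> tvert X; b \<in> tvert X\<rbrakk>
        \<Longrightarrow> bij_betw (tcounit X a b) (carrier (tmod X 0 a b)) (carrier (unit_quiver R a b))"
    and coassoc:
      "\<lbrakk>a \<in> tvert X; b \<in> tvert X; x \<in> carrier (tmod X (p + q + r) a b)\<rbrakk>
        \<Longrightarrow> tensor_maps R (tvert X) [[tmod X p, tmod X q], [tmod X r]]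
              [tcomult X p q, tsingle R X r] a b (tcomult X (p + q) r a b x)
          = tensor_maps R (tvert X) [[tmod X p], [tmod X q, tmod X r]]
              [tsingle R X p, tcomult X q r] a b (tcomult X p (q + r) a b x)"
    and counit_left:
      "\<lbrakk>a \<in> tvert X; b \<in> tvert X; x \<in> carrier (tmod X n a b)\<rbrakk>
        \<Longrightarrow> tensor_maps R (tvert X) [[], [tmod X n]]
              [tcounit_tensor R X, tsingle R X n] a b (tcomult X 0 n a b x) = tsingle R X n a b x"
    and counit_right:
      "\<lbrakk>a \<in> tvert X; b \<in> tvert X; x \<in> carrier (tmod X n a b)\<rbrakk>
        \<Longrightarrow> tensor_maps R (tvert X) [[tmod X n], []]
              [tsingle R X n, tcounit_tensor R X] a b (tcomult X n 0 a b x) = tsingle R X n a b x"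


section \<open>Necklaces\<close>

type_synonym necklace = "nat set \<times> nat"

definition necklaces :: "nat \<Rightarrow> nat set set" where
  "necklaces n = {T. T \<subseteq> {..n} \<and> 0 \<in> T \<and> n \<in> T}"

definition nec_obs :: "necklace set" where
  "nec_obs = {(T,p). T \<in> necklaces p}"

definition nec_maps :: "necklace \<Rightarrow> necklace \<Rightarrow> (nat \<Rightarrow> nat) set" where
  "nec_maps = (\<lambda>(T,p) (U,q). {f \<in> interval_maps p q. U \<subseteq> f ` T})"

text \<open>The pairs of consecutive elements of \<open>T\<close>, and their differences.\<close>

definition beads :: "nat set \<Rightarrow> (nat \<times> nat) list" where
  "beads T = zip (sorted_list_of_set T) (tl (sorted_list_of_set T))"

definition bead_lengths :: "nat set \<Rightarrow> nat list" where
  "bead_lengths T = map (\<lambda>(t,t'). t' - t) (beads T)"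

definition nec_quivers :: "('k,'o,'x) templicial \<Rightarrow> nat set \<Rightarrow> ('k,'o,'x) quiver list" where
  "nec_quivers X T = map (tmod X) (bead_lengths T)"

definition nec_mod ::
  "('k,'r) ring_scheme \<Rightarrow> ('k,'o,'x) templicial \<Rightarrow> nat set \<Rightarrow> ('k,'o,('k,'o,'x) tens) quiver" where
  "nec_mod R X T = tensor R (tvert X) (nec_quivers X T)"

text \<open>The iterated comultiplication \<open>\<mu>\<^sub>T\<close>, in terms of the bead lengths of \<open>T\<close>.\<close>

fun iter_comult ::
  "('k,'r) ring_scheme \<Rightarrow> ('k,'o,'x) templicial \<Rightarrow> nat list \<Rightarrow> 'o \<Rightarrow> 'o \<Rightarrow> 'x \<Rightarrow> ('k,'o,'x) tens" where
  "iter_comult R X [] a b x = tcounit_tensor R X a b x"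
| "iter_comult R X [p] a b x = tsingle R X p a b x"
| "iter_comult R X (p # q # qs) a b x =
     tensor_maps R (tvert X) [[tmod X p], map (tmod X) (q # qs)]
       [tsingle R X p, iter_comult R X (q # qs)] a b (tcomult X p (sum_list (q # qs)) a b x)"

definition inert_map ::
  "('k,'r) ring_scheme \<Rightarrow> ('k,'o,'x) templicial \<Rightarrow> nat set \<Rightarrow> nat set \<Rightarrow> 'o \<Rightarrow> 'o \<Rightarrow>
    ('k,'o,'x) tens \<Rightarrow> ('k,'o,'x) tens" where
  "inert_map R X T U =
     (let Ts = map (\<lambda>(u,v). (\<lambda>t. t - u) ` (T \<inter> {u..v})) (beads U) in
       tensor_maps R (tvert X) (map (nec_quivers X) Ts) (map (\<lambda>T'. iter_comult R X (bead_lengths T')) Ts))"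

text \<open>
  On a generator \<open>([c\<^sub>0,\<dots>], [x\<^sub>1,\<dots>])\<close> of \<open>X\<^bsub>f(T)\<^esub>\<close>, the isomorphism with
  \<open>X\<^bsub>f(t\<^sub>1)\<^esub> \<otimes> \<dots> \<otimes> X\<^bsub>q-f(t\<^sub>k\<^sub>-\<^sub>1)\<^esub>\<close> inserts \<open>\<epsilon>\<^sup>-\<^sup>1(1) \<in> X\<^sub>0(c,c)\<close> at every bead of \<open>T\<close> that \<open>f\<close>
  collapses. Here \<open>pos t\<close> is the position of \<open>f t\<close> in \<open>f(T)\<close>.
\<close>

definition active_map ::
  "('k,'r) ring_scheme \<Rightarrow> ('k,'o,'x) templicial \<Rightarrow> nat set \<Rightarrow> (nat \<Rightarrow> nat) \<Rightarrow> 'o \<Rightarrow> 'o \<Rightarrow>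
    ('k,'o,'x) tens \<Rightarrow> ('k,'o,'x) tens" where
  "active_map R X T f a b =
     tensor_lift R (nec_mod R X T a b) (\<lambda>(cs,xs).
       let pos = (\<lambda>t. card {v \<in> f ` T. v < f t}) in
       pure R (tvert X) (nec_quivers X T)
         (map (\<lambda>t. cs ! pos t) (sorted_list_of_set T))
         (map (\<lambda>(t,t'). tmap X (t' - t) (f t' - f t) (\<lambda>i\<in>{..t' - t}. f (t + i) - f t)
                 (cs ! pos t) (cs ! pos t')
                 (if f t = f t'
                  then the_inv_into (carrier (tmod X 0 (cs ! pos t) (cs ! pos t)))
                         (tcounit X (cs ! pos t) (cs ! pos t)) \<one>\<^bsub>R\<^esub>
                  else xs ! pos t))
            (beads T)))"

text \<open>
  For a functor \<open>Y\<close> from necklaces (contravariant) to modules and \<open>f : N \<rightarrow> N'\<close>,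
  \<open>nmap Y N N' f\<close> is \<open>Y(f) : Y(N') \<rightarrow> Y(N)\<close>.
\<close>

record ('k,'y) nec_functor =
  nob :: "necklace \<Rightarrow> ('k,'y) module"
  nmap :: "necklace \<Rightarrow> necklace \<Rightarrow> (nat \<Rightarrow> nat) \<Rightarrow> 'y \<Rightarrow> 'y"

definition nec_of_templicial ::
  "('k,'r) ring_scheme \<Rightarrow> ('k,'o,'x) templicial \<Rightarrow> 'o \<Rightarrow> 'o \<Rightarrow> ('k, ('k,'o,'x) tens) nec_functor" where
  "nec_of_templicial R X a b = \<lparr>
     nob = (\<lambda>(T,p). nec_mod R X T a b),
     nmap = (\<lambda>(T,p) (U,q) f z. active_map R X T f a b (inert_map R X (f ` T) U a b z))\<rparr>"

definition nec_trans ::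
  "('k,'r) ring_scheme \<Rightarrow> ('k,'y) nec_functor \<Rightarrow> ('k,'z) nec_functor \<Rightarrow> (necklace \<Rightarrow> 'y \<Rightarrow> 'z) set" where
  "nec_trans R Y Z = {\<alpha>.
     (\<forall>N\<in>nec_obs. \<alpha> N \<in> lin_maps R (nob Y N) (nob Z N)) \<and>
     (\<forall>N\<in>nec_obs. \<forall>N'\<in>nec_obs. \<forall>f\<in>nec_maps N N'. \<forall>y\<in>carrier (nob Y N').
        \<alpha> N (nmap Y N N' f y) = nmap Z N N' f (\<alpha> N' y))}"


section \<open>Simplicial sets and free templicial modules\<close>

text \<open>For an order map \<open>g : [m] \<rightarrow> [n]\<close>, \<open>sact K m n g\<close> is \<open>K(g) : K\<^sub>n \<rightarrow> K\<^sub>m\<close>.\<close>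

record 'c sset =
  simplices :: "nat \<Rightarrow> 'c set"
  sact :: "nat \<Rightarrow> nat \<Rightarrow> (nat \<Rightarrow> nat) \<Rightarrow> 'c \<Rightarrow> 'c"

definition std_simplex :: "nat \<Rightarrow> (nat \<Rightarrow> nat) sset" where
  "std_simplex n = \<lparr>simplices = (\<lambda>m. order_maps {..m} {..n}), sact = (\<lambda>l m g x. compose {..l} x g)\<rparr>"

text \<open>The horn \<open>\<Lambda>\<^sup>n\<^sub>j\<close> is the union of the faces opposite to the vertices \<open>i \<noteq> j\<close>.\<close>

definition horn :: "nat \<Rightarrow> nat \<Rightarrow> (nat \<Rightarrow> nat) sset" where
  "horn n j = \<lparr>
     simplices = (\<lambda>m. {x \<in> order_maps {..m} {..n}. \<exists>i\<in>{..n} - {j}. i \<notin> x ` {..m}}),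
     sact = (\<lambda>l m g x. compose {..l} x g)\<rparr>"

definition vertex :: "nat \<Rightarrow> nat \<Rightarrow> nat" where
  "vertex i = (\<lambda>_\<in>{..0}. i)"

definition sset_vertex :: "'c sset \<Rightarrow> nat \<Rightarrow> nat \<Rightarrow> 'c \<Rightarrow> 'c" where
  "sset_vertex K n i x = sact K 0 n (vertex i) x"

definition free_mod ::
  "('k,'r) ring_scheme \<Rightarrow> 'c sset \<Rightarrow> nat \<Rightarrow> ('k,'c,'c \<Rightarrow> 'k) quiver" where
  "free_mod R K n a b =
     free_module R {x \<in> simplices K n. sset_vertex K n 0 x = a \<and> sset_vertex K n n x = b}"

definition free_templicial ::
  "('k,'r) ring_scheme \<Rightarrow> 'c sset \<Rightarrow> ('k,'c,'c \<Rightarrow> 'k) templicial" where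
  "free_templicial R K = \<lparr>
     tvert = simplices K 0,
     tmod = free_mod R K,
     tmap = (\<lambda>m n f a b. lin_ext R (free_mod R K m a b) (\<lambda>x. single R (sact K m n f x))),
     tcomult = (\<lambda>p q a b.
       lin_ext R (tensor R (simplices K 0) [free_mod R K p, free_mod R K q] a b) (\<lambda>x.
         pure R (simplices K 0) [free_mod R K p, free_mod R K q]
           [a, sset_vertex K (p + q) p x, b]
           [single R (sact K p (p + q) (\<lambda>i\<in>{..p}. i) x),
            single R (sact K q (p + q) (\<lambda>i\<in>{..q}. p + i) x)])),
     tcounit = (\<lambda>a b. lin_ext R (unit_quiver R a b) (\<lambda>x. \<one>\<^bsub>R\<^esub>))\<rparr>"

text \<open>
  The component at \<open>(T,p)\<close> of the transformation from \<open>F(K)\<^sub>\<bullet>(a,b)\<close> to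
  \<open>F(L)\<^sub>\<bullet>(\<phi>\<^sub>0(a),\<phi>\<^sub>0(b))\<close> induced by a simplicial map \<open>\<phi>\<close>, with \<open>F\<close> the free templicial module.
\<close>

definition free_nec_map ::
  "('k,'r) ring_scheme \<Rightarrow> 'd sset \<Rightarrow> (nat \<Rightarrow> 'c \<Rightarrow> 'd) \<Rightarrow> 'c \<Rightarrow> 'c \<Rightarrow> necklace \<Rightarrow>
    ('k,'c,'c \<Rightarrow> 'k) tens \<Rightarrow> ('k,'d,'d \<Rightarrow> 'k) tens" where
  "free_nec_map R L \<phi> a b = (\<lambda>(T,p).
     tensor_lift R (nec_mod R (free_templicial R L) T (\<phi> 0 a) (\<phi> 0 b)) (\<lambda>(cs,xs).
       pure R (simplices L 0) (nec_quivers (free_templicial R L) T) (map (\<phi> 0) cs)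
         (map (\<lambda>i. let d = bead_lengths T ! i in
                lin_ext R (free_mod R L d (\<phi> 0 (cs ! i)) (\<phi> 0 (cs ! Suc i)))
                  (\<lambda>x. single R (\<phi> d x)) (xs ! i))
            [0..<length xs])))"


section \<open>Quasi-categories in modules\<close>

definition lifts_inner_horns :: "('k,'r) ring_scheme \<Rightarrow> ('k,'y) nec_functor \<Rightarrow> bool" where
  "lifts_inner_horns R Y \<longleftrightarrow> (\<forall>n j. 0 < j \<and> j < n \<longrightarrow>
     (\<forall>\<alpha> \<in> nec_trans R
        (nec_of_templicial R (free_templicial R (horn n j)) (vertex 0) (vertex n)) Y.
      \<exists>\<beta> \<in> nec_trans R
        (nec_of_templicial R (free_templicial R (std_simplex n)) (vertex 0) (vertex n)) Y.
      \<forall>N\<in>nec_obs.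
      \<forall>x\<in>carrier (nob (nec_of_templicial R (free_templicial R (horn n j)) (vertex 0) (vertex n)) N).
        \<beta> N (free_nec_map R (std_simplex n) (\<lambda>m x. x) (vertex 0) (vertex n) N x) = \<alpha> N x))"

definition quasi_category_in_modules :: "('k,'r) ring_scheme \<Rightarrow> ('k,'o,'x) templicial \<Rightarrow> bool" where
  "quasi_category_in_modules R X \<longleftrightarrow> templicial_module R X \<and>
     (\<forall>a\<in>tvert X. \<forall>b\<in>tvert X. lifts_inner_horns R (nec_of_templicial R X a b))"


section \<open>The templicial module of an enriched category\<close>

text \<open>
  The data of a category enriched in augmented simplicial modules under Day convolution. The first
  argument of \<open>dmod\<close> is a cardinality: \<open>dmod D p\<close> is \<open>\<D>\<^bsub>p-1\<^esub>\<close>, the value at the ordinal with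
  \<open>p\<close> elements \<open>{..<p}\<close>. For an order map \<open>g\<close> from \<open>{..<p}\<close> to \<open>{..<q}\<close>, \<open>dmap D p q g\<close> is
  \<open>\<D>(g) : \<D>\<^bsub>q-1\<^esub> \<rightarrow> \<D>\<^bsub>p-1\<^esub>\<close>. The composition \<open>dcomp D p q a b c\<close> is the bilinear map
  \<open>\<D>\<^bsub>p-1\<^esub>(a,b) \<times> \<D>\<^bsub>q-1\<^esub>(b,c) \<rightarrow> \<D>\<^bsub>p+q-1\<^esub>(a,c)\<close>, and \<open>dunit D a\<close> is \<open>u(1) \<in> \<D>\<^sub>\<emptyset>(a,a)\<close>.
\<close>

record ('k,'o,'d) asmod_cat =
  dobj :: "'o set"
  dmod :: "nat \<Rightarrow> ('k,'o,'d) quiver"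
  dmap :: "nat \<Rightarrow> nat \<Rightarrow> (nat \<Rightarrow> nat) \<Rightarrow> 'o \<Rightarrow> 'o \<Rightarrow> 'd \<Rightarrow> 'd"
  dcomp :: "nat \<Rightarrow> nat \<Rightarrow> 'o \<Rightarrow> 'o \<Rightarrow> 'o \<Rightarrow> 'd \<Rightarrow> 'd \<Rightarrow> 'd"
  dunit :: "'o \<Rightarrow> 'd"

text \<open>
  An order map between finite sets of natural numbers, transported along the order isomorphisms
  with \<open>{..<card I}\<close> and \<open>{..<card J}\<close>.
\<close>

definition std_order_map :: "nat set \<Rightarrow> nat set \<Rightarrow> (nat \<Rightarrow> nat) \<Rightarrow> nat \<Rightarrow> nat" where
  "std_order_map I J g = (\<lambda>i\<in>{..<card I}. card {x \<in> J. x < g (sorted_list_of_set I ! i)})"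

definition dmap_set ::
  "('k,'o,'d) asmod_cat \<Rightarrow> nat set \<Rightarrow> nat set \<Rightarrow> (nat \<Rightarrow> nat) \<Rightarrow> 'o \<Rightarrow> 'o \<Rightarrow> 'd \<Rightarrow> 'd" where
  "dmap_set D I J g = dmap D (card I) (card J) (std_order_map I J g)"

text \<open>
  The iterated composition of \<open>xs\<close> along the objects \<open>cs\<close> (one longer than \<open>xs\<close>), the elements of
  \<open>xs\<close> lying in cardinalities \<open>ps\<close>.
\<close>

fun iter_comp :: "('k,'o,'d) asmod_cat \<Rightarrow> 'o list \<Rightarrow> nat list \<Rightarrow> 'd list \<Rightarrow> 'd" where
  "iter_comp D cs ps [] = dunit D (hd cs)"
| "iter_comp D cs ps [x] = x"
| "iter_comp D cs ps (x # y # xs) =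
     dcomp D (hd ps) (sum_list (tl ps)) (hd cs) (hd (tl cs)) (last cs) x
       (iter_comp D (tl cs) (tl ps) (y # xs))"

definition gap_cards :: "nat set \<Rightarrow> nat list" where
  "gap_cards T = map (\<lambda>(t,t'). card {t<..<t'}) (beads T)"

definition dquivers :: "('k,'o,'d) asmod_cat \<Rightarrow> nat set \<Rightarrow> ('k,'o,'d) quiver list" where
  "dquivers D T = map (dmod D) (gap_cards T)"

definition dtensor ::
  "('k,'r) ring_scheme \<Rightarrow> ('k,'o,'d) asmod_cat \<Rightarrow> nat set \<Rightarrow> ('k,'o,('k,'o,'d) tens) quiver" where
  "dtensor R D T = tensor R (dobj D) (dquivers D T)"

definition nerve_mod ::
  "('k,'r) ring_scheme \<Rightarrow> ('k,'o,'d) asmod_cat \<Rightarrow> nat \<Rightarrow> ('k,'o,nat set \<Rightarrow> ('k,'o,'d) tens) quiver" where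
  "nerve_mod R D n a b = direct_sum (necklaces n) (\<lambda>T. dtensor R D T a b)"

definition nerve_incl ::
  "('k,'r) ring_scheme \<Rightarrow> ('k,'o,'d) asmod_cat \<Rightarrow> nat \<Rightarrow> 'o \<Rightarrow> 'o \<Rightarrow> nat set \<Rightarrow> ('k,'o,'d) tens \<Rightarrow>
    nat set \<Rightarrow> ('k,'o,'d) tens" where
  "nerve_incl R D n a b = summand_incl (necklaces n) (\<lambda>T. dtensor R D T a b)"

definition slice :: "nat \<Rightarrow> nat \<Rightarrow> 'a list \<Rightarrow> 'a list" where
  "slice i j xs = take (j - i) (drop i xs)"

text \<open>
  The restriction of \<open>\<T>(\<D>)(f)\<close> to the summand \<open>T\<close>, with values in the summand
  \<open>U = f\<^sup>-\<^sup>1(T)\<close>. Here \<open>pos u\<close> is the position of \<open>f u\<close> in \<open>T\<close>, and \<open>{f u<..<f u'} - T\<close> is the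
  ordered union of the \<open>T\<^sup>c\<^sub>i\<close> between the positions of \<open>f u\<close> and \<open>f u'\<close>.
\<close>

definition nerve_summand_map ::
  "('k,'r) ring_scheme \<Rightarrow> ('k,'o,'d) asmod_cat \<Rightarrow> (nat \<Rightarrow> nat) \<Rightarrow> nat set \<Rightarrow> nat set \<Rightarrow> 'o \<Rightarrow> 'o \<Rightarrow>
    ('k,'o,'d) tens \<Rightarrow> ('k,'o,'d) tens" where
  "nerve_summand_map R D f T U a b =
     tensor_lift R (dtensor R D U a b) (\<lambda>(cs,xs).
       let pos = (\<lambda>u. card {t \<in> T. t < f u}) in
       pure R (dobj D) (dquivers D U)
         (map (\<lambda>u. cs ! pos u) (sorted_list_of_set U))
         (map (\<lambda>(u,u'). dmap_set D {u<..<u'} ({f u<..<f u'} - T) f (cs ! pos u) (cs ! pos u')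
                 (iter_comp D (slice (pos u) (Suc (pos u')) cs)
                    (slice (pos u) (pos u') (gap_cards T)) (slice (pos u) (pos u') xs)))
            (beads U)))"

definition nerve_map ::
  "('k,'r) ring_scheme \<Rightarrow> ('k,'o,'d) asmod_cat \<Rightarrow> nat \<Rightarrow> nat \<Rightarrow> (nat \<Rightarrow> nat) \<Rightarrow> 'o \<Rightarrow> 'o \<Rightarrow>
    (nat set \<Rightarrow> ('k,'o,'d) tens) \<Rightarrow> nat set \<Rightarrow> ('k,'o,'d) tens" where
  "nerve_map R D m n f a b z =
     (\<lambda>U\<in>necklaces m. finsum (dtensor R D U a b) (\<lambda>T. nerve_summand_map R D f T U a b (z T))
        {T \<in> necklaces n. {i \<in> {..m}. f i \<in> T} = U})"

text \<open>
  \<open>nerve_split\<close> is the embedding of the summand \<open>T \<ni> p\<close> of \<open>\<T>(\<D>)\<^bsub>p+q\<^esub>\<close> into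
  \<open>\<T>(\<D>)\<^sub>p \<otimes> \<T>(\<D>)\<^sub>q\<close> that cuts \<open>T\<close> at \<open>p\<close>.
\<close>

definition nerve_split ::
  "('k,'r) ring_scheme \<Rightarrow> ('k,'o,'d) asmod_cat \<Rightarrow> nat \<Rightarrow> nat \<Rightarrow> nat set \<Rightarrow> 'o \<Rightarrow> 'o \<Rightarrow>
    ('k,'o,'d) tens \<Rightarrow> ('k,'o,nat set \<Rightarrow> ('k,'o,'d) tens) tens" where
  "nerve_split R D p q T a b =
     (let T1 = T \<inter> {..p}; T2 = (\<lambda>t. t - p) ` (T \<inter> {p..}); l = card {t \<in> T. t < p} in
      tensor_lift R (tensor R (dobj D) [nerve_mod R D p, nerve_mod R D q] a b) (\<lambda>(cs,xs).
        pure R (dobj D) [nerve_mod R D p, nerve_mod R D q] [a, cs ! l, b]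
          [nerve_incl R D p a (cs ! l) T1 (pure R (dobj D) (dquivers D T1) (take (Suc l) cs) (take l xs)),
           nerve_incl R D q (cs ! l) b T2 (pure R (dobj D) (dquivers D T2) (drop l cs) (drop l xs))]))"

definition nerve_comult ::
  "('k,'r) ring_scheme \<Rightarrow> ('k,'o,'d) asmod_cat \<Rightarrow> nat \<Rightarrow> nat \<Rightarrow> 'o \<Rightarrow> 'o \<Rightarrow>
    (nat set \<Rightarrow> ('k,'o,'d) tens) \<Rightarrow> ('k,'o,nat set \<Rightarrow> ('k,'o,'d) tens) tens" where
  "nerve_comult R D p q a b z =
     finsum (tensor R (dobj D) [nerve_mod R D p, nerve_mod R D q] a b)
       (\<lambda>T. nerve_split R D p q T a b (z T)) {T \<in> necklaces (p + q). p \<in> T}"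

text \<open>The only necklace of length \<open>0\<close> is \<open>{0}\<close>, and its summand is the empty tensor product.\<close>

definition templicial_of_cat ::
  "('k,'r) ring_scheme \<Rightarrow> ('k,'o,'d) asmod_cat \<Rightarrow> ('k,'o,nat set \<Rightarrow> ('k,'o,'d) tens) templicial" where
  "templicial_of_cat R D = \<lparr>
     tvert = dobj D,
     tmod = nerve_mod R D,
     tmap = nerve_map R D,
     tcomult = nerve_comult R D,
     tcounit = (\<lambda>a b z. tensor_lift R (unit_quiver R a b) (\<lambda>_. \<one>\<^bsub>R\<^esub>) (z {0}))\<rparr>"


section \<open>Dg-categories and the templicial dg-nerve\<close>

text \<open>
  The hom-complexes are homologically graded: \<open>cdiff C A B n\<close> maps degree \<open>n\<close> to degree \<open>n - 1\<close>.
  The composition \<open>ccomp C A B E p q f g\<close> of \<open>f \<in> \<C>(A,B)\<^sub>p\<close> and \<open>g \<in> \<C>(B,E)\<^sub>q\<close> is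
  \<open>m(f \<otimes> g) \<in> \<C>(A,E)\<^bsub>p+q\<^esub>\<close>.
\<close>

record ('k,'o,'m) dg_cat =
  cobj :: "'o set"
  cmod :: "'o \<Rightarrow> 'o \<Rightarrow> int \<Rightarrow> ('k,'m) module"
  cdiff :: "'o \<Rightarrow> 'o \<Rightarrow> int \<Rightarrow> 'm \<Rightarrow> 'm"
  ccomp :: "'o \<Rightarrow> 'o \<Rightarrow> 'o \<Rightarrow> int \<Rightarrow> int \<Rightarrow> 'm \<Rightarrow> 'm \<Rightarrow> 'm"
  cunit :: "'o \<Rightarrow> 'm"

definition sign_mult :: "('k,'m) module \<Rightarrow> int \<Rightarrow> 'm \<Rightarrow> 'm" where
  "sign_mult M p x = (if even p then x else \<ominus>\<^bsub>M\<^esub> x)"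

locale dg_category = cring R for R :: "('k,'r) ring_scheme" (structure) +
  fixes C :: "('k,'o,'m) dg_cat"
  assumes cmod_module:
      "\<lbrakk>A \<in> cobj C; B \<in> cobj C\<rbrakk> \<Longrightarrow> module R (cmod C A B n)"
    and cdiff_linear:
      "\<lbrakk>A \<in> cobj C; B \<in> cobj C\<rbrakk> \<Longrightarrow> cdiff C A B n \<in> lin_maps R (cmod C A B n) (cmod C A B (n - 1))"
    and cdiff_cdiff:
      "\<lbrakk>A \<in> cobj C; B \<in> cobj C; f \<in> carrier (cmod C A B n)\<rbrakk>
        \<Longrightarrow> cdiff C A B (n - 1) (cdiff C A B n f) = \<zero>\<^bsub>cmod C A B (n - 2)\<^esub>"
    and ccomp_linear_left:
      "\<lbrakk>A \<in> cobj C; B \<in> cobj C; E \<in> cobj C; g \<in> carrier (cmod C B E q)\<rbrakk>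
        \<Longrightarrow> (\<lambda>f. ccomp C A B E p q f g) \<in> lin_maps R (cmod C A B p) (cmod C A E (p + q))"
    and ccomp_linear_right:
      "\<lbrakk>A \<in> cobj C; B \<in> cobj C; E \<in> cobj C; f \<in> carrier (cmod C A B p)\<rbrakk>
        \<Longrightarrow> ccomp C A B E p q f \<in> lin_maps R (cmod C B E q) (cmod C A E (p + q))"
    and leibniz:
      "\<lbrakk>A \<in> cobj C; B \<in> cobj C; E \<in> cobj C; f \<in> carrier (cmod C A B p); g \<in> carrier (cmod C B E q)\<rbrakk>
        \<Longrightarrow> cdiff C A E (p + q) (ccomp C A B E p q f g) =
          ccomp C A B E (p - 1) q (cdiff C A B p f) g \<oplus>\<^bsub>cmod C A E (p + q - 1)\<^esub>
          sign_mult (cmod C A E (p + q - 1)) p (ccomp C A B E p (q - 1) f (cdiff C B E q g))"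
    and ccomp_assoc:
      "\<lbrakk>A \<in> cobj C; B \<in> cobj C; E \<in> cobj C; G \<in> cobj C;
        f \<in> carrier (cmod C A B p); g \<in> carrier (cmod C B E q); h \<in> carrier (cmod C E G r)\<rbrakk>
        \<Longrightarrow> ccomp C A E G (p + q) r (ccomp C A B E p q f g) h =
          ccomp C A B G p (q + r) f (ccomp C B E G q r g h)"
    and cunit_closed:
      "A \<in> cobj C \<Longrightarrow> cunit C A \<in> carrier (cmod C A A 0)"
    and cdiff_cunit:
      "A \<in> cobj C \<Longrightarrow> cdiff C A A 0 (cunit C A) = \<zero>\<^bsub>cmod C A A (-1)\<^esub>"
    and ccomp_cunit_left:
      "\<lbrakk>A \<in> cobj C; B \<in> cobj C; f \<in> carrier (cmod C A B p)\<rbrakk> \<Longrightarrow> ccomp C A A B 0 p (cunit C A) f = f"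
    and ccomp_cunit_right:
      "\<lbrakk>A \<in> cobj C; B \<in> cobj C; f \<in> carrier (cmod C A B p)\<rbrakk> \<Longrightarrow> ccomp C A B B p 0 f (cunit C B) = f"

text \<open>
  \<open>\<Gamma>\<^sup>+\<close> of the complex with modules \<open>M n\<close> and differential \<open>d n : M n \<rightarrow> M (n - 1)\<close>, at the
  ordinal \<open>{..<p}\<close>. The summation index \<open>j\<close> is shifted by one, so that \<open>i\<^sub>1 < i\<^sub>2 < \<dots>\<close> are the
  entries \<open>0, 1, \<dots>\<close> of \<open>sorted_list_of_set I\<close>.
\<close>

definition gamma_mod ::
  "(int \<Rightarrow> ('k,'m) module) \<Rightarrow> (int \<Rightarrow> 'm \<Rightarrow> 'm) \<Rightarrow> nat \<Rightarrow> ('k, nat set \<Rightarrow> 'm) module" where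
  "gamma_mod M d p = (direct_sum (Pow {..<p}) (\<lambda>I. M (int (card I))))\<lparr>
     carrier := {a \<in> (\<Pi>\<^sub>E I\<in>Pow {..<p}. carrier (M (int (card I)))).
       \<forall>I\<subseteq>{..<p}. d (int (card I)) (a I) =
         finsum (M (int (card I) - 1))
           (\<lambda>j. sign_mult (M (int (card I) - 1)) (int j) (a (I - {sorted_list_of_set I ! j})))
           {..<card I}}\<rparr>"

definition gamma_map ::
  "(int \<Rightarrow> ('k,'m) module) \<Rightarrow> nat \<Rightarrow> (nat \<Rightarrow> nat) \<Rightarrow> (nat set \<Rightarrow> 'm) \<Rightarrow> nat set \<Rightarrow> 'm" where
  "gamma_map M p h a =
     (\<lambda>I\<in>Pow {..<p}. if inj_on h I then a (h ` I) else \<zero>\<^bsub>M (int (card I))\<^esub>)"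

definition gamma_cat :: "('k,'o,'m) dg_cat \<Rightarrow> ('k,'o,nat set \<Rightarrow> 'm) asmod_cat" where
  "gamma_cat C = \<lparr>
     dobj = cobj C,
     dmod = (\<lambda>p A B. gamma_mod (cmod C A B) (cdiff C A B) p),
     dmap = (\<lambda>p q h A B. gamma_map (cmod C A B) p h),
     dcomp = (\<lambda>p q A B E x y. \<lambda>K\<in>Pow {..<p + q}.
       let K1 = K \<inter> {..<p}; K2 = (\<lambda>i. i - p) ` (K \<inter> {p..<p + q}) in
       ccomp C A B E (int (card K1)) (int (card K2)) (x K1) (y K2)),
     dunit = (\<lambda>A. \<lambda>I\<in>Pow {..<0}. cunit C A)\<rparr>"

definition dg_nerve ::
  "('k,'r) ring_scheme \<Rightarrow> ('k,'o,'m) dg_cat \<Rightarrow>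
    ('k,'o,nat set \<Rightarrow> ('k,'o,nat set \<Rightarrow> 'm) tens) templicial" where
  "dg_nerve R C = templicial_of_cat R (gamma_cat C)"

end

theory Submission
  imports Defs
begin

text \<open>
 For the templicial modules \<open>X\<close> involved there is an associative product
 \<open>J : X\<^sub>p(a,c) \<times> X\<^sub>q(c,b) \<rightarrow> X\<^sub>p\<^sub>+\<^sub>q(a,b)\<close> for which \<open>J \<circ> \<mu>\<^sub>p\<^sub>,\<^sub>q\<close> is an idempotent \<open>P {p}\<close> of \<open>X\<^sub>p\<^sub>+\<^sub>q\<close>:
 on \<open>\<T>(\<D>)\<close> it juxtaposes necklaces and \<open>P {p}\<close> keeps the summands \<open>V\<close> with \<open>p \<in> V\<close>; on the
 standard simplex it glues simplices and \<open>P\<close> is the identity; the horn maps into the simplex.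
 The iterated product \<open>\<Phi>\<^sub>T : X\<^sub>T \<rightarrow> X\<^sub>p\<close> is injective and turns \<open>X\<^sub>\<bullet>(f)\<close>, for a necklace map \<open>f\<close> out
 of \<open>T\<close>, into \<open>x \<mapsto> X(f)(P (f(T)) x)\<close>.

 Hence a transformation from the horn to \<open>\<T>(\<D>)\<close> is determined by its values \<open>y\<^sub>i\<close> on the necklaces
 \<open>{0,i,n}\<close> and \<open>z\<^sub>i\<close> on the faces \<open>d\<^sub>i\<close> with \<open>0 < i < n\<close>, \<open>i \<noteq> j\<close>, and an extension to the simplex is an
 \<open>x\<close> with \<open>P {i} x = y\<^sub>i\<close> and \<open>d\<^sub>i x = z\<^sub>i\<close>. The components of \<open>x\<close> at the necklaces \<open>V \<noteq> {0,n}\<close> are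
 forced by the \<open>y\<^sub>i\<close>. After subtracting them the remaining equations live in the augmented simplicial
 module \<open>\<D>(a,b)\<close>, where every face but the one numbered \<open>j - 1\<close> is prescribed, and they are solved
 with degeneracies like the Kan condition for simplicial groups.
\<close>

text \<open>The horn forces two quivers to be carried along: gluing two of its simplices may leave
  it, so its product takes values in the module \<open>M\<close> of the whole simplex, with
  \<open>Q\<close> as a submodule. Injectivity of the iterated product is clear where
  \<open>\<mu>\<close> inverts the product on pure tensors; for the horn one projects the simplex
  back onto the horn, factor by factor. The necklaces {0,i,n} and the faces d_i suffice because a
  basis element of the horn at T is an interval map f to [n] whose beads all lie in the horn. Either
  f(T) contains an inner i, and the element is pulled back from the one at {0,i,n} whose product is
  the identity simplex; or one bead jumps from 0 to n, must miss some inner i different from j, and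
  f factors through d_i. Why an inner horn is as easy as any other: on the summand {0,n} the inner
  faces of an n-simplex act as all faces, outer ones included, of the ordinal of its n - 1 inner
  vertices. Dropping one of them leaves a horn problem in a simplicial group, where the distinction
  between inner and outer horns has disappeared.\<close>

abbreviation mem_carrier (infix "\<in>:" 50) where "x \<in>: M \<equiv> x \<in> carrier M"
abbreviation "bl \<equiv> bead_lengths"
abbreviation "sl \<equiv> sorted_list_of_set"
abbreviation "imaps \<equiv> interval_maps"

section \<open>Linear maps\<close>

lemma module_zero_closed: "module R M ==> \<zero>\<^bsub>M\<^esub> \<in>: M"
 by (simp add: module_def abelian_group_def abelian_monoid.zero_closed)

lemma lin_mapsI:
 assumes "\<And>x. x \<in>: M ==> h x \<in>: N"
  and "\<And>x y. [|x \<in>: M; y \<in>: M|] ==> h (x \<oplus>\<^bsub>M\<^esub> y) = h x \<oplus>\<^bsub>N\<^esub> h y"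
  and "\<And>r x. [|r \<in>: R; x \<in>: M|] ==> h (r \<odot>\<^bsub>M\<^esub> x) = r \<odot>\<^bsub>N\<^esub> h x"
 shows "h \<in> lin_maps R M N"
 using assms unfolding lin_maps_def by auto

lemma lin_closed: "[|h \<in> lin_maps R M N; x \<in>: M|] ==> h x \<in>: N"
 unfolding lin_maps_def by auto

lemma lin_add:
 "[|h \<in> lin_maps R M N; x \<in>: M; y \<in>: M|] ==> h (x \<oplus>\<^bsub>M\<^esub> y) = h x \<oplus>\<^bsub>N\<^esub> h y"
 unfolding lin_maps_def by auto

lemma lin_smult:
 "[|h \<in> lin_maps R M N; r \<in>: R; x \<in>: M|] ==> h (r \<odot>\<^bsub>M\<^esub> x) = r \<odot>\<^bsub>N\<^esub> h x"
 unfolding lin_maps_def by auto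

text \<open>Linearity is a condition on the carrier alone; \<open>module R M\<close> keeps sums and
  multiples inside the carrier, where the two maps agree.\<close>

lemma lin_cong:
 assumes "h \<in> lin_maps R M N" "\<And>x. x \<in>: M ==> h x = g x" "module R M"
 shows "g \<in> lin_maps R M N"
proof -
 interpret M: module R M by fact
 show ?thesis
  using assms(1,2) by (intro lin_mapsI) (auto simp: lin_closed lin_add lin_smult simp flip: assms(2))
qed

lemma lin_id: "(\<lambda>x. x) \<in> lin_maps R M M"
 by (auto intro: lin_mapsI)

lemma lin_comp:
 "[|g \<in> lin_maps R N L; h \<in> lin_maps R M N|] ==> (\<lambda>x. g (h x)) \<in> lin_maps R M L"
 by (auto intro!: lin_mapsI simp: lin_closed lin_add lin_smult)

lemma lin_zero:
 assumes "module R M" "module R N" "h \<in> lin_maps R M N"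
 shows "h \<zero>\<^bsub>M\<^esub> = \<zero>\<^bsub>N\<^esub>"
proof -
 interpret M: module R M by fact
 interpret N: module R N by fact
 have "h \<zero>\<^bsub>M\<^esub> = h (\<zero>\<^bsub>R\<^esub> \<odot>\<^bsub>M\<^esub> \<zero>\<^bsub>M\<^esub>)" by simp
 also have "\<dots> = \<zero>\<^bsub>R\<^esub> \<odot>\<^bsub>N\<^esub> h \<zero>\<^bsub>M\<^esub>" using assms(3) by (intro lin_smult[where M=M]) auto
 also have "\<dots> = \<zero>\<^bsub>N\<^esub>" using assms(3) by (simp add: lin_closed[where M=M])
 finally show ?thesis .
qed

lemma lin_minus:
 assumes "module R M" "module R N" "h \<in> lin_maps R M N" "x \<in>: M" "y \<in>: M"
 shows "h (x \<ominus>\<^bsub>M\<^esub> y) = h x \<ominus>\<^bsub>N\<^esub> h y"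
proof -
 interpret M: module R M by fact
 interpret N: module R N by fact
 note c = lin_closed[OF assms(3)]
 have "h (\<ominus>\<^bsub>M\<^esub> y) \<oplus>\<^bsub>N\<^esub> h y = h (\<ominus>\<^bsub>M\<^esub> y \<oplus>\<^bsub>M\<^esub> y)" using assms by (simp add: lin_add)
 also have "\<dots> = \<zero>\<^bsub>N\<^esub>" using assms by (simp add: M.l_neg lin_zero)
 finally have "h (\<ominus>\<^bsub>M\<^esub> y) = \<ominus>\<^bsub>N\<^esub> h y" using assms c by (simp add: N.minus_equality)
 then show ?thesis using assms by (simp add: M.minus_eq N.minus_eq lin_add)
qed

lemma lin_finsum:
 assumes "module R M" "module R N" "h \<in> lin_maps R M N" "f \<in> A \<rightarrow> carrier M"
 shows "h (finsum M f A) = finsum N (\<lambda>i. h (f i)) A"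
proof -
 interpret M: module R M by fact
 interpret N: module R N by fact
 show ?thesis using assms(4)
 proof (induction A rule: infinite_finite_induct)
  case (insert x F)
  then have "finsum M f F \<in>: M" by (intro M.finsum_closed) auto
  moreover have "(\<lambda>i. h (f i)) \<in> F \<rightarrow> carrier N" "h (f x) \<in>: N"
   using insert lin_closed[OF assms(3)] by auto
  moreover have "f \<in> F \<rightarrow> carrier M" "f x \<in>: M" using insert by auto
  ultimately show ?case using insert.hyps insert.IH lin_add[OF assms(3)] by simp
 qed (auto simp: lin_zero[OF assms(1-3)])
qed

text \<open>Structure maps and comultiplication of the nerve are sums over necklaces of maps on
  summands; their linearity comes from here.\<close>

lemma lin_finsum_fun:
 assumes "module R M" "module R N" "\<And>i. i \<in> I ==> h i \<in> lin_maps R M N"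
 shows "(\<lambda>x. finsum N (\<lambda>i. h i x) I) \<in> lin_maps R M N"
proof -
 interpret M: module R M by fact
 interpret N: module R N by fact
 have c: "(\<lambda>i. h i x) \<in> I \<rightarrow> carrier N" if "x \<in>: M" for x
  using that assms(3) lin_closed by fastforce
 show ?thesis
 proof (rule lin_mapsI)
  fix x assume "x \<in>: M" then show "finsum N (\<lambda>i. h i x) I \<in>: N"
   by (intro N.finsum_closed c)
 next
  fix x y assume xy: "x \<in>: M" "y \<in>: M"
  have "finsum N (\<lambda>i. h i (x \<oplus>\<^bsub>M\<^esub> y)) I = finsum N (\<lambda>i. h i x \<oplus>\<^bsub>N\<^esub> h i y) I"
   using xy c assms(3) by (intro N.finsum_cong') (auto simp: lin_add[OF assms(3)] Pi_def)
  then show "finsum N (\<lambda>i. h i (x \<oplus>\<^bsub>M\<^esub> y)) I = finsum N (\<lambda>i. h i x) I \<oplus>\<^bsub>N\<^esub> finsum N (\<lambda>i. h i y) I"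
   using xy c by (simp add: N.finsum_addf)
 next
  fix r x assume rx: "r \<in>: R" "x \<in>: M"
  have "finsum N (\<lambda>i. h i (r \<odot>\<^bsub>M\<^esub> x)) I = finsum N (\<lambda>i. r \<odot>\<^bsub>N\<^esub> h i x) I"
   using rx c assms(3) by (intro N.finsum_cong') (auto simp: lin_smult[OF assms(3)] Pi_def)
  also have "\<dots> = r \<odot>\<^bsub>N\<^esub> finsum N (\<lambda>i. h i x) I"
   using rx c[OF rx(2)] assms(2)
   by (intro lin_finsum[symmetric] lin_mapsI)
    (auto simp: N.smult_r_distr N.smult_assoc1[symmetric] M.R.m_comm)
  finally show "finsum N (\<lambda>i. h i (r \<odot>\<^bsub>M\<^esub> x)) I = r \<odot>\<^bsub>N\<^esub> finsum N (\<lambda>i. h i x) I" .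
 qed
qed

text \<open>The test is written \<open>j = i\<close>, the shape in which components of summand
  inclusions appear.\<close>

lemma (in abelian_monoid) finsum_single:
 assumes "i \<in> A" "finite A" "x \<in>: G"
 shows "finsum G (\<lambda>j. if j = i then x else \<zero>) A = x"
 using finsum_singleton[of i A "\<lambda>_. x"] assms by (simp add: eq_commute)

section \<open>Free modules\<close>

context cring
begin

abbreviation "Lin \<equiv> lin_maps R"
abbreviation "FM \<equiv> free_module R"
abbreviation "TT \<equiv> tensor R"
abbreviation "TA \<equiv> tensor_append R"

lemma free_module_simps [simp]:
 "zero (FM B) = (\<lambda>x. \<zero>)" "add (FM B) = (\<lambda>f g x. f x \<oplus> g x)"
 "smult (FM B) = (\<lambda>r f x. r \<otimes> f x)"
 unfolding free_module_def by auto

lemma free_carrier: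
 "f \<in>: FM B \<longleftrightarrow>
   finite {x. f x \<noteq> \<zero>} \<and> (\<forall>x. f x \<in>: R) \<and> (\<forall>x. x \<notin> B \<longrightarrow> f x = \<zero>)"
 unfolding free_module_def by auto

lemma FM_module: "module R (FM B)"
proof (rule moduleI)
 show "abelian_group (FM B)"
 proof (rule abelian_groupI)
  fix x y assume "x \<in>: FM B" "y \<in>: FM B"
  then show "x \<oplus>\<^bsub>FM B\<^esub> y \<in>: FM B"
   by (auto simp: free_carrier intro: finite_subset[where B="{z. x z \<noteq> \<zero>} \<union> {z. y z \<noteq> \<zero>}"])
 next
  fix x assume x: "x \<in>: FM B"
  then have "{z. \<ominus> x z \<noteq> \<zero>} \<subseteq> {z. x z \<noteq> \<zero>}" by auto
  then have "(\<lambda>z. \<ominus> x z) \<in>: FM B" using x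
   by (auto simp: free_carrier intro: finite_subset)
  moreover have "(\<lambda>z. \<ominus> x z) \<oplus>\<^bsub>FM B\<^esub> x = \<zero>\<^bsub>FM B\<^esub>"
   using x by (auto simp: free_carrier l_neg)
  ultimately show "\<exists>y\<in>carrier (FM B). y \<oplus>\<^bsub>FM B\<^esub> x = \<zero>\<^bsub>FM B\<^esub>" by blast
 qed (auto simp: free_carrier a_assoc a_comm a_lcomm)
next
 fix r x assume "r \<in>: R" "x \<in>: FM B"
 then show "r \<odot>\<^bsub>FM B\<^esub> x \<in>: FM B"
  by (auto simp: free_carrier intro: finite_subset[where B="{z. x z \<noteq> \<zero>}"])
qed (auto simp: free_carrier l_distr r_distr m_assoc is_cring)

lemma single_carrier: "b \<in> B ==> single R b \<in>: FM B"
 by (auto simp: free_carrier single_def intro: finite_subset[where B="{b}"])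

text \<open>Induction on the size of the support: erasing one nonzero coefficient leaves a smaller
  vector.\<close>

lemma free_induct [consumes 1, case_names zero step]:
 assumes "f \<in>: FM B" "P (\<lambda>x. \<zero>)"
  and "\<And>r b f. [|r \<in>: R; b \<in> B; f \<in>: FM B; P f|]
   ==> P ((r \<odot>\<^bsub>FM B\<^esub> single R b) \<oplus>\<^bsub>FM B\<^esub> f)"
 shows "P f"
 using assms(1)
proof (induction "card {x. f x \<noteq> \<zero>}" arbitrary: f)
 case 0
 then have "f = (\<lambda>x. \<zero>)" by (auto simp: free_carrier)
 then show ?case using assms(2) by simp
next
 case (Suc n)
 have fin: "finite {x. f x \<noteq> \<zero>}" using Suc by (auto simp: free_carrier)
 obtain b where b: "f b \<noteq> \<zero>" using Suc(2) by (metis (mono_tags, lifting) Collect_empty_eq card.empty nat.distinct(1))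
 have bB: "b \<in> B" and fb: "f b \<in>: R" using b Suc(3) by (auto simp: free_carrier)
 let ?g = "f(b := \<zero>)"
 have eq: "{x. ?g x \<noteq> \<zero>} = {x. f x \<noteq> \<zero>} - {b}" by auto
 have g: "?g \<in>: FM B" using Suc(3) fin unfolding free_carrier eq by auto
 have "n = card {x. ?g x \<noteq> \<zero>}" unfolding eq using b fin Suc(2) by simp
 then have "P ?g" using Suc(1) g by blast
 moreover have "f = (f b \<odot>\<^bsub>FM B\<^esub> single R b) \<oplus>\<^bsub>FM B\<^esub> ?g"
  using Suc(3) by (auto simp: single_def free_carrier)
 ultimately show ?case using assms(3)[OF fb bB g] by simp
qed

text \<open>\<open>lin_ext\<close> sums over the support, which varies with the vector. To compare
  two vectors with their sum, all three must be expressed over one common finite set.\<close>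

lemma lin_ext_superset:
 assumes "module R M" "f \<in>: FM B" "\<phi> \<in> B \<rightarrow> carrier M" "finite A" "{x. f x \<noteq> \<zero>} \<subseteq> A" "A \<subseteq> B"
 shows "lin_ext R M \<phi> f = finsum M (\<lambda>x. f x \<odot>\<^bsub>M\<^esub> \<phi> x) A"
proof -
 interpret M: module R M by fact
 show ?thesis unfolding lin_ext_def
  using assms by (intro M.add.finprod_mono_neutral_cong_left) (auto simp: free_carrier subset_iff Pi_def)
qed

lemma lin_ext_linear:
 assumes "module R M" "\<phi> \<in> B \<rightarrow> carrier M"
 shows "lin_ext R M \<phi> \<in> Lin (FM B) M"
proof -
 interpret M: module R M by fact
 interpret F: module R "FM B" by (rule FM_module)
 have c: "(\<lambda>x. f x \<odot>\<^bsub>M\<^esub> \<phi> x) \<in> A \<rightarrow> carrier M" if "f \<in>: FM B" "A \<subseteq> B" for f A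
  using that assms by (auto simp: free_carrier)
 show ?thesis
 proof (rule lin_mapsI)
  fix f assume f: "f \<in>: FM B"
  have "{x. f x \<noteq> \<zero>} \<subseteq> B" using f by (auto simp: free_carrier)
  then show "lin_ext R M \<phi> f \<in>: M" unfolding lin_ext_def using c f by (intro M.finsum_closed)
 next
  fix f g assume f: "f \<in>: FM B" and g: "g \<in>: FM B"
  let ?A = "{x. f x \<noteq> \<zero>} \<union> {x. g x \<noteq> \<zero>}"
  have A: "finite ?A" "?A \<subseteq> B" using f g by (auto simp: free_carrier)
  have fg: "f \<oplus>\<^bsub>FM B\<^esub> g \<in>: FM B" using f g by (rule F.a_closed)
  have "lin_ext R M \<phi> (f \<oplus>\<^bsub>FM B\<^esub> g)
   = finsum M (\<lambda>x. (f \<oplus>\<^bsub>FM B\<^esub> g) x \<odot>\<^bsub>M\<^esub> \<phi> x) ?A"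
   using A fg assms by (intro lin_ext_superset[where B=B]) auto
  also have "\<dots> = finsum M (\<lambda>x. f x \<odot>\<^bsub>M\<^esub> \<phi> x \<oplus>\<^bsub>M\<^esub> g x \<odot>\<^bsub>M\<^esub> \<phi> x) ?A"
   using f g assms A(2) by (intro M.finsum_cong') (auto simp: free_carrier M.smult_l_distr Pi_def subset_iff)
  also have "\<dots> = finsum M (\<lambda>x. f x \<odot>\<^bsub>M\<^esub> \<phi> x) ?A \<oplus>\<^bsub>M\<^esub> finsum M (\<lambda>x. g x \<odot>\<^bsub>M\<^esub> \<phi> x) ?A"
   using c f g A by (intro M.finsum_addf) auto
  also have "\<dots> = lin_ext R M \<phi> f \<oplus>\<^bsub>M\<^esub> lin_ext R M \<phi> g"
   using lin_ext_superset[OF assms(1) f assms(2) A(1) _ A(2)] lin_ext_superset[OF assms(1) g assms(2) A(1) _ A(2)]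
   by auto
  finally show "lin_ext R M \<phi> (f \<oplus>\<^bsub>FM B\<^esub> g) = lin_ext R M \<phi> f \<oplus>\<^bsub>M\<^esub> lin_ext R M \<phi> g" .
 next
  fix r f assume r: "r \<in>: R" and f: "f \<in>: FM B"
  let ?A = "{x. f x \<noteq> \<zero>}"
  have A: "finite ?A" "?A \<subseteq> B" using f by (auto simp: free_carrier)
  have rf: "r \<odot>\<^bsub>FM B\<^esub> f \<in>: FM B" using r f by (rule F.smult_closed)
  have "lin_ext R M \<phi> (r \<odot>\<^bsub>FM B\<^esub> f)
   = finsum M (\<lambda>x. (r \<odot>\<^bsub>FM B\<^esub> f) x \<odot>\<^bsub>M\<^esub> \<phi> x) ?A"
   using A rf r assms by (intro lin_ext_superset[where B=B]) auto
  also have "\<dots> = finsum M (\<lambda>x. r \<odot>\<^bsub>M\<^esub> (f x \<odot>\<^bsub>M\<^esub> \<phi> x)) ?A"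
   using f r assms A(2) by (intro M.finsum_cong') (auto simp: free_carrier M.smult_assoc1 Pi_def subset_iff)
  also have "\<dots> = r \<odot>\<^bsub>M\<^esub> lin_ext R M \<phi> f" unfolding lin_ext_def
   using M.finsum_smult_ldistr[OF A(1) r c[OF f A(2)]] by simp
  finally show "lin_ext R M \<phi> (r \<odot>\<^bsub>FM B\<^esub> f) = r \<odot>\<^bsub>M\<^esub> lin_ext R M \<phi> f" .
 qed
qed

text \<open>Over the zero ring \<open>single R b\<close> has empty support, so
  \<open>lin_ext_single\<close> holds there only because every module is zero.\<close>

lemma trivial_module:
 assumes "module R M" "\<one> = \<zero>" "x \<in>: M"
 shows "x = \<zero>\<^bsub>M\<^esub>"
proof -
 interpret M: module R M by fact
 show ?thesis using M.smult_one[OF assms(3)] M.smult_l_null[OF assms(3)] assms(2) by simp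
qed

lemma lin_ext_single:
 assumes "module R M" "\<phi> b \<in>: M"
 shows "lin_ext R M \<phi> (single R b) = \<phi> b"
proof (cases "\<one> = \<zero>")
 case True
 interpret M: module R M by fact
 have "{x. single R b x \<noteq> \<zero>} = {}" using True by (auto simp: single_def)
 then have "lin_ext R M \<phi> (single R b) = \<zero>\<^bsub>M\<^esub>" unfolding lin_ext_def by simp
 then show ?thesis using trivial_module[OF assms(1) True assms(2)] by simp
next
 case False
 interpret M: module R M by fact
 have "{x. single R b x \<noteq> \<zero>} = {b}" using False by (auto simp: single_def)
 then show ?thesis unfolding lin_ext_def using assms by (simp add: single_def)
qed

lemma free_eqI:
 assumes "module R N" "h \<in> Lin (FM B) N" "g \<in> Lin (FM B) N"
  and "\<And>b. b \<in> B ==> h (single R b) = g (single R b)" "f \<in>: FM B"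
 shows "h f = g f"
 using assms(5)
proof (induction f rule: free_induct)
 case zero
 show ?case using lin_zero[OF FM_module assms(1) assms(2)] lin_zero[OF FM_module assms(1) assms(3)]
  by simp
next
 case (step r b f)
 interpret F: module R "FM B" by (rule FM_module)
 note s = single_carrier[OF step(2)]
 show ?case
  using step assms(4) s F.smult_closed[OF step(1) s]
  by (simp only: lin_add[OF assms(2)] lin_add[OF assms(3)] lin_smult[OF assms(2)] lin_smult[OF assms(3)])
qed

section \<open>Quotient modules\<close>

context
 fixes M :: "('a, 'm) module" and N
 assumes M: "module R M" and N: "submodule N R M"
begin

interpretation M: module R M by (rule M)
interpretation N: submodule N R M by (rule N)

lemma sub_add: "abelian_subgroup N M"
 by (rule abelian_subgroupI3) (auto intro: additive_subgroup.intro N.subgroup_axioms M.abelian_group_axioms)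

interpretation NM: abelian_subgroup N M by (rule sub_add)

lemma quot_simps [simp]:
 "zero (quot_module M N) = N" "add (quot_module M N) = (\<lambda>A B. A <+>\<^bsub>M\<^esub> B)"
 "smult (quot_module M N) = (\<lambda>r A. N <+>\<^bsub>M\<^esub> ((\<lambda>x. r \<odot>\<^bsub>M\<^esub> x) ` A))"
 "carrier (quot_module M N) = a_rcosets\<^bsub>M\<^esub> N"
 unfolding quot_module_def by auto

lemma coset_closed: "x \<in>: M ==> N +>\<^bsub>M\<^esub> x \<in>: quot_module M N"
 by (simp add: M.a_rcosetsI NM.a_subset)

lemma cosetE:
 assumes "A \<in>: quot_module M N"
 obtains x where "x \<in>: M" "A = N +>\<^bsub>M\<^esub> x"
 using assms by (auto simp: A_RCOSETS_def')

lemma coset_elem: "z \<in> N +>\<^bsub>M\<^esub> x \<longleftrightarrow> (\<exists>n\<in>N. z = n \<oplus>\<^bsub>M\<^esub> x)"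
 by (auto simp: a_r_coset_def')

lemma coset_add:
 "[|x \<in>: M; y \<in>: M|]
  ==> (N +>\<^bsub>M\<^esub> x) \<oplus>\<^bsub>quot_module M N\<^esub> (N +>\<^bsub>M\<^esub> y) = N +>\<^bsub>M\<^esub> (x \<oplus>\<^bsub>M\<^esub> y)"
 by (simp add: NM.a_rcos_sum)

text \<open>Scaling may shrink a coset (for r = 0 to a point). Adding N, as the definition of the
  scalar action does, fills it up to a coset again.\<close>

lemma coset_smult:
 assumes "r \<in>: R" "x \<in>: M"
 shows "r \<odot>\<^bsub>quot_module M N\<^esub> (N +>\<^bsub>M\<^esub> x) = N +>\<^bsub>M\<^esub> (r \<odot>\<^bsub>M\<^esub> x)"
proof -
 have Nc: "n \<in> N ==> n \<in>: M" for n using NM.a_subset by auto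
 have "z \<in> N <+>\<^bsub>M\<^esub> ((\<lambda>x. r \<odot>\<^bsub>M\<^esub> x) ` (N +>\<^bsub>M\<^esub> x)) \<longleftrightarrow> z \<in> N +>\<^bsub>M\<^esub> (r \<odot>\<^bsub>M\<^esub> x)" for z
 proof
  assume "z \<in> N <+>\<^bsub>M\<^esub> ((\<lambda>x. r \<odot>\<^bsub>M\<^esub> x) ` (N +>\<^bsub>M\<^esub> x))"
  then obtain n n' where n: "n \<in> N" "n' \<in> N" "z = n \<oplus>\<^bsub>M\<^esub> (r \<odot>\<^bsub>M\<^esub> (n' \<oplus>\<^bsub>M\<^esub> x))"
   by (auto simp: set_add_def' coset_elem)
  then have "z = (n \<oplus>\<^bsub>M\<^esub> r \<odot>\<^bsub>M\<^esub> n') \<oplus>\<^bsub>M\<^esub> (r \<odot>\<^bsub>M\<^esub> x)"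
   using assms Nc by (simp add: M.smult_r_distr M.a_assoc)
  moreover have "n \<oplus>\<^bsub>M\<^esub> r \<odot>\<^bsub>M\<^esub> n' \<in> N" using n assms by (simp add: NM.a_closed N.smult_closed)
  ultimately show "z \<in> N +>\<^bsub>M\<^esub> (r \<odot>\<^bsub>M\<^esub> x)" by (auto simp: coset_elem)
 next
  assume "z \<in> N +>\<^bsub>M\<^esub> (r \<odot>\<^bsub>M\<^esub> x)"
  then obtain n where n: "n \<in> N" "z = n \<oplus>\<^bsub>M\<^esub> (r \<odot>\<^bsub>M\<^esub> x)" by (auto simp: coset_elem)
  have "x \<in> N +>\<^bsub>M\<^esub> x" using assms(2) by (auto simp: coset_elem intro!: bexI[of _ "\<zero>\<^bsub>M\<^esub>"] NM.zero_closed)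
  then show "z \<in> N <+>\<^bsub>M\<^esub> ((\<lambda>x. r \<odot>\<^bsub>M\<^esub> x) ` (N +>\<^bsub>M\<^esub> x))" using n by (auto simp: set_add_def')
 qed
 then show ?thesis by auto
qed

lemma coset_zero: "N +>\<^bsub>M\<^esub> \<zero>\<^bsub>M\<^esub> = \<zero>\<^bsub>quot_module M N\<^esub>"
 using NM.a_subset by (simp add: M.a_coset_add_zero)

lemma coset_eqI:
 assumes "x \<in>: M" "y \<in>: M" "x \<ominus>\<^bsub>M\<^esub> y \<in> N"
 shows "N +>\<^bsub>M\<^esub> x = N +>\<^bsub>M\<^esub> y"
proof -
 have "x = (x \<ominus>\<^bsub>M\<^esub> y) \<oplus>\<^bsub>M\<^esub> y" using assms by (simp add: M.minus_eq M.a_assoc M.l_neg)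
 then have "x \<in> N +>\<^bsub>M\<^esub> y" using assms(3) by (auto simp: coset_elem)
 then show ?thesis using M.a_repr_independence assms NM.a_subgroup by metis
qed

lemma quot_is_module: "module R (quot_module M N)"
proof -
 let ?Q = "quot_module M N" and ?c = "\<lambda>x. N +>\<^bsub>M\<^esub> x"
 \<comment> \<open>Every element is the coset of a representative, so each module law is inherited
   from M through \<open>coset_add\<close> and \<open>coset_smult\<close>.\<close>
 have c: "carrier ?Q = ?c ` carrier M" by (auto elim!: cosetE simp del: quot_simps intro: coset_closed)
 note s = coset_add coset_smult M.a_closed M.smult_closed
 show ?thesis
 proof (rule moduleI)
  show "abelian_group ?Q"
  proof (rule abelian_groupI; unfold c ball_simps; (elim imageE; hypsubst)?)
   show "\<zero>\<^bsub>?Q\<^esub> \<in> ?c ` carrier M" unfolding coset_zero[symmetric] by blast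
  next
   fix x assume "x \<in>: M"
   then have "?c (\<ominus>\<^bsub>M\<^esub> x) \<oplus>\<^bsub>?Q\<^esub> ?c x = \<zero>\<^bsub>?Q\<^esub>" "\<ominus>\<^bsub>M\<^esub> x \<in>: M"
    by (simp_all only: s M.a_inv_closed M.l_neg coset_zero)
   then show "\<exists>y\<in>?c ` carrier M. y \<oplus>\<^bsub>?Q\<^esub> ?c x = \<zero>\<^bsub>?Q\<^esub>" by blast
  next
   fix x assume "x \<in>: M"
   then show "\<zero>\<^bsub>?Q\<^esub> \<oplus>\<^bsub>?Q\<^esub> ?c x = ?c x"
    unfolding coset_zero[symmetric] by (simp only: s M.zero_closed M.l_zero)
  next
   fix x y assume "x \<in>: M" "y \<in>: M"
   then show "?c x \<oplus>\<^bsub>?Q\<^esub> ?c y = ?c y \<oplus>\<^bsub>?Q\<^esub> ?c x" "?c x \<oplus>\<^bsub>?Q\<^esub> ?c y \<in> ?c ` carrier M"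
    by (simp_all only: s M.a_comm imageI)
  next
   fix x y z assume "x \<in>: M" "y \<in>: M" "z \<in>: M"
   then show "?c x \<oplus>\<^bsub>?Q\<^esub> ?c y \<oplus>\<^bsub>?Q\<^esub> ?c z = ?c x \<oplus>\<^bsub>?Q\<^esub> (?c y \<oplus>\<^bsub>?Q\<^esub> ?c z)"
    by (simp only: s M.a_assoc)
  qed
 next
  show "cring R" by (rule is_cring)
 next
  fix r x assume "r \<in>: R" "x \<in>: ?Q"
  then show "r \<odot>\<^bsub>?Q\<^esub> x \<in>: ?Q" unfolding c
   by (elim imageE; hypsubst) (simp only: s imageI)
 next
  fix r q x assume "r \<in>: R" "q \<in>: R" "x \<in>: ?Q"
  then show "(r \<oplus> q) \<odot>\<^bsub>?Q\<^esub> x = r \<odot>\<^bsub>?Q\<^esub> x \<oplus>\<^bsub>?Q\<^esub> q \<odot>\<^bsub>?Q\<^esub> x"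
   "r \<otimes> q \<odot>\<^bsub>?Q\<^esub> x = r \<odot>\<^bsub>?Q\<^esub> (q \<odot>\<^bsub>?Q\<^esub> x)" unfolding c
   by (elim imageE; hypsubst; simp only: s a_closed m_closed M.smult_l_distr M.smult_assoc1)+
 next
  fix r x y assume "r \<in>: R" "x \<in>: ?Q" "y \<in>: ?Q"
  then show "r \<odot>\<^bsub>?Q\<^esub> (x \<oplus>\<^bsub>?Q\<^esub> y) = r \<odot>\<^bsub>?Q\<^esub> x \<oplus>\<^bsub>?Q\<^esub> r \<odot>\<^bsub>?Q\<^esub> y" unfolding c
   by (elim imageE; hypsubst) (simp only: s M.smult_r_distr)
 next
  fix x assume "x \<in>: ?Q"
  then show "\<one> \<odot>\<^bsub>?Q\<^esub> x = x" unfolding c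
   by (elim imageE; hypsubst) (simp only: s one_closed M.smult_one)
 qed
qed

lemma coset_linear: "(\<lambda>x. N +>\<^bsub>M\<^esub> x) \<in> Lin M (quot_module M N)"
 by (rule lin_mapsI) (simp_all del: quot_simps add: coset_add coset_smult coset_closed)

text \<open>A linear map that kills N is constant on each coset, so the image is a singleton and
  \<open>the_elem\<close> reads off its element.\<close>

lemma quot_lift:
 assumes "module R L" "h \<in> Lin M L" "\<And>n. n \<in> N ==> h n = \<zero>\<^bsub>L\<^esub>" "x \<in>: M"
 shows "the_elem (h ` (N +>\<^bsub>M\<^esub> x)) = h x"
proof -
 interpret L: module R L by fact
 have Nc: "n \<in> N ==> n \<in>: M" for n using NM.a_subset by auto
 have "h ` (N +>\<^bsub>M\<^esub> x) = {h x}"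
 proof
  show "h ` (N +>\<^bsub>M\<^esub> x) \<subseteq> {h x}"
   using assms Nc by (auto simp: coset_elem lin_add[OF assms(2)] lin_closed[OF assms(2)])
  have "x \<in> N +>\<^bsub>M\<^esub> x" using assms(4) by (auto simp: coset_elem intro!: bexI[of _ "\<zero>\<^bsub>M\<^esub>"] NM.zero_closed)
  then show "{h x} \<subseteq> h ` (N +>\<^bsub>M\<^esub> x)" by auto
 qed
 then show ?thesis by simp
qed

end

end

section \<open>Tensor products\<close>

lemma paths_Nil: "(cs,xs) \<in> paths S [] a b \<longleftrightarrow> cs = [a] \<and> xs = [] \<and> a = b \<and> a \<in> S"
 unfolding paths_def by (auto simp: length_Suc_conv)

text \<open>Peeling off the first factor turns statements on lists of quivers into inductions in
  which the start vertex moves from a to c.\<close>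

lemma paths_Cons:
 "(cs,xs) \<in> paths S (Q # Qs) a b \<longleftrightarrow>
   (\<exists>c x ds ys. cs = a # ds \<and> xs = x # ys \<and> a \<in> S \<and> x \<in>: Q a c \<and> (ds,ys) \<in> paths S Qs c b)"
 (is "?L \<longleftrightarrow> ?R")
proof
 assume L: ?L
 then obtain ds x ys where eq: "cs = a # ds" "xs = x # ys" "length ds = Suc (length Qs)"
  by (cases cs; cases xs) (auto simp: paths_def)
 have "\<forall>i<Suc (length Qs). xs ! i \<in>: ((Q # Qs) ! i) (cs ! i) (cs ! Suc i)"
  using L by (auto simp: paths_def)
 then have "x \<in>: Q a (hd ds)" "\<forall>i<length Qs. ys ! i \<in>: (Qs ! i) (ds ! i) (ds ! Suc i)"
  using eq by (cases ds; fastforce)+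
 then show ?R using L eq
  by (intro exI[of _ "hd ds"] exI[of _ x] exI[of _ ds] exI[of _ ys]) (cases ds; auto simp: paths_def)
next
 assume ?R
 then show ?L by (fastforce simp: paths_def All_less_Suc2 hd_conv_nth neq_Nil_conv)
qed

lemma pathsD:
 assumes "(cs,xs) \<in> paths S Qs a b"
 shows "length cs = Suc (length Qs)" "length xs = length Qs" "hd cs = a" "last cs = b" "set cs \<subseteq> S"
  "a \<in> S" "b \<in> S" "cs \<noteq> []" "cs ! 0 = a"
  "i < length Qs ==> xs ! i \<in>: (Qs ! i) (cs ! i) (cs ! Suc i)"
proof -
 show 1: "length cs = Suc (length Qs)" "length xs = length Qs" "hd cs = a" "last cs = b" "set cs \<subseteq> S"
  "i < length Qs ==> xs ! i \<in>: (Qs ! i) (cs ! i) (cs ! Suc i)"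
  using assms by (auto simp: paths_def)
 show "cs \<noteq> []" using 1 by auto
 then show "a \<in> S" "b \<in> S" "cs ! 0 = a" using 1 by (auto simp: hd_conv_nth)
qed

lemma paths_nth: "[|(cs,xs) \<in> paths S Qs a b; i \<le> length Qs|] ==> cs ! i \<in> S"
 using nth_mem[of i cs] by (auto simp: paths_def)

lemma paths_update:
 assumes "(cs,xs) \<in> paths S Qs a b" "x \<in>: (Qs ! i) (cs ! i) (cs ! Suc i)"
 shows "(cs,xs[i := x]) \<in> paths S Qs a b"
proof -
 have "xs[i := x] ! j \<in>: (Qs ! j) (cs ! j) (cs ! Suc j)" if "j < length Qs" for j
  using assms that by (cases "j = i") (auto simp: paths_def)
 then show ?thesis using assms(1) by (auto simp: paths_def)
qed

text \<open>Consecutive paths share the vertex c, which \<open>tl\<close> drops from the second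
  list.\<close>

lemma paths_append:
 assumes "(cs,xs) \<in> paths S Qs a c" "(ds,ys) \<in> paths S Ps c b"
 shows "(cs @ tl ds, xs @ ys) \<in> paths S (Qs @ Ps) a b"
 using assms(1)
proof (induction Qs arbitrary: cs xs a)
 case Nil
 then show ?case using assms(2) pathsD(3,8)[OF assms(2)] by (cases ds) (auto simp: paths_Nil)
qed (fastforce simp: paths_Cons)

lemma paths_appendE:
 assumes "(es,zs) \<in> paths S (Qs @ Ps) a b"
 obtains c cs xs ds ys where "(cs,xs) \<in> paths S Qs a c" "(ds,ys) \<in> paths S Ps c b"
  "es = cs @ tl ds" "zs = xs @ ys"
 using assms
proof (induction Qs arbitrary: es zs a thesis)
 case Nil
 have "([a],[]) \<in> paths S [] a a" using pathsD(6)[OF Nil(2)] by (simp add: paths_Nil)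
 moreover have "es = [a] @ tl es" using pathsD(3,8)[OF Nil(2)] by (cases es) auto
 ultimately show ?case using Nil(1)[of "[a]" "[]" a es zs] Nil(2) by auto
next
 case (Cons Q Qs)
 then obtain e x es' zs' where 1: "es = a # es'" "zs = x # zs'" "a \<in> S" "x \<in>: Q a e"
  "(es',zs') \<in> paths S (Qs @ Ps) e b" by (auto simp: paths_Cons)
 obtain c cs xs ds ys where "(cs,xs) \<in> paths S Qs e c" "(ds,ys) \<in> paths S Ps c b"
  "es' = cs @ tl ds" "zs' = xs @ ys" using Cons(1)[OF _ 1(5)] by blast
 then show ?case using 1 by (intro Cons(2)[of "a # cs" "x # xs" c ds ys]) (auto simp: paths_Cons)
qed

definition quivers :: "('k,'r) ring_scheme => 'o set => ('k,'o,'m) quiver list => bool" where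
 "quivers R S Qs \<longleftrightarrow> (\<forall>Q\<in>set Qs. \<forall>c\<in>S. \<forall>d\<in>S. module R (Q c d))"

lemma quivers_simps [simp]:
 "quivers R S []" "quivers R S (Q # Qs) \<longleftrightarrow> (\<forall>c\<in>S. \<forall>d\<in>S. module R (Q c d)) \<and> quivers R S Qs"
 "quivers R S (Qs @ Ps) \<longleftrightarrow> quivers R S Qs \<and> quivers R S Ps"
 unfolding quivers_def by auto

text \<open>The vertices stay fixed while one entry varies: over S, multilinearity is tested
  separately for every sequence of intermediate vertices.\<close>

definition multilinear ::
 "('k,'r) ring_scheme => 'o set => ('k,'o,'m) quiver list => 'o => 'o => ('k,'n) module =>
  ('o list \<times> 'm list => 'n) => bool" where
 "multilinear R S Qs a b N \<phi> \<longleftrightarrow> (\<forall>(cs,xs)\<in>paths S Qs a b. \<phi> (cs,xs) \<in>: N \<and>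
   (\<forall>i<length Qs. (\<lambda>x. \<phi> (cs,xs[i := x])) \<in> lin_maps R ((Qs ! i) (cs ! i) (cs ! Suc i)) N))"

lemma multilinear_closed: "[|multilinear R S Qs a b N \<phi>; (cs,xs) \<in> paths S Qs a b|] ==> \<phi> (cs,xs) \<in>: N"
 unfolding multilinear_def by auto

lemma multilinear_Nil:
 "multilinear R S [] a b N \<phi> \<longleftrightarrow> (a = b \<longrightarrow> a \<in> S \<longrightarrow> \<phi> ([a],[]) \<in>: N)"
 unfolding multilinear_def by (auto simp: paths_Nil)

text \<open>The recursive form on which the inductions rest. If \<open>Q a c\<close> has no
  elements, no path starts with a step from a to c and nothing is imposed on the first entry; hence
  the guard.\<close>

lemma multilinear_Cons:
 "multilinear R S (Q # Qs) a b N \<phi> \<longleftrightarrow> (a \<in> S \<longrightarrow> (\<forall>c\<in>S.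
   (\<forall>(ds,ys)\<in>paths S Qs c b. carrier (Q a c) \<noteq> {} \<longrightarrow> (\<lambda>x. \<phi> (a # ds, x # ys)) \<in> lin_maps R (Q a c) N) \<and>
   (\<forall>x\<in>carrier (Q a c). multilinear R S Qs c b N (\<lambda>(ds,ys). \<phi> (a # ds, x # ys)))))" (is "?L \<longleftrightarrow> ?R")
proof
 assume L: ?L
 show ?R
 proof (intro impI ballI conjI)
  fix c p assume a: "a \<in> S" "c \<in> S" and p: "p \<in> paths S Qs c b"
  obtain ds ys where p': "p = (ds,ys)" by force
  have "(\<lambda>x. \<phi> (a # ds, x # ys)) \<in> lin_maps R (Q a c) N" if ne: "carrier (Q a c) \<noteq> {}"
  proof -
   obtain x where x: "x \<in>: Q a c" using ne by auto
   have "(a # ds, x # ys) \<in> paths S (Q # Qs) a b" using a p p' x by (auto simp: paths_Cons)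
   from L[unfolded multilinear_def, rule_format, OF this] have
    "(\<lambda>z. \<phi> (a # ds, (x # ys)[0 := z])) \<in> lin_maps R (((Q # Qs) ! 0) ((a # ds) ! 0) ((a # ds) ! Suc 0)) N" by auto
   moreover have "ds ! 0 = c" using p p' pathsD(9) by fastforce
   ultimately show ?thesis by simp
  qed
  then show "case p of (ds,ys) => carrier (Q a c) \<noteq> {} \<longrightarrow> (\<lambda>x. \<phi> (a # ds, x # ys)) \<in> lin_maps R (Q a c) N"
   unfolding p' by simp
 next
  fix c x assume a: "a \<in> S" "c \<in> S" and x: "x \<in>: Q a c"
  show "multilinear R S Qs c b N (\<lambda>(ds,ys). \<phi> (a # ds, x # ys))"
   unfolding multilinear_def
  proof (clarify, intro conjI allI impI)
   fix ds ys assume p: "(ds,ys) \<in> paths S Qs c b"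
   have P: "(a # ds, x # ys) \<in> paths S (Q # Qs) a b" using a p x by (auto simp: paths_Cons)
   show "\<phi> (a # ds, x # ys) \<in>: N" using multilinear_closed[OF L P] .
   fix i assume "i < length Qs"
   then have "(\<lambda>z. \<phi> (a # ds, (x # ys)[Suc i := z])) \<in> lin_maps R (((Q # Qs) ! Suc i) ((a # ds) ! Suc i) ((a # ds) ! Suc (Suc i))) N"
    using L[unfolded multilinear_def, rule_format, OF P] by auto
   then show "(\<lambda>z. \<phi> (a # ds, x # ys[i := z])) \<in> lin_maps R ((Qs ! i) (ds ! i) (ds ! Suc i)) N" by simp
  qed
 qed
next
 assume R: ?R
 show ?L unfolding multilinear_def
 proof (clarify)
  fix cs xs assume "(cs,xs) \<in> paths S (Q # Qs) a b"
  then obtain c x ds ys where p: "cs = a # ds" "xs = x # ys" "a \<in> S" "x \<in>: Q a c" "(ds,ys) \<in> paths S Qs c b"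
   by (auto simp: paths_Cons)
  have c: "c \<in> S" "ds ! 0 = c" using pathsD[OF p(5)] by auto
  have "\<forall>(ds,ys)\<in>paths S Qs c b. carrier (Q a c) \<noteq> {} \<longrightarrow> (\<lambda>x. \<phi> (a # ds, x # ys)) \<in> lin_maps R (Q a c) N"
   using R p(3) c(1) by blast
  from bspec[OF this p(5)] have 1: "(\<lambda>x. \<phi> (a # ds, x # ys)) \<in> lin_maps R (Q a c) N" using p(4) by auto
  have 2: "multilinear R S Qs c b N (\<lambda>(ds,ys). \<phi> (a # ds, x # ys))" using R p c by auto
  show "\<phi> (cs,xs) \<in>: N \<and> (\<forall>i<length (Q # Qs).
   (\<lambda>x. \<phi> (cs,xs[i := x])) \<in> lin_maps R (((Q # Qs) ! i) (cs ! i) (cs ! Suc i)) N)"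
  proof (intro conjI allI impI)
   show "\<phi> (cs,xs) \<in>: N" using lin_closed[OF 1 p(4)] p by simp
   fix i assume i: "i < length (Q # Qs)"
   show "(\<lambda>x. \<phi> (cs,xs[i := x])) \<in> lin_maps R (((Q # Qs) ! i) (cs ! i) (cs ! Suc i)) N"
   proof (cases i)
    case 0 then show ?thesis using 1 p c by simp
   next
    case (Suc j)
    then have "(\<lambda>z. \<phi> (a # ds, x # ys[j := z])) \<in> lin_maps R ((Qs ! j) (ds ! j) (ds ! Suc j)) N"
     using 2[unfolded multilinear_def, rule_format, OF p(5)] i by auto
    then show ?thesis using Suc p by simp
   qed
  qed
 qed
qed

lemma multilinear_cong:
 assumes "\<And>cs xs. (cs,xs) \<in> paths S Qs a b ==> \<phi> (cs,xs) = \<psi> (cs,xs)" "quivers R S Qs"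
 shows "multilinear R S Qs a b N \<phi> \<longleftrightarrow> multilinear R S Qs a b N \<psi>"
proof -
 have imp: "multilinear R S Qs a b N \<psi>" if L: "multilinear R S Qs a b N \<phi>"
  and eq: "\<And>cs xs. (cs,xs) \<in> paths S Qs a b ==> \<phi> (cs,xs) = \<psi> (cs,xs)" for \<phi> \<psi>
  unfolding multilinear_def
 proof (clarify, intro conjI allI impI)
  fix cs xs assume p: "(cs,xs) \<in> paths S Qs a b"
  show "\<psi> (cs,xs) \<in>: N" using multilinear_closed[OF L p] eq[OF p] by simp
  fix i assume i: "i < length Qs"
  have P: "(cs,xs[i := x]) \<in> paths S Qs a b" if "x \<in>: (Qs ! i) (cs ! i) (cs ! Suc i)" for x
   by (rule paths_update[OF p that])
  have "(\<lambda>x. \<phi> (cs,xs[i := x])) \<in> lin_maps R ((Qs ! i) (cs ! i) (cs ! Suc i)) N"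
   using L p i by (auto simp: multilinear_def)
  moreover have "cs ! i \<in> S" "cs ! Suc i \<in> S" using paths_nth[OF p] i by auto
  ultimately show "(\<lambda>x. \<psi> (cs,xs[i := x])) \<in> lin_maps R ((Qs ! i) (cs ! i) (cs ! Suc i)) N"
   using assms(2) i eq[OF P]
   by (elim lin_cong) (simp_all add: quivers_def)
 qed
 show ?thesis using imp[of \<phi> \<psi>] imp[of \<psi> \<phi>] assms(1) by auto
qed

lemmas multilinear_congI = multilinear_cong[THEN iffD1, rotated 1]

lemma multilinear_comp:
 "[|multilinear R S Qs a b N \<phi>; h \<in> lin_maps R N L|] ==> multilinear R S Qs a b L (\<lambda>p. h (\<phi> p))"
 unfolding multilinear_def by (fast intro: lin_closed lin_comp[where g=h])

text \<open>Every entry belongs to one of the two halves, and varying it leaves the other half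
  frozen. The induction peels off the first list.\<close>

lemma multilinear_append:
 assumes "\<And>c ds ys. (ds,ys) \<in> paths S Ps c b ==> multilinear R S Qs a c N (\<lambda>(cs,xs). \<phi> (cs @ tl ds, xs @ ys))"
  and "\<And>c cs xs. (cs,xs) \<in> paths S Qs a c ==> multilinear R S Ps c b N (\<lambda>(ds,ys). \<phi> (cs @ tl ds, xs @ ys))"
  and q: "quivers R S Ps" "quivers R S Qs"
 shows "multilinear R S (Qs @ Ps) a b N \<phi>"
 using assms(1,2) q(2)
proof (induction Qs arbitrary: a \<phi>)
 case Nil
 have "multilinear R S Ps a b N \<phi>" if "a \<in> S"
 proof -
  have "multilinear R S Ps a b N (\<lambda>(ds,ys). \<phi> ([a] @ tl ds, [] @ ys))"
   using Nil(2)[of "[a]" "[]" a] that by (auto simp: paths_Nil)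
  moreover have "\<phi> ([a] @ tl ds, [] @ ys) = \<phi> (ds,ys)" if "(ds,ys) \<in> paths S Ps a b" for ds ys
   using pathsD(3,8)[OF that] by (cases ds) auto
  ultimately show ?thesis using multilinear_cong[of S Ps a b "\<lambda>(ds,ys). \<phi> ([a] @ tl ds, [] @ ys)" \<phi> R N] q(1) by auto
 qed
 \<comment> \<open>Outside S no path starts, and the condition is empty.\<close>
 moreover have "multilinear R S Ps a b N \<phi>" if "a \<notin> S" using that pathsD(6) by (fastforce simp: multilinear_def)
 ultimately show ?case by auto
next
 case (Cons Q Qs)
 show ?case unfolding append_Cons multilinear_Cons
 proof (intro impI ballI conjI)
  fix c p assume a: "a \<in> S" "c \<in> S" and p: "p \<in> paths S (Qs @ Ps) c b"
  obtain es zs where p': "p = (es,zs)" by force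
  obtain d cs xs ds ys where d: "(cs,xs) \<in> paths S Qs c d" "(ds,ys) \<in> paths S Ps d b"
   "es = cs @ tl ds" "zs = xs @ ys" using p p' by (auto elim: paths_appendE)
  show "case p of (ds,ys) => carrier (Q a c) \<noteq> {} \<longrightarrow> (\<lambda>x. \<phi> (a # ds, x # ys)) \<in> lin_maps R (Q a c) N"
  proof -
   have "\<forall>(cs,xs)\<in>paths S Qs c d. carrier (Q a c) \<noteq> {} \<longrightarrow>
     (\<lambda>x. \<phi> (a # cs @ tl ds, x # xs @ ys)) \<in> lin_maps R (Q a c) N"
    using Cons(2)[OF d(2)] a unfolding multilinear_Cons by simp
   then show ?thesis using bspec[OF _ d(1)] unfolding p' d(3,4) by fast
  qed
 next
  fix c x assume a: "a \<in> S" "c \<in> S" and x: "x \<in>: Q a c"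
  show "multilinear R S (Qs @ Ps) c b N (\<lambda>(ds,ys). \<phi> (a # ds, x # ys))"
  proof (rule Cons.IH)
   fix d ds ys assume "(ds,ys) \<in> paths S Ps d b"
   from Cons(2)[OF this] show "multilinear R S Qs c d N (\<lambda>(cs, xs). case (cs @ tl ds, xs @ ys) of (ds, ys) => \<phi> (a # ds, x # ys))"
    using a x unfolding multilinear_Cons by auto
  next
   fix d cs xs assume "(cs,xs) \<in> paths S Qs c d"
   then have "(a # cs, x # xs) \<in> paths S (Q # Qs) a d" using a x by (auto simp: paths_Cons)
   from Cons(3)[OF this] show "multilinear R S Ps d b N (\<lambda>(ds, ys). case (cs @ tl ds, xs @ ys) of (ds, ys) => \<phi> (a # ds, x # ys))"
    by simp
  qed (use Cons(4) in auto)
 qed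
qed

lemma multilinear_appendD:
 assumes "multilinear R S (Qs @ Ps) a b N \<phi>" "quivers R S (Qs @ Ps)"
 shows "(ds,ys) \<in> paths S Ps c b ==> multilinear R S Qs a c N (\<lambda>(cs,xs). \<phi> (cs @ tl ds, xs @ ys))"
  and "(cs,xs) \<in> paths S Qs a c ==> multilinear R S Ps c b N (\<lambda>(ds,ys). \<phi> (cs @ tl ds, xs @ ys))"
proof -
 show "multilinear R S Qs a c N (\<lambda>(cs,xs). \<phi> (cs @ tl ds, xs @ ys))" if p: "(ds,ys) \<in> paths S Ps c b"
  unfolding multilinear_def
 proof (clarify, intro conjI allI impI)
  fix cs xs assume q: "(cs,xs) \<in> paths S Qs a c"
  note P = paths_append[OF q p]
  show "\<phi> (cs @ tl ds, xs @ ys) \<in>: N" using multilinear_closed[OF assms(1) P] .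
  fix i assume i: "i < length Qs"
  then show "(\<lambda>x. \<phi> (cs @ tl ds, xs[i := x] @ ys)) \<in> lin_maps R ((Qs ! i) (cs ! i) (cs ! Suc i)) N"
   using assms(1)[unfolded multilinear_def, rule_format, OF P] pathsD[OF q]
   by (auto simp: nth_append list_update_append split: if_splits dest!: spec[of _ i])
 qed
 show "multilinear R S Ps c b N (\<lambda>(ds,ys). \<phi> (cs @ tl ds, xs @ ys))" if q: "(cs,xs) \<in> paths S Qs a c"
  unfolding multilinear_def
 proof (clarify, intro conjI allI impI)
  fix ds ys assume p: "(ds,ys) \<in> paths S Ps c b"
  note P = paths_append[OF q p]
  show "\<phi> (cs @ tl ds, xs @ ys) \<in>: N" using multilinear_closed[OF assms(1) P] .
  fix i assume i: "i < length Ps"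
  \<comment> \<open>For k = 0 this is the shared vertex, which has been dropped from ds and is found
    at the end of cs.\<close>
  have "(cs @ tl ds) ! (length Qs + k) = ds ! k" if "k \<le> length Ps" for k
  proof (cases k)
   case 0 then show ?thesis using pathsD[OF q] pathsD[OF p] last_conv_nth[of cs] by (simp add: nth_append)
  next
   case (Suc j) then show ?thesis using pathsD[OF q] pathsD[OF p] that by (simp add: nth_append nth_tl)
  qed
  from this[of i] this[of "Suc i"]
  have e: "(cs @ tl ds) ! (length Qs + i) = ds ! i" "(cs @ tl ds) ! Suc (length Qs + i) = ds ! Suc i" using i by auto
  have "\<forall>i<length (Qs @ Ps). (\<lambda>x. \<phi> (cs @ tl ds, (xs @ ys)[i := x])) \<in>
   lin_maps R (((Qs @ Ps) ! i) ((cs @ tl ds) ! i) ((cs @ tl ds) ! Suc i)) N"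
   using assms(1)[unfolded multilinear_def, rule_format, OF P] by auto
  from this[rule_format, of "length Qs + i"]
  have "(\<lambda>x. \<phi> (cs @ tl ds, (xs @ ys)[length Qs + i := x])) \<in>
   lin_maps R (((Qs @ Ps) ! (length Qs + i)) ((cs @ tl ds) ! (length Qs + i)) ((cs @ tl ds) ! Suc (length Qs + i))) N"
   using i by simp
  then show "(\<lambda>x. \<phi> (cs @ tl ds, xs @ ys[i := x])) \<in> lin_maps R ((Ps ! i) (ds ! i) (ds ! Suc i)) N"
   using e pathsD(2)[OF q] by (simp add: list_update_append)
 qed
qed

context cring
begin

abbreviation "MLin \<equiv> multilinear R"
abbreviation "qv \<equiv> quivers R"

context
 fixes S :: "'o set" and Qs :: "('a,'o,'m) quiver list" and a b :: 'o
 assumes Qs: "qv S Qs"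
begin

abbreviation (input) "F \<equiv> FM (paths S Qs a b)"

interpretation F: module R F by (rule FM_module)

lemma paths_module:
 "[|(cs,xs) \<in> paths S Qs a b; i < length Qs|] ==> module R ((Qs ! i) (cs ! i) (cs ! Suc i))"
 using Qs paths_nth[of cs xs S Qs a b i] paths_nth[of cs xs S Qs a b "Suc i"] by (auto simp: quivers_def)

lemma multilin_rels_closed: "multilin_rels R S Qs a b \<subseteq> carrier F"
proof -
 have 1: "single R (cs,xs[i := x]) \<in>: F"
  if "(cs,xs) \<in> paths S Qs a b" "x \<in>: (Qs ! i) (cs ! i) (cs ! Suc i)" for cs xs i x
  using paths_update[OF that] by (rule single_carrier)
 have 2: "x \<oplus>\<^bsub>(Qs ! i) (cs ! i) (cs ! Suc i)\<^esub> y \<in>: (Qs ! i) (cs ! i) (cs ! Suc i)"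
  if "(cs,xs) \<in> paths S Qs a b" "i < length Qs" "x \<in>: (Qs ! i) (cs ! i) (cs ! Suc i)"
   "y \<in>: (Qs ! i) (cs ! i) (cs ! Suc i)" for cs xs i x y
  using abelian_monoid.a_closed[OF abelian_group.axioms(1)[OF module.axioms(2)[OF paths_module[OF that(1,2)]]] that(3,4)] .
 have 3: "r \<odot>\<^bsub>(Qs ! i) (cs ! i) (cs ! Suc i)\<^esub> x \<in>: (Qs ! i) (cs ! i) (cs ! Suc i)"
  if "(cs,xs) \<in> paths S Qs a b" "i < length Qs" "x \<in>: (Qs ! i) (cs ! i) (cs ! Suc i)" "r \<in>: R" for cs xs i x r
  using module.smult_closed[OF paths_module[OF that(1,2)] that(4,3)] .
 show ?thesis unfolding multilin_rels_def Let_def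
  by (auto simp del: free_module_simps intro!: F.minus_closed F.a_closed F.smult_closed 1 2 3)
qed

lemma submodule_multilin: "submodule (multilin_submod R S Qs a b) R F"
proof -
 \<comment> \<open>The free module itself is a submodule containing the relations, so the hull is an
   intersection over a nonempty family.\<close>
 have carr: "submodule (carrier F) R F"
  by (rule F.submoduleI) (auto simp del: free_module_simps intro: F.a_closed F.a_inv_closed)
 have sub: "multilin_submod R S Qs a b \<subseteq> carrier F"
  unfolding multilin_submod_def by (rule hull_minimal[of _ _ "\<lambda>N. submodule N R F"]) (auto simp: carr multilin_rels_closed)
 have mem: "x \<in> multilin_submod R S Qs a b \<longleftrightarrow> (\<forall>T. submodule T R F \<longrightarrow> multilin_rels R S Qs a b \<subseteq> T \<longrightarrow> x \<in> T)" for x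
  unfolding multilin_submod_def hull_def by (simp only: Inter_iff mem_Collect_eq) blast
 have z: "\<zero>\<^bsub>F\<^esub> \<in> T" if "submodule T R F" for T
  using subgroup.one_closed[OF submodule.axioms(1)[OF that]] by (simp only: monoid.simps)
 show ?thesis
  by (rule F.submoduleI[OF sub]; unfold mem) (metis z F.submoduleE(3,4,5))+
qed

lemma TT_module: "module R (TT S Qs a b)"
 unfolding tensor_def by (rule quot_is_module[OF FM_module submodule_multilin])

lemma pure_coset:
 "(cs,xs) \<in> paths S Qs a b ==> pure R S Qs cs xs = multilin_submod R S Qs a b +>\<^bsub>F\<^esub> single R (cs,xs)"
 unfolding pure_def by (simp only: pathsD(3,4))

lemma pure_closed: "(cs,xs) \<in> paths S Qs a b ==> pure R S Qs cs xs \<in>: TT S Qs a b"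
 unfolding pure_coset tensor_def
 by (intro coset_closed[OF FM_module submodule_multilin] single_carrier)

text \<open>The relations divided out are precisely additivity and homogeneity in one entry.\<close>

lemma pure_multilinear: "MLin S Qs a b (TT S Qs a b) (\<lambda>(cs,xs). pure R S Qs cs xs)"
 unfolding multilinear_def
proof (clarify, intro conjI allI impI)
 fix cs xs assume p: "(cs,xs) \<in> paths S Qs a b"
 show "pure R S Qs cs xs \<in>: TT S Qs a b" by (rule pure_closed[OF p])
 fix i assume i: "i < length Qs"
 let ?M = "(Qs ! i) (cs ! i) (cs ! Suc i)" and ?N = "multilin_submod R S Qs a b"
 interpret M: module R ?M by (rule paths_module[OF p i])
 note cs = coset_closed[OF FM_module submodule_multilin] coset_add[OF FM_module submodule_multilin]
  coset_smult[OF FM_module submodule_multilin] coset_eqI[OF FM_module submodule_multilin]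
 have sc: "single R (cs,xs[i := x]) \<in>: F" if "x \<in>: ?M" for x
  using paths_update[OF p that] by (rule single_carrier)
 have rel: "r \<in> ?N" if "r \<in> multilin_rels R S Qs a b" for r
  using that hull_subset[of "multilin_rels R S Qs a b"] unfolding multilin_submod_def by auto
 show "(\<lambda>x. pure R S Qs cs (xs[i := x])) \<in> Lin ?M (TT S Qs a b)"
 proof (rule lin_mapsI)
  fix x assume "x \<in>: ?M"
  then show "pure R S Qs cs (xs[i := x]) \<in>: TT S Qs a b" by (intro pure_closed paths_update[OF p])
 next
  fix x y assume xy: "x \<in>: ?M" "y \<in>: ?M"
  have "single R (cs,xs[i := x \<oplus>\<^bsub>?M\<^esub> y]) \<ominus>\<^bsub>F\<^esub> (single R (cs,xs[i := x]) \<oplus>\<^bsub>F\<^esub> single R (cs,xs[i := y])) \<in> ?N"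
   using p i xy by (intro rel) (fastforce simp: multilin_rels_def Let_def simp del: free_module_simps)
  then have "?N +>\<^bsub>F\<^esub> single R (cs,xs[i := x \<oplus>\<^bsub>?M\<^esub> y]) = ?N +>\<^bsub>F\<^esub> (single R (cs,xs[i := x]) \<oplus>\<^bsub>F\<^esub> single R (cs,xs[i := y]))"
   by (intro cs(4)) (auto simp del: free_module_simps intro: sc xy F.a_closed)
  then show "pure R S Qs cs (xs[i := x \<oplus>\<^bsub>?M\<^esub> y]) = pure R S Qs cs (xs[i := x]) \<oplus>\<^bsub>TT S Qs a b\<^esub> pure R S Qs cs (xs[i := y])"
   using xy M.a_closed[OF xy]
   by (simp only: pure_coset paths_update[OF p] tensor_def cs(2) sc)
 next
  fix r x assume r: "r \<in>: R" and x: "x \<in>: ?M"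
  have "single R (cs,xs[i := r \<odot>\<^bsub>?M\<^esub> x]) \<ominus>\<^bsub>F\<^esub> (r \<odot>\<^bsub>F\<^esub> single R (cs,xs[i := x])) \<in> ?N"
   using p i r x by (intro rel) (fastforce simp: multilin_rels_def Let_def simp del: free_module_simps)
  then have "?N +>\<^bsub>F\<^esub> single R (cs,xs[i := r \<odot>\<^bsub>?M\<^esub> x]) = ?N +>\<^bsub>F\<^esub> (r \<odot>\<^bsub>F\<^esub> single R (cs,xs[i := x]))"
   using r by (intro cs(4)) (auto simp del: free_module_simps intro: sc x F.smult_closed)
  then show "pure R S Qs cs (xs[i := r \<odot>\<^bsub>?M\<^esub> x]) = r \<odot>\<^bsub>TT S Qs a b\<^esub> pure R S Qs cs (xs[i := x])"
   using r x M.smult_closed[OF r x]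
   by (simp only: pure_coset paths_update[OF p] tensor_def cs(3) sc)
 qed
qed

text \<open>Pure tensors are the images of the basis vectors of the free module, and a linear map on
  the latter is determined by the basis.\<close>

lemma tensor_eqI:
 assumes "module R N" "h \<in> Lin (TT S Qs a b) N" "g \<in> Lin (TT S Qs a b) N"
  and "\<And>cs xs. (cs,xs) \<in> paths S Qs a b ==> h (pure R S Qs cs xs) = g (pure R S Qs cs xs)"
  and "z \<in>: TT S Qs a b"
 shows "h z = g z"
proof -
 let ?N = "multilin_submod R S Qs a b"
 obtain x where x: "x \<in>: F" "z = ?N +>\<^bsub>F\<^esub> x"
  using assms(5) unfolding tensor_def by (rule cosetE[OF FM_module submodule_multilin])
 have l: "(\<lambda>x. ?N +>\<^bsub>F\<^esub> x) \<in> Lin F (TT S Qs a b)"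
  unfolding tensor_def by (rule coset_linear[OF FM_module submodule_multilin])
 show ?thesis unfolding x(2)
 proof (rule free_eqI[OF assms(1) lin_comp[OF assms(2) l] lin_comp[OF assms(3) l] _ x(1)])
  fix p assume "p \<in> paths S Qs a b"
  moreover obtain cs xs where "p = (cs,xs)" by force
  ultimately show "h (?N +>\<^bsub>F\<^esub> single R p) = g (?N +>\<^bsub>F\<^esub> single R p)" using assms(4) by (simp flip: pure_coset)
 qed
qed

context
 fixes N :: "('a,'n) module" and \<phi>
 assumes N: "module R N" and \<phi>: "MLin S Qs a b N \<phi>"
begin

interpretation N: module R N by (rule N)

lemma \<phi>_closed: "\<phi> \<in> paths S Qs a b \<rightarrow> carrier N"
 using \<phi> by (auto simp: multilinear_def)

text \<open>The kernel of the linear extension is a submodule. Multilinearity puts the defining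
  relations into it, hence also their hull.\<close>

lemma lin_ext_multilin_submod: "z \<in> multilin_submod R S Qs a b ==> lin_ext R N \<phi> z = \<zero>\<^bsub>N\<^esub>"
proof -
 note l = lin_ext_linear[OF N \<phi>_closed]
 let ?K = "{z \<in> carrier F. lin_ext R N \<phi> z = \<zero>\<^bsub>N\<^esub>}"
 have "submodule ?K R F"
 proof (rule F.submoduleI)
  fix z assume z: "z \<in> ?K"
  have "\<ominus>\<^bsub>F\<^esub> z = \<zero>\<^bsub>F\<^esub> \<ominus>\<^bsub>F\<^esub> z" unfolding F.minus_eq using z by (intro F.l_zero[symmetric] F.a_inv_closed) auto
  then show "\<ominus>\<^bsub>F\<^esub> z \<in> ?K" using z lin_minus[OF FM_module N l, of "\<zero>\<^bsub>F\<^esub>" z] lin_zero[OF FM_module N l] F.a_inv_closed[of z]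
   by (auto simp del: free_module_simps simp: N.minus_eq)
 qed (use lin_zero[OF FM_module N l] in \<open>auto simp del: free_module_simps simp: lin_add[OF l] lin_smult[OF l] F.a_closed\<close>)
 moreover have "multilin_rels R S Qs a b \<subseteq> ?K"
 proof
  fix z assume z: "z \<in> multilin_rels R S Qs a b"
  have zc: "z \<in>: F" using z multilin_rels_closed by auto
  from z consider
   (add) cs xs i x y where "z = single R (cs, xs[i := x \<oplus>\<^bsub>(Qs ! i) (cs ! i) (cs ! Suc i)\<^esub> y])
    \<ominus>\<^bsub>F\<^esub> (single R (cs, xs[i := x]) \<oplus>\<^bsub>F\<^esub> single R (cs, xs[i := y]))"
    "(cs,xs) \<in> paths S Qs a b" "i < length Qs"
    "x \<in>: (Qs ! i) (cs ! i) (cs ! Suc i)" "y \<in>: (Qs ! i) (cs ! i) (cs ! Suc i)" |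
   (smult) cs xs i r x where "z = single R (cs, xs[i := r \<odot>\<^bsub>(Qs ! i) (cs ! i) (cs ! Suc i)\<^esub> x])
    \<ominus>\<^bsub>F\<^esub> (r \<odot>\<^bsub>F\<^esub> single R (cs, xs[i := x]))"
    "(cs,xs) \<in> paths S Qs a b" "i < length Qs" "r \<in>: R" "x \<in>: (Qs ! i) (cs ! i) (cs ! Suc i)"
   unfolding multilin_rels_def Let_def by blast
  then have "lin_ext R N \<phi> z = \<zero>\<^bsub>N\<^esub>"
  proof cases
   case add
   let ?M = "(Qs ! i) (cs ! i) (cs ! Suc i)"
   interpret M: module R ?M by (rule paths_module[OF add(2,3)])
   have p: "(cs,xs[i := v]) \<in> paths S Qs a b" if "v \<in>: ?M" for v by (rule paths_update[OF add(2) that])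
   have m: "(\<lambda>x. \<phi> (cs,xs[i := x])) \<in> Lin ?M N" using \<phi> add by (auto simp: multilinear_def)
   have s: "single R (cs,xs[i := v]) \<in>: F" "lin_ext R N \<phi> (single R (cs,xs[i := v])) = \<phi> (cs,xs[i := v])"
    "\<phi> (cs,xs[i := v]) \<in>: N" if "v \<in>: ?M" for v
    using single_carrier[OF p[OF that]] multilinear_closed[OF \<phi> p[OF that]] lin_ext_single[OF N] by auto
   note xy = add(4,5) M.a_closed[OF add(4,5)]
   have "lin_ext R N \<phi> z = \<phi> (cs,xs[i := x \<oplus>\<^bsub>?M\<^esub> y]) \<ominus>\<^bsub>N\<^esub> (\<phi> (cs,xs[i := x]) \<oplus>\<^bsub>N\<^esub> \<phi> (cs,xs[i := y]))"
    unfolding add(1) using xy by (simp only: lin_minus[OF FM_module N l] lin_add[OF l] s F.a_closed)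
   also have "\<dots> = \<zero>\<^bsub>N\<^esub>" using xy by (simp add: lin_add[OF m] s(3) N.minus_eq N.r_neg)
   finally show ?thesis .
  next
   case smult
   let ?M = "(Qs ! i) (cs ! i) (cs ! Suc i)"
   interpret M: module R ?M by (rule paths_module[OF smult(2,3)])
   have p: "(cs,xs[i := v]) \<in> paths S Qs a b" if "v \<in>: ?M" for v by (rule paths_update[OF smult(2) that])
   have m: "(\<lambda>x. \<phi> (cs,xs[i := x])) \<in> Lin ?M N" using \<phi> smult by (auto simp: multilinear_def)
   have s: "single R (cs,xs[i := v]) \<in>: F" "lin_ext R N \<phi> (single R (cs,xs[i := v])) = \<phi> (cs,xs[i := v])"
    "\<phi> (cs,xs[i := v]) \<in>: N" if "v \<in>: ?M" for v
    using single_carrier[OF p[OF that]] multilinear_closed[OF \<phi> p[OF that]] lin_ext_single[OF N] by auto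
   note xy = smult(4,5) M.smult_closed[OF smult(4,5)]
   have "lin_ext R N \<phi> z = \<phi> (cs,xs[i := r \<odot>\<^bsub>?M\<^esub> x]) \<ominus>\<^bsub>N\<^esub> (r \<odot>\<^bsub>N\<^esub> \<phi> (cs,xs[i := x]))"
    unfolding smult(1) using xy by (simp only: lin_minus[OF FM_module N l] lin_smult[OF l] s F.smult_closed)
   also have "\<dots> = \<zero>\<^bsub>N\<^esub>" using xy by (simp add: lin_smult[OF m] s(3) N.minus_eq N.r_neg)
   finally show ?thesis .
  qed
  then show "z \<in> ?K" using zc by simp
 qed
 ultimately have "multilin_submod R S Qs a b \<subseteq> ?K" unfolding multilin_submod_def by (intro hull_minimal)
 then show "z \<in> multilin_submod R S Qs a b ==> lin_ext R N \<phi> z = \<zero>\<^bsub>N\<^esub>" by auto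
qed

lemma tensor_lift_coset:
 "x \<in>: F ==> tensor_lift R N \<phi> (multilin_submod R S Qs a b +>\<^bsub>F\<^esub> x) = lin_ext R N \<phi> x"
 unfolding tensor_lift_def
 by (rule quot_lift[OF FM_module submodule_multilin N lin_ext_linear[OF N \<phi>_closed] lin_ext_multilin_submod])

lemma tensor_lift_pure: "(cs,xs) \<in> paths S Qs a b ==> tensor_lift R N \<phi> (pure R S Qs cs xs) = \<phi> (cs,xs)"
 using \<phi>_closed by (auto simp: pure_coset tensor_lift_coset[OF single_carrier] lin_ext_single[OF N] Pi_def)

lemma tensor_lift_linear: "tensor_lift R N \<phi> \<in> Lin (TT S Qs a b) N"
proof -
 note l = lin_ext_linear[OF N \<phi>_closed]
 let ?N = "multilin_submod R S Qs a b"
 note cE = cosetE[OF FM_module submodule_multilin]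
 note s = tensor_lift_coset coset_add[OF FM_module submodule_multilin]
  coset_smult[OF FM_module submodule_multilin] F.a_closed F.smult_closed lin_add[OF l] lin_smult[OF l] lin_closed[OF l]
 show ?thesis unfolding tensor_def
  by (rule lin_mapsI; elim cE; hypsubst) (simp_all only: s)
qed

end

end

end

lemma lin_plus:
 assumes "module R M" "module R N" "h \<in> lin_maps R M N" "g \<in> lin_maps R M N"
 shows "(\<lambda>x. h x \<oplus>\<^bsub>N\<^esub> g x) \<in> lin_maps R M N"
proof -
 interpret M: module R M by fact
 interpret N: module R N by fact
 note s = lin_closed[OF assms(3)] lin_closed[OF assms(4)] lin_add[OF assms(3)] lin_add[OF assms(4)]
  lin_smult[OF assms(3)] lin_smult[OF assms(4)]
 show ?thesis by (rule lin_mapsI) (simp_all add: s N.smult_r_distr N.a_ac)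
qed

lemma lin_scale:
 assumes "module R M" "module R N" "h \<in> lin_maps R M N" "r \<in>: R"
 shows "(\<lambda>x. r \<odot>\<^bsub>N\<^esub> h x) \<in> lin_maps R M N"
proof -
 interpret M: module R M by fact
 interpret N: module R N by fact
 note s = lin_closed[OF assms(3)] lin_add[OF assms(3)] lin_smult[OF assms(3)]
 show ?thesis using assms(4) by (intro lin_mapsI) (simp_all add: s N.smult_r_distr N.smult_assoc1[symmetric] M.R.m_comm)
qed

context cring
begin

text \<open>\<open>tensor_append\<close> is a lift inside a lift. For the outer one to exist, the
  inner one evaluated at a fixed B must remain multilinear in the outer variable;
  \<open>tensor_eqI\<close> reduces this to pure B.\<close>

lemma multilinear_lift:
 assumes q: "qv S Qs" "qv S Ps" and N: "module R N"
  and 1: "\<And>p. p \<in> paths S Qs a c ==> MLin S Ps c' b N (\<phi> p)"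
  and 2: "\<And>q. q \<in> paths S Ps c' b ==> MLin S Qs a c N (\<lambda>p. \<phi> p q)"
  and B: "B \<in>: TT S Ps c' b"
 shows "MLin S Qs a c N (\<lambda>p. tensor_lift R N (\<phi> p) B)"
 unfolding multilinear_def
proof (clarify, intro conjI allI impI)
 fix cs xs assume p: "(cs,xs) \<in> paths S Qs a c"
 note T = TT_module[OF q(2)]
 show "tensor_lift R N (\<phi> (cs,xs)) B \<in>: N"
  using tensor_lift_linear[OF q(2) N 1[OF p]] B by (rule lin_closed)
 fix i assume i: "i < length Qs"
 let ?M = "(Qs ! i) (cs ! i) (cs ! Suc i)"
 interpret M: module R ?M by (rule paths_module[OF q(1) p i])
 have P: "(cs,xs[i := x]) \<in> paths S Qs a c" if "x \<in>: ?M" for x by (rule paths_update[OF p that])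
 note lp = tensor_lift_pure[OF q(2) N 1[OF P]]
 note ll = tensor_lift_linear[OF q(2) N 1[OF P]]
 have m: "(\<lambda>x. \<phi> (cs,xs[i := x]) r) \<in> Lin ?M N" if "r \<in> paths S Ps c' b" for r
  using 2[OF that] p i by (auto simp: multilinear_def)
 show "(\<lambda>x. tensor_lift R N (\<phi> (cs,xs[i := x])) B) \<in> Lin ?M N"
 proof (rule lin_mapsI)
  fix x assume x: "x \<in>: ?M"
  show "tensor_lift R N (\<phi> (cs,xs[i := x])) B \<in>: N" using ll[OF x] B by (rule lin_closed)
 next
  fix x y assume x: "x \<in>: ?M" and y: "y \<in>: ?M"
  show "tensor_lift R N (\<phi> (cs,xs[i := x \<oplus>\<^bsub>?M\<^esub> y])) B =
   tensor_lift R N (\<phi> (cs,xs[i := x])) B \<oplus>\<^bsub>N\<^esub> tensor_lift R N (\<phi> (cs,xs[i := y])) B"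
   by (rule tensor_eqI[OF q(2) N ll[OF M.a_closed[OF x y]] lin_plus[OF T N ll[OF x] ll[OF y]] _ B])
    (simp add: lp x y lin_add[OF m])
 next
  fix r x assume r: "r \<in>: R" and x: "x \<in>: ?M"
  show "tensor_lift R N (\<phi> (cs,xs[i := r \<odot>\<^bsub>?M\<^esub> x])) B = r \<odot>\<^bsub>N\<^esub> tensor_lift R N (\<phi> (cs,xs[i := x])) B"
   by (rule tensor_eqI[OF q(2) N ll[OF M.smult_closed[OF r x]] lin_scale[OF T N ll[OF x] r] _ B])
    (simp add: lp r x lin_smult[OF m])
 qed
qed

text \<open>The other half of bilinearity: a lift depends linearly on a parameter of the map being
  lifted.\<close>

lemma tensor_lift_param:
 assumes q: "qv S Qs" and L: "module R L" and N: "module R N"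
  and 1: "\<And>B. B \<in>: L ==> MLin S Qs a c N (\<phi> B)"
  and 2: "\<And>p. p \<in> paths S Qs a c ==> (\<lambda>B. \<phi> B p) \<in> Lin L N"
  and A: "A \<in>: TT S Qs a c"
 shows "(\<lambda>B. tensor_lift R N (\<phi> B) A) \<in> Lin L N"
proof -
 interpret L: module R L by (rule L)
 note T = TT_module[OF q]
 note lp = tensor_lift_pure[OF q N 1]
 note ll = tensor_lift_linear[OF q N 1]
 show ?thesis
 proof (rule lin_mapsI)
  fix x assume x: "x \<in>: L"
  show "tensor_lift R N (\<phi> x) A \<in>: N" using ll[OF x] A by (rule lin_closed)
 next
  fix x y assume x: "x \<in>: L" and y: "y \<in>: L"
  show "tensor_lift R N (\<phi> (x \<oplus>\<^bsub>L\<^esub> y)) A = tensor_lift R N (\<phi> x) A \<oplus>\<^bsub>N\<^esub> tensor_lift R N (\<phi> y) A"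
   by (rule tensor_eqI[OF q N ll[OF L.a_closed[OF x y]] lin_plus[OF T N ll[OF x] ll[OF y]] _ A])
    (simp add: lp x y lin_add[OF 2])
 next
  fix r x assume r: "r \<in>: R" and x: "x \<in>: L"
  show "tensor_lift R N (\<phi> (r \<odot>\<^bsub>L\<^esub> x)) A = r \<odot>\<^bsub>N\<^esub> tensor_lift R N (\<phi> x) A"
   by (rule tensor_eqI[OF q N ll[OF L.smult_closed[OF r x]] lin_scale[OF T N ll[OF x] r] _ A])
    (simp add: lp r x lin_smult[OF 2])
 qed
qed

context
 fixes S :: "'o set" and Qs Ps :: "('a,'o,'m) quiver list" and a b c :: 'o
 assumes q: "qv S Qs" "qv S Ps"
begin

lemma append_quivers: "qv S (Qs @ Ps)" using q by simp

lemma append_inner: "(cs,xs) \<in> paths S Qs a c ==> MLin S Ps c b (TT S (Qs @ Ps) a b)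
  (\<lambda>(ds,ys). pure R S (Qs @ Ps) (cs @ tl ds) (xs @ ys))"
 using multilinear_appendD(2)[OF pure_multilinear[OF append_quivers] append_quivers] by simp

lemma append_outer: "(ds,ys) \<in> paths S Ps c b ==> MLin S Qs a c (TT S (Qs @ Ps) a b)
  (\<lambda>(cs,xs). pure R S (Qs @ Ps) (cs @ tl ds) (xs @ ys))"
 using multilinear_appendD(1)[OF pure_multilinear[OF append_quivers] append_quivers] by simp

lemma append_multilinear:
 assumes "B \<in>: TT S Ps c b"
 shows "MLin S Qs a c (TT S (Qs @ Ps) a b) (\<lambda>(cs,xs).
    tensor_lift R (TT S (Qs @ Ps) a b) (\<lambda>(ds,ys). pure R S (Qs @ Ps) (cs @ tl ds) (xs @ ys)) B)"
proof -
 have "MLin S Qs a c (TT S (Qs @ Ps) a b) (\<lambda>p.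
    tensor_lift R (TT S (Qs @ Ps) a b) (\<lambda>r. pure R S (Qs @ Ps) (fst p @ tl (fst r)) (snd p @ snd r)) B)"
  by (rule multilinear_lift[OF q TT_module[OF append_quivers] _ _ assms])
   (use append_inner[unfolded case_prod_beta] append_outer[unfolded case_prod_beta] in \<open>auto\<close>)
 then show ?thesis by (simp only: case_prod_beta')
qed

lemma tensor_append_linear_left:
 "B \<in>: TT S Ps c b ==>
  (\<lambda>A. TA S Qs Ps a b A B) \<in> Lin (TT S Qs a c) (TT S (Qs @ Ps) a b)"
 unfolding tensor_append_def by (rule tensor_lift_linear[OF q(1) TT_module[OF append_quivers] append_multilinear])

lemma tensor_append_linear_right:
 "A \<in>: TT S Qs a c ==>
  TA S Qs Ps a b A \<in> Lin (TT S Ps c b) (TT S (Qs @ Ps) a b)"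
 unfolding tensor_append_def
 by (rule tensor_lift_param[OF q(1) TT_module[OF q(2)] TT_module[OF append_quivers] append_multilinear])
  (use tensor_lift_linear[OF q(2) TT_module[OF append_quivers] append_inner] in auto)

lemma tensor_append_pure:
 assumes "(cs,xs) \<in> paths S Qs a c" "(ds,ys) \<in> paths S Ps c b"
 shows "TA S Qs Ps a b (pure R S Qs cs xs) (pure R S Ps ds ys) = pure R S (Qs @ Ps) (cs @ tl ds) (xs @ ys)"
 unfolding tensor_append_def
 using tensor_lift_pure[OF q(1) TT_module[OF append_quivers] append_multilinear[OF pure_closed[OF q(2) assms(2)]] assms(1)]
  tensor_lift_pure[OF q(2) TT_module[OF append_quivers] append_inner[OF assms(1)] assms(2)] by simp

lemma tensor_append_closed:
 "[|A \<in>: TT S Qs a c; B \<in>: TT S Ps c b|]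
  ==> TA S Qs Ps a b A B \<in>: TT S (Qs @ Ps) a b"
 by (rule lin_closed[OF tensor_append_linear_right])

end

text \<open>All three arguments enter linearly, so three uses of \<open>tensor_eqI\<close> lead to
  pure tensors, where both sides concatenate lists; \<open>ds \<noteq> []\<close> lets
  \<open>tl\<close> pass through the append.\<close>

lemma tensor_append_assoc:
 assumes q: "qv S Qs" "qv S Ps" "qv S Os"
  and A: "A \<in>: TT S Qs a c" and B: "B \<in>: TT S Ps c d" and C: "C \<in>: TT S Os d b"
 shows "TA S (Qs @ Ps) Os a b (TA S Qs Ps a d A B) C =
  TA S Qs (Ps @ Os) a b A (TA S Ps Os c b B C)"
proof -
 have q': "qv S (Qs @ Ps)" "qv S (Ps @ Os)" using q by auto
 have M: "module R (TT S (Qs @ Ps @ Os) a b)" using q by (intro TT_module) simp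
 note l = tensor_append_linear_left tensor_append_linear_right
 have 1: "TA S (Qs @ Ps) Os a b (TA S Qs Ps a d A B) C =
  TA S Qs (Ps @ Os) a b A (TA S Ps Os c b B C)"
  if A: "A = pure R S Qs cs xs" "(cs,xs) \<in> paths S Qs a c" and B: "B = pure R S Ps ds ys" "(ds,ys) \<in> paths S Ps c d"
   and C: "C = pure R S Os es zs" "(es,zs) \<in> paths S Os d b" for A B C cs xs ds ys es zs
 proof -
  have "ds \<noteq> []" using pathsD(8)[OF B(2)] .
  then show ?thesis unfolding that using A B C
   by (simp add: tensor_append_pure[OF q(1,2)] tensor_append_pure[OF q(2,3)]
    tensor_append_pure[OF q'(1) q(3) paths_append] tensor_append_pure[OF q(1) q'(2) _ paths_append])
 qed
 let ?L = "\<lambda>A B C. TA S (Qs @ Ps) Os a b (TA S Qs Ps a d A B) C"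
 let ?R = "\<lambda>A B C. TA S Qs (Ps @ Os) a b A (TA S Ps Os c b B C)"
 let ?TQ = "TT S Qs a c" and ?TP = "TT S Ps c d" and ?TO = "TT S Os d b" and ?T = "TT S (Qs @ Ps @ Os) a b"
 have L1: "(\<lambda>A. ?L A B C) \<in> Lin ?TQ ?T" if "B \<in>: ?TP" "C \<in>: ?TO" for B C
  using lin_comp[OF l(1)[OF q'(1) q(3) that(2)] l(1)[OF q(1,2) that(1)]] by simp
 have L2: "(\<lambda>B. ?L A B C) \<in> Lin ?TP ?T" if "A \<in>: ?TQ" "C \<in>: ?TO" for A C
  using lin_comp[OF l(1)[OF q'(1) q(3) that(2)] l(2)[OF q(1,2) that(1)]] by simp
 have L3: "(\<lambda>C. ?L A B C) \<in> Lin ?TO ?T" if "A \<in>: ?TQ" "B \<in>: ?TP" for A B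
  using l(2)[OF q'(1) q(3) tensor_append_closed[OF q(1,2) that]] by simp
 have R1: "(\<lambda>A. ?R A B C) \<in> Lin ?TQ ?T" if "B \<in>: ?TP" "C \<in>: ?TO" for B C
  using l(1)[OF q(1) q'(2) tensor_append_closed[OF q(2,3) that]] by simp
 have R2: "(\<lambda>B. ?R A B C) \<in> Lin ?TP ?T" if "A \<in>: ?TQ" "C \<in>: ?TO" for A C
  using lin_comp[OF l(2)[OF q(1) q'(2) that(1)] l(1)[OF q(2,3) that(2)]] by simp
 have R3: "(\<lambda>C. ?R A B C) \<in> Lin ?TO ?T" if "A \<in>: ?TQ" "B \<in>: ?TP" for A B
  using lin_comp[OF l(2)[OF q(1) q'(2) that(1)] l(2)[OF q(2,3) that(2)]] by simp
 note pc = pure_closed[OF q(1)] pure_closed[OF q(2)] pure_closed[OF q(3)]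
 show ?thesis
 proof (rule tensor_eqI[OF q(1) M L1[OF B C] R1[OF B C] _ A])
  fix cs xs assume p1: "(cs,xs) \<in> paths S Qs a c"
  show "?L (pure R S Qs cs xs) B C = ?R (pure R S Qs cs xs) B C"
  proof (rule tensor_eqI[OF q(2) M L2[OF pc(1)[OF p1] C] R2[OF pc(1)[OF p1] C] _ B])
   fix ds ys assume p2: "(ds,ys) \<in> paths S Ps c d"
   show "?L (pure R S Qs cs xs) (pure R S Ps ds ys) C = ?R (pure R S Qs cs xs) (pure R S Ps ds ys) C"
    by (rule tensor_eqI[OF q(3) M L3[OF pc(1)[OF p1] pc(2)[OF p2]] R3[OF pc(1)[OF p1] pc(2)[OF p2]] _ C])
     (rule 1[OF refl p1 refl p2 refl])
  qed
 qed
qed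

lemma tensor_append_unit_left:
 assumes "qv S Ps" "B \<in>: TT S Ps a b" "a \<in> S"
 shows "TA S [] Ps a b (pure R S [] [a] []) B = B"
proof -
 have n: "([a],[]) \<in> paths S [] a a" using assms by (simp add: paths_Nil)
 show ?thesis
 proof (rule tensor_eqI[OF assms(1) TT_module[OF assms(1)] _ lin_id _ assms(2)])
  show "TA S [] Ps a b (pure R S [] [a] []) \<in> Lin (TT S Ps a b) (TT S Ps a b)"
   using tensor_append_linear_right[of S "[]" Ps _ a a b] assms pure_closed[OF _ n] by simp
  fix ds ys assume p: "(ds,ys) \<in> paths S Ps a b"
  then have "[a] @ tl ds = ds" using pathsD(3,8)[OF p] by (cases ds) auto
  then show "TA S [] Ps a b (pure R S [] [a] []) (pure R S Ps ds ys) = pure R S Ps ds ys"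
   using tensor_append_pure[OF _ assms(1) n p] by simp
 qed
qed

lemma tensor_append_unit_right:
 assumes "qv S Ps" "B \<in>: TT S Ps a b" "b \<in> S"
 shows "TA S Ps [] a b B (pure R S [] [b] []) = B"
proof -
 have n: "([b],[]) \<in> paths S [] b b" using assms by (simp add: paths_Nil)
 show ?thesis
 proof (rule tensor_eqI[OF assms(1) TT_module[OF assms(1)] _ lin_id _ assms(2)])
  show "(\<lambda>B. TA S Ps [] a b B (pure R S [] [b] [])) \<in> Lin (TT S Ps a b) (TT S Ps a b)"
   using tensor_append_linear_left[of S Ps "[]" _ b b a] assms pure_closed[OF _ n] by simp
  fix ds ys assume p: "(ds,ys) \<in> paths S Ps a b"
  then show "TA S Ps [] a b (pure R S Ps ds ys) (pure R S [] [b] []) = pure R S Ps ds ys"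
   using tensor_append_pure[OF assms(1) _ p n] by simp
 qed
qed

text \<open>Induction along \<open>multilinear_Cons\<close>: the first entry enters through the left
  argument of \<open>tensor_append\<close>, the remaining ones through the right argument.\<close>

lemma tensor_concat_multilinear:
 "\<forall>Qs\<in>set Qss. qv S Qs ==>
  MLin S (map (TT S) Qss) a b (TT S (concat Qss) a b) (\<lambda>(cs,As). tensor_concat R S Qss cs As)"
proof (induction Qss arbitrary: a)
 case Nil
 then show ?case by (auto simp: multilinear_Nil intro!: pure_closed paths_Nil[THEN iffD2])
next
 case (Cons Qs Qss)
 have q: "qv S Qs" "qv S (concat Qss)" using Cons(2) by (auto simp: quivers_def)
 show ?case unfolding list.map multilinear_Cons
 proof (intro impI ballI conjI)
  fix c p assume a: "a \<in> S" "c \<in> S" and p: "p \<in> paths S (map (TT S) Qss) c b"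
  obtain ds As where p': "p = (ds,As)" by force
  have ds: "last (a # ds) = b" using pathsD(4,8) p p' by fastforce
  have "tensor_concat R S Qss ds As \<in>: TT S (concat Qss) c b"
   using multilinear_closed[OF Cons.IH] Cons(2) p p' by fastforce
  then show "case p of (ds, ys) => carrier (TT S Qs a c) \<noteq> {} \<longrightarrow>
    (\<lambda>x. case (a # ds, x # ys) of (cs, As) => tensor_concat R S (Qs # Qss) cs As)
    \<in> Lin (TT S Qs a c) (TT S (concat (Qs # Qss)) a b)"
   using tensor_append_linear_left[OF q] ds unfolding p' by (auto simp del: last.simps)
 next
  fix c A assume a: "a \<in> S" "c \<in> S" and A: "A \<in>: TT S Qs a c"
  have m: "MLin S (map (TT S) Qss) c b (TT S (concat (Qs # Qss)) a b)
   (\<lambda>p. TA S Qs (concat Qss) a b A (case p of (ds,As) => tensor_concat R S Qss ds As))"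
   using multilinear_comp[OF Cons.IH tensor_append_linear_right[OF q A]] Cons(2) by simp
  have "qv S (map (TT S) Qss)" using Cons(2) by (simp add: quivers_def[of R S "map _ _"] TT_module)
  from this m show "MLin S (map (TT S) Qss) c b (TT S (concat (Qs # Qss)) a b)
   (\<lambda>(ds,ys). case (a # ds, A # ys) of (cs, As) => tensor_concat R S (Qs # Qss) cs As)"
   by (rule multilinear_congI) (simp add: pathsD(4,8))
 qed
qed

end

text \<open>The entrywise part of \<open>tensor_maps\<close>, separated so that
  \<open>tensor_maps\<close> is the lift of \<open>tensor_concat\<close> after
  \<open>pmap\<close>.\<close>

definition pmap :: "('o => 'o => 'm => 'n) list => 'o list => 'm list => 'n list" where
 "pmap hs cs xs = map (\<lambda>i. (hs ! i) (cs ! i) (cs ! Suc i) (xs ! i)) [0..<length xs]"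

lemma pmap_Nil [simp]: "pmap hs cs [] = []" by (simp add: pmap_def)

lemma pmap_Cons [simp]: "pmap (h # hs) (c # d # cs) (x # xs) = h c d x # pmap hs (d # cs) xs"
 by (simp add: pmap_def upt_conv_Cons map_Suc_upt[symmetric] del: upt_Suc)

lemma paths_pmap:
 assumes "length hs = length Qs" "length Ps = length Qs" "(cs,xs) \<in> paths S Qs a b"
  "\<And>i c d. [|i < length Qs; c \<in> S; d \<in> S|] ==> (hs ! i) c d \<in> lin_maps R ((Qs ! i) c d) ((Ps ! i) c d)"
 shows "(cs, pmap hs cs xs) \<in> paths S Ps a b"
proof -
 have "(hs ! i) (cs ! i) (cs ! Suc i) (xs ! i) \<in>: (Ps ! i) (cs ! i) (cs ! Suc i)" if "i < length Qs" for i
  using that paths_nth[OF assms(3), of i] paths_nth[OF assms(3), of "Suc i"] pathsD(10)[OF assms(3) that]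
  by (intro lin_closed[OF assms(4)]) auto
 then show ?thesis using assms by (auto simp: paths_def pmap_def)
qed

text \<open>The vertices are untouched, so updating an entry commutes with
  \<open>pmap\<close>.\<close>

lemma multilinear_pmap:
 assumes "length hs = length Qs" "length Ps = length Qs"
  "\<And>i c d. [|i < length Qs; c \<in> S; d \<in> S|] ==> (hs ! i) c d \<in> lin_maps R ((Qs ! i) c d) ((Ps ! i) c d)"
  "multilinear R S Ps a b N \<phi>"
 shows "multilinear R S Qs a b N (\<lambda>(cs,xs). \<phi> (cs, pmap hs cs xs))"
 unfolding multilinear_def
proof (clarify, intro conjI allI impI)
 fix cs xs assume p: "(cs,xs) \<in> paths S Qs a b"
 note P = paths_pmap[OF assms(1,2) p assms(3)]
 show "\<phi> (cs, pmap hs cs xs) \<in>: N" using multilinear_closed[OF assms(4) P] .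
 fix i assume i: "i < length Qs"
 have 1: "(\<lambda>x. \<phi> (cs, (pmap hs cs xs)[i := x])) \<in> lin_maps R ((Ps ! i) (cs ! i) (cs ! Suc i)) N"
  using assms(2,4) P i by (auto simp: multilinear_def)
 have 2: "(hs ! i) (cs ! i) (cs ! Suc i) \<in> lin_maps R ((Qs ! i) (cs ! i) (cs ! Suc i)) ((Ps ! i) (cs ! i) (cs ! Suc i))"
  using paths_nth[OF p] i by (intro assms(3)) auto
 have "pmap hs cs (xs[i := x]) = (pmap hs cs xs)[i := (hs ! i) (cs ! i) (cs ! Suc i) x]" for x
  using pathsD(2)[OF p] i by (auto simp: pmap_def intro!: nth_equalityI simp: nth_list_update)
 then show "(\<lambda>x. \<phi> (cs, pmap hs cs (xs[i := x]))) \<in> lin_maps R ((Qs ! i) (cs ! i) (cs ! Suc i)) N"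
  using lin_comp[OF 1 2] by simp
qed

context cring
begin

lemma tensor_maps_alt: "tensor_maps R S Qss hs a b =
   tensor_lift R (TT S (concat Qss) a b) (\<lambda>(cs,xs). tensor_concat R S Qss cs (pmap hs cs xs))"
 unfolding tensor_maps_def pmap_def by simp

context
 fixes S Ps Qss hs
 assumes q: "qv S Ps" "\<forall>Qs\<in>set Qss. qv S Qs"
  and hs: "length hs = length Ps" "length Qss = length Ps"
  "\<And>i c d. [|i < length Ps; c \<in> S; d \<in> S|] ==> (hs ! i) c d \<in> Lin ((Ps ! i) c d) (TT S (Qss ! i) c d)"
begin

lemma concat_quivers: "qv S (concat Qss)"
 using q(2) by (auto simp: quivers_def)

lemma tensor_maps_multilinear: "MLin S Ps a b (TT S (concat Qss) a b)
  (\<lambda>(cs,xs). tensor_concat R S Qss cs (pmap hs cs xs))"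
 using multilinear_pmap[OF _ _ _ tensor_concat_multilinear[OF q(2)], of hs Ps a b] hs by simp

lemma tensor_maps_linear: "tensor_maps R S Qss hs a b \<in> Lin (TT S Ps a b) (TT S (concat Qss) a b)"
 unfolding tensor_maps_alt by (rule tensor_lift_linear[OF q(1) TT_module[OF concat_quivers] tensor_maps_multilinear])

lemma tensor_maps_pure: "(cs,xs) \<in> paths S Ps a b ==>
  tensor_maps R S Qss hs a b (pure R S Ps cs xs) = tensor_concat R S Qss cs (pmap hs cs xs)"
 unfolding tensor_maps_alt using tensor_lift_pure[OF q(1) TT_module[OF concat_quivers] tensor_maps_multilinear] by simp

lemma paths_tensor_maps: "(cs,xs) \<in> paths S Ps a b ==> (cs, pmap hs cs xs) \<in> paths S (map (TT S) Qss) a b"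
 by (rule paths_pmap[where Qs=Ps and R=R]) (use hs in auto)

end

text \<open>\<open>tensor_concat\<close> always ends in the empty tensor product at b; the unit law
  removes it and leaves a single \<open>tensor_append\<close>.\<close>

lemma tensor_maps_pure2:
 assumes "qv S [P1,P2]" "qv S Q1" "qv S Q2"
  "\<And>c d. [|c \<in> S; d \<in> S|] ==> h1 c d \<in> Lin (P1 c d) (TT S Q1 c d)"
  "\<And>c d. [|c \<in> S; d \<in> S|] ==> h2 c d \<in> Lin (P2 c d) (TT S Q2 c d)"
  and p: "a \<in> S" "c \<in> S" "b \<in> S" "x \<in>: P1 a c" "y \<in>: P2 c b"
 shows "tensor_maps R S [Q1,Q2] [h1,h2] a b (pure R S [P1,P2] [a,c,b] [x,y]) =
  TA S Q1 Q2 a b (h1 a c x) (h2 c b y)"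
proof -
 have "(hs ! i) c d \<in> Lin (([P1,P2] ! i) c d) (TT S ([Q1,Q2] ! i) c d)"
  if "i < length [P1,P2]" "c \<in> S" "d \<in> S" "hs = [h1,h2]" for i c d hs
  using that assms(4,5) by (auto simp: less_Suc_eq)
 then have "tensor_maps R S [Q1,Q2] [h1,h2] a b (pure R S [P1,P2] [a,c,b] [x,y]) =
   tensor_concat R S [Q1,Q2] [a,c,b] (pmap [h1,h2] [a,c,b] [x,y])"
  using assms by (intro tensor_maps_pure) (auto simp: paths_Cons paths_Nil)
 also have "\<dots> = TA S Q1 Q2 a b (h1 a c x) (TA S Q2 [] c b (h2 c b y) (pure R S [] [b] []))"
  by simp
 also have "TA S Q2 [] c b (h2 c b y) (pure R S [] [b] []) = h2 c b y"
  using assms by (intro tensor_append_unit_right lin_closed[OF assms(5)])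
 finally show ?thesis .
qed

lemma tensor_maps_linear2:
 assumes "qv S [P1,P2]" "qv S Q1" "qv S Q2"
  "\<And>c d. [|c \<in> S; d \<in> S|] ==> h1 c d \<in> Lin (P1 c d) (TT S Q1 c d)"
  "\<And>c d. [|c \<in> S; d \<in> S|] ==> h2 c d \<in> Lin (P2 c d) (TT S Q2 c d)"
 shows "tensor_maps R S [Q1,Q2] [h1,h2] a b \<in> Lin (TT S [P1,P2] a b) (TT S (Q1 @ Q2) a b)"
proof -
 have "(hs ! i) c d \<in> Lin (([P1,P2] ! i) c d) (TT S ([Q1,Q2] ! i) c d)"
  if "i < length [P1,P2]" "c \<in> S" "d \<in> S" "hs = [h1,h2]" for i c d hs
  using that assms(4,5) by (auto simp: less_Suc_eq)
 then have "tensor_maps R S [Q1,Q2] [h1,h2] a b \<in> Lin (TT S [P1,P2] a b) (TT S (concat [Q1,Q2]) a b)"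
  using assms by (intro tensor_maps_linear) auto
 then show ?thesis by simp
qed

lemma tensor_eqI2:
 assumes q: "qv S [P1,P2]" and "module R N" "h \<in> Lin (TT S [P1,P2] a b) N" "g \<in> Lin (TT S [P1,P2] a b) N"
  and e: "\<And>c x y. [|a \<in> S; b \<in> S; c \<in> S; x \<in>: P1 a c; y \<in>: P2 c b|] ==>
   h (pure R S [P1,P2] [a,c,b] [x,y]) = g (pure R S [P1,P2] [a,c,b] [x,y])"
  and "z \<in>: TT S [P1,P2] a b"
 shows "h z = g z"
proof (rule tensor_eqI[OF assms(1-4) _ assms(6)])
 fix cs xs assume "(cs,xs) \<in> paths S [P1,P2] a b"
 then obtain c x y where "cs = [a,c,b]" "xs = [x,y]" "a \<in> S" "c \<in> S" "b \<in> S" "x \<in>: P1 a c" "y \<in>: P2 c b"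
  by (auto simp: paths_Cons paths_Nil)
 then show "h (pure R S [P1,P2] cs xs) = g (pure R S [P1,P2] cs xs)" using e by simp
qed

lemma to_tensor_linear:
 assumes "\<And>c d. [|c \<in> S; d \<in> S|] ==> module R (Q c d)" "a \<in> S" "b \<in> S"
 shows "to_tensor R S Q a b \<in> Lin (Q a b) (TT S [Q] a b)"
proof -
 have q: "qv S [Q]" using assms by auto
 have p: "([b],[]) \<in> paths S [] b b" using assms by (auto simp: paths_Nil)
 interpret M: module R "Q a b" using assms by auto
 have "carrier (Q a b) \<noteq> {}" using M.zero_closed by blast
 then show ?thesis unfolding to_tensor_def[abs_def]
  using pure_multilinear[OF q, of a b, unfolded multilinear_Cons, THEN mp, OF assms(2), THEN bspec, OF assms(3),
    THEN conjunct1, THEN bspec, OF p] by simp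
qed

end

section \<open>Necklaces and interval maps\<close>

definition cutL :: "nat => nat set => nat set" where "cutL w T = T \<inter> {..w}"
definition cutR :: "nat => nat set => nat set" where "cutR w T = (\<lambda>t. t - w) ` (T \<inter> {w..})"
definition joinN :: "nat => nat set => nat set => nat set" where "joinN w T U = T \<union> (+) w ` U"

lemma cutR_iff: "x \<in> cutR w T \<longleftrightarrow> w + x \<in> T"
 unfolding cutR_def by (force simp: image_iff intro: bexI[of _ "w + x"])

lemma cutL_iff: "x \<in> cutL w T \<longleftrightarrow> x \<in> T \<and> x \<le> w"
 unfolding cutL_def by auto

lemma joinN_iff: "x \<in> joinN w T U \<longleftrightarrow> x \<in> T \<or> (w \<le> x \<and> x - w \<in> U)"
 unfolding joinN_def by (force simp: image_iff intro: bexI[of _ "x - w"])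

lemma nec_finite: "T \<in> necklaces n ==> finite T"
 unfolding necklaces_def by (auto intro: finite_subset)

lemma finite_necklaces: "finite (necklaces n)"
 unfolding necklaces_def by (rule finite_subset[of _ "Pow {..n}"]) auto

lemma necklacesD: "T \<in> necklaces n ==> 0 \<in> T" "T \<in> necklaces n ==> n \<in> T"
 "[|T \<in> necklaces n; t \<in> T|] ==> t \<le> n"
 unfolding necklaces_def by auto

lemma necklaces_0: "T \<in> necklaces 0 \<longleftrightarrow> T = {0}"
 unfolding necklaces_def by auto

lemma cutL_necklace: "[|T \<in> necklaces n; w \<in> T|] ==> cutL w T \<in> necklaces w"
 unfolding necklaces_def by (auto simp: cutL_iff)

lemma cutR_necklace: "[|T \<in> necklaces n; w \<in> T|] ==> cutR w T \<in> necklaces (n - w)"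
 using necklacesD(3)[of T n "w + _"] by (fastforce simp: necklaces_def cutR_iff)

lemma joinN_necklace: "[|T \<in> necklaces p; U \<in> necklaces q|] ==> joinN p T U \<in> necklaces (p + q)"
 unfolding necklaces_def by (auto simp: joinN_def)

lemma cutL_joinN: "[|T \<in> necklaces p; U \<in> necklaces q|] ==> cutL p (joinN p T U) = T"
 unfolding necklaces_def by (auto simp: cutL_iff joinN_iff)

lemma cutR_joinN: "[|T \<in> necklaces p; U \<in> necklaces q|] ==> cutR p (joinN p T U) = U"
 unfolding necklaces_def by (auto simp: cutR_iff joinN_iff)

lemma joinN_cut: "w \<in> T ==> joinN w (cutL w T) (cutR w T) = T"
 by (auto simp: cutR_iff cutL_iff joinN_iff set_eq_iff) (metis le_add_diff_inverse nle_le)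

lemma joinN_mid: "[|T \<in> necklaces p; U \<in> necklaces q|] ==> p \<in> joinN p T U"
 by (auto simp: joinN_iff necklacesD)

lemma cutL_cutL: "cutL p (cutL (p + q) V) = cutL p V"
 by (auto simp: cutL_iff)

lemma cutR_cutL: "cutR p (cutL (p + q) V) = cutL q (cutR p V)"
 by (auto simp: cutL_iff cutR_iff)

lemma cutR_cutR: "cutR q (cutR p V) = cutR (p + q) V"
 by (auto simp: cutR_iff add.assoc)

text \<open>Both sides are strictly sorted lists of one set. The vertex w closes the left part and
  opens the right one, hence \<open>tl\<close>.\<close>

lemma sorted_list_cut:
 assumes "finite T" "w \<in> T"
 shows "sl T = sl (cutL w T) @ tl (map ((+) w) (sl (cutR w T)))"
  and "last (sl (cutL w T)) = w" "hd (sl (cutR w T)) = 0"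
  and "sl (cutL w T) \<noteq> []" "sl (cutR w T) \<noteq> []"
proof -
 have fin: "finite (cutL w T)" "finite (cutR w T)" using assms by (auto simp: cutL_def cutR_def)
 have s: "sorted_wrt (<) (sl A)" for A :: "nat set" by (rule strict_sorted_list_of_set)
 have 0: "sl (cutR w T) = 0 # sl (cutR w T - {0})"
  using fin assms by (intro strict_sorted_equal) (auto simp: cutR_iff)
 have 1: "sl (cutL w T) = sl (cutL w T - {w}) @ [w]"
  using fin assms by (intro strict_sorted_equal) (auto simp: cutL_iff sorted_wrt_append)
 show "last (sl (cutL w T)) = w" by (subst 1) simp
 show "hd (sl (cutR w T)) = 0" by (subst 0) simp
 show "sl (cutL w T) \<noteq> []" by (subst 1) simp
 show "sl (cutR w T) \<noteq> []" by (subst 0) simp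
 have tl: "tl (map ((+) w) (sl (cutR w T))) = map ((+) w) (sl (cutR w T - {0}))"
  by (subst 0) simp
 have "sorted_wrt (<) (map ((+) w) (sl (cutR w T - {0})))"
  using s[of "cutR w T - {0}"] by (simp add: sorted_wrt_map)
 moreover have "x < w + y" if "x \<in> cutL w T" "y \<in> cutR w T - {0}" for x y using that by (auto simp: cutL_iff)
 moreover have "T = cutL w T \<union> (+) w ` (cutR w T - {0})"
 proof (intro equalityI subsetI)
  fix x assume x: "x \<in> T"
  show "x \<in> cutL w T \<union> (+) w ` (cutR w T - {0})"
  proof (cases "x \<le> w")
   case False
   then show ?thesis using x by (intro UnI2 image_eqI[of _ _ "x - w"]) (auto simp: cutR_iff)
  qed (use x in \<open>simp add: cutL_iff\<close>)
 qed (auto simp: cutL_iff cutR_iff)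
 ultimately show "sl T = sl (cutL w T) @ tl (map ((+) w) (sl (cutR w T)))"
  unfolding tl using assms fin s by (intro strict_sorted_equal) (auto simp: sorted_wrt_append)
qed

text \<open>The shared element belongs to the last pair of A and to the first pair of B, so no pair
  of neighbours straddles the junction.\<close>

lemma zip_tl_append:
 "[|A \<noteq> []; B \<noteq> []; last A = hd B|] ==> zip (A @ tl B) (tl (A @ tl B)) = zip A (tl A) @ zip B (tl B)"
proof (induction A)
 case (Cons a A)
 then show ?case by (cases A; cases B) (auto split: list.splits)
qed simp

lemma beads_cut:
 assumes "finite T" "w \<in> T"
 shows "beads T = beads (cutL w T) @ map (\<lambda>(t,t'). (w + t, w + t')) (beads (cutR w T))"
proof -
 let ?A = "sl (cutL w T)" and ?B = "map ((+) w) (sl (cutR w T))"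
 note c = sorted_list_cut[OF assms]
 have "hd ?B = w" using c(3,5) by (simp add: hd_map)
 then have "beads T = zip ?A (tl ?A) @ zip ?B (tl ?B)"
  unfolding beads_def c(1) using c by (intro zip_tl_append) auto
 then show ?thesis by (simp add: beads_def zip_map_map map_tl[symmetric])
qed

lemma beads_0 [simp]: "beads {0} = []" by (simp add: beads_def)

lemma beads_pair: "0 < w ==> beads {0,w} = [(0,w)]"
 by (simp add: beads_def)

lemma bead_lengths_cut:
 assumes "finite T" "w \<in> T"
 shows "bl T = bl (cutL w T) @ bl (cutR w T)"
 unfolding bead_lengths_def beads_cut[OF assms] by (auto simp: case_prod_beta comp_def)

lemma gap_cards_bead_lengths: "gap_cards T = map (\<lambda>d. d - 1) (bl T)"
 unfolding gap_cards_def bead_lengths_def by (auto simp: case_prod_beta)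

lemma gap_cards_cut: "[|finite T; w \<in> T|] ==> gap_cards T = gap_cards (cutL w T) @ gap_cards (cutR w T)"
 by (simp add: gap_cards_bead_lengths bead_lengths_cut)

lemma length_beads: "length (beads T) = card T - 1"
 by (simp add: beads_def)

lemma length_gap_cards: "length (gap_cards T) = card T - 1"
 by (simp add: gap_cards_def length_beads)

lemma beadsD:
 assumes "(t,t') \<in> set (beads T)" "finite T"
 shows "t \<in> T" "t' \<in> T" "t < t'" "{t<..<t'} \<inter> T = {}"
proof -
 let ?s = "sl T"
 obtain i where i: "i < length ?s - 1" "t = ?s ! i" "t' = ?s ! Suc i"
  using assms(1) by (auto simp: beads_def in_set_zip nth_tl)
 have s: "sorted_wrt (<) ?s" by (rule strict_sorted_list_of_set)
 show "t \<in> T" "t' \<in> T" using i assms(2) by (metis Suc_lessD less_diff_conv nth_mem set_sorted_list_of_set Suc_eq_plus1)+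
 show "t < t'" using i s by (auto simp: sorted_wrt_iff_nth_less)
 show "{t<..<t'} \<inter> T = {}"
 proof (rule ccontr)
  assume "\<not> ?thesis"
  then obtain x where x: "x \<in> T" "t < x" "x < t'" by auto
  then obtain k where k: "k < length ?s" "x = ?s ! k" using assms(2) by (metis in_set_conv_nth set_sorted_list_of_set)
  have "i < k" using x k i s by (metis Suc_lessD less_diff_conv linorder_neqE_nat less_asym sorted_wrt_nth_less Suc_eq_plus1)
  moreover have "k < Suc i" using x k i s by (metis less_diff_conv linorder_neqE_nat less_asym sorted_wrt_nth_less Suc_eq_plus1)
  ultimately show False by simp
 qed
qed

text \<open>The bead joins the largest vertex up to x to the least vertex beyond x; nothing lies
  between them, so they are neighbours in the sorted list.\<close>

lemma beads_cover:
 assumes "T \<in> necklaces n" "x < n"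
 obtains t t' where "(t,t') \<in> set (beads T)" "t \<le> x" "x < t'"
proof -
 let ?s = "sl T"
 have fin: "finite T" using assms nec_finite by auto
 define i where "i = card {t \<in> T. t \<le> x}"
 have s: "sorted_wrt (<) ?s" by (rule strict_sorted_list_of_set)
 have "\<exists>t\<in>T. t \<le> x" "\<exists>t\<in>T. x < t" using assms necklacesD by blast+
 define t where "t = Max {t \<in> T. t \<le> x}" define t' where "t' = Min {t \<in> T. x < t}"
 have t: "t \<in> T" "t \<le> x" "\<And>y. y \<in> T ==> y \<le> x ==> y \<le> t"
 proof -
  have "t \<in> {t \<in> T. t \<le> x}" unfolding t_def using \<open>\<exists>t\<in>T. t \<le> x\<close> fin by (intro Max_in) auto
  then show "t \<in> T" "t \<le> x" "\<And>y. y \<in> T ==> y \<le> x ==> y \<le> t" using fin by (auto simp: t_def)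
 qed
 have t': "t' \<in> T" "x < t'" "\<And>y. y \<in> T ==> x < y ==> t' \<le> y"
 proof -
  have "t' \<in> {t \<in> T. x < t}" unfolding t'_def using \<open>\<exists>t\<in>T. x < t\<close> fin by (intro Min_in) auto
  then show "t' \<in> T" "x < t'" "\<And>y. y \<in> T ==> x < y ==> t' \<le> y" using fin by (auto simp: t'_def)
 qed
 obtain i where i: "i < length ?s" "?s ! i = t" using t fin by (metis in_set_conv_nth set_sorted_list_of_set)
 obtain j where j: "j < length ?s" "?s ! j = t'" using t' fin by (metis in_set_conv_nth set_sorted_list_of_set)
 have ij: "i < j" using t t' i j s by (metis leD less_le_trans linorder_neqE_nat order.strict_implies_order sorted_wrt_nth_less)
 have "j = Suc i"
 proof (rule ccontr)
  assume "j \<noteq> Suc i" then have k: "i < Suc i" "Suc i < j" "Suc i < length ?s" using ij j by auto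
  then have "t < ?s ! Suc i" "?s ! Suc i < t'" using i j s by (auto simp: sorted_wrt_iff_nth_less)
  moreover have "?s ! Suc i \<in> T" using k fin by (metis nth_mem set_sorted_list_of_set)
  ultimately show False using t(3)[of "?s ! Suc i"] t'(3)[of "?s ! Suc i"] by (cases "?s ! Suc i \<le> x") auto
 qed
 then have "(t,t') \<in> set (beads T)" using i j by (auto simp: beads_def in_set_zip nth_tl intro!: exI[of _ i])
 then show thesis using that t t' by auto
qed

text \<open>Peels off the first bead, from 0 to the least positive vertex w. All inductions on
  necklaces have this form, with \<open>join_bead\<close> as computation rules.\<close>

lemma necklace_induct [consumes 1, case_names zero bead]:
 assumes "T \<in> necklaces n" "P 0 {0}"
  and step: "\<And>w n T. [|0 < w; T \<in> necklaces n; P n T|] ==> P (w + n) (joinN w {0,w} T)"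
 shows "P n T"
 using assms(1)
proof (induction n arbitrary: T rule: less_induct)
 case (less n)
 show ?case
 proof (cases "n = 0")
  case True then show ?thesis using less assms(2) by (simp add: necklaces_0)
 next
  case False
  have fin: "finite T" using less(2) by (rule nec_finite)
  define w where "w = Min (T - {0})"
  have "n \<in> T - {0}" using less(2) False necklacesD by auto
  then have "w \<in> T - {0}" unfolding w_def using fin by (intro Min_in) auto
  then have w: "w \<in> T" "0 < w" "\<And>t. t \<in> T ==> t \<noteq> 0 ==> w \<le> t" using fin by (auto simp: w_def)
  have "w \<le> n" using w less(2) necklacesD by blast
  have "cutL w T = {0,w}" using w less(2) by (force simp: cutL_iff necklacesD dest: antisym)
  then have T: "T = joinN w {0,w} (cutR w T)" using joinN_cut[OF w(1)] by simp
  have "cutR w T \<in> necklaces (n - w)" using less(2) w by (rule_tac cutR_necklace)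
  then have "P (w + (n - w)) (joinN w {0,w} (cutR w T))"
   using w \<open>w \<le> n\<close> by (intro step less.IH) auto
  then show ?thesis using T \<open>w \<le> n\<close> by simp
 qed
qed

lemma pair_nec: "{0,w} \<in> necklaces w" by (auto simp: necklaces_def)

lemma join_bead:
 assumes "0 < w" "T \<in> necklaces n"
 shows "sl (joinN w {0,w} T) = 0 # map ((+) w) (sl T)"
  and "beads (joinN w {0,w} T) = (0,w) # map (\<lambda>(t,t'). (w + t, w + t')) (beads T)"
  and "bl (joinN w {0,w} T) = w # bl T"
proof -
 have V: "joinN w {0,w} T \<in> necklaces (w + n)" by (intro joinN_necklace pair_nec assms)
 have w: "w \<in> joinN w {0,w} T" by (rule joinN_mid[OF pair_nec assms(2)])
 note c = cutL_joinN[OF pair_nec assms(2)] cutR_joinN[OF pair_nec assms(2)]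
 show "beads (joinN w {0,w} T) = (0,w) # map (\<lambda>(t,t'). (w + t, w + t')) (beads T)"
  using beads_cut[OF nec_finite[OF V] w] assms(1) by (simp add: c beads_pair)
 show "bl (joinN w {0,w} T) = w # bl T"
  using bead_lengths_cut[OF nec_finite[OF V] w] assms(1) by (simp add: c bead_lengths_def beads_pair)
 have "hd (sl T) = 0" "sl T \<noteq> []"
  using sorted_list_cut(3,5)[OF nec_finite[OF V] w] by (auto simp: c)
 then show "sl (joinN w {0,w} T) = 0 # map ((+) w) (sl T)"
  using sorted_list_cut(1)[OF nec_finite[OF V] w] assms(1) by (cases "sl T") (auto simp: c)
qed

text \<open>Recovers a necklace from its bead lengths, inverse to \<open>bead_lengths\<close> by
  \<open>psums_bl\<close>. Iterated comultiplications are indexed by lists of lengths, the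
  projections P by sets of vertices.\<close>

fun psums :: "nat list => nat set" where
 "psums [] = {0}"
| "psums (p # ps) = insert 0 ((+) p ` psums ps)"

lemma psums_0: "0 \<in> psums ps" by (cases ps) auto

lemma psums_append: "psums (ps @ qs) = psums ps \<union> (+) (sum_list ps) ` psums qs"
proof (induction ps)
 case Nil
 then show ?case using psums_0[of qs] by auto
qed (auto simp: image_Un image_image add.assoc)

lemma psums_bounds: "x \<in> psums ps ==> x \<le> sum_list ps"
 by (induction ps arbitrary: x) auto

lemma psums_sum: "sum_list ps \<in> psums ps"
 by (induction ps) auto

lemma psums_necklace: "psums ps \<in> necklaces (sum_list ps)"
 unfolding necklaces_def using psums_0 psums_sum psums_bounds by auto

lemma cut_psums:
 "cutL (sum_list ps) (psums (ps @ qs)) = psums ps" "cutR (sum_list ps) (psums (ps @ qs)) = psums qs"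
 unfolding psums_append joinN_def[symmetric]
 by (rule cutL_joinN[OF psums_necklace psums_necklace], rule cutR_joinN[OF psums_necklace psums_necklace])

lemma bead_lengths_0 [simp]: "bl {0} = []" by (simp add: bead_lengths_def)

lemma
 assumes "T \<in> necklaces n"
 shows sum_bl: "sum_list (bl T) = n" and psums_bl: "psums (bl T) = T"
proof -
 have "sum_list (bl T) = n \<and> psums (bl T) = T"
  using assms
 proof (induction rule: necklace_induct)
  case (bead w n T)
  then have "psums (bl (joinN w {0,w} T)) = insert 0 ((+) w ` T)" by (simp add: join_bead)
  also have "\<dots> = joinN w {0,w} T" using necklacesD(1)[OF bead(2)] by (auto simp: joinN_def)
  finally show ?case using bead by (simp add: join_bead)
 qed simp
 then show "sum_list (bl T) = n" "psums (bl T) = T" by auto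
qed

text \<open>Since U is contained in T, each bead of U is subdivided by T: the pieces together give
  the beads of T, and the total of each piece is a bead of U.\<close>

lemma inert_beads:
 assumes "U \<in> necklaces n" "T \<in> necklaces n" "U \<subseteq> T"
 defines "Ts \<equiv> map (\<lambda>(u,v). (\<lambda>t. t - u) ` (T \<inter> {u..v})) (beads U)"
 shows "concat (map bl Ts) = bl T"
  and "map (\<lambda>T'. sum_list (bl T')) Ts = bl U"
proof -
 have "concat (map bl (map (\<lambda>(u,v). (\<lambda>t. t - u) ` (T \<inter> {u..v})) (beads U))) = bl T \<and>
  map (\<lambda>T'. sum_list (bl T')) (map (\<lambda>(u,v). (\<lambda>t. t - u) ` (T \<inter> {u..v})) (beads U)) = bl U"
  using assms(1-3)
 proof (induction arbitrary: T rule: necklace_induct)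
  case zero
  then show ?case by (simp add: necklaces_0)
 next
  case (bead w n U T)
  have w: "w \<in> T" using bead joinN_mid[OF pair_nec bead(2)] by auto
  have fin: "finite T" using bead(4) by (rule nec_finite)
  have 0: "T \<inter> {0..w} = cutL w T" by (auto simp: cutL_iff)
  have 1: "(\<lambda>t. t - (w + u)) ` (T \<inter> {w + u..w + v}) = (\<lambda>t. t - u) ` (cutR w T \<inter> {u..v})" for u v
  proof -
   have "T \<inter> {w + u..w + v} = (+) w ` (cutR w T \<inter> {u..v})"
   proof (intro equalityI subsetI)
    fix x assume "x \<in> T \<inter> {w + u..w + v}"
    then show "x \<in> (+) w ` (cutR w T \<inter> {u..v})" by (intro image_eqI[of _ _ "x - w"]) (auto simp: cutR_iff)
   qed (auto simp: cutR_iff)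
   then show ?thesis by (simp add: image_image)
  qed
  have "cutR w T \<in> necklaces n" using cutR_necklace[OF bead(4) w] by simp
  moreover have "U \<subseteq> cutR w T" using bead(5) by (auto simp: cutR_iff joinN_def)
  ultimately have IH: "concat (map bl (map (\<lambda>(u,v). (\<lambda>t. t - u) ` (cutR w T \<inter> {u..v})) (beads U))) = bl (cutR w T)"
    "map (\<lambda>T'. sum_list (bl T')) (map (\<lambda>(u,v). (\<lambda>t. t - u) ` (cutR w T \<inter> {u..v})) (beads U)) = bl U"
   using bead(3) by auto
  show ?case unfolding join_bead[OF bead(1,2)]
   using IH bead_lengths_cut[OF fin w] sum_bl[OF cutL_necklace[OF bead(4) w]]
   by (simp add: 0 1 case_prod_beta comp_def)
 qed
 then show "concat (map bl Ts) = bl T" "map (\<lambda>T'. sum_list (bl T')) Ts = bl U"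
  unfolding Ts_def by auto
qed

lemma idx_cutL: "x \<le> w ==> card {t \<in> cutL w T. t < x} = card {t \<in> T. t < x}"
 by (rule arg_cong[where f=card]) (auto simp: cutL_iff)

text \<open>Positions in a necklace are counted as cardinalities; those beyond a cut at w shift by
  the number of vertices before w.\<close>

lemma idx_cutR:
 assumes "finite T"
 shows "card {t \<in> T. t < w + x} = card {t \<in> T. t < w} + card {t \<in> cutR w T. t < x}"
proof -
 have "{t \<in> T. t < w + x} = {t \<in> T. t < w} \<union> (+) w ` {t \<in> cutR w T. t < x}"
 proof (intro equalityI subsetI)
  fix y assume y: "y \<in> {t \<in> T. t < w + x}"
  show "y \<in> {t \<in> T. t < w} \<union> (+) w ` {t \<in> cutR w T. t < x}"
  proof (cases "y < w")
   case False
   then show ?thesis using y by (intro UnI2 image_eqI[of _ _ "y - w"]) (auto simp: cutR_iff)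
  qed (use y in simp)
 qed (auto simp: cutR_iff)
 moreover have "finite {t \<in> cutR w T. t < x}" by auto
 moreover have "finite {t \<in> T. t < w}" "{t \<in> T. t < w} \<inter> (+) w ` {t \<in> cutR w T. t < x} = {}" by auto
 ultimately show ?thesis by (simp add: card_Un_disjoint card_image)
qed

section \<open>Interval maps: cutting, adding, pulling back necklaces\<close>

lemma imapsD:
 assumes "f \<in> imaps m n"
 shows "f 0 = 0" "f m = n" "i \<le> m ==> f i \<le> n" "[|i \<le> j; j \<le> m|] ==> f i \<le> f j" "f \<in> extensional {..m}"
 using assms unfolding interval_maps_def order_maps_def by (auto simp: PiE_iff mono_on_def)

lemma imapsI:
 assumes "f 0 = 0" "f m = n" "\<And>i j. [|i \<le> j; j \<le> m|] ==> f i \<le> f j" "f \<in> extensional {..m}"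
 shows "f \<in> imaps m n"
 using assms unfolding interval_maps_def order_maps_def by (auto simp: PiE_iff mono_on_def)

definition fcutL :: "nat => (nat => nat) => nat => nat" where
 "fcutL w f = (\<lambda>i\<in>{..w}. f i)"
definition fcutR :: "nat => nat => (nat => nat) => nat => nat" where
 "fcutR w m f = (\<lambda>i\<in>{..m}. f (w + i) - f w)"

lemma fcutL_map: "[|f \<in> imaps m n; w \<le> m|] ==> fcutL w f \<in> imaps w (f w)"
 by (rule imapsI) (auto simp: fcutL_def imapsD)

lemma fcutR_map:
 assumes "f \<in> imaps (w + m) n"
 shows "fcutR w m f \<in> imaps m (n - f w)"
 by (rule imapsI) (auto simp: fcutR_def imapsD(2)[OF assms] intro!: diff_le_mono imapsD(4)[OF assms])

text \<open>Every interval map is the sum of its restrictions on both sides of w. Thus compatibility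
  with sums, applied bead by bead, controls arbitrary maps.\<close>

lemma interval_sum_cut:
 assumes "f \<in> imaps (w + m) n"
 shows "interval_sum w (f w) m (fcutL w f) (fcutR w m f) = f"
proof
 fix i
 show "interval_sum w (f w) m (fcutL w f) (fcutR w m f) i = f i"
  using imapsD(4)[OF assms, of w i] imapsD(5)[OF assms]
  by (auto simp: interval_sum_def fcutL_def fcutR_def extensional_def)
qed

lemma interval_sum_map:
 assumes "f \<in> imaps p p'" "g \<in> imaps q q'"
 shows "interval_sum p p' q f g \<in> imaps (p + q) (p' + q')"
proof (rule imapsI)
 fix i j assume "i \<le> j" "j \<le> p + q"
 then show "interval_sum p p' q f g i \<le> interval_sum p p' q f g j"
  using imapsD(3)[OF assms(1), of i]
  by (auto simp: interval_sum_def intro: imapsD(4)[OF assms(1)] imapsD(4)[OF assms(2)] trans_le_add1)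
qed (use imapsD[OF assms(1)] imapsD[OF assms(2)] in \<open>auto simp: interval_sum_def\<close>)

lemma interval_sum_mid: "[|f \<in> imaps p p'|] ==> interval_sum p p' q f g p = p'"
 by (auto simp: interval_sum_def imapsD)

lemma fcut_sum:
 assumes "f \<in> imaps p p'" "g \<in> imaps q q'"
 shows "fcutL p (interval_sum p p' q f g) = f" "fcutR p q (interval_sum p p' q f g) = g"
 using imapsD[OF assms(1)] imapsD[OF assms(2)]
 by (auto simp: fcutL_def fcutR_def interval_sum_def extensional_def fun_eq_iff)

lemma interval_maps_comp:
 assumes "f \<in> imaps l m" "g \<in> imaps m n"
 shows "compose {..l} g f \<in> imaps l n"
 using imapsD[OF assms(1)] imapsD[OF assms(2)]
 by (intro imapsI) (auto simp: compose_def)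

lemma interval_maps_id: "(\<lambda>i\<in>{..n}. i) \<in> imaps n n"
 by (rule imapsI) auto

lemma interval_maps_0: "f \<in> imaps 0 n ==> n = 0 \<and> f = (\<lambda>i\<in>{..0}. i)"
 using imapsD[of f 0 n] by (auto simp: extensional_def fun_eq_iff)

definition preN :: "nat => (nat => nat) => nat set => nat set" where
 "preN m f T = {i \<in> {..m}. f i \<in> T}"

lemma preN_necklace: "[|f \<in> imaps m n; T \<in> necklaces n|] ==> preN m f T \<in> necklaces m"
 by (auto simp: necklaces_def preN_def imapsD)

lemma cutL_preN: "w \<le> m ==> f \<in> imaps m n ==> cutL w (preN m f T) = preN w (fcutL w f) (cutL (f w) T)"
 by (auto simp: cutL_iff preN_def fcutL_def imapsD(4))

lemma cutR_preN:
 assumes "f \<in> imaps (w + m) n"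
 shows "cutR w (preN (w + m) f T) = preN m (fcutR w m f) (cutR (f w) T)"
 using imapsD(4)[OF assms, of w] by (auto simp: cutR_iff preN_def fcutR_def)

lemma preN_comp: "f \<in> imaps l m ==> preN l (compose {..l} g f) T = preN l f (preN m g T)"
 by (auto simp: preN_def compose_def imapsD)

text \<open>Separates {0,m}, the only necklace at which a filler has freedom, from those with an
  inner vertex.\<close>

lemma necklace_cases:
 assumes "U \<in> necklaces m"
 obtains "U = {0}" "m = 0" | "U = {0,m}" "0 < m" | w where "w \<in> U" "0 < w" "w < m"
proof (cases "\<exists>w\<in>U. 0 < w \<and> w < m")
 case False
 then have "U = {0,m}" using assms necklacesD[of U m] by (force simp: not_less)
 then show ?thesis using that by (cases "m = 0") auto
qed (use that in auto)

section \<open>Graded categories\<close>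

text \<open>A category with object set S, graded by the natural numbers. It occurs three times: as
  \<open>dcomp\<close> on an enriched category, as juxtaposition on the nerve and as gluing of
  simplices.\<close>

locale graded_cat = cring R for R :: "('k,'r) ring_scheme" (structure) +
 fixes S :: "'o set" and M :: "nat => ('k,'o,'x) quiver"
  and J :: "nat => nat => 'o => 'o => 'o => 'x => 'x => 'x" and u :: "'o => 'x"
 assumes M_module: "[|a \<in> S; b \<in> S|] ==> module R (M n a b)"
  and J_left: "[|a \<in> S; c \<in> S; b \<in> S; y \<in>: M q c b|]
   ==> (\<lambda>x. J p q a c b x y) \<in> lin_maps R (M p a c) (M (p + q) a b)"
  and J_right: "[|a \<in> S; c \<in> S; b \<in> S; x \<in>: M p a c|]
   ==> J p q a c b x \<in> lin_maps R (M q c b) (M (p + q) a b)"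
  and J_assoc: "[|a \<in> S; c \<in> S; d \<in> S; b \<in> S; x \<in>: M p a c; y \<in>: M q c d; z \<in>: M r d b|]
   ==> J (p + q) r a d b (J p q a c d x y) z = J p (q + r) a c b x (J q r c d b y z)"
  and u_closed: "a \<in> S ==> u a \<in>: M 0 a a"
  and J_unit_left: "[|a \<in> S; b \<in> S; x \<in>: M p a b|] ==> J 0 p a a b (u a) x = x"
  and J_unit_right: "[|a \<in> S; b \<in> S; x \<in>: M p a b|] ==> J p 0 a b b x (u b) = x"
begin

lemma J_closed: "[|a \<in> S; c \<in> S; b \<in> S; x \<in>: M p a c; y \<in>: M q c b|]
  ==> J p q a c b x y \<in>: M (p + q) a b"
 by (rule lin_closed[OF J_right])

text \<open>Unlike \<open>iter_comp\<close> the recursion runs down to the unit even for one factor,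
  which avoids a special case; the two agree by the unit law.\<close>

primrec itJ :: "nat list => 'o list => 'x list => 'x" where
 "itJ [] cs xs = u (hd cs)"
| "itJ (p # ps) cs xs = J p (sum_list ps) (hd cs) (hd (tl cs)) (last cs) (hd xs) (itJ ps (tl cs) (tl xs))"

lemma quivers_M: "qv S (map M ps)"
 unfolding quivers_def using M_module by auto

lemma itJ_multilinear_M: "MLin S (map M ps) a b (M (sum_list ps) a b) (\<lambda>(cs,xs). itJ ps cs xs)"
proof (induction ps arbitrary: a)
 case Nil
 then show ?case by (simp add: multilinear_Nil u_closed)
next
 case (Cons p ps)
 show ?case unfolding list.map multilinear_Cons
 proof (intro impI ballI conjI)
  fix c q assume a: "a \<in> S" "c \<in> S" and q: "q \<in> paths S (map M ps) c b"
  obtain ds ys where q': "q = (ds,ys)" by force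
  note p = q[unfolded q']
  have "itJ ps ds ys \<in>: M (sum_list ps) c b" using multilinear_closed[OF Cons p] by simp
  then have "(\<lambda>x. J p (sum_list ps) a c b x (itJ ps ds ys)) \<in> Lin (M p a c) (M (p + sum_list ps) a b)"
   using a pathsD(7)[OF p] by (intro J_left)
  then show "case q of (ds,ys) => carrier (M p a c) \<noteq> {} \<longrightarrow>
    (\<lambda>x. case (a # ds, x # ys) of (cs,xs) => itJ (p # ps) cs xs) \<in> Lin (M p a c) (M (sum_list (p # ps)) a b)"
   using pathsD(3,4,8)[OF p] by (simp add: q')
 next
  fix c x assume a: "a \<in> S" "c \<in> S" and x: "x \<in>: M p a c"
  show "MLin S (map M ps) c b (M (sum_list (p # ps)) a b)
    (\<lambda>(ds,ys). case (a # ds, x # ys) of (cs,xs) => itJ (p # ps) cs xs)"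
  proof (cases "b \<in> S")
   case True
   have m: "MLin S (map M ps) c b (M (sum_list (p # ps)) a b)
     (\<lambda>q. J p (sum_list ps) a c b x (case q of (ds,ys) => itJ ps ds ys))"
    using multilinear_comp[OF Cons J_right[OF a True x]] by simp
   from quivers_M[of ps] m show ?thesis
    by (rule multilinear_cong[THEN iffD1, rotated 1, of R S "map M ps"]) (auto dest: pathsD(3,4,8))
  next
   case False
   then have "paths S (map M ps) c b = {}" using pathsD(7) by fastforce
   then show ?thesis by (simp add: multilinear_def)
  qed
 qed
qed

lemma itJ_closed: "(cs,xs) \<in> paths S (map M ps) a b ==> itJ ps cs xs \<in>: M (sum_list ps) a b"
 using multilinear_closed[OF itJ_multilinear_M] by fastforce

text \<open>Associativity moves the bracket one factor at a time; the left unit law is the case of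
  an empty first list.\<close>

lemma itJ_append:
 assumes "(cs,xs) \<in> paths S (map M ps) a c" "(ds,ys) \<in> paths S (map M qs) c b"
 shows "itJ (ps @ qs) (cs @ tl ds) (xs @ ys) = J (sum_list ps) (sum_list qs) a c b (itJ ps cs xs) (itJ qs ds ys)"
 using assms(1)
proof (induction ps arbitrary: a cs xs)
 case Nil
 then have "cs = [a]" "xs = []" "a = c" "a \<in> S" by (auto simp: paths_Nil)
 moreover have "[c] @ tl ds = ds" using pathsD(3,8)[OF assms(2)] by (cases ds) auto
 ultimately show ?case using J_unit_left[OF _ _ itJ_closed[OF assms(2)]] pathsD(7)[OF assms(2)] by simp
next
 case (Cons p ps)
 then obtain e es x xs' where p: "cs = a # es" "xs = x # xs'" "a \<in> S" "x \<in>: M p a e"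
  "(es,xs') \<in> paths S (map M ps) e c" by (auto simp: paths_Cons)
 note P = pathsD[OF p(5)] and P' = pathsD[OF paths_append[OF p(5) assms(2)]]
 have "itJ ((p # ps) @ qs) (cs @ tl ds) (xs @ ys) =
   J p (sum_list ps + sum_list qs) a e b x (itJ (ps @ qs) (es @ tl ds) (xs' @ ys))"
  using P P'(3,4,8) by (simp add: p)
 also have "\<dots> = J p (sum_list ps + sum_list qs) a e b x (J (sum_list ps) (sum_list qs) e c b (itJ ps es xs') (itJ qs ds ys))"
  by (simp add: Cons.IH[OF p(5)])
 also have "\<dots> = J (p + sum_list ps) (sum_list qs) a c b (J p (sum_list ps) a e c x (itJ ps es xs')) (itJ qs ds ys)"
  using p(3,4) P(6,7) pathsD(7)[OF assms(2)] itJ_closed[OF p(5)] itJ_closed[OF assms(2)] by (intro J_assoc[symmetric])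
 also have "J p (sum_list ps) a e c x (itJ ps es xs') = itJ (p # ps) cs xs" using P by (simp add: p)
 finally show ?case by simp
qed

lemma itJ_single: "[|a \<in> S; b \<in> S; x \<in>: M p a b|] ==> itJ [p] [a,b] [x] = x"
 by (simp add: J_unit_right)

lemma itJ_pair: "[|a \<in> S; b \<in> S; c \<in> S; x \<in>: M p a c; y \<in>: M q c b|]
  ==> itJ [p,q] [a,c,b] [x,y] = J p q a c b x y"
 by (simp add: J_unit_right)

end

text \<open>\<open>Q\<close> consists of submodules of \<open>M\<close> and is not assumed closed
  under \<open>J\<close>: for the horn it is spanned by the horn simplices, whose products live in
  the full simplex.\<close>

locale graded_sub = graded_cat R S M J u
 for R :: "('k,'r) ring_scheme" (structure) and S :: "'o set" and M :: "nat => ('k,'o,'x) quiver"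
  and J :: "nat => nat => 'o => 'o => 'o => 'x => 'x => 'x" and u :: "'o => 'x" +
 fixes Q :: "nat => ('k,'o,'x) quiver"
 assumes Q_module: "[|a \<in> S; b \<in> S|] ==> module R (Q n a b)"
  and Q_sub: "[|a \<in> S; b \<in> S|] ==> carrier (Q n a b) \<subseteq> carrier (M n a b)"
  and Q_zero: "[|a \<in> S; b \<in> S|] ==> zero (Q n a b) = zero (M n a b)"
  and Q_add: "[|a \<in> S; b \<in> S|] ==> add (Q n a b) = add (M n a b)"
  and Q_smult: "[|a \<in> S; b \<in> S|] ==> smult (Q n a b) = smult (M n a b)"
begin

abbreviation "pQ ps \<equiv> paths S (map Q ps)"
abbreviation "mQ ps \<equiv> MLin S (map Q ps)"
abbreviation "tQ ps \<equiv> TT S (map Q ps)"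
abbreviation "puQ ps \<equiv> pure R S (map Q ps)"
abbreviation "pM ps \<equiv> paths S (map M ps)"
abbreviation "tM ps \<equiv> TT S (map M ps)"
abbreviation "mM ps \<equiv> MLin S (map M ps)"
abbreviation "puM ps \<equiv> pure R S (map M ps)"

lemma Q_in_M: "[|x \<in>: Q n a b; a \<in> S; b \<in> S|] ==> x \<in>: M n a b"
 using Q_sub by blast

lemma lin_restrict: "[|h \<in> Lin (M n a b) N; a \<in> S; b \<in> S|] ==> h \<in> Lin (Q n a b) N"
 by (rule lin_mapsI) (simp_all add: Q_add Q_smult Q_in_M lin_closed lin_add[of h R "M n a b"] lin_smult[of h R "M n a b"])

lemma quivers_Q: "qv S (map Q ps)"
 unfolding quivers_def using Q_module by auto

lemma paths_Q: "(cs,xs) \<in> pQ ps a b ==> (cs,xs) \<in> pM ps a b"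
proof (induction ps arbitrary: a cs xs)
 case (Cons p ps)
 then show ?case using Q_in_M pathsD(6) by (fastforce simp: paths_Cons)
qed (simp add: paths_Nil)

lemma multilinear_Q:
 assumes "mM ps a b N \<phi>"
 shows "mQ ps a b N \<phi>"
 unfolding multilinear_def
proof (clarify, intro conjI allI impI)
 fix cs xs assume p: "(cs,xs) \<in> pQ ps a b"
 show "\<phi> (cs,xs) \<in>: N" using multilinear_closed[OF assms paths_Q[OF p]] .
 fix i assume i: "i < length (map Q ps)"
 have "(\<lambda>x. \<phi> (cs,xs[i := x])) \<in> Lin (M (ps ! i) (cs ! i) (cs ! Suc i)) N"
  using assms paths_Q[OF p] i by (auto simp: multilinear_def)
 then show "(\<lambda>x. \<phi> (cs,xs[i := x])) \<in> Lin ((map Q ps ! i) (cs ! i) (cs ! Suc i)) N"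
  using lin_restrict paths_nth[OF p, of i] paths_nth[OF p, of "Suc i"] i by simp
qed

lemma itJ_multilinear: "mQ ps a b (M (sum_list ps) a b) (\<lambda>(cs,xs). itJ ps cs xs)"
 by (rule multilinear_Q[OF itJ_multilinear_M])

definition "Phi ps a b = tensor_lift R (M (sum_list ps) a b) (\<lambda>(cs,xs). itJ ps cs xs)"

lemma Phi_linear: "[|a \<in> S; b \<in> S|] ==> Phi ps a b \<in> Lin (tQ ps a b) (M (sum_list ps) a b)"
 unfolding Phi_def by (rule tensor_lift_linear[OF quivers_Q M_module itJ_multilinear])

lemma Phi_closed: "[|z \<in>: tQ ps a b; a \<in> S; b \<in> S|] ==> Phi ps a b z \<in>: M (sum_list ps) a b"
 by (rule lin_closed[OF Phi_linear])

lemma Phi_pure: "(cs,xs) \<in> pQ ps a b ==> Phi ps a b (puQ ps cs xs) = itJ ps cs xs"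
 unfolding Phi_def using tensor_lift_pure[OF quivers_Q M_module itJ_multilinear, of a b cs xs ps] pathsD(6,7) by fastforce

lemma Phi_append:
 assumes S: "a \<in> S" "c \<in> S" "b \<in> S"
  and A: "A \<in>: tQ ps a c" and B: "B \<in>: tQ qs c b"
 shows "Phi (ps @ qs) a b (TA S (map Q ps) (map Q qs) a b A B)
  = J (sum_list ps) (sum_list qs) a c b (Phi ps a c A) (Phi qs c b B)"
proof -
 note q = quivers_Q
 have Ml: "module R (M (sum_list ps + sum_list qs) a b)" using S by (intro M_module)
 have Phi: "Phi (ps @ qs) a b \<in> Lin (TT S (map Q ps @ map Q qs) a b) (M (sum_list ps + sum_list qs) a b)"
  using Phi_linear[OF S(1,3), of "ps @ qs"] by simp
 have pp: "Phi (ps @ qs) a b (pure R S (map Q ps @ map Q qs) cs xs) = itJ (ps @ qs) cs xs"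
  if "(cs,xs) \<in> paths S (map Q ps @ map Q qs) a b" for cs xs using Phi_pure[of cs xs "ps @ qs"] that by simp
 show ?thesis
 proof (rule tensor_eqI[OF q Ml lin_comp[OF Phi tensor_append_linear_left[OF q q B]]
   lin_comp[OF J_left[OF S Phi_closed[OF B S(2,3)]] Phi_linear[OF S(1,2)]] _ A])
  fix cs xs assume 1: "(cs,xs) \<in> pQ ps a c"
  show "Phi (ps @ qs) a b (TA S (map Q ps) (map Q qs) a b (puQ ps cs xs) B)
   = J (sum_list ps) (sum_list qs) a c b (Phi ps a c (puQ ps cs xs)) (Phi qs c b B)"
  proof (rule tensor_eqI[OF q Ml lin_comp[OF Phi tensor_append_linear_right[OF q q pure_closed[OF q 1]]]
    lin_comp[OF J_right[OF S Phi_closed[OF pure_closed[OF q 1] S(1,2)]] Phi_linear[OF S(2,3)]] _ B])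
   fix ds ys assume 2: "(ds,ys) \<in> pQ qs c b"
   show "Phi (ps @ qs) a b (TA S (map Q ps) (map Q qs) a b (puQ ps cs xs) (puQ qs ds ys))
    = J (sum_list ps) (sum_list qs) a c b (Phi ps a c (puQ ps cs xs)) (Phi qs c b (puQ qs ds ys))"
    using itJ_append[OF paths_Q[OF 1] paths_Q[OF 2]]
    by (simp add: tensor_append_pure[OF q q 1 2] pp[OF paths_append[OF 1 2]] Phi_pure[OF 1] Phi_pure[OF 2])
  qed
 qed
qed

lemma tensor_concat_closed:
 assumes "(cs,As) \<in> paths S (map (\<lambda>ps. tQ ps) pss) a b"
 shows "tensor_concat R S (map (map Q) pss) cs As \<in>: tQ (concat pss) a b"
proof -
 have "\<forall>Qs\<in>set (map (map Q) pss). qv S Qs" by (auto simp: quivers_Q)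
 from multilinear_closed[OF tensor_concat_multilinear[OF this, of a b], of cs As] assms show ?thesis
  by (simp add: map_concat comp_def)
qed

text \<open>Computes the product over a refined necklace in two stages, first inside the coarse
  beads and then across them. This is what inert maps need.\<close>

lemma Phi_concat:
 assumes "(cs,As) \<in> paths S (map (\<lambda>ps. tQ ps) pss) a b"
 shows "Phi (concat pss) a b (tensor_concat R S (map (map Q) pss) cs As) = itJ (map sum_list pss) cs (pmap (map Phi pss) cs As)"
 using assms
proof (induction pss arbitrary: a cs As)
 case Nil
 then have p: "cs = [a]" "a = b" "a \<in> S" "As = []" by (auto simp: paths_Nil)
 have "([a],[]) \<in> pQ [] a a" using p by (simp add: paths_Nil)
 from Phi_pure[OF this] show ?case using p by simp
next
 case (Cons ps pss)
 then obtain c ds A As' where p: "cs = a # ds" "As = A # As'" "a \<in> S" "A \<in>: tQ ps a c"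
  "(ds,As') \<in> paths S (map (\<lambda>ps. tQ ps) pss) c b" by (auto simp: paths_Cons)
 note P = pathsD[OF p(5)]
 obtain ds' where ds: "ds = c # ds'" using P(3,8) by (cases ds) auto
 have s: "sum_list (map sum_list pss) = sum_list (concat pss)" by (induction pss) auto
 have "Phi (concat (ps # pss)) a b (tensor_concat R S (map (map Q) (ps # pss)) cs As)
  = Phi (ps @ concat pss) a b (TA S (map Q ps) (map Q (concat pss)) a b A (tensor_concat R S (map (map Q) pss) ds As'))"
  using P by (simp add: p map_concat)
 also have "\<dots> = J (sum_list ps) (sum_list (concat pss)) a c b (Phi ps a c A)
   (Phi (concat pss) c b (tensor_concat R S (map (map Q) pss) ds As'))"
  using P by (intro Phi_append p tensor_concat_closed) auto
 also have "\<dots> = itJ (map sum_list (ps # pss)) cs (pmap (map Phi (ps # pss)) cs As)"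
  using P by (simp add: Cons.IH[OF p(5), unfolded ds] s p ds)
 finally show ?case .
qed

lemma Phi_single: "[|a \<in> S; b \<in> S; x \<in>: Q p a b|] ==> Phi [p] a b (to_tensor R S (Q p) a b x) = x"
 using Phi_pure[of "[a,b]" "[x]" "[p]" a b] itJ_single[of a b x p] Q_in_M
 by (simp add: to_tensor_def paths_Cons paths_Nil)

lemma Phi_pair: "[|a \<in> S; b \<in> S; c \<in> S; x \<in>: Q p a c; y \<in>: Q q c b|]
  ==> Phi [p,q] a b (pure R S [Q p,Q q] [a,c,b] [x,y]) = J p q a c b x y"
 using Phi_pure[of "[a,c,b]" "[x,y]" "[p,q]" a b] itJ_pair[of a b c x p y q] Q_in_M
 by (simp add: paths_Cons paths_Nil)

lemma single_linear: "[|a \<in> S; b \<in> S|] ==> to_tensor R S (Q p) a b \<in> Lin (Q p a b) (TT S [Q p] a b)"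
 by (rule to_tensor_linear) (auto intro: Q_module)

end

lemma (in cring) unit_quiver_module: "module R (unit_quiver R a b)"
proof (rule moduleI)
 show "abelian_group (unit_quiver R a b)"
 proof (rule abelian_groupI)
  fix x assume "x \<in>: unit_quiver R a b"
  then show "\<exists>y\<in>carrier (unit_quiver R a b). y \<oplus>\<^bsub>unit_quiver R a b\<^esub> x = \<zero>\<^bsub>unit_quiver R a b\<^esub>"
   by (auto simp: unit_quiver_def l_neg intro!: bexI[of _ "\<ominus> x"] split: if_splits)
 qed (auto simp: unit_quiver_def a_ac split: if_splits)
qed (auto simp: unit_quiver_def l_distr r_distr m_assoc is_cring split: if_splits)

lemma (in cring) unit_to_tensor_linear:
 assumes "a \<in> S" "b \<in> S"
 shows "unit_to_tensor R S a b \<in> lin_maps R (unit_quiver R a b) (tensor R S ([] :: ('a,'o,'m) quiver list) a b)"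
proof -
 let ?T = "tensor R S ([] :: ('a,'o,'m) quiver list)"
 have T: "module R (?T a b)" by (rule TT_module) simp
 show ?thesis
 proof (cases "a = b")
  case False
  interpret T: module R "?T a b" by (rule T)
  show ?thesis using False
   by (intro lin_mapsI) (simp_all add: unit_to_tensor_def unit_quiver_def)
 next
  case [simp]: True
  interpret T: module R "?T b b" using T by simp
  have "pure R S [] [b] [] \<in>: ?T b b" using assms by (intro pure_closed) (auto simp: paths_Nil)
  then show ?thesis
   by (intro lin_mapsI) (simp_all add: unit_to_tensor_def unit_quiver_def T.smult_l_distr T.smult_assoc1)
 qed
qed

section \<open>Templicial modules with a product\<close>

text \<open>A product and a comultiplication linked as in a Frobenius structure:
  \<open>Phi_tcomult\<close> makes the product after \<open>\<mu>\<close> a projection. The maps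
  \<open>tm\<close> extend the structure maps from \<open>Q\<close> to \<open>M\<close>. The last
  three axioms say that the unit \<open>u a\<close> has counit 1 and generates degree 0.\<close>

locale frob = graded_sub R S M J u Q
 for R :: "('k,'r) ring_scheme" (structure) and S :: "'o set" and M :: "nat => ('k,'o,'x) quiver"
  and J :: "nat => nat => 'o => 'o => 'o => 'x => 'x => 'x" and u :: "'o => 'x"
  and Q :: "nat => ('k,'o,'x) quiver" +
 fixes X :: "('k,'o,'x) templicial"
  and tm :: "nat => nat => (nat => nat) => 'o => 'o => 'x => 'x"
  and P :: "nat => nat set => 'o => 'o => 'x => 'x"
 assumes X_vert: "tvert X = S" and X_mod: "tmod X = Q"
  and tm_linear: "[|f \<in> imaps m n; a \<in> S; b \<in> S|] ==> tm m n f a b \<in> lin_maps R (M n a b) (M m a b)"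
  and tm_id: "[|a \<in> S; b \<in> S; x \<in>: M n a b|] ==> tm n n (\<lambda>i\<in>{..n}. i) a b x = x"
  and tm_comp: "[|f \<in> imaps l m; g \<in> imaps m n; a \<in> S; b \<in> S; x \<in>: M n a b|]
    ==> tm l n (compose {..l} g f) a b x = tm l m f a b (tm m n g a b x)"
  and tmap_tm: "[|f \<in> imaps m n; a \<in> S; b \<in> S; x \<in>: Q n a b|] ==> tmap X m n f a b x = tm m n f a b x"
  and tmap_linear_Q: "[|f \<in> imaps m n; a \<in> S; b \<in> S|] ==> tmap X m n f a b \<in> lin_maps R (Q n a b) (Q m a b)"
  and tm_J: "[|f \<in> imaps p p'; g \<in> imaps q q'; a \<in> S; c \<in> S; b \<in> S;
    x \<in>: M p' a c; y \<in>: M q' c b|] ==>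
    tm (p + q) (p' + q') (interval_sum p p' q f g) a b (J p' q' a c b x y) =
    J p q a c b (tm p p' f a c x) (tm q q' g c b y)"
  and P_linear: "[|a \<in> S; b \<in> S|] ==> P n T a b \<in> lin_maps R (M n a b) (M n a b)"
  and P_P: "[|a \<in> S; b \<in> S; x \<in>: M n a b|] ==> P n T a b (P n U a b x) = P n (T \<union> U) a b x"
  and P_triv: "[|T \<subseteq> {0,n}; a \<in> S; b \<in> S; x \<in>: M n a b|] ==> P n T a b x = x"
  and P_J: "[|a \<in> S; c \<in> S; b \<in> S; x \<in>: M p a c; y \<in>: M q c b|] ==>
    P (p + q) T a b (J p q a c b x y) = J p q a c b (P p (cutL p T) a c x) (P q (cutR p T) c b y)"
  and P_tm: "[|f \<in> imaps m n; T \<subseteq> {..m}; a \<in> S; b \<in> S; x \<in>: M n a b|] ==>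
    P m T a b (tm m n f a b x) = tm m n f a b (P n (f ` T) a b x)"
  and tcomult_linear_Q: "[|a \<in> S; b \<in> S|] ==> tcomult X p q a b \<in> lin_maps R (Q (p + q) a b) (tensor R S [Q p, Q q] a b)"
  and Phi_tcomult: "[|a \<in> S; b \<in> S; x \<in>: Q (p + q) a b|] ==> Phi [p,q] a b (tcomult X p q a b x) = P (p + q) {p} a b x"
  and tcounit_linear_Q: "[|a \<in> S; b \<in> S|] ==> tcounit X a b \<in> lin_maps R (Q 0 a b) (unit_quiver R a b)"
  and u_Q: "a \<in> S ==> u a \<in>: Q 0 a a"
  and tcounit_u: "a \<in> S ==> tcounit X a a (u a) = \<one>"
  and tcounit_eq: "[|a \<in> S; b \<in> S; x \<in>: Q 0 a b|]
    ==> x = (if a = b then tcounit X a b x \<odot>\<^bsub>Q 0 a b\<^esub> u a else \<zero>\<^bsub>Q 0 a b\<^esub>)"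
begin

lemma tcounit_inj:
 assumes "a \<in> S" "b \<in> S"
 shows "inj_on (tcounit X a b) (carrier (Q 0 a b))"
proof (rule inj_onI)
 fix x y assume x: "x \<in>: Q 0 a b" and y: "y \<in>: Q 0 a b" and e: "tcounit X a b x = tcounit X a b y"
 have "x = (if a = b then tcounit X a b x \<odot>\<^bsub>Q 0 a b\<^esub> u a else \<zero>\<^bsub>Q 0 a b\<^esub>)" by (rule tcounit_eq[OF assms x])
 also have "\<dots> = y" unfolding e by (rule tcounit_eq[OF assms y, symmetric])
 finally show "x = y" .
qed

lemma tcounit_bij:
 assumes S: "a \<in> S" "b \<in> S"
 shows "bij_betw (tcounit X a b) (carrier (Q 0 a b)) (carrier (unit_quiver R a b))"
proof -
 interpret Q: module R "Q 0 a b" by (rule Q_module[OF S])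
 interpret U: module R "unit_quiver R a b" by (rule unit_quiver_module)
 have "r \<in> tcounit X a b ` carrier (Q 0 a b)" if r: "r \<in>: unit_quiver R a b" for r
 proof (cases "a = b")
  case [simp]: True
  have r: "r \<in>: R" using r by (simp add: unit_quiver_def)
  have "tcounit X a b (r \<odot>\<^bsub>Q 0 a b\<^esub> u a) = r"
   using lin_smult[OF tcounit_linear_Q[OF S] r, of "u b"] u_Q[OF S(2)] tcounit_u[OF S(2)] r
   by (simp add: unit_quiver_def)
  then show ?thesis using r u_Q[OF S(2)] by (metis True Q.smult_closed imageI)
 next
  case False
  then have "r = \<zero>\<^bsub>unit_quiver R a b\<^esub>" using r by (simp add: unit_quiver_def)
  then show ?thesis using lin_zero[OF Q_module[OF S] unit_quiver_module tcounit_linear_Q[OF S]]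
   by (metis Q.zero_closed imageI)
 qed
 then show ?thesis using lin_closed[OF tcounit_linear_Q[OF S]] tcounit_inj[OF S]
  unfolding bij_betw_def by auto
qed

text \<open>The element that \<open>active_map\<close> inserts at a collapsed bead is the unit of
  the product, and so disappears on multiplication.\<close>

lemma inv_tcounit: "c \<in> S ==> the_inv_into (carrier (tmod X 0 c c)) (tcounit X c c) \<one> = u c"
 unfolding X_mod by (rule the_inv_into_f_eq[OF tcounit_inj tcounit_u u_Q])

lemma tcounit_tensor_linear:
 "[|a \<in> S; b \<in> S|] ==> tcounit_tensor R X a b \<in> Lin (Q 0 a b) (TT S ([] :: ('k,'o,'x) quiver list) a b)"
 unfolding X_vert by (rule lin_comp[OF unit_to_tensor_linear tcounit_linear_Q])

lemma Phi_tcounit: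
 assumes S: "a \<in> S" "b \<in> S" and x: "x \<in>: Q 0 a b"
 shows "Phi [] a b (tcounit_tensor R X a b x) = x"
proof (cases "a = b")
 case [simp]: True
 have p: "([b],[]) \<in> pQ [] b b" using S by (simp add: paths_Nil)
 have r: "tcounit X b b x \<in>: R" using lin_closed[OF tcounit_linear_Q[OF S] x] by (simp add: unit_quiver_def)
 have "Phi [] a b (tcounit_tensor R X a b x) = tcounit X b b x \<odot>\<^bsub>M 0 b b\<^esub> u b"
  using lin_smult[OF Phi_linear[OF S(2,2), of "[]"] r pure_closed[OF _ p]] Phi_pure[OF p]
  by (simp add: unit_to_tensor_def X_vert)
 also have "\<dots> = x" using tcounit_eq[OF S x] Q_smult[OF S(2,2), of 0] by simp
 finally show ?thesis .
next
 case False
 have "Phi [] a b (tcounit_tensor R X a b x) = Phi [] a b \<zero>\<^bsub>tQ [] a b\<^esub>"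
  using False by (simp add: unit_to_tensor_def X_vert)
 also have "\<dots> = \<zero>\<^bsub>M 0 a b\<^esub>"
  using lin_zero[OF TT_module[OF quivers_Q] M_module[OF S] Phi_linear[OF S, of "[]"]] by simp
 also have "\<dots> = x" using tcounit_eq[OF S x] Q_zero[OF S, of 0] False by simp
 finally show ?thesis .
qed

lemma P_closed: "[|a \<in> S; b \<in> S; x \<in>: M n a b|] ==> P n T a b x \<in>: M n a b"
 by (rule lin_closed[OF P_linear])

lemma tm_closed: "[|f \<in> imaps m n; a \<in> S; b \<in> S; x \<in>: M n a b|] ==> tm m n f a b x \<in>: M m a b"
 by (rule lin_closed[OF tm_linear])

lemma iter_comult_linear: "[|a \<in> S; b \<in> S|] ==>
  iter_comult R X ps a b \<in> Lin (Q (sum_list ps) a b) (tQ ps a b)"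
proof (induction ps arbitrary: a b rule: induct_list012)
 case 1
 show ?case using tcounit_tensor_linear[OF 1] by simp
next
 case (2 p)
 show ?case using single_linear[OF 2] by (simp add: X_mod X_vert)
next
 case (3 p q qs)
 have q: "qv S [Q p, Q (sum_list (q # qs))]" "qv S [Q p]" "qv S (map Q (q # qs))"
  using quivers_Q[of "[p,sum_list (q # qs)]"] quivers_Q[of "[p]"] quivers_Q[of "q # qs"] by auto
 have "(\<lambda>x. tensor_maps R S [[Q p], map Q (q # qs)] [to_tensor R S (Q p), iter_comult R X (q # qs)] a b
   (tcomult X p (sum_list (q # qs)) a b x)) \<in> Lin (Q (p + sum_list (q # qs)) a b) (TT S ([Q p] @ map Q (q # qs)) a b)"
  by (rule lin_comp[OF tensor_maps_linear2[OF q single_linear 3(2)] tcomult_linear_Q[OF 3(3,4)]])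
 then show ?case by (simp add: X_mod X_vert)
qed

text \<open>The method behind all identities on \<open>\<mu>\<close>: if h agrees on pure tensors
  with P T after the product, then h after \<open>\<mu>\<close> is P T after P {p}, that is, P of
  the union.\<close>

lemma P_tcomult:
 assumes S: "a \<in> S" "b \<in> S" and x: "x \<in>: Q (p + q) a b"
  and h: "h \<in> Lin (TT S [Q p, Q q] a b) (M (p + q) a b)"
  and e: "\<And>c y z. [|c \<in> S; y \<in>: Q p a c; z \<in>: Q q c b|] ==>
   h (pure R S [Q p, Q q] [a,c,b] [y,z]) = P (p + q) T a b (J p q a c b y z)"
 shows "h (tcomult X p q a b x) = P (p + q) (T \<union> {p}) a b x"
proof -
 have q: "qv S [Q p, Q q]" using quivers_Q[of "[p,q]"] by simp
 have Phi: "Phi [p,q] a b \<in> Lin (TT S [Q p, Q q] a b) (M (p + q) a b)" using Phi_linear[OF S, of "[p,q]"] by simp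
 have "h (tcomult X p q a b x) = P (p + q) T a b (Phi [p,q] a b (tcomult X p q a b x))"
  by (rule tensor_eqI2[OF q M_module[OF S] h lin_comp[OF P_linear[OF S] Phi] _ lin_closed[OF tcomult_linear_Q[OF S] x]])
   (simp add: e Phi_pair)
 then show ?thesis using P_P[OF S Q_in_M[OF x S]] by (simp add: Phi_tcomult[OF S x])
qed

text \<open>P on the right factor is P on the product for the translated set; the extra 0 is
  harmless by \<open>P_triv\<close>. It shows up in the right half only for p = 0, hence the
  disjunction.\<close>

lemma P_J_right:
 assumes "a \<in> S" "c \<in> S" "b \<in> S" "x \<in>: M p a c" "y \<in>: M q c b"
 shows "J p q a c b x (P q T c b y) = P (p + q) (insert 0 ((+) p ` T)) a b (J p q a c b x y)"
proof -
 have "cutR p (insert 0 ((+) p ` T)) = T \<or> cutR p (insert 0 ((+) p ` T)) = {0} \<union> T" by (auto simp: cutR_iff set_eq_iff)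
 moreover have "P q ({0} \<union> T) c b y = P q T c b y"
  using P_P[OF assms(2,3,5), of "{0}" T] P_triv[of "{0}" q c b "P q T c b y"] P_closed assms by simp
 ultimately have "P q (cutR p (insert 0 ((+) p ` T))) c b y = P q T c b y" by metis
 moreover have "P p (cutL p (insert 0 ((+) p ` T))) a c x = x"
  using assms by (intro P_triv) (auto simp: cutL_iff)
 ultimately show ?thesis using assms by (simp add: P_J)
qed

text \<open>Each comultiplication contributes its cut point to the projection, and together they
  contribute the whole necklace.\<close>

lemma Phi_iter_comult: "[|a \<in> S; b \<in> S; x \<in>: Q (sum_list ps) a b|] ==>
  Phi ps a b (iter_comult R X ps a b x) = P (sum_list ps) (psums ps) a b x"
proof (induction ps arbitrary: a b x rule: induct_list012)
 case 1
 then show ?case by (simp add: Phi_tcounit P_triv Q_in_M)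
next
 case (2 p)
 then show ?case by (simp add: X_mod X_vert Phi_single P_triv Q_in_M)
next
 case (3 p q qs a b x)
 let ?q = "sum_list (q # qs)"
 note S = 3(3,4)
 have x: "x \<in>: Q (p + ?q) a b" using 3(5) by simp
 have q: "qv S [Q p, Q ?q]" "qv S [Q p]" "qv S (map Q (q # qs))"
  using quivers_Q[of "[p,?q]"] quivers_Q[of "[p]"] quivers_Q[of "q # qs"] by auto
 let ?t = "tensor_maps R S [[Q p], map Q (q # qs)] [to_tensor R S (Q p), iter_comult R X (q # qs)] a b"
 have t: "?t \<in> Lin (TT S [Q p, Q ?q] a b) (tQ (p # q # qs) a b)"
  using tensor_maps_linear2[OF q single_linear iter_comult_linear] by simp
 have Phi: "Phi (p # q # qs) a b \<in> Lin (tQ (p # q # qs) a b) (M (p + ?q) a b)"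
  using Phi_linear[OF S, of "p # q # qs"] by simp
 have "Phi (p # q # qs) a b (?t (tcomult X p ?q a b x)) = P (p + ?q) (psums (p # q # qs) \<union> {p}) a b x"
 proof (rule P_tcomult[OF S x lin_comp[OF Phi t]])
  fix c y z assume c: "c \<in> S" and y: "y \<in>: Q p a c" and z: "z \<in>: Q ?q c b"
  have i: "iter_comult R X (q # qs) c b z \<in>: tQ (q # qs) c b"
   by (rule lin_closed[OF iter_comult_linear[OF c S(2)] z])
  have "?t (pure R S [Q p, Q ?q] [a,c,b] [y,z]) =
   TA S [Q p] (map Q (q # qs)) a b (to_tensor R S (Q p) a c y) (iter_comult R X (q # qs) c b z)"
   by (rule tensor_maps_pure2[OF q single_linear iter_comult_linear S(1) c S(2) y z])
  then have "Phi (p # q # qs) a b (?t (pure R S [Q p, Q ?q] [a,c,b] [y,z])) =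
   J p ?q a c b y (P ?q (psums (q # qs)) c b z)"
   using Phi_append[OF S(1) c S(2), of "to_tensor R S (Q p) a c y" "[p]" "iter_comult R X (q # qs) c b z" "q # qs"]
    lin_closed[OF single_linear[OF S(1) c] y] i Phi_single[OF S(1) c y] 3(2)[OF c S(2)] z by simp
  also have "\<dots> = P (p + ?q) (psums (p # q # qs)) a b (J p ?q a c b y z)"
   using P_J_right[OF S(1) c S(2) Q_in_M[OF y S(1) c] Q_in_M[OF z c S(2)]] by simp
  finally show "Phi (p # q # qs) a b (?t (pure R S [Q p, Q ?q] [a,c,b] [y,z])) = P (p + ?q) (psums (p # q # qs)) a b (J p ?q a c b y z)" .
 qed
 moreover have "psums (p # q # qs) \<union> {p} = psums (p # q # qs)" using psums_0[of "q # qs"] by force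
 ultimately show ?case by (simp add: X_mod X_vert)
qed

text \<open>P of a refined necklace acts on every factor by the piece lying in that factor;
  \<open>cut_psums\<close> identifies the pieces.\<close>

lemma P_itJ:
 assumes "(cs,xs) \<in> pM (map sum_list pss) a b"
 shows "P (sum_list (concat pss)) (psums (concat pss)) a b (itJ (map sum_list pss) cs xs)
  = itJ (map sum_list pss) cs (pmap (map (\<lambda>ps. P (sum_list ps) (psums ps)) pss) cs xs)"
 using assms
proof (induction pss arbitrary: a cs xs)
 case Nil
 then show ?case by (auto simp: paths_Nil P_triv u_closed)
next
 case (Cons ps pss)
 then obtain c ds x xs' where p: "cs = a # ds" "xs = x # xs'" "a \<in> S" "x \<in>: M (sum_list ps) a c"
  "(ds,xs') \<in> pM (map sum_list pss) c b" by (auto simp: paths_Cons)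
 note D = pathsD[OF p(5)]
 obtain ds' where ds: "ds = c # ds'" using D(3,8) by (cases ds) auto
 have s: "sum_list (map sum_list pss) = sum_list (concat pss)" by (induction pss) auto
 have "P (sum_list (concat (ps # pss))) (psums (concat (ps # pss))) a b (itJ (map sum_list (ps # pss)) cs xs)
  = P (sum_list ps + sum_list (concat pss)) (psums (ps @ concat pss)) a b
   (J (sum_list ps) (sum_list (concat pss)) a c b x (itJ (map sum_list pss) ds xs'))"
  using D by (simp add: p s)
 also have "\<dots> = J (sum_list ps) (sum_list (concat pss)) a c b (P (sum_list ps) (psums ps) a c x)
   (P (sum_list (concat pss)) (psums (concat pss)) c b (itJ (map sum_list pss) ds xs'))"
  using P_J[OF p(3) D(6,7) p(4) itJ_closed[OF p(5), unfolded s], of "psums (ps @ concat pss)"] by (simp add: cut_psums)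
 also have "\<dots> = itJ (map sum_list (ps # pss)) cs (pmap (map (\<lambda>ps. P (sum_list ps) (psums ps)) (ps # pss)) cs xs)"
  using D by (simp add: Cons.IH[OF p(5), unfolded ds] s p ds)
 finally show ?case .
qed

abbreviation PhiN :: "nat set => 'o => 'o => ('k,'o,'x) tens => 'x" where
 "PhiN T \<equiv> Phi (bl T)"

lemma nec_mod_alt: "nec_mod R X T = tQ (bl T)"
 unfolding nec_mod_def nec_quivers_def X_vert X_mod ..

text \<open>On a generator the pieces of T inside one bead of U multiply to a projection on that
  bead by \<open>Phi_iter_comult\<close>, and \<open>P_itJ\<close> assembles these projections into
  P T.\<close>

lemma inert_linear_Phi:
 assumes U: "U \<in> necklaces n" and T: "T \<in> necklaces n" and sub: "U \<subseteq> T" and S: "a \<in> S" "b \<in> S"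
 shows "inert_map R X T U a b \<in> Lin (nec_mod R X U a b) (nec_mod R X T a b)"
  and "z \<in>: nec_mod R X U a b ==> PhiN T a b (inert_map R X T U a b z) = P n T a b (PhiN U a b z)"
proof -
 define Ts where "Ts = map (\<lambda>(u,v). (\<lambda>t. t - u) ` (T \<inter> {u..v})) (beads U)"
 \<comment> \<open>The bead lengths of T, grouped by the beads of U.\<close>
 define pss where "pss = map bl Ts"
 have pss: "concat pss = bl T" "map sum_list pss = bl U"
  using inert_beads[OF U T sub] unfolding pss_def Ts_def by (auto simp: comp_def)
 define hs where "hs = map (\<lambda>T'. iter_comult R X (bl T')) Ts"
 have hs: "hs = map (iter_comult R X) pss" unfolding hs_def pss_def by simp
 have nq: "map (nec_quivers X) Ts = map (map Q) pss" unfolding pss_def nec_quivers_def[abs_def] X_mod by simp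
 have it: "inert_map R X T U = tensor_maps R S (map (map Q) pss) hs"
  unfolding inert_map_def Let_def Ts_def[symmetric] hs_def[symmetric] nq X_vert ..
 have len: "length (bl U) = length pss" using pss(2) by (metis length_map)
 have nth: "bl U ! i = sum_list (pss ! i)" if "i < length pss" for i using pss(2) that by (metis nth_map)
 have q: "\<forall>Qs\<in>set (map (map Q) pss). qv S Qs" using quivers_Q by auto
 have hl: "(hs ! i) c d \<in> Lin ((map Q (bl U) ! i) c d) (TT S (map (map Q) pss ! i) c d)"
  if "i < length (map Q (bl U))" "c \<in> S" "d \<in> S" for i c d
  using that iter_comult_linear[of c d "pss ! i"] by (simp add: hs len nth)
 have l: "length hs = length (map Q (bl U))" "length (map (map Q) pss) = length (map Q (bl U))"
  by (simp_all add: hs len)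
 note tm = quivers_Q[of "bl U"] q l hl
 have cc: "concat (map (map Q) pss) = map Q (bl T)" by (simp add: pss(1)[symmetric] map_concat)
 show lin: "inert_map R X T U a b \<in> Lin (nec_mod R X U a b) (nec_mod R X T a b)"
  unfolding it nec_mod_alt using tensor_maps_linear[OF tm] unfolding cc .
 show "PhiN T a b (inert_map R X T U a b z) = P n T a b (PhiN U a b z)" if z: "z \<in>: nec_mod R X U a b"
 proof -
  have l1: "PhiN T a b \<in> Lin (nec_mod R X T a b) (M n a b)" "PhiN U a b \<in> Lin (nec_mod R X U a b) (M n a b)"
   using Phi_linear[OF S, of "bl T"] Phi_linear[OF S, of "bl U"]
    sum_bl[OF T] sum_bl[OF U] unfolding nec_mod_alt by simp_all
  show ?thesis
  proof (rule tensor_eqI[OF quivers_Q M_module[OF S] lin_comp[OF l1(1) lin, unfolded nec_mod_alt]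
     lin_comp[OF P_linear[OF S] l1(2), unfolded nec_mod_alt] _ z[unfolded nec_mod_alt]])
   fix cs xs assume p: "(cs,xs) \<in> pQ (bl U) a b"
   have p1: "(cs, pmap hs cs xs) \<in> paths S (map (\<lambda>ps. tQ ps) pss) a b"
    using paths_tensor_maps[OF tm p] by (simp add: comp_def)
   have e: "pmap (map Phi pss) cs (pmap hs cs xs) = pmap (map (\<lambda>ps. P (sum_list ps) (psums ps)) pss) cs xs"
   proof (rule nth_equalityI)
    show "length (pmap (map Phi pss) cs (pmap hs cs xs)) = length (pmap (map (\<lambda>ps. P (sum_list ps) (psums ps)) pss) cs xs)"
     by (simp add: pmap_def)
    fix i assume "i < length (pmap (map Phi pss) cs (pmap hs cs xs))"
    then have i: "i < length xs" by (simp add: pmap_def)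
    then have i': "i < length pss" using pathsD(2)[OF p] len by simp
    have "Phi (pss ! i) (cs ! i) (cs ! Suc i) (iter_comult R X (pss ! i) (cs ! i) (cs ! Suc i) (xs ! i))
     = P (sum_list (pss ! i)) (psums (pss ! i)) (cs ! i) (cs ! Suc i) (xs ! i)"
     using pathsD(10)[OF p, of i] paths_nth[OF p, of i] paths_nth[OF p, of "Suc i"] i' len nth[OF i']
     by (intro Phi_iter_comult) simp_all
    then show "pmap (map Phi pss) cs (pmap hs cs xs) ! i = pmap (map (\<lambda>ps. P (sum_list ps) (psums ps)) pss) cs xs ! i"
     using i i' by (simp add: pmap_def hs)
   qed
   have tp: "tensor_maps R S (map (map Q) pss) hs a b (puQ (bl U) cs xs) =
     tensor_concat R S (map (map Q) pss) cs (pmap hs cs xs)"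
    by (rule tensor_maps_pure[OF tm p])
   have "PhiN T a b (inert_map R X T U a b (puQ (bl U) cs xs))
    = Phi (concat pss) a b (tensor_concat R S (map (map Q) pss) cs (pmap hs cs xs))"
    unfolding it tp pss(1) ..
   also have "\<dots> = itJ (map sum_list pss) cs (pmap (map (\<lambda>ps. P (sum_list ps) (psums ps)) pss) cs xs)"
    unfolding Phi_concat[OF p1] e ..
   also have "\<dots> = P (sum_list (concat pss)) (psums (concat pss)) a b (itJ (map sum_list pss) cs xs)"
    using paths_Q[OF p] pss(2) by (intro P_itJ[symmetric]) simp
   also have "\<dots> = P n T a b (PhiN U a b (puQ (bl U) cs xs))"
    unfolding pss Phi_pure[OF p] by (simp add: sum_bl[OF T] psums_bl[OF T])
   finally show "PhiN T a b (inert_map R X T U a b (puQ (bl U) cs xs)) =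
    P n T a b (PhiN U a b (puQ (bl U) cs xs))" .
  qed
 qed
qed

section \<open>Active maps on generators\<close>

definition act_pos :: "nat set => (nat => nat) => nat => nat" where
 "act_pos T f t = card {v \<in> f ` T. v < f t}"

text \<open>The formula of \<open>active_map\<close> before passing to tensor products, where
  induction on the necklace is possible.\<close>

definition "act T f = (\<lambda>(cs,xs).
   (map (\<lambda>t. cs ! act_pos T f t) (sl T),
   map (\<lambda>(t,t'). tmap X (t' - t) (f t' - f t) (\<lambda>i\<in>{..t' - t}. f (t + i) - f t)
         (cs ! act_pos T f t) (cs ! act_pos T f t')
         (if f t = f t'
         then the_inv_into (carrier (tmod X 0 (cs ! act_pos T f t) (cs ! act_pos T f t)))
             (tcounit X (cs ! act_pos T f t) (cs ! act_pos T f t)) \<one>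
         else xs ! act_pos T f t))
      (beads T)))"

lemma active_act: "active_map R X T f a b =
  tensor_lift R (nec_mod R X T a b) (\<lambda>p. puQ (bl T) (fst (act T f p)) (snd (act T f p)))"
 unfolding active_map_def act_def act_pos_def Let_def nec_quivers_def X_vert X_mod by (simp add: case_prod_beta')

lemma act_pos_0: "f 0 = 0 ==> act_pos T f 0 = 0"
 by (simp add: act_pos_def)

text \<open>If f collapses the first bead, its two ends have the same image and no entry is used up;
  otherwise all later positions move by one.\<close>

lemma act_pos_join:
 assumes f: "f \<in> imaps (w + n) q" and w: "0 < w" and T: "T \<in> necklaces n" and s: "s \<le> n"
 shows "act_pos (joinN w {0,w} T) f (w + s) = (if f w = 0 then 0 else 1) + act_pos T (fcutR w n f) s"
proof -
 let ?g = "fcutR w n f"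
 have g: "f (w + t) = f w + ?g t" if "t \<le> n" for t
  using imapsD(4)[OF f, of w "w + t"] that by (simp add: fcutR_def)
 have "joinN w {0,w} T = insert 0 ((+) w ` T)" using necklacesD(1)[OF T] by (auto simp: joinN_def)
 moreover have "f ` (+) w ` T = (+) (f w) ` ?g ` T" using g necklacesD(3)[OF T] by (auto simp: image_image)
 ultimately have im: "f ` joinN w {0,w} T = insert 0 ((+) (f w) ` ?g ` T)" using imapsD(1)[OF f] by simp
 have fin: "finite {v \<in> ?g ` T. v < ?g s}" by (rule finite_subset[of _ "{..?g s}"]) auto
 show ?thesis
 proof (cases "f w = 0")
  case True
  have "0 \<in> ?g ` T" using necklacesD(1)[OF T] True by (auto simp: fcutR_def image_iff intro!: bexI[of _ 0])
  then have "f ` joinN w {0,w} T = ?g ` T" using im True by auto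
  then show ?thesis using True g[OF s] by (simp add: act_pos_def)
 next
  case False
  then have "{v \<in> f ` joinN w {0,w} T. v < f (w + s)} = insert 0 ((+) (f w) ` {v \<in> ?g ` T. v < ?g s})"
   unfolding im g[OF s] by auto
  then show ?thesis using False fin by (simp add: act_pos_def card_image image_iff)
 qed
qed

lemma act_0: "f 0 = 0 ==> act {0} f (cs,xs) = ([cs ! 0],[])"
 by (simp add: act_def act_pos_0)

text \<open>k counts the entries consumed by the first bead: none if f collapses it, one
  otherwise.\<close>

lemma act_join:
 assumes f: "f \<in> imaps (w + n) q" and w: "0 < w" and T: "T \<in> necklaces n"
  and k: "k = (if f w = 0 then 0 else 1)" and len: "k \<le> length cs" "k \<le> length xs"
 shows "act (joinN w {0,w} T) f (cs,xs) =
  (cs ! 0 # fst (act T (fcutR w n f) (drop k cs, drop k xs)),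
   tmap X w (f w) (fcutL w f) (cs ! 0) (cs ! k)
    (if f w = 0 then the_inv_into (carrier (tmod X 0 (cs ! 0) (cs ! 0))) (tcounit X (cs ! 0) (cs ! 0)) \<one> else xs ! 0)
   # snd (act T (fcutR w n f) (drop k cs, drop k xs)))"
proof -
 let ?g = "fcutR w n f"
 have g: "f (w + t) = f w + ?g t" if "t \<le> n" for t
  using imapsD(4)[OF f, of w "w + t"] that by (simp add: fcutR_def)
 have f0: "f 0 = 0" by (rule imapsD(1)[OF f])
 have g0: "?g 0 = 0" by (simp add: fcutR_def)
 have pos: "act_pos (joinN w {0,w} T) f (w + s) = k + act_pos T ?g s" if "s \<le> n" for s
  using act_pos_join[OF f w T that] k by simp
 have pw: "act_pos (joinN w {0,w} T) f w = k" using pos[of 0] act_pos_0[of ?g T, OF g0] by simp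
 have 1: "cs ! act_pos (joinN w {0,w} T) f (w + t) = drop k cs ! act_pos T ?g t" if "t \<in> T" for t
  using pos[of t] necklacesD(3)[OF T that] len by simp
 have 2: "xs ! act_pos (joinN w {0,w} T) f (w + t) = drop k xs ! act_pos T ?g t" if "t \<in> T" for t
  using pos[of t] necklacesD(3)[OF T that] len by simp
 have 3: "(\<lambda>i\<in>{..t' - t}. f (w + t + i) - (f w + v)) = (\<lambda>i\<in>{..t' - t}. ?g (t + i) - v)" if "(t,t') \<in> set (beads T)" for t t' v
 proof -
  have "t' \<le> n" "t < t'" using beadsD[OF that nec_finite[OF T]] necklacesD(3)[OF T] by auto
  then show ?thesis using g[of "t + _"] by (auto simp: fun_eq_iff add.assoc)
 qed
 have 5: "(\<lambda>i\<in>{..t' - t}. f (w + t + i) - v) = (\<lambda>i\<in>{..t' - t}. ?g (t + i) - v)" if "(t,t') \<in> set (beads T)" "f w = 0" for t t' v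
  using 3[OF that(1), of v] that(2) by simp
 have 4: "(\<lambda>i\<in>{..w}. f i) = fcutL w f" by (simp add: fcutL_def)
 have b: "t \<in> T" "t' \<in> T" "t \<le> n" "t' \<le> n" if "(t,t') \<in> set (beads T)" for t t'
  using beadsD[OF that nec_finite[OF T]] necklacesD(3)[OF T] by auto
 have fin: "finite T" using T by (rule nec_finite)
 show ?thesis
  unfolding act_def join_bead[OF w T] case_prod_conv fst_conv snd_conv list.map map_map
  by (auto simp: f0 act_pos_0 pw 1 2 3 4 5 g b fin comp_def split: prod.splits intro!: map_cong)
qed

lemma image_necklace: "[|f \<in> imaps n q; T \<in> necklaces n|] ==> f ` T \<in> necklaces q"
 unfolding necklaces_def by (auto simp: imapsD(3) image_iff imapsD(1,2)[of f n q] intro: bexI[of _ 0] bexI[of _ n])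

lemma image_join:
 assumes f: "f \<in> imaps (w + n) q" and w: "0 < w" and T: "T \<in> necklaces n"
 shows "f ` joinN w {0,w} T = (if f w = 0 then fcutR w n f ` T else joinN (f w) {0,f w} (fcutR w n f ` T))"
proof -
 let ?g = "fcutR w n f"
 have g: "f (w + t) = f w + ?g t" if "t \<le> n" for t
  using imapsD(4)[OF f, of w "w + t"] that by (simp add: fcutR_def)
 have "joinN w {0,w} T = insert 0 ((+) w ` T)" using necklacesD(1)[OF T] by (auto simp: joinN_def)
 moreover have "f ` (+) w ` T = (+) (f w) ` ?g ` T" using g necklacesD(3)[OF T] by (auto simp: image_image)
 ultimately have im: "f ` joinN w {0,w} T = insert 0 ((+) (f w) ` ?g ` T)" using imapsD(1)[OF f] by simp
 have "0 \<in> ?g ` T" using necklacesD(1)[OF T] by (auto simp: fcutR_def image_iff intro!: bexI[of _ 0])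
 then show ?thesis unfolding im by (auto simp: joinN_def)
qed

text \<open>Closure, the effect on products and multilinearity share one recursion and are proved
  together: the first bead of T is removed and f is split there by
  \<open>interval_sum_cut\<close>.\<close>

lemma act_facts:
 assumes "T \<in> necklaces n" "f \<in> imaps n q"
 shows "(cs,xs) \<in> pQ (bl (f ` T)) a b ==> act T f (cs,xs) \<in> pQ (bl T) a b"
  and "(cs,xs) \<in> pQ (bl (f ` T)) a b ==>
   itJ (bl T) (fst (act T f (cs,xs))) (snd (act T f (cs,xs))) = tm n q f a b (itJ (bl (f ` T)) cs xs)"
  and "mQ (bl T) a b N \<psi> ==>
   mQ (bl (f ` T)) a b N (\<lambda>p. \<psi> (act T f p))"
proof -
 have "((cs,xs) \<in> pQ (bl (f ` T)) a b \<longrightarrow> act T f (cs,xs) \<in> pQ (bl T) a b \<and>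
   itJ (bl T) (fst (act T f (cs,xs))) (snd (act T f (cs,xs))) = tm n q f a b (itJ (bl (f ` T)) cs xs)) \<and>
   (mQ (bl T) a b N \<psi> \<longrightarrow>
   mQ (bl (f ` T)) a b N (\<lambda>p. \<psi> (act T f p)))"
  using assms
 proof (induction arbitrary: f q a cs xs \<psi> rule: necklace_induct)
  case (zero f q)
  have f: "f 0 = 0" "q = 0" "f = (\<lambda>i\<in>{..0}. i)" using imapsD(1)[OF zero] interval_maps_0[OF zero] by auto
  have im: "f ` {0} = {0}" using f(1) by simp
  have "tm 0 q f a a (u a) = u a" if "a \<in> S" using tm_id[OF that that u_closed[OF that]] f(2,3) by simp
  then show ?case unfolding im by (auto simp: paths_Nil act_0[of f] f(1) multilinear_Nil)
 next
  case (bead w n T f q)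
  note f = bead(4) and w = bead(1) and T = bead(2)
  let ?g = "fcutR w n f" and ?h = "fcutL w f"
  have h: "?h \<in> imaps w (f w)" by (rule fcutL_map[OF f]) simp
  have g: "?g \<in> imaps n (q - f w)" by (rule fcutR_map[OF f])
  have fw: "f w \<le> q" by (rule imapsD(3)[OF f]) simp
  have sum: "interval_sum w (f w) n ?h ?g = f" by (rule interval_sum_cut[OF f])
  have gT: "?g ` T \<in> necklaces (q - f w)" by (rule image_necklace[OF g T])
  have blT: "bl (joinN w {0,w} T) = w # bl T" by (rule join_bead(3)[OF w T])
  note sT = sum_bl[OF T] and sg = sum_bl[OF gT]
  let ?A = "act (joinN w {0,w} T) f" and ?a = "act T ?g" and ?B = "bl T" and ?C = "bl (?g ` T)"
  let ?v = "\<lambda>a. tmap X w 0 ?h a a (u a)" and ?t = "tmap X w (f w) ?h"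
  note IH = bead(3)[OF g]
  show ?case
  proof (cases "f w = 0")
   \<comment> \<open>Collapsed first bead: its entry is a degeneracy of the unit \<open>u a\<close>.
     Once \<open>tm_J\<close> has moved the structure maps outside, \<open>J_unit_left\<close>
     absorbs the unit.\<close>
   case True
   have im: "f ` joinN w {0,w} T = ?g ` T" using image_join[OF f w T] True by simp
   have aj: "?A (cs,xs) = (a # fst (?a (cs,xs)), ?v a # snd (?a (cs,xs)))"
    if "(cs,xs) \<in> pQ ?C a b" for cs xs
    using act_join[OF f w T, of 0 cs xs] True pathsD(6,9)[OF that] by (simp add: inv_tcounit)
   have h0: "?h \<in> imaps w 0" using h True by simp
   have tq: "?v a \<in>: Q w a a" if "a \<in> S"
    by (rule lin_closed[OF tmap_linear_Q[OF h0 that that] u_Q[OF that]])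
   show ?thesis unfolding im blT
   proof (intro conjI impI)
    assume p: "(cs,xs) \<in> pQ ?C a b"
    note D = pathsD[OF p]
    have IH1: "?a (cs,xs) \<in> pQ ?B a b"
     "itJ ?B (fst (?a (cs,xs))) (snd (?a (cs,xs))) = tm n (q - f w) ?g a b (itJ ?C cs xs)"
     using IH p by blast+
    obtain ds ys where ds: "?a (cs,xs) = (ds,ys)" by force
    show "?A (cs,xs) \<in> pQ (w # ?B) a b"
     using IH1(1) tq D(6) unfolding aj[OF p] ds by (auto simp: paths_Cons)
    note D' = pathsD[OF IH1(1)[unfolded ds]]
    have i: "itJ ?C cs xs \<in>: M q a b"
     using itJ_closed[OF paths_Q[OF p]] sg True by simp
    have "itJ (w # ?B) (fst (?A (cs,xs))) (snd (?A (cs,xs)))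
     = J w n a a b (tm w 0 ?h a a (u a)) (tm n q ?g a b (itJ ?C cs xs))"
     using IH1(2) D' D(6) unfolding aj[OF p] ds by (simp add: sT True tmap_tm[OF h0] u_Q)
    also have "\<dots> = tm (w + n) (0 + q) (interval_sum w 0 n ?h ?g) a b (J 0 q a a b (u a) (itJ ?C cs xs))"
     using g True D(6,7) i by (intro tm_J[symmetric] h0 u_closed) auto
    also have "\<dots> = tm (w + n) q f a b (itJ ?C cs xs)"
     using sum True J_unit_left[OF D(6,7) i] by simp
    finally show "itJ (w # ?B) (fst (?A (cs,xs))) (snd (?A (cs,xs)))
     = tm (w + n) q f a b (itJ ?C cs xs)" .
   next
    assume m: "mQ (w # ?B) a b N \<psi>"
    show "mQ ?C a b N (\<lambda>p. \<psi> (?A p))"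
    proof (cases "a \<in> S")
     case a: True
     have "mQ ?B a b N (\<lambda>(ds,ys). \<psi> (a # ds, ?v a # ys))"
      using m tq[OF a] a unfolding list.map multilinear_Cons by blast
     then have "mQ ?C a b N
       (\<lambda>p. (case ?a p of (ds,ys) => \<psi> (a # ds, ?v a # ys)))"
      using IH by blast
     from quivers_Q[of "?C"] this show ?thesis
      by (rule multilinear_congI) (simp add: aj case_prod_beta')
    next
     case False
     then have "pQ ?C a b = {}" using pathsD(6) by fastforce
     then show ?thesis by (simp add: multilinear_def)
    qed
   qed
  next
   \<comment> \<open>The first bead survives with length \<open>f w\<close>, and its entry is acted
     on by the restriction of f.\<close>
   case False
   have im: "f ` joinN w {0,w} T = joinN (f w) {0,f w} (?g ` T)" using image_join[OF f w T] False by simp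
   have bl: "bl (f ` joinN w {0,w} T) = f w # ?C"
    unfolding im using False by (intro join_bead(3)[OF _ gT]) simp
   have aj: "?A (a # c # ds, x # ys) =
     (a # fst (?a (c # ds,ys)), ?t a c x # snd (?a (c # ds,ys)))" for a c ds x ys
    using act_join[OF f w T, of 1 "a # c # ds" "x # ys"] False by simp
   have tl: "?t a c \<in> Lin (Q (f w) a c) (Q w a c)" if "a \<in> S" "c \<in> S" for c
    by (rule tmap_linear_Q[OF h that])
   show ?thesis unfolding bl blT
   proof (intro conjI impI)
    assume "(cs,xs) \<in> pQ (f w # ?C) a b"
    then obtain c x ds ys where p: "cs = a # ds" "xs = x # ys" "a \<in> S" "x \<in>: Q (f w) a c"
     "(ds,ys) \<in> pQ ?C c b" by (auto simp: paths_Cons)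
    note D = pathsD[OF p(5)]
    obtain ds' where ds': "ds = c # ds'" using D(3,8) by (cases ds) auto
    have IH1: "?a (ds,ys) \<in> pQ ?B c b"
     "itJ ?B (fst (?a (ds,ys))) (snd (?a (ds,ys))) = tm n (q - f w) ?g c b (itJ ?C ds ys)"
     using IH p(5) by blast+
    obtain es zs where es: "?a (ds,ys) = (es,zs)" by force
    have aj': "?A (cs,xs) = (a # es, ?t a c x # zs)"
     using aj[of a c ds' x ys] es by (simp add: p ds')
    show "?A (cs,xs) \<in> pQ (w # ?B) a b"
     using IH1(1) lin_closed[OF tl[OF p(3) D(6)] p(4)] p(3) unfolding aj' es by (auto simp: paths_Cons)
    note D' = pathsD[OF IH1(1)[unfolded es]]
    have i: "itJ ?C ds ys \<in>: M (q - f w) c b"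
     using itJ_closed[OF paths_Q[OF p(5)]] sg by simp
    have x: "x \<in>: M (f w) a c" using Q_in_M[OF p(4,3) D(6)] .
    have "itJ (w # ?B) (fst (?A (cs,xs))) (snd (?A (cs,xs)))
     = J w n a c b (tm w (f w) ?h a c x) (tm n (q - f w) ?g c b (itJ ?C ds ys))"
     using IH1(2) D' D(6) p(3,4) unfolding aj' es by (simp add: sT tmap_tm[OF h])
    also have "\<dots> = tm (w + n) (f w + (q - f w)) (interval_sum w (f w) n ?h ?g) a b (J (f w) (q - f w) a c b x (itJ ?C ds ys))"
     using p(3) D(6,7) i x by (intro tm_J[symmetric] h g)
    also have "\<dots> = tm (w + n) q f a b (itJ (f w # ?C) cs xs)"
     using sum fw D(3,4,8) by (simp add: p sg)
    finally show "itJ (w # ?B) (fst (?A (cs,xs))) (snd (?A (cs,xs)))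
     = tm (w + n) q f a b (itJ (f w # ?C) cs xs)" .
   next
    assume m: "mQ (w # ?B) a b N \<psi>"
    show "mQ (f w # ?C) a b N (\<lambda>p. \<psi> (?A p))"
     unfolding list.map multilinear_Cons
    proof (intro impI ballI conjI)
     fix c p assume a: "a \<in> S" "c \<in> S" and p: "p \<in> pQ ?C c b"
     obtain ds ys where p': "p = (ds,ys)" by force
     obtain ds' where ds': "ds = c # ds'" using pathsD(3,8)[OF p[unfolded p']] by (cases ds) auto
     have "?a (ds,ys) \<in> pQ ?B c b" using IH p p' by blast
     moreover obtain es zs where es: "?a (ds,ys) = (es,zs)" by force
     ultimately have e: "(es,zs) \<in> pQ ?B c b" by simp
     have ne: "carrier (Q w a c) \<noteq> {}" using module_zero_closed[OF Q_module[OF a]] by blast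
     have "(\<lambda>x. \<psi> (a # es, x # zs)) \<in> Lin (Q w a c) N"
      using m[unfolded list.map multilinear_Cons, THEN mp, OF a(1), THEN bspec, OF a(2), THEN conjunct1, THEN bspec, OF e] ne by simp
     from lin_comp[OF this tl[OF a]]
     show "case p of (ds,ys) => carrier (Q (f w) a c) \<noteq> {} \<longrightarrow> (\<lambda>x. \<psi> (?A (a # ds, x # ys))) \<in> Lin (Q (f w) a c) N"
      using es by (simp add: p' aj ds')
    next
     fix c x assume a: "a \<in> S" "c \<in> S" and x: "x \<in>: Q (f w) a c"
     have "mQ ?B c b N (\<lambda>(ds,ys). \<psi> (a # ds, ?t a c x # ys))"
      using m lin_closed[OF tl[OF a] x] a unfolding list.map multilinear_Cons by blast
     then have "mQ ?C c b N
       (\<lambda>p. (case ?a p of (ds,ys) => \<psi> (a # ds, ?t a c x # ys)))"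
      using IH by blast
     from quivers_Q[of "?C"] this
     show "mQ ?C c b N (\<lambda>(ds,ys). \<psi> (?A (a # ds, x # ys)))"
     proof (rule multilinear_congI)
      fix ds ys assume "(ds,ys) \<in> pQ ?C c b"
      from pathsD(3,8)[OF this] obtain ds' where "ds = c # ds'" by (cases ds) auto
      then show "(case ?a (ds,ys) of (ds,ys) => \<psi> (a # ds, ?t a c x # ys)) =
       (case (ds,ys) of (ds,ys) => \<psi> (?A (a # ds, x # ys)))"
       by (simp add: aj case_prod_beta')
     qed
    qed
   qed
  qed
 qed
 then show "(cs,xs) \<in> pQ (bl (f ` T)) a b ==> act T f (cs,xs) \<in> pQ (bl T) a b"
  and "(cs,xs) \<in> pQ (bl (f ` T)) a b ==>
   itJ (bl T) (fst (act T f (cs,xs))) (snd (act T f (cs,xs))) = tm n q f a b (itJ (bl (f ` T)) cs xs)"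
  and "mQ (bl T) a b N \<psi> ==>
   mQ (bl (f ` T)) a b N (\<lambda>p. \<psi> (act T f p))"
  by blast+
qed

text \<open>In the product the inserted units vanish and the maps on the single beads assemble
  through \<open>tm_J\<close>, so an active map becomes \<open>tm\<close>.\<close>

lemma active_linear_Phi:
 assumes T: "T \<in> necklaces n" and f: "f \<in> imaps n q" and S: "a \<in> S" "b \<in> S"
 shows "active_map R X T f a b \<in> Lin (nec_mod R X (f ` T) a b) (nec_mod R X T a b)"
  and "z \<in>: nec_mod R X (f ` T) a b ==> PhiN T a b (active_map R X T f a b z) = tm n q f a b (PhiN (f ` T) a b z)"
proof -
 note Tn = TT_module[OF quivers_Q]
 let ?p = "\<lambda>p. puQ (bl T) (fst (act T f p)) (snd (act T f p))"
 have fT: "f ` T \<in> necklaces q" by (rule image_necklace[OF f T])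
 have m: "mQ (bl (f ` T)) a b (nec_mod R X T a b) ?p"
  using act_facts(3)[OF T f pure_multilinear[OF quivers_Q], of a b] by (simp add: nec_mod_alt case_prod_beta')
 show lin: "active_map R X T f a b \<in> Lin (nec_mod R X (f ` T) a b) (nec_mod R X T a b)"
  unfolding active_act using tensor_lift_linear[OF quivers_Q _ m] Tn by (simp add: nec_mod_alt)
 show "PhiN T a b (active_map R X T f a b z) = tm n q f a b (PhiN (f ` T) a b z)" if z: "z \<in>: nec_mod R X (f ` T) a b"
 proof -
  have l1: "PhiN T a b \<in> Lin (nec_mod R X T a b) (M n a b)" "PhiN (f ` T) a b \<in> Lin (nec_mod R X (f ` T) a b) (M q a b)"
   using Phi_linear[OF S, of "bl T"] Phi_linear[OF S, of "bl (f ` T)"]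
    sum_bl[OF T] sum_bl[OF fT] unfolding nec_mod_alt by simp_all
  show ?thesis
  proof (rule tensor_eqI[OF quivers_Q M_module[OF S] lin_comp[OF l1(1) lin, unfolded nec_mod_alt]
     lin_comp[OF tm_linear[OF f S] l1(2), unfolded nec_mod_alt] _ z[unfolded nec_mod_alt]])
   fix cs xs assume p: "(cs,xs) \<in> pQ (bl (f ` T)) a b"
   have "active_map R X T f a b (puQ (bl (f ` T)) cs xs) = ?p (cs,xs)"
    unfolding active_act using tensor_lift_pure[OF quivers_Q _ m p] Tn by (simp add: nec_mod_alt)
   then show "PhiN T a b (active_map R X T f a b (puQ (bl (f ` T)) cs xs)) =
     tm n q f a b (PhiN (f ` T) a b (puQ (bl (f ` T)) cs xs))"
    using act_facts(1,2)[OF T f p] Phi_pure[OF p] by (simp add: Phi_pure)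
  qed
 qed
qed

lemma nmap_linear_Phi:
 assumes T: "T \<in> necklaces n" and U: "U \<in> necklaces q" and f: "f \<in> nec_maps (T,n) (U,q)" and S: "a \<in> S" "b \<in> S"
 shows "nmap (nec_of_templicial R X a b) (T,n) (U,q) f \<in> Lin (nec_mod R X U a b) (nec_mod R X T a b)"
  and "z \<in>: nec_mod R X U a b ==> PhiN T a b (nmap (nec_of_templicial R X a b) (T,n) (U,q) f z) =
   tm n q f a b (P q (f ` T) a b (PhiN U a b z))"
proof -
 have f': "f \<in> imaps n q" "U \<subseteq> f ` T" using f by (auto simp: nec_maps_def)
 note fT = image_necklace[OF f'(1) T]
 note i = inert_linear_Phi[OF U fT f'(2) S] and ac = active_linear_Phi[OF T f'(1) S]
 have e: "nmap (nec_of_templicial R X a b) (T,n) (U,q) f = (\<lambda>z. active_map R X T f a b (inert_map R X (f ` T) U a b z))"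
  by (simp add: nec_of_templicial_def)
 show "nmap (nec_of_templicial R X a b) (T,n) (U,q) f \<in> Lin (nec_mod R X U a b) (nec_mod R X T a b)"
  unfolding e by (rule lin_comp[OF ac(1) i(1)])
 show "PhiN T a b (nmap (nec_of_templicial R X a b) (T,n) (U,q) f z) = tm n q f a b (P q (f ` T) a b (PhiN U a b z))"
  if z: "z \<in>: nec_mod R X U a b"
  unfolding e using ac(2)[OF lin_closed[OF i(1) z]] i(2)[OF z] by simp
qed

end

text \<open>Here Q = M and \<open>\<mu>\<close> undoes a product of two factors, so
  \<open>iter_comult\<close> is a left inverse of \<open>Phi\<close>. The nerve and the full simplex
  are of this kind.\<close>

locale frob_split = frob R S M J u M X tm P
 for R :: "('k,'r) ring_scheme" (structure) and S :: "'o set" and M :: "nat => ('k,'o,'x) quiver"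
  and J :: "nat => nat => 'o => 'o => 'o => 'x => 'x => 'x" and u :: "'o => 'x"
  and X :: "('k,'o,'x) templicial"
  and tm :: "nat => nat => (nat => nat) => 'o => 'o => 'x => 'x"
  and P :: "nat => nat set => 'o => 'o => 'x => 'x" +
 assumes tcomult_J: "[|a \<in> S; c \<in> S; b \<in> S; x \<in>: M p a c; y \<in>: M q c b|] ==>
   tcomult X p q a b (J p q a c b x y) = pure R S [M p, M q] [a,c,b] [x,y]"
begin

text \<open>By \<open>tcomult_J\<close> each comultiplication takes the first factor off the product
  again.\<close>

lemma iter_comult_itJ: "(cs,xs) \<in> pM ps a b ==> iter_comult R X ps a b (itJ ps cs xs) = puM ps cs xs"
proof (induction ps arbitrary: a b cs xs rule: induct_list012)
 case 1
 then have p: "cs = [a]" "a = b" "a \<in> S" "xs = []" by (auto simp: paths_Nil)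
 interpret T: module R "TT S ([] :: ('k,'o,'x) quiver list) a a" by (rule TT_module) simp
 have "pure R S ([] :: ('k,'o,'x) quiver list) [a] [] \<in>: TT S [] a a" using p by (intro pure_closed) (auto simp: paths_Nil)
 from T.smult_one[OF this] show ?case using p by (simp add: X_vert unit_to_tensor_def tcounit_u)
next
 case (2 p)
 then obtain c x where p: "cs = [a,b]" "xs = [x]" "a \<in> S" "x \<in>: M p a b" "b \<in> S" by (auto simp: paths_Cons paths_Nil)
 then show ?case using itJ_single[of a b x p] by (simp add: X_vert X_mod to_tensor_def)
next
 case (3 p q qs)
 let ?q = "sum_list (q # qs)"
 from 3(3) obtain c x ds ys where p: "cs = a # ds" "xs = x # ys" "a \<in> S" "x \<in>: M p a c"
  "(ds,ys) \<in> pM (q # qs) c b" unfolding list.map(2)[of M p] paths_Cons by blast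
 note D = pathsD[OF p(5)]
 have i: "itJ (q # qs) ds ys \<in>: M ?q c b" by (rule itJ_closed[OF p(5)])
 have q: "qv S [M p, M ?q]" "qv S [M p]" "qv S (map M (q # qs))"
  using quivers_Q[of "[p,?q]"] quivers_Q[of "[p]"] quivers_Q[of "q # qs"] by auto
 have e: "itJ (p # q # qs) cs xs = J p ?q a c b x (itJ (q # qs) ds ys)"
  using D(3,4,8) by (simp only: itJ.simps(2)[of p] p list.sel last.simps if_False)
 have "iter_comult R X (p # q # qs) a b (itJ (p # q # qs) cs xs) =
   tensor_maps R S [[M p], map M (q # qs)] [to_tensor R S (M p), iter_comult R X (q # qs)] a b
    (pure R S [M p, M ?q] [a,c,b] [x,itJ (q # qs) ds ys])"
  unfolding e using tcomult_J[OF p(3) D(6,7) p(4) i] by (simp add: X_vert X_mod)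
 also have "\<dots> = TA S [M p] (map M (q # qs)) a b (to_tensor R S (M p) a c x) (iter_comult R X (q # qs) c b (itJ (q # qs) ds ys))"
  by (rule tensor_maps_pure2[OF q single_linear iter_comult_linear p(3) D(6,7) p(4) i])
 also have "\<dots> = TA S [M p] (map M (q # qs)) a b (pure R S [M p] [a,c] [x]) (puM (q # qs) ds ys)"
  by (simp only: 3(2)[OF p(5)] to_tensor_def)
 also have "\<dots> = pure R S ([M p] @ map M (q # qs)) ([a,c] @ tl ds) ([x] @ ys)"
  using p(3,4) D(6) by (intro tensor_append_pure[OF q(2,3) _ p(5)]) (simp add: paths_Cons paths_Nil)
 also have "\<dots> = puM (p # q # qs) cs xs" using D(3,8) by (cases ds) (auto simp: p)
 finally show ?case .
qed

lemma iter_comult_Phi: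
 assumes S: "a \<in> S" "b \<in> S" and z: "z \<in>: tM ps a b"
 shows "iter_comult R X ps a b (Phi ps a b z) = z"
 by (rule tensor_eqI[OF quivers_M TT_module[OF quivers_M]
    lin_comp[OF iter_comult_linear[OF S] Phi_linear[OF S]] lin_id _ z])
  (simp add: Phi_pure iter_comult_itJ)

lemma Phi_inj:
 assumes "a \<in> S" "b \<in> S" "z \<in>: tM ps a b" "z' \<in>: tM ps a b"
  "Phi ps a b z = Phi ps a b z'"
 shows "z = z'"
proof -
 have "z = iter_comult R X ps a b (Phi ps a b z)" by (rule iter_comult_Phi[OF assms(1-3), symmetric])
 also have "\<dots> = z'" unfolding assms(5) by (rule iter_comult_Phi[OF assms(1,2,4)])
 finally show ?thesis .
qed

lemma tm_single_linear:
 "[|f \<in> imaps p p'; c \<in> S; d \<in> S|] ==>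
  (\<lambda>y. to_tensor R S (M p) c d (tmap X p p' f c d y)) \<in> Lin (M p' c d) (TT S [M p] c d)"
 by (rule lin_comp[OF single_linear tmap_linear_Q])

text \<open>The templicial axioms are verified after the injective \<open>Phi\<close>. Here both
  sides become P {p} after the structure map; \<open>P_tm\<close> matches it with P {p'} before that
  map.\<close>

lemma tcomult_natural:
 assumes f: "f \<in> imaps p p'" and g: "g \<in> imaps q q'" and S: "a \<in> S" "b \<in> S"
  and x: "x \<in>: M (p' + q') a b"
 shows "tcomult X p q a b (tmap X (p + q) (p' + q') (interval_sum p p' q f g) a b x)
     = tensor_maps R S [[M p], [M q]]
       [\<lambda>c d y. to_tensor R S (M p) c d (tmap X p p' f c d y),
        \<lambda>c d y. to_tensor R S (M q) c d (tmap X q q' g c d y)] a b (tcomult X p' q' a b x)"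
  (is "?L = ?t (tcomult X p' q' a b x)")
proof -
 let ?h = "interval_sum p p' q f g"
 have h: "?h \<in> imaps (p + q) (p' + q')" by (rule interval_sum_map[OF f g])
 have q: "qv S [M p', M q']" "qv S [M p]" "qv S [M q]" using M_module by auto
 have q2: "qv S [M p', M q']" by (rule q(1))
 have t: "?t \<in> Lin (TT S [M p', M q'] a b) (TT S [M p, M q] a b)"
  using tensor_maps_linear2[OF q tm_single_linear[OF f] tm_single_linear[OF g]] by simp
 have P1: "Phi [p,q] a b \<in> Lin (TT S [M p, M q] a b) (M (p + q) a b)" using Phi_linear[OF S, of "[p,q]"] by simp
 have P2: "Phi [p',q'] a b \<in> Lin (TT S [M p', M q'] a b) (M (p' + q') a b)" using Phi_linear[OF S, of "[p',q']"] by simp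
 note mu = lin_closed[OF tcomult_linear_Q[OF S] x]
 have tx: "tmap X (p + q) (p' + q') ?h a b x = tm (p + q) (p' + q') ?h a b x" by (rule tmap_tm[OF h S x])
 have tc: "tm (p + q) (p' + q') ?h a b x \<in>: M (p + q) a b" by (rule tm_closed[OF h S x])
 have "Phi [p,q] a b (?t (tcomult X p' q' a b x)) = tm (p + q) (p' + q') ?h a b (Phi [p',q'] a b (tcomult X p' q' a b x))"
 proof (rule tensor_eqI2[OF q2 M_module[OF S] lin_comp[OF P1 t] lin_comp[OF tm_linear[OF h S] P2] _ mu])
  fix c y z assume c: "c \<in> S" and y: "y \<in>: M p' a c" and z: "z \<in>: M q' c b"
  have e: "?t (pure R S [M p', M q'] [a,c,b] [y,z]) =
   TA S [M p] [M q] a b (to_tensor R S (M p) a c (tmap X p p' f a c y)) (to_tensor R S (M q) c b (tmap X q q' g c b z))"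
   by (rule tensor_maps_pure2[OF q tm_single_linear[OF f] tm_single_linear[OF g] S(1) c S(2) y z])
  have c1: "tmap X p p' f a c y \<in>: M p a c" "tmap X q q' g c b z \<in>: M q c b"
   using lin_closed[OF tmap_linear_Q[OF f S(1) c] y] lin_closed[OF tmap_linear_Q[OF g c S(2)] z] by auto
  show "Phi [p,q] a b (?t (pure R S [M p', M q'] [a,c,b] [y,z])) =
   tm (p + q) (p' + q') ?h a b (Phi [p',q'] a b (pure R S [M p', M q'] [a,c,b] [y,z]))"
   unfolding e
   using Phi_append[OF S(1) c S(2), of "to_tensor R S (M p) a c (tmap X p p' f a c y)" "[p]" "to_tensor R S (M q) c b (tmap X q q' g c b z)" "[q]"]
    lin_closed[OF single_linear[OF S(1) c] c1(1)] lin_closed[OF single_linear[OF c S(2)] c1(2)]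
   by (simp add: Phi_single S c c1 Phi_pair[OF S c y z] tm_J[OF f g S(1) c S(2) y z] tmap_tm[OF f S(1) c y] tmap_tm[OF g c S(2) z]
     tm_closed[OF f S(1) c y] tm_closed[OF g c S(2) z])
 qed
 also have "\<dots> = tm (p + q) (p' + q') ?h a b (P (p' + q') {p'} a b x)" by (simp add: Phi_tcomult[OF S x])
 also have "\<dots> = P (p + q) {p} a b (tm (p + q) (p' + q') ?h a b x)"
  using P_tm[OF h, of "{p}" a b x] S x interval_sum_mid[OF f] by simp
 also have "\<dots> = Phi [p,q] a b ?L" unfolding tx by (rule Phi_tcomult[OF S tc, symmetric])
 finally show ?thesis
  using Phi_inj[OF S, of ?L "[p,q]" "?t (tcomult X p' q' a b x)"] lin_closed[OF tcomult_linear_Q[OF S] tc] lin_closed[OF t mu] tx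
  by simp
qed

text \<open>Under \<open>Phi\<close> both sides become the projection for {p, p + q}.\<close>

lemma coassoc:
 assumes S: "a \<in> S" "b \<in> S" and x: "x \<in>: M (p + q + r) a b"
 shows "tensor_maps R S [[M p, M q], [M r]] [tcomult X p q, to_tensor R S (M r)] a b (tcomult X (p + q) r a b x)
   = tensor_maps R S [[M p], [M q, M r]] [to_tensor R S (M p), tcomult X q r] a b (tcomult X p (q + r) a b x)"
  (is "?s (tcomult X (p + q) r a b x) = ?t (tcomult X p (q + r) a b x)")
proof -
 have q: "qv S [M (p + q), M r]" "qv S [M p, M (q + r)]" "qv S [M p, M q]" "qv S [M q, M r]"
  "qv S [M p]" "qv S [M r]" using M_module by auto
 have s: "?s \<in> Lin (TT S [M (p + q), M r] a b) (TT S [M p, M q, M r] a b)"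
  using tensor_maps_linear2[OF q(1,3,6) tcomult_linear_Q single_linear] by simp
 have t: "?t \<in> Lin (TT S [M p, M (q + r)] a b) (TT S [M p, M q, M r] a b)"
  using tensor_maps_linear2[OF q(2,5,4) single_linear tcomult_linear_Q] by simp
 have P1: "Phi [p,q,r] a b \<in> Lin (TT S [M p, M q, M r] a b) (M (p + q + r) a b)"
  using Phi_linear[OF S, of "[p,q,r]"] by (simp add: add.assoc)
 have x': "x \<in>: M (p + (q + r)) a b" using x by (simp add: add.assoc)
 have "Phi [p,q,r] a b (?s (tcomult X (p + q) r a b x)) = P (p + q + r) ({p} \<union> {p + q}) a b x"
 proof (rule P_tcomult[OF S x lin_comp[OF P1 s]])
  fix c y z assume c: "c \<in> S" and y: "y \<in>: M (p + q) a c" and z: "z \<in>: M r c b"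
  have e: "?s (pure R S [M (p + q), M r] [a,c,b] [y,z]) =
   TA S [M p, M q] [M r] a b (tcomult X p q a c y) (to_tensor R S (M r) c b z)"
   by (rule tensor_maps_pure2[OF q(1,3,6) tcomult_linear_Q single_linear S(1) c S(2) y z])
  \<comment> \<open>Seen from the right factor, p is at most the vertex 0, and that only when q = 0;
    so P {p} acts on the left factor alone.\<close>
  have cl: "cutL (p + q) {p} = {p}" "cutR (p + q) {p} \<subseteq> {0,r}" by (auto simp: cutL_iff cutR_iff)
  show "Phi [p,q,r] a b (?s (pure R S [M (p + q), M r] [a,c,b] [y,z])) = P (p + q + r) {p} a b (J (p + q) r a c b y z)"
   unfolding e P_J[OF S(1) c S(2) y z] cl(1) P_triv[OF cl(2) c S(2) z]
   using Phi_append[OF S(1) c S(2), of "tcomult X p q a c y" "[p,q]" "to_tensor R S (M r) c b z" "[r]"]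
    lin_closed[OF single_linear[OF c S(2)] z] lin_closed[OF tcomult_linear_Q[OF S(1) c] y]
   by (simp add: Phi_single[OF c S(2) z] Phi_tcomult[OF S(1) c y])
 qed
 moreover have "Phi [p,q,r] a b (?t (tcomult X p (q + r) a b x)) = P (p + (q + r)) ({p + q} \<union> {p}) a b x"
 proof (rule P_tcomult[OF S x' lin_comp[OF P1[unfolded add.assoc] t]])
  fix c y z assume c: "c \<in> S" and y: "y \<in>: M p a c" and z: "z \<in>: M (q + r) c b"
  have e: "?t (pure R S [M p, M (q + r)] [a,c,b] [y,z]) =
   TA S [M p] [M q, M r] a b (to_tensor R S (M p) a c y) (tcomult X q r c b z)"
   by (rule tensor_maps_pure2[OF q(2,5,4) single_linear tcomult_linear_Q S(1) c S(2) y z])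
  have cl: "cutR p {p + q} = {q}" "cutL p {p + q} \<subseteq> {0,p}" by (auto simp: cutL_iff cutR_iff)
  show "Phi [p,q,r] a b (?t (pure R S [M p, M (q + r)] [a,c,b] [y,z])) = P (p + (q + r)) {p + q} a b (J p (q + r) a c b y z)"
   unfolding e P_J[OF S(1) c S(2) y z] cl(1) P_triv[OF cl(2) S(1) c y]
   using Phi_append[OF S(1) c S(2), of "to_tensor R S (M p) a c y" "[p]" "tcomult X q r c b z" "[q,r]"]
    lin_closed[OF single_linear[OF S(1) c] y] lin_closed[OF tcomult_linear_Q[OF c S(2)] z]
   by (simp add: Phi_single[OF S(1) c y] Phi_tcomult[OF c S(2) z])
 qed
 ultimately have "Phi [p,q,r] a b (?s (tcomult X (p + q) r a b x)) = Phi [p,q,r] a b (?t (tcomult X p (q + r) a b x))"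
  by (simp add: add.assoc Un_commute)
 then show ?thesis
  using lin_closed[OF s lin_closed[OF tcomult_linear_Q[OF S] x]] lin_closed[OF t lin_closed[OF tcomult_linear_Q[OF S] x']]
  by (intro Phi_inj[OF S, of _ "[p,q,r]"]) simp_all
qed

text \<open>Under \<open>Phi\<close> the left-hand sides become P {0} x and P {n} x, and P ignores
  end vertices.\<close>

lemma counit:
 assumes S: "a \<in> S" "b \<in> S" and x: "x \<in>: M n a b"
 shows "tensor_maps R S [[], [M n]] [tcounit_tensor R X, to_tensor R S (M n)] a b (tcomult X 0 n a b x) = to_tensor R S (M n) a b x"
   (is "?s (tcomult X 0 n a b x) = _")
  and "tensor_maps R S [[M n], []] [to_tensor R S (M n), tcounit_tensor R X] a b (tcomult X n 0 a b x) = to_tensor R S (M n) a b x"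
   (is "?t (tcomult X n 0 a b x) = _")
proof -
 have q: "qv S [M 0, M n]" "qv S [M n, M 0]" "qv S ([] :: ('k,'o,'x) quiver list)" "qv S [M n]"
  using M_module by auto
 have s: "?s \<in> Lin (TT S [M 0, M n] a b) (TT S [M n] a b)"
  using tensor_maps_linear2[OF q(1,3,4) tcounit_tensor_linear single_linear] by simp
 have t: "?t \<in> Lin (TT S [M n, M 0] a b) (TT S [M n] a b)"
  using tensor_maps_linear2[OF q(2,4,3) single_linear tcounit_tensor_linear] by simp
 have P1: "Phi [n] a b \<in> Lin (TT S [M n] a b) (M n a b)" using Phi_linear[OF S, of "[n]"] by simp
 have x1: "x \<in>: M (0 + n) a b" "x \<in>: M (n + 0) a b" using x by simp_all
 have hs: "(\<lambda>z. Phi [n] a b (?s z)) \<in> Lin (TT S [M 0, M n] a b) (M (0 + n) a b)"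
  "(\<lambda>z. Phi [n] a b (?t z)) \<in> Lin (TT S [M n, M 0] a b) (M (n + 0) a b)"
  using lin_comp[OF P1 s] lin_comp[OF P1 t] by simp_all
 have "Phi [n] a b (?s (tcomult X 0 n a b x)) = P (0 + n) ({} \<union> {0}) a b x"
 proof (rule P_tcomult[OF S x1(1) hs(1)], unfold add_0)
  fix c y z assume c: "c \<in> S" and y: "y \<in>: M 0 a c" and z: "z \<in>: M n c b"
  have e: "?s (pure R S [M 0, M n] [a,c,b] [y,z]) =
   TA S [] [M n] a b (tcounit_tensor R X a c y) (to_tensor R S (M n) c b z)"
   by (rule tensor_maps_pure2[OF q(1,3,4) tcounit_tensor_linear single_linear S(1) c S(2) y z])
  have "J 0 n a c b y z \<in>: M n a b" using J_closed[OF S(1) c S(2) y z] by simp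
  then show "Phi [n] a b (?s (pure R S [M 0, M n] [a,c,b] [y,z])) = P n {} a b (J 0 n a c b y z)"
   unfolding e
   using Phi_append[OF S(1) c S(2), of "tcounit_tensor R X a c y" "[]" "to_tensor R S (M n) c b z" "[n]"]
    lin_closed[OF single_linear[OF c S(2)] z] lin_closed[OF tcounit_tensor_linear[OF S(1) c] y]
   by (simp add: Phi_single[OF c S(2) z] Phi_tcounit[OF S(1) c y] P_triv S)
 qed
 then show "?s (tcomult X 0 n a b x) = to_tensor R S (M n) a b x"
  using lin_closed[OF s lin_closed[OF tcomult_linear_Q[OF S] x1(1)]] lin_closed[OF single_linear[OF S] x]
  by (intro Phi_inj[OF S, of _ "[n]"]) (simp_all add: Phi_single[OF S x] P_triv S x)
 have "Phi [n] a b (?t (tcomult X n 0 a b x)) = P (n + 0) ({} \<union> {n}) a b x"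
 proof (rule P_tcomult[OF S x1(2) hs(2)], unfold add_0_right)
  fix c y z assume c: "c \<in> S" and y: "y \<in>: M n a c" and z: "z \<in>: M 0 c b"
  have e: "?t (pure R S [M n, M 0] [a,c,b] [y,z]) =
   TA S [M n] [] a b (to_tensor R S (M n) a c y) (tcounit_tensor R X c b z)"
   by (rule tensor_maps_pure2[OF q(2,4,3) single_linear tcounit_tensor_linear S(1) c S(2) y z])
  have "J n 0 a c b y z \<in>: M n a b" using J_closed[OF S(1) c S(2) y z] by simp
  then show "Phi [n] a b (?t (pure R S [M n, M 0] [a,c,b] [y,z])) = P n {} a b (J n 0 a c b y z)"
   unfolding e
   using Phi_append[OF S(1) c S(2), of "to_tensor R S (M n) a c y" "[n]" "tcounit_tensor R X c b z" "[]"]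
    lin_closed[OF single_linear[OF S(1) c] y] lin_closed[OF tcounit_tensor_linear[OF c S(2)] z]
   by (simp add: Phi_single[OF S(1) c y] Phi_tcounit[OF c S(2) z] P_triv S)
 qed
 then show "?t (tcomult X n 0 a b x) = to_tensor R S (M n) a b x"
  using lin_closed[OF t lin_closed[OF tcomult_linear_Q[OF S] x1(2)]] lin_closed[OF single_linear[OF S] x]
  by (intro Phi_inj[OF S, of _ "[n]"]) (simp_all add: Phi_single[OF S x] P_triv S x)
qed

lemma tmap_id: "[|a \<in> S; b \<in> S; x \<in>: M n a b|] ==> tmap X n n (\<lambda>i\<in>{..n}. i) a b x = x"
 by (simp only: tmap_tm[OF interval_maps_id] tm_id)

lemma tmap_comp:
 assumes "f \<in> imaps l m" "g \<in> imaps m n" "a \<in> S" "b \<in> S" "x \<in>: M n a b"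
 shows "tmap X l n (compose {..l} g f) a b x = tmap X l m f a b (tmap X m n g a b x)"
 by (simp only: tmap_tm[OF interval_maps_comp[OF assms(1,2)] assms(3-5)] tmap_tm[OF assms(2-5)]
   tmap_tm[OF assms(1,3,4) tm_closed[OF assms(2-5)]] tm_comp[OF assms])

lemma is_templicial_module: "templicial_module R X"
 by (rule templicial_module.intro[OF is_cring], rule templicial_module_axioms.intro; unfold X_vert X_mod)
  (erule (4) tcomult_natural | erule (4) tmap_comp |
   erule (2) M_module tmap_linear_Q tmap_id coassoc counit[unfolded X_vert] | erule (1) M_module tcounit_linear_Q tcounit_bij tcomult_linear_Q)+

end

section \<open>Order maps between finite sets\<close>

text \<open>\<open>std_order_map\<close> works with ranks, counted as cardinalities; they have to be
  identified with positions in the sorted list.\<close>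

lemma sorted_nth_card:
 assumes "finite J" "i < card J"
 shows "card {x \<in> J. x < sl J ! i} = (i::nat)"
proof -
 let ?s = "sl J"
 have s: "sorted_wrt (<) ?s" by (rule strict_sorted_list_of_set)
 have l: "length ?s = card J" by simp
 have inj: "inj_on (\<lambda>k. ?s ! k) {..<card J}" by (rule inj_onI) (simp add: nth_eq_iff_index_eq)
 have lt: "?s ! k < ?s ! i \<longleftrightarrow> k < i" if "k < card J" for k
  using sorted_wrt_nth_less[OF s, of k i] sorted_wrt_nth_less[OF s, of i k] that assms(2) l by (metis less_asym linorder_neqE_nat less_irrefl)
 have "{x \<in> J. x < ?s ! i} = (\<lambda>k. ?s ! k) ` {..<i}"
 proof (intro equalityI subsetI)
  fix x assume "x \<in> {x \<in> J. x < ?s ! i}"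
  then have x: "x \<in> J" "x < ?s ! i" by auto
  obtain k where "k < card J" "?s ! k = x" using x(1) assms(1) by (metis in_set_conv_nth l set_sorted_list_of_set)
  then show "x \<in> (\<lambda>k. ?s ! k) ` {..<i}" using lt x(2) by auto
 next
  fix x assume "x \<in> (\<lambda>k. ?s ! k) ` {..<i}"
  then obtain k where k: "k < i" "x = ?s ! k" by auto
  then have "x \<in> J" using assms by (metis l less_trans nth_mem set_sorted_list_of_set)
  then show "x \<in> {x \<in> J. x < ?s ! i}" using lt k assms(2) by auto
 qed
 moreover have "inj_on (\<lambda>k. ?s ! k) {..<i}" using inj assms(2) by (auto intro: inj_on_subset)
 ultimately show ?thesis by (simp add: card_image)
qed

lemma sorted_nth_index:
 assumes "finite J" "y \<in> J"
 shows "sl J ! card {x \<in> J. x < (y::nat)} = y" "card {x \<in> J. x < y} < card J"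
proof -
 obtain i where i: "i < card J" "sl J ! i = y"
  using assms by (metis in_set_conv_nth length_sorted_list_of_set set_sorted_list_of_set)
 then have "card {x \<in> J. x < y} = i" using sorted_nth_card[OF assms(1) i(1)] by simp
 then show "sl J ! card {x \<in> J. x < y} = y" "card {x \<in> J. x < y} < card J" using i by auto
qed

lemma sorted_list_shift: "finite I ==> sl ((+) w ` I) = map ((+) (w::nat)) (sl I)"
proof -
 assume "finite I"
 moreover have "sorted_wrt (<) (map ((+) w) (sl I))"
  using strict_sorted_list_of_set[of I] by (simp add: sorted_wrt_map)
 ultimately show ?thesis by (intro strict_sorted_equal) auto
qed

lemma std_order_map_in:
 assumes "finite I" "finite J" "g ` I \<subseteq> J" "mono_on I g"
 shows "std_order_map I J g \<in> order_maps {..<card I} {..<card J}"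
proof -
 have m: "sl I ! i \<in> I" if "i < card I" for i
  using assms(1) that by (metis length_sorted_list_of_set nth_mem set_sorted_list_of_set)
 have "card {x \<in> J. x < g (sl I ! i)} < card J" if "i < card I" for i
  using sorted_nth_index(2)[OF assms(2)] m[OF that] assms(3) by blast
 moreover have "card {x \<in> J. x < g (sl I ! i)} \<le> card {x \<in> J. x < g (sl I ! j)}"
  if "i \<le> j" "j < card I" for i j
 proof -
  have "sl I ! i \<le> sl I ! j"
   using that by (intro sorted_nth_mono) auto
  then have "g (sl I ! i) \<le> g (sl I ! j)"
   using m that by (intro mono_onD[OF assms(4)]) auto
  then show ?thesis using assms(2) by (intro card_mono) auto
 qed
 ultimately show ?thesis by (auto simp: std_order_map_def order_maps_def mono_on_def)
qed

lemma std_order_map_comp: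
 assumes "finite I" "finite J" "g ` I \<subseteq> J"
 shows "std_order_map I K (\<lambda>i. h (g i)) = compose {..<card I} (std_order_map J K h) (std_order_map I J g)"
proof
 fix i
 have m: "g (sl I ! i) \<in> J" if "i < card I"
  using assms that by (metis image_subset_iff length_sorted_list_of_set nth_mem set_sorted_list_of_set)
 show "std_order_map I K (\<lambda>i. h (g i)) i = compose {..<card I} (std_order_map J K h) (std_order_map I J g) i"
  using sorted_nth_index[OF assms(2) m] by (auto simp: std_order_map_def compose_def)
qed

lemma std_order_map_id: "finite I ==> std_order_map I I (\<lambda>i. i) = (\<lambda>i\<in>{..<card I}. i)"
 by (auto simp: std_order_map_def sorted_nth_card fun_eq_iff)

lemma std_order_map_cong: "(\<And>i. i \<in> I ==> f i = g i) ==> std_order_map I J f = std_order_map I J g"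
proof (cases "finite I")
 assume "\<And>i. i \<in> I ==> f i = g i" "finite I"
 then show ?thesis unfolding std_order_map_def
  by (intro restrict_ext) (metis lessThan_iff length_sorted_list_of_set nth_mem set_sorted_list_of_set)
qed (simp add: std_order_map_def restrict_def)

lemma std_order_map_shift:
 assumes "finite I" "finite J" "\<And>i. i \<in> I ==> f (w + i) = v + g i"
 shows "std_order_map ((+) w ` I) ((+) v ` J) f = std_order_map I J g"
proof
 fix i
 have c: "card ((+) w ` I) = card I" by (simp add: card_image)
 show "std_order_map ((+) w ` I) ((+) v ` J) f i = std_order_map I J g i"
 proof (cases "i < card I")
  case True
  then have "sl I ! i \<in> I" using assms(1) by (metis length_sorted_list_of_set nth_mem set_sorted_list_of_set)
  then have "f (sl ((+) w ` I) ! i) = v + g (sl I ! i)"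
   using assms True by (simp add: sorted_list_shift)
  moreover have "{x \<in> (+) v ` J. x < v + g (sl I ! i)} = (+) v ` {x \<in> J. x < g (sl I ! i)}" by auto
  ultimately show ?thesis using True c by (simp add: std_order_map_def card_image)
 qed (simp add: std_order_map_def c)
qed

text \<open>The ordered disjoint union of g and h, acting on the join of two ordinals.\<close>

definition ord_sum :: "nat => nat => nat => (nat => nat) => (nat => nat) => nat => nat" where
 "ord_sum p p' q g h = (\<lambda>i\<in>{..<p + q}. if i < p then g i else p' + h (i - p))"

text \<open>The first block has values at most v, so no element of the translated J' lies strictly
  below them; the second block has values at least v, so all of J does. Ranks therefore split as in
  \<open>ord_sum\<close>.\<close>

lemma std_order_map_union:
 assumes fin: "finite I" "finite I'" "finite J" "finite J'" and I: "I \<subseteq> {..<w}" and J: "J \<subseteq> {..<v}"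
  and f: "\<And>i. i \<in> I ==> f i \<le> v" "\<And>i. i \<in> I' ==> f (w + i) = v + g i"
 shows "std_order_map (I \<union> (+) w ` I') (J \<union> (+) v ` J') f =
  ord_sum (card I) (card J) (card I') (std_order_map I J f) (std_order_map I' J' g)"
proof
 fix i
 have c: "card (I \<union> (+) w ` I') = card I + card I'"
  using fin I by (subst card_Un_disjoint) (auto simp: card_image)
 have s: "sl (I \<union> (+) w ` I') = sl I @ map ((+) w) (sl I')"
  using fin I strict_sorted_list_of_set[of I] strict_sorted_list_of_set[of I']
  by (intro strict_sorted_equal) (auto simp: sorted_wrt_append sorted_wrt_map)
 consider "i < card I" | k where "i = card I + k" "k < card I'" | "i \<ge> card I + card I'"
  by (metis add_diff_inverse_nat nat_add_left_cancel_less not_less)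
 then show "std_order_map (I \<union> (+) w ` I') (J \<union> (+) v ` J') f i =
  ord_sum (card I) (card J) (card I') (std_order_map I J f) (std_order_map I' J' g) i"
 proof cases
  case 1
  then have m: "sl I ! i \<in> I" using fin by (metis length_sorted_list_of_set nth_mem set_sorted_list_of_set)
  have "{x \<in> J \<union> (+) v ` J'. x < f (sl I ! i)} = {x \<in> J. x < f (sl I ! i)}"
   using f(1)[OF m] by auto
  then show ?thesis using 1 by (simp add: std_order_map_def ord_sum_def c s nth_append)
 next
  case (2 k)
  then have m: "sl I' ! k \<in> I'" using fin by (metis length_sorted_list_of_set nth_mem set_sorted_list_of_set)
  have "{x \<in> J \<union> (+) v ` J'. x < v + g (sl I' ! k)} = J \<union> (+) v ` {x \<in> J'. x < g (sl I' ! k)}"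
   using J by auto
  moreover have "card (J \<union> (+) v ` {x \<in> J'. x < g (sl I' ! k)}) = card J + card {x \<in> J'. x < g (sl I' ! k)}"
   using fin J by (subst card_Un_disjoint) (auto simp: card_image)
  ultimately show ?thesis using 2 f(2)[OF m] by (simp add: std_order_map_def ord_sum_def c s nth_append)
 qed (simp add: std_order_map_def ord_sum_def c)
qed

lemma interval_mono: "f \<in> imaps m n ==> A \<subseteq> {..m} ==> mono_on A f"
 using imapsD(4)[of f m n] by (auto simp: mono_on_def)

text \<open>The ordered union of all gaps of T. By \<open>sum_gap_cards\<close> its size is the
  degree of the composite of a whole generator of the summand T.\<close>

definition innerN :: "nat => nat set => nat set" where "innerN n T = {0<..<n} - T"

lemma finite_innerN [simp]: "finite (innerN n T)" by (simp add: innerN_def)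

text \<open>An inner vertex may be sent to 0 or n, but these belong to T, so such a vertex lies in
  the preimage and is not counted.\<close>

lemma innerN_preN:
 assumes "f \<in> imaps m n" "T \<in> necklaces n"
 shows "f ` innerN m (preN m f T) \<subseteq> innerN n T"
proof
 fix y assume "y \<in> f ` innerN m (preN m f T)"
 then obtain i where "i \<in> innerN m (preN m f T)" "y = f i" by blast
 then have i: "0 < i" "i < m" "f i \<notin> T" "y = f i" by (auto simp: innerN_def preN_def)
 have "f i \<noteq> 0" "f i \<noteq> n" using necklacesD(1,2)[OF assms(2)] i(3) by metis+
 then show "y \<in> innerN n T" using i imapsD(3)[OF assms(1), of i] by (auto simp: innerN_def)
qed

lemma innerN_cut:
 assumes "T \<in> necklaces n" "w \<in> T"
 shows "innerN n T = innerN w (cutL w T) \<union> (+) w ` innerN (n - w) (cutR w T)"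
proof (intro equalityI subsetI)
 fix x assume x: "x \<in> innerN n T"
 show "x \<in> innerN w (cutL w T) \<union> (+) w ` innerN (n - w) (cutR w T)"
 proof (cases "x < w")
  case False
  then have "w < x" using x assms(2) by (cases "x = w") (auto simp: innerN_def)
  then show ?thesis using x by (intro UnI2 image_eqI[of _ _ "x - w"]) (auto simp: innerN_def cutR_iff)
 qed (use x in \<open>auto simp: innerN_def cutL_iff\<close>)
qed (use necklacesD(3)[OF assms] in \<open>auto simp: innerN_def cutL_iff cutR_iff\<close>)

lemma sum_gap_cards: "T \<in> necklaces n ==> sum_list (gap_cards T) = card (innerN n T)"
proof (induction rule: necklace_induct)
 case zero
 then show ?case by (simp add: gap_cards_bead_lengths innerN_def)
next
 case (bead w n T)
 have V: "joinN w {0,w} T \<in> necklaces (w + n)" by (intro joinN_necklace pair_nec bead)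
 have w: "w \<in> joinN w {0,w} T" by (rule joinN_mid[OF pair_nec bead(2)])
 have "innerN (w + n) (joinN w {0,w} T) = {0<..<w} \<union> (+) w ` innerN n T"
  using innerN_cut[OF V w] cutL_joinN[OF pair_nec bead(2)] cutR_joinN[OF pair_nec bead(2)]
  by (auto simp: innerN_def)
 moreover have "card ({0<..<w} \<union> (+) w ` innerN n T) = w - 1 + card (innerN n T)"
  by (subst card_Un_disjoint) (auto simp: card_image)
 ultimately show ?case using bead by (simp add: gap_cards_bead_lengths join_bead)
qed

lemma gap_cards_0 [simp]: "gap_cards {0} = []" by (simp add: gap_cards_bead_lengths)

lemma gap_cards_pair: "0 < w ==> gap_cards {0,w} = [w - 1]"
 by (simp add: gap_cards_bead_lengths bead_lengths_def beads_pair)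

section \<open>Categories enriched in augmented simplicial modules\<close>

text \<open>Degrees are cardinalities, not dimensions: the join of ordinals becomes addition, and
  enrichment under Day convolution becomes a \<open>graded_cat\<close> with natural structure
  maps.\<close>

locale asmod = graded_cat R "dobj D" "dmod D" "dcomp D" "dunit D"
 for R :: "('k,'r) ring_scheme" (structure) and D :: "('k,'o,'d) asmod_cat" +
 assumes dmap_linear: "[|g \<in> order_maps {..<p} {..<q}; a \<in> dobj D; b \<in> dobj D|]
   ==> dmap D p q g a b \<in> lin_maps R (dmod D q a b) (dmod D p a b)"
  and dmap_id: "[|a \<in> dobj D; b \<in> dobj D; x \<in>: dmod D p a b|] ==> dmap D p p (\<lambda>i\<in>{..<p}. i) a b x = x"
  and dmap_comp: "[|f \<in> order_maps {..<p} {..<q}; g \<in> order_maps {..<q} {..<r}; a \<in> dobj D; b \<in> dobj D; x \<in>: dmod D r a b|]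
   ==> dmap D p r (compose {..<p} g f) a b x = dmap D p q f a b (dmap D q r g a b x)"
  and dcomp_natural: "[|g \<in> order_maps {..<p} {..<p'}; h \<in> order_maps {..<q} {..<q'}; a \<in> dobj D; c \<in> dobj D; b \<in> dobj D;
    x \<in>: dmod D p' a c; y \<in>: dmod D q' c b|]
   ==> dmap D (p + q) (p' + q') (ord_sum p p' q g h) a b (dcomp D p' q' a c b x y) =
    dcomp D p q a c b (dmap D p p' g a c x) (dmap D q q' h c b y)"
begin

abbreviation "dM \<equiv> dmod D"
abbreviation "dC \<equiv> dcomp D"
abbreviation "dm \<equiv> dmap D"
abbreviation "som \<equiv> std_order_map"
abbreviation "Ob \<equiv> dobj D"
abbreviation "dms \<equiv> dmap_set D"
abbreviation "dq \<equiv> dquivers D"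
abbreviation "dpaths T \<equiv> paths (dobj D) (dquivers D T)"
abbreviation "DT \<equiv> dtensor R D"
abbreviation "nsm \<equiv> nerve_summand_map R D"
abbreviation "NI \<equiv> nerve_incl R D"
abbreviation "NF \<equiv> nerve_map R D"
abbreviation "nsplit \<equiv> nerve_split R D"

lemma iter_comp_itJ: "(cs,xs) \<in> paths Ob (map (dM) ps) a b ==> iter_comp D cs ps xs = itJ ps cs xs"
proof (induction ps arbitrary: cs xs a rule: induct_list012)
 case 1
 then show ?case by (auto simp: paths_Nil)
next
 case (2 p)
 then obtain x where p: "cs = [a,b]" "xs = [x]" "a \<in> Ob" "x \<in>: dM p a b" "b \<in> Ob"
  by (auto simp: paths_Cons paths_Nil)
 then show ?case using itJ_single[of a b x p] by simp
next
 case (3 p q qs)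
 then obtain c x ds zs where p: "cs = a # ds" "xs = x # zs" "(ds,zs) \<in> paths Ob (map (dM) (q # qs)) c b"
  unfolding list.map(2)[of _ p] paths_Cons by blast
 moreover obtain y ys where "zs = y # ys" using pathsD(2)[OF p(3)] by (cases zs) auto
 ultimately show ?case using 3(2)[OF p(3)] by simp
qed

lemma quivers_d: "qv Ob (dq T)"
 unfolding dquivers_def by (rule quivers_M)

lemma dmap_set_shift:
 assumes "finite I" "finite J" "\<And>i. i \<in> I ==> f (w + i) = v + g i"
 shows "dms ((+) w ` I) ((+) v ` J) f = dms I J g"
proof -
 have "som ((+) w ` I) ((+) v ` J) f = som I J g" using assms by (rule std_order_map_shift)
 then show ?thesis unfolding dmap_set_def by (simp add: card_image)
qed

lemma dmap_set_cong: "(\<And>i. i \<in> I ==> f i = g i) ==> dms I J f = dms I J g"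
 unfolding dmap_set_def by (simp cong: std_order_map_cong)

section \<open>The action of an interval map on one summand of the nerve\<close>

definition npos :: "(nat => nat) => nat set => nat => nat" where "npos f T u = card {t \<in> T. t < f u}"

text \<open>The formula of \<open>nerve_summand_map\<close> before passing to tensor products; it
  plays the part that \<open>act\<close> plays for necklace maps.\<close>

definition "nsl f T U = (\<lambda>(cs,xs).
   (map (\<lambda>u. cs ! npos f T u) (sl U),
   map (\<lambda>(u,u'). dms {u<..<u'} ({f u<..<f u'} - T) f (cs ! npos f T u) (cs ! npos f T u')
         (iter_comp D (slice (npos f T u) (Suc (npos f T u')) cs)
          (slice (npos f T u) (npos f T u') (gap_cards T)) (slice (npos f T u) (npos f T u') xs)))
      (beads U)))"

lemma nerve_summand_map_nsl: "nsm f T U a b =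
  tensor_lift R (DT U a b) (\<lambda>p. pure R Ob (dq U) (fst (nsl f T U p)) (snd (nsl f T U p)))"
 unfolding nerve_summand_map_def nsl_def npos_def Let_def by (simp add: case_prod_beta')

lemma slice_left: "j \<le> length xs ==> slice i j (xs @ ys) = slice i j xs"
 by (simp add: slice_def)

lemma slice_right: "length xs = k ==> slice (k + i) (k + j) (xs @ ys) = slice i j ys"
 by (simp add: slice_def)

text \<open>A joined path lists the common vertex once, at position k, and a slice starting there
  must still begin with it.\<close>

lemma slice_verts:
 assumes "length cs = Suc k" "ds \<noteq> []" "last cs = hd ds"
 shows "slice (k + i) (Suc (k + j)) (cs @ tl ds) = slice i (Suc j) ds"
proof -
 have "cs \<noteq> []" using assms(1) by auto
 then have "drop k cs = [last cs]" using assms(1) append_eq_conv_conj[of "butlast cs" "[last cs]" cs] by simp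
 then have "drop k (cs @ tl ds) = last cs # tl ds" using assms(1) by simp
 then have "drop k (cs @ tl ds) = ds" using assms by simp
 then have "drop (k + i) (cs @ tl ds) = drop i ds" using drop_drop[of i k "cs @ tl ds"] by (simp only: add.commute)
 then show ?thesis by (simp add: slice_def Suc_diff_le)
qed

lemma nth_verts:
 assumes "length cs = Suc k" "ds \<noteq> []" "last cs = hd ds"
 shows "i \<le> k ==> (cs @ tl ds) ! i = cs ! i" "i < length ds ==> (cs @ tl ds) ! (k + i) = ds ! i"
proof -
 show "i \<le> k ==> (cs @ tl ds) ! i = cs ! i" using assms(1) by (simp add: nth_append)
 show "i < length ds ==> (cs @ tl ds) ! (k + i) = ds ! i"
 proof (cases i)
  case 0 then show ?thesis using assms last_conv_nth[of cs] by (cases "cs = []") (auto simp: nth_append hd_conv_nth)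
 next
  case (Suc j) then show "i < length ds ==> ?thesis" using assms by (simp add: nth_append nth_tl)
 qed
qed

lemma npos_last: "f \<in> imaps m n ==> T \<in> necklaces n ==> npos f T m = card T - 1"
proof -
 assume f: "f \<in> imaps m n" and T: "T \<in> necklaces n"
 have "{t \<in> T. t < f m} = T - {n}" using necklacesD(3)[OF T] imapsD(2)[OF f] by (auto simp: less_le)
 then show ?thesis using necklacesD(2)[OF T] nec_finite[OF T] by (simp add: npos_def)
qed

text \<open>As \<open>f w\<close> is a vertex of T, no bead of the preimage crosses w. The formula
  falls into those for the two halves of f, with all positions on the right shifted by k.\<close>

lemma nsl_split:
 assumes f: "f \<in> imaps (w + m) n" and T: "T \<in> necklaces n" and w: "f w \<in> T"
  and len: "length cs = card (cutL (f w) T)" "length xs = card (cutL (f w) T) - 1" "length ds = card (cutR (f w) T)"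
  and last: "last cs = hd ds"
 shows "nsl f T (preN (w + m) f T) (cs @ tl ds, xs @ ys) =
  (fst (nsl (fcutL w f) (cutL (f w) T) (preN w (fcutL w f) (cutL (f w) T)) (cs,xs)) @
    tl (fst (nsl (fcutR w m f) (cutR (f w) T) (preN m (fcutR w m f) (cutR (f w) T)) (ds,ys))),
   snd (nsl (fcutL w f) (cutL (f w) T) (preN w (fcutL w f) (cutL (f w) T)) (cs,xs)) @
    snd (nsl (fcutR w m f) (cutR (f w) T) (preN m (fcutR w m f) (cutR (f w) T)) (ds,ys)))"
proof -
 let ?fL = "fcutL w f" and ?fR = "fcutR w m f" and ?TL = "cutL (f w) T" and ?TR = "cutR (f w) T"
 let ?U = "preN (w + m) f T"
 define k where "k = card {t \<in> T. t < f w}"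
 have fL: "?fL \<in> imaps w (f w)" by (rule fcutL_map[OF f]) simp
 have fR: "?fR \<in> imaps m (n - f w)" by (rule fcutR_map[OF f])
 have fin: "finite T" by (rule nec_finite[OF T])
 have TL: "?TL \<in> necklaces (f w)" by (rule cutL_necklace[OF T w])
 have TR: "?TR \<in> necklaces (n - f w)" by (rule cutR_necklace[OF T w])
 have U: "?U \<in> necklaces (w + m)" by (rule preN_necklace[OF f T])
 have UL: "preN w ?fL ?TL = cutL w ?U" using cutL_preN[OF _ f, of w] by simp
 have UR: "preN m ?fR ?TR = cutR w ?U" using cutR_preN[OF f] by simp
 have wU: "w \<in> ?U" using w by (simp add: preN_def)
 have kw: "npos ?fL ?TL w = k" unfolding npos_def k_def by (simp add: fcutL_def idx_cutL)
 have kL: "k = card ?TL - 1" using npos_last[OF fL TL] kw by simp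
 have "card ?TL \<noteq> 0" using TL nec_finite[OF TL] necklacesD(1)[OF TL] by auto
 then have lc: "length cs = Suc k" "length xs = k" using len kL by auto
 have "card ?TR \<noteq> 0" using nec_finite[OF TR] necklacesD(1)[OF TR] by auto
 then have dsn: "ds \<noteq> []" using len by auto
 have fa: "f (w + s) = f w + ?fR s" if "s \<le> m" for s
  using imapsD(4)[OF f, of w "w + s"] that by (simp add: fcutR_def)
 have posL: "npos f T u = npos ?fL ?TL u" "npos ?fL ?TL u \<le> k" if "u \<le> w" for u
 proof -
  have "f u \<le> f w" using imapsD(4)[OF f that] by simp
  then show "npos f T u = npos ?fL ?TL u" using that by (simp add: npos_def fcutL_def idx_cutL)
  show "npos ?fL ?TL u \<le> k" unfolding kw[symmetric] npos_def
   using \<open>f u \<le> f w\<close> that nec_finite[OF TL] by (intro card_mono) (auto simp: fcutL_def)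
 qed
 have posR: "npos f T (w + s) = k + npos ?fR ?TR s" "npos ?fR ?TR s < length ds" if "s \<le> m" for s
 proof -
  show "npos f T (w + s) = k + npos ?fR ?TR s" unfolding npos_def fa[OF that] k_def by (rule idx_cutR[OF fin])
  have "npos ?fR ?TR s \<le> npos ?fR ?TR m" unfolding npos_def
   using imapsD(4)[OF fR that] nec_finite[OF TR] by (intro card_mono) auto
  then show "npos ?fR ?TR s < length ds" using npos_last[OF fR TR] len(3) \<open>card ?TR \<noteq> 0\<close> by simp
 qed
 have v1: "(cs @ tl ds) ! npos f T u = cs ! npos ?fL ?TL u" if "u \<le> w" for u
  using posL[OF that] nth_verts(1)[OF lc(1) dsn last] by simp
 have v2: "(cs @ tl ds) ! npos f T (w + s) = ds ! npos ?fR ?TR s" if "s \<le> m" for s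
  using posR[OF that] nth_verts(2)[OF lc(1) dsn last] by simp
 have gap: "gap_cards T = gap_cards ?TL @ gap_cards ?TR" by (rule gap_cards_cut[OF fin w])
 have lg: "length (gap_cards ?TL) = k" using kL by (simp add: length_gap_cards)
 let ?p = "npos f T" and ?nL = "npos ?fL ?TL" and ?nR = "npos ?fR ?TR" and ?G = "gap_cards T"
 have e1: "dms {u<..<u'} ({f u<..<f u'} - T) f ((cs @ tl ds) ! ?p u) ((cs @ tl ds) ! ?p u')
    (iter_comp D (slice (?p u) (Suc (?p u')) (cs @ tl ds))
     (slice (?p u) (?p u') ?G) (slice (?p u) (?p u') (xs @ ys))) =
   dms {u<..<u'} ({?fL u<..<?fL u'} - ?TL) ?fL (cs ! ?nL u) (cs ! ?nL u')
    (iter_comp D (slice (?nL u) (Suc (?nL u')) cs)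
     (slice (?nL u) (?nL u') (gap_cards ?TL)) (slice (?nL u) (?nL u') xs))"
  if b: "(u,u') \<in> set (beads (cutL w ?U))" for u u'
 proof -
  have u: "u \<le> w" "u' \<le> w" using beadsD[OF b] nec_finite[OF cutL_necklace[OF U wU]] by (auto simp: cutL_iff)
  have s1: "{f u<..<f u'} - T = {?fL u<..<?fL u'} - ?TL"
   using u imapsD(4)[OF f u(2)] by (auto simp: fcutL_def cutL_iff)
  have s2: "dms {u<..<u'} J f = dms {u<..<u'} J ?fL" for J
   using u by (intro dmap_set_cong) (auto simp: fcutL_def)
  show ?thesis unfolding s1 s2 gap v1[OF u(1)] v1[OF u(2)]
   using posL(1)[OF u(1)] posL(1)[OF u(2)] posL(2)[OF u(2)] lc lg by (simp add: slice_left)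
 qed
 have e2: "dms {w + u<..<w + u'} ({f (w + u)<..<f (w + u')} - T) f ((cs @ tl ds) ! ?p (w + u)) ((cs @ tl ds) ! ?p (w + u'))
    (iter_comp D (slice (?p (w + u)) (Suc (?p (w + u'))) (cs @ tl ds))
     (slice (?p (w + u)) (?p (w + u')) ?G) (slice (?p (w + u)) (?p (w + u')) (xs @ ys))) =
   dms {u<..<u'} ({?fR u<..<?fR u'} - ?TR) ?fR (ds ! ?nR u) (ds ! ?nR u')
    (iter_comp D (slice (?nR u) (Suc (?nR u')) ds)
     (slice (?nR u) (?nR u') (gap_cards ?TR)) (slice (?nR u) (?nR u') ys))"
  if b: "(u,u') \<in> set (beads (cutR w ?U))" for u u'
 proof -
  have "cutR w ?U \<in> necklaces m" using cutR_necklace[OF U wU] by simp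
  then have u: "u \<le> m" "u' \<le> m" using beadsD[OF b nec_finite] necklacesD(3) by blast+
  have s0: "{w + u<..<w + u'} = (+) w ` {u<..<u'}"
  proof (intro equalityI subsetI)
   fix x assume "x \<in> {w + u<..<w + u'}"
   then show "x \<in> (+) w ` {u<..<u'}" by (intro image_eqI[of _ _ "x - w"]) auto
  qed auto
  have s1: "{f (w + u)<..<f (w + u')} - T = (+) (f w) ` ({?fR u<..<?fR u'} - ?TR)"
  proof (intro equalityI subsetI)
   fix x assume "x \<in> {f (w + u)<..<f (w + u')} - T"
   then show "x \<in> (+) (f w) ` ({?fR u<..<?fR u'} - ?TR)" unfolding fa[OF u(1)] fa[OF u(2)]
    by (intro image_eqI[of _ _ "x - f w"]) (auto simp: cutR_iff)
  qed (auto simp: fa[OF u(1)] fa[OF u(2)] cutR_iff)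
  have s2: "dms ((+) w ` {u<..<u'}) ((+) (f w) ` ({?fR u<..<?fR u'} - ?TR)) f = dms {u<..<u'} ({?fR u<..<?fR u'} - ?TR) ?fR"
   using u fa by (intro dmap_set_shift) auto
  show ?thesis unfolding s0 s1 s2 gap v2[OF u(1)] v2[OF u(2)] posR(1)[OF u(1)] posR(1)[OF u(2)]
   using lc lg posR(2)[OF u(1)] posR(2)[OF u(2)]
   by (simp add: slice_right slice_verts[OF lc(1) dsn last] nth_verts(2)[OF lc(1) dsn last])
 qed
 have finU: "finite ?U" by (rule nec_finite[OF U])
 have elems: "snd (nsl f T ?U (cs @ tl ds, xs @ ys)) = snd (nsl ?fL ?TL (cutL w ?U) (cs,xs)) @ snd (nsl ?fR ?TR (cutR w ?U) (ds,ys))"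
  unfolding nsl_def beads_cut[OF finU wU] case_prod_conv snd_conv map_append map_map
  using e1 e2 by (intro arg_cong2[where f=append] map_cong refl) (auto split: prod.splits)
 have verts: "fst (nsl f T ?U (cs @ tl ds, xs @ ys)) = fst (nsl ?fL ?TL (cutL w ?U) (cs,xs)) @ tl (fst (nsl ?fR ?TR (cutR w ?U) (ds,ys)))"
 proof -
  have "u \<le> w" if "u \<in> set (sl (cutL w ?U))" for u
   using that nec_finite[OF cutL_necklace[OF U wU]] by (auto simp: cutL_iff)
  moreover have "s \<le> m" if "s \<in> set (tl (sl (cutR w ?U)))" for s
  proof -
   have c: "cutR w ?U \<in> necklaces m" using cutR_necklace[OF U wU] by simp
   have "s \<in> set (sl (cutR w ?U))" using that by (cases "sl (cutR w ?U)") auto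
   then show ?thesis using c nec_finite[OF c] necklacesD(3)[OF c] by simp
  qed
  ultimately show ?thesis
   unfolding nsl_def sorted_list_cut(1)[OF finU wU] case_prod_conv fst_conv map_append map_map map_tl[symmetric]
   using v1 v2 by (intro arg_cong2[where f=append] map_cong refl) auto
 qed
 show ?thesis unfolding UL UR by (rule prod_eqI) (simp_all only: verts elems fst_conv snd_conv)
qed

lemma nsl_0: "nsl f T {0} (cs,xs) = ([cs ! npos f T 0],[])"
 by (simp add: nsl_def)

lemma npos_0: "f \<in> imaps m n ==> npos f T 0 = 0"
 by (simp add: npos_def imapsD(1))

text \<open>A single bead collects all entries: the whole generator is composed and then pulled back
  along f.\<close>

lemma nsl_pair:
 assumes f: "f \<in> imaps w n" and T: "T \<in> necklaces n" and w: "0 < w"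
  and p: "(cs,xs) \<in> dpaths T a b"
 shows "nsl f T {0,w} (cs,xs) = ([a,b], [dms {0<..<w} (innerN n T) f a b (itJ (gap_cards T) cs xs)])"
proof -
 have l: "length cs = Suc (card T - 1)" "length xs = card T - 1" "length (gap_cards T) = card T - 1"
  using pathsD(1,2)[OF p] by (simp_all add: dquivers_def length_gap_cards)
 have e: "cs ! 0 = a" "cs ! (card T - 1) = b"
  using pathsD(4,8,9)[OF p] l by (simp_all add: last_conv_nth)
 have "sl {0,w} = [0,w]" using w by simp
 then show ?thesis
  using w l e iter_comp_itJ[OF p[unfolded dquivers_def]]
  by (simp add: nsl_def beads_pair npos_0[OF f] npos_last[OF f T] slice_def imapsD(1,2)[OF f] innerN_def)
qed

lemma dmap_set_linear:
 assumes "finite I" "finite J" "g ` I \<subseteq> J" "mono_on I g" "a \<in> Ob" "b \<in> Ob"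
 shows "dms I J g a b \<in> Lin (dM (card J) a b) (dM (card I) a b)"
 unfolding dmap_set_def by (rule dmap_linear[OF std_order_map_in[OF assms(1-4)] assms(5,6)])

lemma dmap_inner_linear:
 assumes "f \<in> imaps m n" "T \<in> necklaces n" "a \<in> Ob" "b \<in> Ob"
 shows "dms (innerN m (preN m f T)) (innerN n T) f a b \<in>
   Lin (dM (sum_list (gap_cards T)) a b) (dM (card (innerN m (preN m f T))) a b)"
 unfolding sum_gap_cards[OF assms(2)]
 by (intro dmap_set_linear innerN_preN interval_mono[OF assms(1)] assms finite_innerN) (auto simp: innerN_def)

lemma dquivers_cut: "[|T \<in> necklaces n; w \<in> T|] ==> dq T = dq (cutL w T) @ dq (cutR w T)"
 unfolding dquivers_def by (simp add: gap_cards_cut[OF nec_finite])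

lemma dquivers_0 [simp]: "dq {0} = []" by (simp add: dquivers_def)

lemma length_dquivers: "length (dq T) = card T - 1"
 by (simp add: dquivers_def length_gap_cards)

lemma card_necklace: "T \<in> necklaces n ==> Suc (card T - 1) = card T"
 using nec_finite[of T n] necklacesD(1)[of T n] by (cases "card T") auto

lemma nsl_append:
 assumes f: "f \<in> imaps (w + m) n" and T: "T \<in> necklaces n" and w: "f w \<in> T"
  and p: "(cs,xs) \<in> dpaths (cutL (f w) T) a c"
  and q: "(ds,ys) \<in> dpaths (cutR (f w) T) c b"
 shows "nsl f T (preN (w + m) f T) (cs @ tl ds, xs @ ys) =
  (fst (nsl (fcutL w f) (cutL (f w) T) (preN w (fcutL w f) (cutL (f w) T)) (cs,xs)) @
    tl (fst (nsl (fcutR w m f) (cutR (f w) T) (preN m (fcutR w m f) (cutR (f w) T)) (ds,ys))),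
   snd (nsl (fcutL w f) (cutL (f w) T) (preN w (fcutL w f) (cutL (f w) T)) (cs,xs)) @
    snd (nsl (fcutR w m f) (cutR (f w) T) (preN m (fcutR w m f) (cutR (f w) T)) (ds,ys)))"
proof (rule nsl_split[OF f T w])
 show "length cs = card (cutL (f w) T)"
  using pathsD(1)[OF p] card_necklace[OF cutL_necklace[OF T w]] by (simp only: length_dquivers)
 show "length xs = card (cutL (f w) T) - 1" using pathsD(2)[OF p] by (simp only: length_dquivers)
 show "length ds = card (cutR (f w) T)"
  using pathsD(1)[OF q] card_necklace[OF cutR_necklace[OF T w]] by (simp only: length_dquivers)
 show "last cs = hd ds" using pathsD(4)[OF p] pathsD(3)[OF q] by simp
qed

lemma nsl_join:
 assumes f: "f \<in> imaps (w + m) n" and T: "T \<in> necklaces n" and w: "0 < w" and U: "U \<in> necklaces m"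
  and pre: "preN (w + m) f T = joinN w {0,w} U"
  and p: "(cs,xs) \<in> dpaths (cutL (f w) T) a c"
  and q: "(ds,ys) \<in> dpaths (cutR (f w) T) c b"
 shows "f w \<in> T" "preN w (fcutL w f) (cutL (f w) T) = {0,w}" "preN m (fcutR w m f) (cutR (f w) T) = U"
  and "nsl f T (joinN w {0,w} U) (cs @ tl ds, xs @ ys) =
  (a # c # tl (fst (nsl (fcutR w m f) (cutR (f w) T) U (ds,ys))),
   dms {0<..<w} (innerN (f w) (cutL (f w) T)) (fcutL w f) a c (itJ (gap_cards (cutL (f w) T)) cs xs) #
    snd (nsl (fcutR w m f) (cutR (f w) T) U (ds,ys)))"
proof -
 have "w \<in> preN (w + m) f T" unfolding pre using joinN_mid[OF pair_nec U] .
 then show w': "f w \<in> T" by (simp add: preN_def)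
 show L: "preN w (fcutL w f) (cutL (f w) T) = {0,w}"
  using cutL_preN[OF _ f, of w T] pre cutL_joinN[OF pair_nec U] by simp
 show R: "preN m (fcutR w m f) (cutR (f w) T) = U"
  using cutR_preN[OF f, of T] pre cutR_joinN[OF pair_nec U] by simp
 have fL: "fcutL w f \<in> imaps w (f w)" by (rule fcutL_map[OF f]) simp
 show "nsl f T (joinN w {0,w} U) (cs @ tl ds, xs @ ys) =
  (a # c # tl (fst (nsl (fcutR w m f) (cutR (f w) T) U (ds,ys))),
   dms {0<..<w} (innerN (f w) (cutL (f w) T)) (fcutL w f) a c (itJ (gap_cards (cutL (f w) T)) cs xs) #
    snd (nsl (fcutR w m f) (cutR (f w) T) U (ds,ys)))"
  using nsl_append[OF f T w' p q] unfolding pre L R nsl_pair[OF fL cutL_necklace[OF T w'] w p] by simp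
qed

lemma inner_pair: "innerN w {0,w} = {0<..<w}" by (auto simp: innerN_def)

text \<open>As in \<open>act_facts\<close>, closure, composites and multilinearity go through one
  induction. For composites, pulling back bead by bead and composing equals composing first; the
  step is naturality of \<open>dcomp\<close>.\<close>

lemma nsl_facts:
 assumes "f \<in> imaps m n" "T \<in> necklaces n" and U: "U = preN m f T"
 shows "(cs,xs) \<in> dpaths T a b ==> nsl f T U (cs,xs) \<in> dpaths U a b"
  and "(cs,xs) \<in> dpaths T a b ==> itJ (gap_cards U) (fst (nsl f T U (cs,xs))) (snd (nsl f T U (cs,xs))) =
   dms (innerN m U) (innerN n T) f a b (itJ (gap_cards T) cs xs)"
  and "MLin Ob (dq U) a b N \<psi> ==> MLin Ob (dq T) a b N (\<lambda>p. \<psi> (nsl f T U p))"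
proof -
 have "U \<in> necklaces m" unfolding U by (rule preN_necklace[OF assms(1,2)])
 then have "((cs,xs) \<in> dpaths T a b \<longrightarrow> nsl f T U (cs,xs) \<in> dpaths U a b \<and>
  itJ (gap_cards U) (fst (nsl f T U (cs,xs))) (snd (nsl f T U (cs,xs))) =
   dms (innerN m U) (innerN n T) f a b (itJ (gap_cards T) cs xs)) \<and>
  (MLin Ob (dq U) a b N \<psi> \<longrightarrow> MLin Ob (dq T) a b N (\<lambda>p. \<psi> (nsl f T U p)))"
  using assms
 proof (induction arbitrary: f n T a cs xs \<psi> rule: necklace_induct)
  case (zero f n T)
  have n: "n = 0" "f = (\<lambda>i\<in>{..0}. i)" using interval_maps_0[OF zero(1)] by blast+
  have T: "T = {0}" using zero(2) unfolding n(1) necklaces_0 .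
  have i: "innerN 0 {0} = {}" by (auto simp: innerN_def)
  have "dms {} {} f a a (dunit D a) = dunit D a" if "a \<in> Ob"
   using dmap_id[OF that that u_closed[OF that]] by (simp add: dmap_set_def std_order_map_def restrict_def)
  then show ?case using npos_0[OF zero(1)] unfolding T n(1) i
   by (auto simp: paths_Nil nsl_0 multilinear_Nil)
 next
  case (bead w m U f n T)
  note f = bead(4) and w = bead(1) and U = bead(2) and T = bead(5) and pre = bead(6)[symmetric]
  let ?fL = "fcutL w f" and ?fR = "fcutR w m f" and ?TL = "cutL (f w) T" and ?TR = "cutR (f w) T"
  have "w \<in> preN (w + m) f T" unfolding pre using joinN_mid[OF pair_nec U] .
  then have w': "f w \<in> T" by (simp add: preN_def)
  have fL: "?fL \<in> imaps w (f w)" by (rule fcutL_map[OF f]) simp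
  have fR: "?fR \<in> imaps m (n - f w)" by (rule fcutR_map[OF f])
  have TL: "?TL \<in> necklaces (f w)" by (rule cutL_necklace[OF T w'])
  have TR: "?TR \<in> necklaces (n - f w)" by (rule cutR_necklace[OF T w'])
  have L: "preN w ?fL ?TL = {0,w}" using cutL_preN[OF _ f, of w T] pre cutL_joinN[OF pair_nec U] by simp
  have R: "preN m ?fR ?TR = U" using cutR_preN[OF f, of T] pre cutR_joinN[OF pair_nec U] by simp
  let ?V = "joinN w {0,w} U"
  let ?A = "nsl f T ?V" and ?a = "nsl ?fR ?TR U" and ?iL = "innerN (f w) ?TL" and ?iR = "innerN (n - f w) ?TR"
  let ?c = "card ?iL" and ?d = "card (innerN m U)" and ?e = "card ?iR" and ?h = "dms {0<..<w} ?iL ?fL"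
  let ?s = "som {0<..<w} ?iL ?fL" and ?r = "som (innerN m U) ?iR ?fR"
  note nj = nsl_join(4)[OF f T w U pre]
  note IH = bead(3)[OF fR TR R[symmetric]]
  have qT: "dq T = dq ?TL @ dq ?TR" by (rule dquivers_cut[OF T w'])
  have qU: "dq ?V = dM (w - 1) # dq U"
   unfolding dquivers_def by (simp add: gap_cards_bead_lengths join_bead[OF w U])
  have gU: "gap_cards ?V = (w - 1) # gap_cards U"
   by (simp add: gap_cards_bead_lengths join_bead[OF w U])
  have dl: "?h c d \<in> Lin (dM (sum_list (gap_cards ?TL)) c d) (dM (w - 1) c d)"
   if "c \<in> Ob" "d \<in> Ob" for c d
   using dmap_inner_linear[OF fL TL that] unfolding L inner_pair by simp
  show ?case
  proof (intro conjI impI)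
   assume p: "(cs,xs) \<in> dpaths T a b"
   obtain c cs1 xs1 ds ys where p1: "(cs1,xs1) \<in> dpaths ?TL a c"
    and p2: "(ds,ys) \<in> dpaths ?TR c b" and e: "cs = cs1 @ tl ds" "xs = xs1 @ ys"
    using p unfolding qT by (rule paths_appendE)
   have i1: "itJ (gap_cards ?TL) cs1 xs1 \<in>: dM (sum_list (gap_cards ?TL)) a c"
    using p1 itJ_closed unfolding dquivers_def by blast
   have i2: "itJ (gap_cards ?TR) ds ys \<in>: dM (sum_list (gap_cards ?TR)) c b"
    using p2 itJ_closed unfolding dquivers_def by blast
   have IH1: "?a (ds,ys) \<in> dpaths U c b"
    "itJ (gap_cards U) (fst (?a (ds,ys))) (snd (?a (ds,ys))) =
     dms (innerN m U) ?iR ?fR c b (itJ (gap_cards ?TR) ds ys)" using IH p2 by blast+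
   obtain es zs where es: "?a (ds,ys) = (es,zs)" by force
   note D' = pathsD[OF IH1(1)[unfolded es]] and D1 = pathsD[OF p1]
   obtain es' where es': "es = c # es'" using D'(3,8) by (cases es) auto
   have n: "?A (cs,xs) =
    (a # es, ?h a c (itJ (gap_cards ?TL) cs1 xs1) # zs)"
    using nj[OF p1 p2] by (simp add: e es es')
   note dc = lin_closed[OF dl[OF D1(6,7)] i1]
   show "?A (cs,xs) \<in> dpaths ?V a b"
    unfolding n qU using IH1(1) dc D1(6) by (auto simp: paths_Cons es)
   have iV: "innerN (w + m) ?V = {0<..<w} \<union> (+) w ` innerN m U"
    using innerN_cut[OF joinN_necklace[OF pair_nec U] joinN_mid[OF pair_nec U], of w]
     cutL_joinN[OF pair_nec U] cutR_joinN[OF pair_nec U] by (simp add: inner_pair)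
   have iT: "innerN n T = ?iL \<union> (+) (f w) ` ?iR" by (rule innerN_cut[OF T w'])
   \<comment> \<open>The vertex w separates the inner vertices into two blocks that f respects; this
     brings in the \<open>ord_sum\<close> required by \<open>dcomp_natural\<close>.\<close>
   have so: "som (innerN (w + m) ?V) (innerN n T) f =
    ord_sum (w - 1) ?c ?d (som {0<..<w} ?iL f)
     ?r"
   proof -
    have "f i \<le> f w" if "i \<in> {0<..<w}" for i using imapsD(4)[OF f, of i w] that by auto
    moreover have "f (w + i) = f w + ?fR i" if "i \<in> innerN m U" for i
     using imapsD(4)[OF f, of w "w + i"] that by (auto simp: fcutR_def innerN_def)
    ultimately show ?thesis unfolding iV iT
     by (subst std_order_map_union[where g = "?fR"]) (auto simp: innerN_def)
   qed
   have sf: "som {0<..<w} ?iL f = som {0<..<w} ?iL ?fL"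
    by (rule std_order_map_cong) (auto simp: fcutL_def)
   have cV: "card (innerN (w + m) ?V) = w - 1 + ?d"
    unfolding iV by (subst card_Un_disjoint) (auto simp: card_image)
   have cT: "card (innerN n T) = ?c + ?e"
    unfolding iT by (subst card_Un_disjoint) (auto simp: card_image innerN_def)
   have o1: "som {0<..<w} ?iL ?fL \<in> order_maps {..<w - 1} {..<?c}"
   proof -
    have "{0<..<w} \<subseteq> {..w}" by auto
    then show ?thesis
     using std_order_map_in[of "{0<..<w}" "?iL" ?fL] innerN_preN[OF fL TL] interval_mono[OF fL, of "{0<..<w}"]
     unfolding L inner_pair by auto
   qed
   have o2: "som (innerN m U) ?iR ?fR \<in> order_maps {..<?d} {..<?e}"
   proof -
    have "innerN m U \<subseteq> {..m}" by (auto simp: innerN_def)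
    then show ?thesis using innerN_preN[OF fR TR] interval_mono[OF fR, of "innerN m U"] unfolding R
     by (intro std_order_map_in) auto
   qed
   have "itJ (gap_cards ?V) (fst (?A (cs,xs))) (snd (?A (cs,xs))) =
    dC (w - 1) ?d a c b
     (dm (w - 1) ?c ?s a c (itJ (gap_cards ?TL) cs1 xs1))
     (dm ?d ?e ?r c b (itJ (gap_cards ?TR) ds ys))"
    unfolding n gU using IH1(2) D'(3,4,8) by (simp add: es sum_gap_cards[OF U] dmap_set_def)
   also have "\<dots> = dm (w - 1 + ?d) (?c + ?e)
     (ord_sum (w - 1) ?c ?d ?s
     ?r) a b
     (dC ?c ?e a c b (itJ (gap_cards ?TL) cs1 xs1) (itJ (gap_cards ?TR) ds ys))"
    using i1 i2 D1(6,7) D'(7) unfolding sum_gap_cards[OF TL] sum_gap_cards[OF TR]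
    by (intro dcomp_natural[symmetric] o1 o2)
   also have "\<dots> = dms (innerN (w + m) ?V) (innerN n T) f a b (itJ (gap_cards T) cs xs)"
    using itJ_append[OF p1[unfolded dquivers_def] p2[unfolded dquivers_def]]
    by (simp add: dmap_set_def so sf cV cT e gap_cards_cut[OF nec_finite[OF T] w'] sum_gap_cards[OF TL] sum_gap_cards[OF TR])
   finally show "itJ (gap_cards ?V) (fst (?A (cs,xs))) (snd (?A (cs,xs))) =
    dms (innerN (w + m) ?V) (innerN n T) f a b (itJ (gap_cards T) cs xs)" .
  next
   assume m: "MLin Ob (dq ?V) a b N \<psi>"
   show "MLin Ob (dq T) a b N (\<lambda>p. \<psi> (?A p))"
    unfolding qT
   proof (rule multilinear_append[OF _ _ quivers_d quivers_d])
    fix c ds ys assume p2: "(ds,ys) \<in> dpaths ?TR c b"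
    have e: "?a (ds,ys) \<in> dpaths U c b" using IH p2 by blast
    obtain es zs where es: "?a (ds,ys) = (es,zs)" by force
    note D' = pathsD[OF e[unfolded es]]
    obtain es' where es': "es = c # es'" using D'(3,8) by (cases es) auto
    show "MLin Ob (dq ?TL) a c N (\<lambda>(cs,xs). \<psi> (?A (cs @ tl ds, xs @ ys)))"
    proof (cases "a \<in> Ob")
     case a: True
     have ne: "carrier (dM (w - 1) a c) \<noteq> {}"
      using module_zero_closed[OF M_module[OF a D'(6)]] by blast
     have "(\<lambda>x. \<psi> (a # es, x # zs)) \<in> Lin (dM (w - 1) a c) N"
      using m[unfolded qU multilinear_Cons, THEN mp, OF a, THEN bspec, OF D'(6), THEN conjunct1, THEN bspec, OF e] ne es by simp
     from multilinear_comp[OF itJ_multilinear_M[of "gap_cards ?TL" a c] lin_comp[OF this dl[OF a D'(6)]]]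
     have "MLin Ob (dq ?TL) a c N (\<lambda>p. \<psi> (a # es, ?h a c
       (case p of (cs,xs) => itJ (gap_cards ?TL) cs xs) # zs))" unfolding dquivers_def .
     from quivers_d[of ?TL] this show ?thesis
      by (rule multilinear_congI) (simp add: nj[OF _ p2] es es')
    next
     case False
     then have "dpaths ?TL a c = {}" using pathsD(6) by fastforce
     then show ?thesis by (simp add: multilinear_def)
    qed
   next
    fix c cs1 xs1 assume p1: "(cs1,xs1) \<in> dpaths ?TL a c"
    note D1 = pathsD[OF p1]
    let ?x = "?h a c (itJ (gap_cards ?TL) cs1 xs1)"
    have "?x \<in>: dM (w - 1) a c"
     using itJ_closed[OF p1[unfolded dquivers_def]] by (rule lin_closed[OF dl[OF D1(6,7)]])
    then have "MLin Ob (dq U) c b N (\<lambda>(ds,ys). \<psi> (a # ds, ?x # ys))"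
     using m D1(6,7) unfolding qU multilinear_Cons by blast
    then have "MLin Ob (dq ?TR) c b N (\<lambda>p. case ?a p of (ds,ys) => \<psi> (a # ds, ?x # ys))"
     using IH by blast
    from quivers_d[of ?TR] this
    show "MLin Ob (dq ?TR) c b N (\<lambda>(ds,ys). \<psi> (?A (cs1 @ tl ds, xs1 @ ys)))"
    proof (rule multilinear_congI)
     fix ds ys assume p2: "(ds,ys) \<in> dpaths ?TR c b"
     have e: "?a (ds,ys) \<in> dpaths U c b" using IH p2 by blast
     obtain es zs where es: "?a (ds,ys) = (es,zs)" by force
     note D' = pathsD[OF e[unfolded es]]
     obtain es' where es': "es = c # es'" using D'(3,8) by (cases es) auto
     show "(case ?a (ds,ys) of (ds,ys) => \<psi> (a # ds, ?x # ys)) =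
      (case (ds,ys) of (ds,ys) => \<psi> (?A (cs1 @ tl ds, xs1 @ ys)))"
      by (simp add: nj[OF p1 p2] es es')
    qed
   qed
  qed
 qed
 then show "(cs,xs) \<in> dpaths T a b ==> nsl f T U (cs,xs) \<in> dpaths U a b"
  and "(cs,xs) \<in> dpaths T a b ==> itJ (gap_cards U) (fst (nsl f T U (cs,xs))) (snd (nsl f T U (cs,xs))) =
   dms (innerN m U) (innerN n T) f a b (itJ (gap_cards T) cs xs)"
  and "MLin Ob (dq U) a b N \<psi> ==> MLin Ob (dq T) a b N (\<lambda>p. \<psi> (nsl f T U p))"
  by blast+
qed

lemma dmap_set_comp:
 assumes "finite I" "finite J" "finite K" "g ` I \<subseteq> J" "h ` J \<subseteq> K" "mono_on I g" "mono_on J h"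
  and "a \<in> Ob" "b \<in> Ob" "x \<in>: dM (card K) a b"
 shows "dms I K (\<lambda>i. h (g i)) a b x = dms I J g a b (dms J K h a b x)"
 unfolding dmap_set_def std_order_map_comp[OF assms(1,2,4)]
 by (rule dmap_comp[OF std_order_map_in[OF assms(1,2,4,6)] std_order_map_in[OF assms(2,3,5,7)] assms(8-10)])

lemma fcutL_comp:
 "f \<in> imaps l m ==> w \<le> l ==> fcutL w (compose {..l} g f) = compose {..w} (fcutL (f w) g) (fcutL w f)"
 using imapsD(4)[of f l m _ w] by (auto simp: fcutL_def compose_def fun_eq_iff)

lemma fcutR_comp:
 assumes "f \<in> imaps (w + l) m"
 shows "fcutR w l (compose {..w + l} g f) = compose {..l} (fcutR (f w) (m - f w) g) (fcutR w l f)"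
proof
 fix i
 have "f w \<le> f (w + i)" "f (w + i) \<le> m" if "i \<le> l" using imapsD(3,4)[OF assms] that by auto
 then show "fcutR w l (compose {..w + l} g f) i = compose {..l} (fcutR (f w) (m - f w) g) (fcutR w l f) i"
  by (auto simp: fcutR_def compose_def)
qed

text \<open>Induction on the last necklace W. On its first bead \<open>nsl_facts\<close> replaces
  the composite of the entries produced by g by a pullback of the original composite, and pullbacks
  compose.\<close>

lemma nsl_comp:
 assumes "f \<in> imaps l m" "g \<in> imaps m n" "T \<in> necklaces n" "U = preN m g T" "W = preN l f U"
  and "(cs,xs) \<in> dpaths T a b"
 shows "nsl f U W (nsl g T U (cs,xs)) = nsl (compose {..l} g f) T W (cs,xs)"
proof -
 have "W \<in> necklaces l" unfolding assms(4,5) by (intro preN_necklace[OF assms(1)] preN_necklace[OF assms(2)] assms(3))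
 then show ?thesis using assms
 proof (induction arbitrary: f g m n T U a cs xs rule: necklace_induct)
  case (zero f g m n T U)
  have m: "m = 0" "f = (\<lambda>i\<in>{..0}. i)" using interval_maps_0[OF zero(1)] by blast+
  have n: "n = 0" "g = (\<lambda>i\<in>{..0}. i)" using interval_maps_0[OF zero(2)[unfolded m(1)]] by blast+
  have T: "T = {0}" using zero(3) unfolding n(1) necklaces_0 .
  have U: "U = {0}" unfolding zero(4) T m n by (auto simp: preN_def)
  have "compose {..0} g f 0 = 0" unfolding m n by (simp add: compose_def)
  then show ?case unfolding T U m(2) n(2) by (simp add: nsl_0 npos_def compose_def)
 next
  case (bead w l W f g m n T U a cs xs)
  note f = bead(4) and w = bead(1) and W = bead(2) and g = bead(5) and T = bead(6) and U = bead(7) and preW = bead(8)[symmetric]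
  let ?v = "f w" and ?z = "g (f w)"
  have v: "?v \<le> m" by (rule imapsD(3)[OF f]) simp
  have Un: "U \<in> necklaces m" unfolding U by (rule preN_necklace[OF g T])
  have "w \<in> preN (w + l) f U" unfolding preW using joinN_mid[OF pair_nec W] .
  then have vU: "?v \<in> U" by (simp add: preN_def)
  then have zT: "?z \<in> T" by (simp add: U preN_def)
  have g': "g \<in> imaps (?v + (m - ?v)) n" using g v by simp
  let ?fL = "fcutL w f" and ?fR = "fcutR w l f" and ?gL = "fcutL ?v g" and ?gR = "fcutR ?v (m - ?v) g"
  let ?TL = "cutL ?z T" and ?TR = "cutR ?z T" and ?UL = "cutL ?v U" and ?UR = "cutR ?v U"
  have fL: "?fL \<in> imaps w ?v" by (rule fcutL_map[OF f]) simp
  have fR: "?fR \<in> imaps l (m - ?v)" by (rule fcutR_map[OF f])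
  have gL: "?gL \<in> imaps ?v ?z" by (rule fcutL_map[OF g v])
  have gR: "?gR \<in> imaps (m - ?v) (n - ?z)" by (rule fcutR_map[OF g'])
  have UL: "preN ?v ?gL ?TL = ?UL" using cutL_preN[OF v g] U by simp
  have UR: "preN (m - ?v) ?gR ?TR = ?UR" using cutR_preN[OF g', of T] U v by simp
  have TL: "?TL \<in> necklaces ?z" by (rule cutL_necklace[OF T zT])
  have TR: "?TR \<in> necklaces (n - ?z)" by (rule cutR_necklace[OF T zT])
  have ULn: "?UL \<in> necklaces ?v" by (rule cutL_necklace[OF Un vU])
  obtain c cs1 xs1 ds ys where p1: "(cs1,xs1) \<in> dpaths ?TL a c"
   and p2: "(ds,ys) \<in> dpaths ?TR c b" and e: "cs = cs1 @ tl ds" "xs = xs1 @ ys"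
   using bead(9) unfolding dquivers_cut[OF T zT] by (rule paths_appendE)
  note D1 = pathsD[OF p1]
  obtain es1 zs1 where e1: "nsl ?gL ?TL ?UL (cs1,xs1) = (es1,zs1)" by force
  obtain es2 zs2 where e2: "nsl ?gR ?TR ?UR (ds,ys) = (es2,zs2)" by force
  have q1: "(es1,zs1) \<in> dpaths ?UL a c" using nsl_facts(1)[OF gL TL UL[symmetric] p1] e1 by simp
  have q2: "(es2,zs2) \<in> dpaths ?UR c b" using nsl_facts(1)[OF gR TR UR[symmetric] p2] e2 by simp
  have i1: "itJ (gap_cards ?UL) es1 zs1 = dms (innerN ?v ?UL) (innerN ?z ?TL) ?gL a c (itJ (gap_cards ?TL) cs1 xs1)"
   using nsl_facts(2)[OF gL TL UL[symmetric] p1] e1 by simp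
  have n1: "nsl g T U (cs,xs) = (es1 @ tl es2, zs1 @ zs2)"
   using nsl_append[OF g' T zT p1 p2] unfolding UL UR e1 e2 using v U by (simp add: e)
  note nf = nsl_join[OF f Un w W preW q1 q2]
  have R: "preN l ?fR ?UR = W" by (rule nf(3))
  have IH: "nsl ?fR ?UR W (nsl ?gR ?TR ?UR (ds,ys)) = nsl (compose {..l} ?gR ?fR) ?TR W (ds,ys)"
   by (rule bead(3)[OF fR gR TR UR[symmetric] R[symmetric] p2])
  let ?h = "compose {..w + l} g f"
  have h: "?h \<in> imaps (w + l) n" by (rule interval_maps_comp[OF f g])
  have hw: "?h w = ?z" by (simp add: compose_def)
  have preh: "preN (w + l) ?h T = joinN w {0,w} W" unfolding preN_comp[OF f] U[symmetric] preW ..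
  have hL: "fcutL w ?h = compose {..w} ?gL ?fL" by (rule fcutL_comp[OF f]) simp
  have hR: "fcutR w l ?h = compose {..l} ?gR ?fR" by (rule fcutR_comp[OF f])
  note nh = nsl_join[OF h T w W preh, unfolded hw, OF p1 p2, unfolded hL hR]
  have sub: "?fL ` {0<..<w} \<subseteq> innerN ?v ?UL"
   using innerN_preN[OF fL ULn] unfolding nf(2) inner_pair .
  have sub2: "?gL ` innerN ?v ?UL \<subseteq> innerN ?z ?TL" using innerN_preN[OF gL TL] unfolding UL .
  have i2: "itJ (gap_cards ?TL) cs1 xs1 \<in>: dM (card (innerN ?z ?TL)) a c"
   using itJ_closed[OF p1[unfolded dquivers_def]] sum_gap_cards[OF TL] by simp
  have "dms {0<..<w} (innerN ?z ?TL) (compose {..w} ?gL ?fL) a c (itJ (gap_cards ?TL) cs1 xs1)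
   = dms {0<..<w} (innerN ?z ?TL) (\<lambda>i. ?gL (?fL i)) a c (itJ (gap_cards ?TL) cs1 xs1)"
  proof -
   have "dms {0<..<w} (innerN ?z ?TL) (compose {..w} ?gL ?fL) = dms {0<..<w} (innerN ?z ?TL) (\<lambda>i. ?gL (?fL i))"
    by (rule dmap_set_cong) (auto simp: compose_def)
   then show ?thesis by simp
  qed
  also have "\<dots> = dms {0<..<w} (innerN ?v ?UL) ?fL a c (itJ (gap_cards ?UL) es1 zs1)"
   unfolding i1 by (intro dmap_set_comp[OF _ _ _ sub sub2 interval_mono[OF fL] interval_mono[OF gL] D1(6,7) i2]) (auto simp: innerN_def)
  finally show ?case unfolding n1 unfolding e nf(4) nh(4) using IH e2 by simp
 qed
qed

lemma nsl_id:
 assumes "T \<in> necklaces n" "(cs,xs) \<in> dpaths T a b"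
 shows "nsl (\<lambda>i\<in>{..n}. i) T T (cs,xs) = (cs,xs)"
 using assms
proof (induction arbitrary: a cs xs rule: necklace_induct)
 case zero
 then show ?case by (auto simp: nsl_0 paths_Nil npos_def)
next
 case (bead w n T)
 let ?V = "joinN w {0,w} T" and ?i = "\<lambda>i\<in>{..w + n}. i"
 note w = bead(1) and T = bead(2)
 have V: "?V \<in> necklaces (w + n)" by (intro joinN_necklace pair_nec T)
 have wV: "w \<in> ?V" by (rule joinN_mid[OF pair_nec T])
 have cut: "cutL w ?V = {0,w}" "cutR w ?V = T" by (rule cutL_joinN[OF pair_nec T], rule cutR_joinN[OF pair_nec T])
 have q: "dq {0,w} = [dM (w - 1)]" using w by (simp add: dquivers_def gap_cards_pair)
 obtain c cs1 xs1 ds ys where p1: "(cs1,xs1) \<in> paths Ob (dq {0,w}) a c"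
  and p2: "(ds,ys) \<in> dpaths T c b" and e: "cs = cs1 @ tl ds" "xs = xs1 @ ys"
  using bead(4) unfolding dquivers_cut[OF V wV] cut by (rule paths_appendE)
 obtain x where x: "cs1 = [a,c]" "xs1 = [x]" "a \<in> Ob" "c \<in> Ob" "x \<in>: dM (w - 1) a c"
  using p1 unfolding q by (auto simp: paths_Cons paths_Nil)
 have pre: "preN (w + n) ?i ?V = ?V" using necklacesD(3)[OF V] by (auto simp: preN_def)
 have iw: "?i w = w" by simp
 have iR: "fcutR w n ?i = (\<lambda>i\<in>{..n}. i)" by (auto simp: fcutR_def fun_eq_iff)
 have "dms {0<..<w} {0<..<w} (fcutL w ?i) a c x = dms {0<..<w} {0<..<w} (\<lambda>i. i) a c x"
  by (subst dmap_set_cong[of "{0<..<w}" "fcutL w ?i" "\<lambda>i. i"]) (auto simp: fcutL_def)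
 also have "\<dots> = x" using dmap_id[OF x(3,4,5)] by (simp add: dmap_set_def std_order_map_id)
 finally have d: "dms {0<..<w} {0<..<w} (fcutL w ?i) a c x = x" .
 have IH: "nsl (\<lambda>i\<in>{..n}. i) T T (ds,ys) = (ds,ys)" by (rule bead(3)[OF p2])
 have x': "itJ (gap_cards {0,w}) cs1 xs1 = x" using w itJ_single[OF x(3,4,5)] unfolding x(1,2) gap_cards_pair[OF w] by simp
 have "nsl ?i ?V ?V (cs1 @ tl ds, xs1 @ ys) = (a # c # tl ds, x # ys)"
  using nsl_join(4)[OF interval_maps_id V w T pre, unfolded iw cut iR, OF p1 p2]
  by (simp only: x' inner_pair d IH fst_conv snd_conv)
 then show ?case by (simp only: e x(1,2) append.simps)
qed

lemma DT_module: "module R (DT T a b)"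
 unfolding dtensor_def by (rule TT_module[OF quivers_d])

lemma nsm_multilinear:
 assumes "f \<in> imaps m n" "T \<in> necklaces n" "U = preN m f T"
 shows "MLin Ob (dq T) a b (DT U a b)
  (\<lambda>p. pure R Ob (dq U) (fst (nsl f T U p)) (snd (nsl f T U p)))"
 using nsl_facts(3)[OF assms pure_multilinear[OF quivers_d], of a b] by (simp add: dtensor_def case_prod_beta')

lemma nsm_linear:
 assumes "f \<in> imaps m n" "T \<in> necklaces n" "U = preN m f T"
 shows "nsm f T U a b \<in> Lin (DT T a b) (DT U a b)"
 unfolding nerve_summand_map_nsl dtensor_def[of R D T]
 by (rule tensor_lift_linear[OF quivers_d DT_module nsm_multilinear[OF assms]])

lemma nsm_pure:
 assumes "f \<in> imaps m n" "T \<in> necklaces n" "U = preN m f T" "(cs,xs) \<in> dpaths T a b"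
 shows "nsm f T U a b (pure R Ob (dq T) cs xs) =
  pure R Ob (dq U) (fst (nsl f T U (cs,xs))) (snd (nsl f T U (cs,xs)))"
 unfolding nerve_summand_map_nsl
 by (rule tensor_lift_pure[OF quivers_d DT_module nsm_multilinear[OF assms(1-3)] assms(4)])

lemma nsm_comp:
 assumes f: "f \<in> imaps l m" and g: "g \<in> imaps m n" and T: "T \<in> necklaces n" and U: "U = preN m g T" and W: "W = preN l f U"
  and A: "A \<in>: DT T a b"
 shows "nsm f U W a b (nsm g T U a b A) = nsm (compose {..l} g f) T W a b A"
proof -
 have Un: "U \<in> necklaces m" unfolding U by (rule preN_necklace[OF g T])
 have h: "compose {..l} g f \<in> imaps l n" by (rule interval_maps_comp[OF f g])
 have W': "W = preN l (compose {..l} g f) T" unfolding preN_comp[OF f] U[symmetric] W ..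
 show ?thesis
 proof (rule tensor_eqI[OF quivers_d DT_module
   lin_comp[OF nsm_linear[OF f Un W] nsm_linear[OF g T U], unfolded dtensor_def[of R D T]]
   nsm_linear[OF h T W', unfolded dtensor_def[of R D T]] _ A[unfolded dtensor_def]])
  fix cs xs assume p: "(cs,xs) \<in> dpaths T a b"
  obtain ds ys where e: "nsl g T U (cs,xs) = (ds,ys)" by force
  have q: "(ds,ys) \<in> dpaths U a b" using nsl_facts(1)[OF g T U p] e by simp
  show "nsm f U W a b (nsm g T U a b (pure R Ob (dq T) cs xs)) =
   nsm (compose {..l} g f) T W a b (pure R Ob (dq T) cs xs)"
   using nsl_comp[OF f g T U W p] by (simp add: nsm_pure[OF g T U p] e nsm_pure[OF f Un W q] nsm_pure[OF h T W' p])
 qed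
qed

lemma nsm_id:
 assumes T: "T \<in> necklaces n" and A: "A \<in>: DT T a b"
 shows "nsm (\<lambda>i\<in>{..n}. i) T T a b A = A"
proof -
 have pre: "T = preN n (\<lambda>i\<in>{..n}. i) T" using necklacesD(3)[OF T] by (auto simp: preN_def)
 note i = interval_maps_id[of n]
 show ?thesis
  by (rule tensor_eqI[OF quivers_d DT_module[unfolded dtensor_def] nsm_linear[OF i T pre, unfolded dtensor_def]
    lin_id _ A[unfolded dtensor_def]])
   (simp add: nsm_pure[OF i T pre] nsl_id[OF T])
qed

text \<open>Makes the structure maps compatible with juxtaposition, from which \<open>tm_J\<close>
  for the nerve is obtained.\<close>

lemma nsm_append:
 assumes f: "f \<in> imaps (w + m) n" and T: "T \<in> necklaces n" and w: "f w \<in> T"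
  and A: "A \<in>: DT (cutL (f w) T) a c" and B: "B \<in>: DT (cutR (f w) T) c b"
 defines "UL \<equiv> preN w (fcutL w f) (cutL (f w) T)" and "UR \<equiv> preN m (fcutR w m f) (cutR (f w) T)"
 shows "nsm f T (preN (w + m) f T) a b
   (TA Ob (dq (cutL (f w) T)) (dq (cutR (f w) T)) a b A B) =
  TA Ob (dq UL) (dq UR) a b
   (nsm (fcutL w f) (cutL (f w) T) UL a c A) (nsm (fcutR w m f) (cutR (f w) T) UR c b B)"
proof -
 let ?U = "preN (w + m) f T" and ?TL = "cutL (f w) T" and ?TR = "cutR (f w) T"
 let ?fL = "fcutL w f" and ?fR = "fcutR w m f"
 have fL: "?fL \<in> imaps w (f w)" by (rule fcutL_map[OF f]) simp
 have fR: "?fR \<in> imaps m (n - f w)" by (rule fcutR_map[OF f])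
 have TL: "?TL \<in> necklaces (f w)" by (rule cutL_necklace[OF T w])
 have TR: "?TR \<in> necklaces (n - f w)" by (rule cutR_necklace[OF T w])
 have U: "?U \<in> necklaces (w + m)" by (rule preN_necklace[OF f T])
 have wU: "w \<in> ?U" using w by (simp add: preN_def)
 have UL: "UL = cutL w ?U" unfolding UL_def using cutL_preN[OF _ f, of w] by simp
 have UR: "UR = cutR w ?U" unfolding UR_def using cutR_preN[OF f] by simp
 have qT: "dq T = dq ?TL @ dq ?TR" by (rule dquivers_cut[OF T w])
 have qU: "dq ?U = dq UL @ dq UR" unfolding UL UR by (rule dquivers_cut[OF U wU])
 note q = quivers_d
 have ULr: "UL = preN w ?fL ?TL" "UR = preN m ?fR ?TR" by (simp_all add: UL_def UR_def)
 note lf = nsm_linear[OF f T refl, unfolded dtensor_def qT qU]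
 note lL = nsm_linear[OF fL TL ULr(1), unfolded dtensor_def] and lR = nsm_linear[OF fR TR ULr(2), unfolded dtensor_def]
 have Mod: "module R (TT Ob (dq UL @ dq UR) a b)" using q by (intro TT_module) simp
 note al = tensor_append_linear_left and ar = tensor_append_linear_right
 note A' = A[unfolded dtensor_def] and B' = B[unfolded dtensor_def]
 show ?thesis
 proof (rule tensor_eqI[OF q Mod lin_comp[OF lf al[OF q q B']] lin_comp[OF al[OF q q lin_closed[OF lR B']] lL] _ A'])
  fix cs xs assume p1: "(cs,xs) \<in> dpaths ?TL a c"
  note pc = pure_closed[OF q p1]
  show "nsm f T ?U a b (TA Ob (dq ?TL) (dq ?TR) a b (pure R Ob (dq ?TL) cs xs) B) =
   TA Ob (dq UL) (dq UR) a b
   (nsm ?fL ?TL UL a c (pure R Ob (dq ?TL) cs xs)) (nsm ?fR ?TR UR c b B)"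
  proof (rule tensor_eqI[OF q Mod lin_comp[OF lf ar[OF q q pc]] lin_comp[OF ar[OF q q lin_closed[OF lL pc]] lR] _ B'])
   fix ds ys assume p2: "(ds,ys) \<in> dpaths ?TR c b"
   obtain es1 zs1 where e1: "nsl ?fL ?TL UL (cs,xs) = (es1,zs1)" by force
   obtain es2 zs2 where e2: "nsl ?fR ?TR UR (ds,ys) = (es2,zs2)" by force
   have q1: "(es1,zs1) \<in> dpaths UL a c" using nsl_facts(1)[OF fL TL ULr(1) p1] e1 by simp
   have q2: "(es2,zs2) \<in> dpaths UR c b" using nsl_facts(1)[OF fR TR ULr(2) p2] e2 by simp
   have "nsl f T ?U (cs @ tl ds, xs @ ys) = (es1 @ tl es2, zs1 @ zs2)"
    using nsl_append[OF f T w p1 p2] e1 e2 by (simp add: UL_def UR_def)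
   then show "nsm f T ?U a b (TA Ob (dq ?TL) (dq ?TR) a b
     (pure R Ob (dq ?TL) cs xs) (pure R Ob (dq ?TR) ds ys)) =
    TA Ob (dq UL) (dq UR) a b
     (nsm ?fL ?TL UL a c (pure R Ob (dq ?TL) cs xs))
     (nsm ?fR ?TR UR c b (pure R Ob (dq ?TR) ds ys))"
    using nsm_pure[OF f T refl, of "cs @ tl ds" "xs @ ys" a b] paths_append[OF p1 p2]
    by (simp add: tensor_append_pure[OF q q p1 p2] qT qU nsm_pure[OF fL TL ULr(1) p1] nsm_pure[OF fR TR ULr(2) p2] e1 e2
      tensor_append_pure[OF q q q1 q2])
  qed
 qed
qed

end

section \<open>Finite direct sums\<close>

lemma lin_const_zero:
 assumes "module R N"
 shows "(\<lambda>x. \<zero>\<^bsub>N\<^esub>) \<in> lin_maps R M N"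
proof -
 interpret N: module R N by fact
 show ?thesis by (rule lin_mapsI) auto
qed

context cring
begin

context
 fixes I :: "'i set" and M :: "'i => ('a,'m) module"
 assumes M: "\<And>i. i \<in> I ==> module R (M i)"
begin

lemma direct_sum_simps:
 "carrier (direct_sum I M) = (\<Pi>\<^sub>E i\<in>I. carrier (M i))" "zero (direct_sum I M) = (\<lambda>i\<in>I. \<zero>\<^bsub>M i\<^esub>)"
 "add (direct_sum I M) = (\<lambda>f g. \<lambda>i\<in>I. f i \<oplus>\<^bsub>M i\<^esub> g i)" "smult (direct_sum I M) = (\<lambda>r f. \<lambda>i\<in>I. r \<odot>\<^bsub>M i\<^esub> f i)"
 by (simp_all add: direct_sum_def)

lemma direct_sum_module: "module R (direct_sum I M)"
proof (rule moduleI)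
 note m = module.axioms(2)[OF M]
 note am = abelian_group.axioms(1)[OF m]
 show "abelian_group (direct_sum I M)"
 proof (rule abelian_groupI)
  fix x assume x: "x \<in>: direct_sum I M"
  then have "(\<lambda>i\<in>I. \<ominus>\<^bsub>M i\<^esub> x i) \<in>: direct_sum I M"
   by (auto simp: direct_sum_simps intro!: abelian_group.a_inv_closed[OF m])
  moreover have "(\<lambda>i\<in>I. \<ominus>\<^bsub>M i\<^esub> x i) \<oplus>\<^bsub>direct_sum I M\<^esub> x = \<zero>\<^bsub>direct_sum I M\<^esub>"
   using x by (auto simp: direct_sum_simps fun_eq_iff intro!: abelian_group.l_neg[OF m])
  ultimately show "\<exists>y\<in>carrier (direct_sum I M). y \<oplus>\<^bsub>direct_sum I M\<^esub> x = \<zero>\<^bsub>direct_sum I M\<^esub>" by blast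
 next
  fix x assume "x \<in>: direct_sum I M"
  then show "\<zero>\<^bsub>direct_sum I M\<^esub> \<oplus>\<^bsub>direct_sum I M\<^esub> x = x"
   by (auto simp: direct_sum_simps fun_eq_iff PiE_iff extensional_def intro!: abelian_monoid.l_zero[OF am])
 next
  fix x y assume "x \<in>: direct_sum I M" "y \<in>: direct_sum I M"
  then show "x \<oplus>\<^bsub>direct_sum I M\<^esub> y = y \<oplus>\<^bsub>direct_sum I M\<^esub> x"
   by (auto simp: direct_sum_simps fun_eq_iff intro!: abelian_monoid.a_comm[OF am])
 qed (auto simp: direct_sum_simps fun_eq_iff intro!: abelian_monoid.a_assoc[OF am] abelian_monoid.a_closed[OF am] abelian_monoid.zero_closed[OF am])
qed (auto simp: direct_sum_simps fun_eq_iff PiE_iff extensional_def is_cring intro!: module.smult_closed[OF M] module.smult_l_distr[OF M] module.smult_r_distr[OF M]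
  module.smult_assoc1[OF M] module.smult_one[OF M])

lemma proj_linear: "i \<in> I ==> (\<lambda>z. z i) \<in> Lin (direct_sum I M) (M i)"
 by (rule lin_mapsI) (auto simp: direct_sum_simps)

lemma direct_sum_mapI:
 assumes h: "\<And>i. i \<in> I ==> h i \<in> Lin L (M i)"
 shows "(\<lambda>x. \<lambda>i\<in>I. h i x) \<in> Lin L (direct_sum I M)"
 by (rule lin_mapsI)
  (auto simp: direct_sum_simps fun_eq_iff lin_closed[OF h] lin_add[OF h] lin_smult[OF h])

lemma incl_linear: "i \<in> I ==> summand_incl I M i \<in> Lin (M i) (direct_sum I M)"
 unfolding summand_incl_def[abs_def]
proof (rule direct_sum_mapI)
 fix j assume "i \<in> I" "j \<in> I"
 then show "(\<lambda>x. if j = i then x else \<zero>\<^bsub>M j\<^esub>) \<in> Lin (M i) (M j)"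
  using lin_id[of R "M i"] lin_const_zero[OF M, of j "M i"] by (cases "j = i") auto
qed

lemma direct_sum_decomp:
 assumes "finite I" "z \<in>: direct_sum I M"
 shows "z = finsum (direct_sum I M) (\<lambda>i. summand_incl I M i (z i)) I"
proof (rule PiE_ext[of _ I "\<lambda>i. carrier (M i)"])
 have c: "(\<lambda>i. summand_incl I M i (z i)) \<in> I \<rightarrow> carrier (direct_sum I M)"
  using assms(2) by (auto intro!: lin_closed[OF incl_linear] lin_closed[OF proj_linear])
 interpret DS: module R "direct_sum I M" by (rule direct_sum_module)
 show "z \<in> (\<Pi>\<^sub>E i\<in>I. carrier (M i))" using assms(2) by (simp add: direct_sum_simps)
 show "finsum (direct_sum I M) (\<lambda>i. summand_incl I M i (z i)) I \<in> (\<Pi>\<^sub>E i\<in>I. carrier (M i))"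
  using DS.finsum_closed[OF c] by (simp add: direct_sum_simps)
 fix j assume j: "j \<in> I"
 interpret Mj: module R "M j" by (rule M[OF j])
 have "finsum (direct_sum I M) (\<lambda>i. summand_incl I M i (z i)) I j = finsum (M j) (\<lambda>i. summand_incl I M i (z i) j) I"
  using lin_finsum[OF direct_sum_module M[OF j] proj_linear[OF j] c] .
 also have "\<dots> = finsum (M j) (\<lambda>i. if i = j then z j else \<zero>\<^bsub>M j\<^esub>) I"
  using j assms(2) by (intro Mj.finsum_cong') (auto simp: summand_incl_def direct_sum_simps)
 also have "\<dots> = z j" using j assms by (intro Mj.finsum_single) (auto simp: direct_sum_simps)
 finally show "z j = finsum (direct_sum I M) (\<lambda>i. summand_incl I M i (z i)) I j" ..
qed

lemma direct_sum_eqI: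
 assumes "finite I" "module R N" "h \<in> Lin (direct_sum I M) N" "g \<in> Lin (direct_sum I M) N"
  and e: "\<And>i x. [|i \<in> I; x \<in>: M i|] ==> h (summand_incl I M i x) = g (summand_incl I M i x)"
  and z: "z \<in>: direct_sum I M"
 shows "h z = g z"
proof -
 interpret N: module R N by fact
 have c: "(\<lambda>i. summand_incl I M i (z i)) \<in> I \<rightarrow> carrier (direct_sum I M)"
  using z by (auto intro!: lin_closed[OF incl_linear] lin_closed[OF proj_linear])
 have zi: "z i \<in>: M i" if "i \<in> I" for i using z that by (auto simp: direct_sum_simps)
 have "h z = finsum N (\<lambda>i. h (summand_incl I M i (z i))) I"
  by (subst direct_sum_decomp[OF assms(1) z]) (rule lin_finsum[OF direct_sum_module assms(2,3) c])
 also have "\<dots> = finsum N (\<lambda>i. g (summand_incl I M i (z i))) I"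
  using zi lin_closed[OF assms(4)] c by (intro N.finsum_cong') (auto simp: e)
 also have "\<dots> = g z"
  by (subst (2) direct_sum_decomp[OF assms(1) z]) (rule lin_finsum[OF direct_sum_module assms(2,4) c, symmetric])
 finally show ?thesis .
qed

end

lemma pure_pair_linear:
 assumes q: "qv S [P1,P2]" and S: "a \<in> S" "c \<in> S" "b \<in> S"
 shows "y \<in>: P2 c b ==> (\<lambda>x. pure R S [P1,P2] [a,c,b] [x,y]) \<in> Lin (P1 a c) (TT S [P1,P2] a b)"
  and "x \<in>: P1 a c ==> (\<lambda>y. pure R S [P1,P2] [a,c,b] [x,y]) \<in> Lin (P2 c b) (TT S [P1,P2] a b)"
proof -
 have ne: "carrier (P1 a c) \<noteq> {}" "carrier (P2 c b) \<noteq> {}"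
  using q S module_zero_closed by (auto; blast)+
 have pb: "([b],[]) \<in> paths S [] b b" using S by (simp add: paths_Nil)
 note m = pure_multilinear[OF q, of a b, unfolded multilinear_Cons[of R S P1], THEN mp, OF S(1), THEN bspec, OF S(2)]
 show "(\<lambda>x. pure R S [P1,P2] [a,c,b] [x,y]) \<in> Lin (P1 a c) (TT S [P1,P2] a b)" if "y \<in>: P2 c b"
 proof -
  have p: "([c,b],[y]) \<in> paths S [P2] c b" using S that pb by (auto simp: paths_Cons)
  show ?thesis using m[THEN conjunct1, THEN bspec, OF p] ne by simp
 qed
 show "(\<lambda>y. pure R S [P1,P2] [a,c,b] [x,y]) \<in> Lin (P2 c b) (TT S [P1,P2] a b)" if "x \<in>: P1 a c"
  using m[THEN conjunct2, THEN bspec, OF that, unfolded multilinear_Cons, THEN mp, OF S(2), THEN bspec, OF S(3), THEN conjunct1, THEN bspec, OF pb] ne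
  by simp
qed

end

section \<open>The templicial module of an enriched category\<close>

context asmod
begin

section \<open>Juxtaposition of necklaces as a product on the nerve\<close>

definition "nJ p q a c b x y = (\<lambda>V\<in>necklaces (p + q). if p \<in> V
   then TA Ob (dq (cutL p V)) (dq (cutR p V)) a b (x (cutL p V)) (y (cutR p V))
   else \<zero>\<^bsub>DT V a b\<^esub>)"

definition nu :: "'o => nat set => ('k,'o,'d) tens" where
 "nu a = (\<lambda>V\<in>necklaces 0. pure R Ob [] [a] [])"

definition "nP n T a b z = (\<lambda>V\<in>necklaces n. if T \<subseteq> V then z V else \<zero>\<^bsub>DT V a b\<^esub>)"

abbreviation "NM \<equiv> nerve_mod R D"
abbreviation "NX \<equiv> templicial_of_cat R D"

lemma NM_module: "module R (NM n a b)"
 unfolding nerve_mod_def by (rule direct_sum_module[OF DT_module])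

lemma NM_proj: "V \<in> necklaces n ==> (\<lambda>z. z V) \<in> Lin (NM n a b) (DT V a b)"
 unfolding nerve_mod_def by (rule proj_linear[OF DT_module])

lemma NM_apply: "[|z \<in>: NM n a b; V \<in> necklaces n|] ==> z V \<in>: DT V a b"
 by (rule lin_closed[OF NM_proj])

lemma NM_mapI: "(\<And>V. V \<in> necklaces n ==> h V \<in> Lin L (DT V a b)) ==> (\<lambda>x. \<lambda>V\<in>necklaces n. h V x) \<in> Lin L (NM n a b)"
 unfolding nerve_mod_def by (rule direct_sum_mapI[OF DT_module])

lemma NM_ext: "[|x \<in>: NM n a b; y \<in>: NM n a b; \<And>V. V \<in> necklaces n ==> x V = y V|] ==> x = y"
 by (rule PiE_ext[of x "necklaces n" "\<lambda>V. carrier (DT V a b)" y]) (simp_all add: nerve_mod_def direct_sum_def)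

lemma incl_lin: "V \<in> necklaces n ==> NI n a b V \<in> Lin (DT V a b) (NM n a b)"
 unfolding nerve_mod_def nerve_incl_def by (rule incl_linear[OF DT_module])

lemma incl_app: "V \<in> necklaces n ==> NI n a b T x V = (if V = T then x else \<zero>\<^bsub>DT V a b\<^esub>)"
 by (simp add: nerve_incl_def summand_incl_def)

lemma NM_eqI:
 assumes "module R N" "h \<in> Lin (NM n a b) N" "g \<in> Lin (NM n a b) N"
  and "\<And>V x. [|V \<in> necklaces n; x \<in>: DT V a b|] ==> h (NI n a b V x) = g (NI n a b V x)"
  and "z \<in>: NM n a b"
 shows "h z = g z"
 by (rule direct_sum_eqI[OF DT_module finite_necklaces assms(1) assms(2,3)[unfolded nerve_mod_def] _ assms(5)[unfolded nerve_mod_def]])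
  (rule assms(4)[unfolded nerve_incl_def])

lemma dtensor_join: "V \<in> necklaces n ==> w \<in> V ==> DT V = TT Ob (dq (cutL w V) @ dq (cutR w V))"
 unfolding dtensor_def by (simp add: dquivers_cut)

lemma dapp_left: "[|V \<in> necklaces n; w \<in> V; B \<in>: DT (cutR w V) c b|] ==>
  (\<lambda>A. TA Ob (dq (cutL w V)) (dq (cutR w V)) a b A B)
   \<in> Lin (DT (cutL w V) a c) (DT V a b)"
 unfolding dtensor_join[of V n w] unfolding dtensor_def by (rule tensor_append_linear_left[OF quivers_d quivers_d])

lemma dapp_right: "[|V \<in> necklaces n; w \<in> V; A \<in>: DT (cutL w V) a c|] ==>
  (\<lambda>B. TA Ob (dq (cutL w V)) (dq (cutR w V)) a b A B)
   \<in> Lin (DT (cutR w V) c b) (DT V a b)"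
 unfolding dtensor_join[of V n w] unfolding dtensor_def by (rule tensor_append_linear_right[OF quivers_d quivers_d])

lemma cutR_necklace': "[|V \<in> necklaces (p + q); p \<in> V|] ==> cutR p V \<in> necklaces q"
 using cutR_necklace[of V "p + q" p] by simp

lemma nJ_left:
 assumes "y \<in>: NM q c b"
 shows "(\<lambda>x. nJ p q a c b x y) \<in> Lin (NM p a c) (NM (p + q) a b)"
 unfolding nJ_def
proof (rule NM_mapI)
 fix V assume V: "V \<in> necklaces (p + q)"
 show "(\<lambda>x. if p \<in> V then TA Ob (dq (cutL p V)) (dq (cutR p V)) a b (x (cutL p V)) (y (cutR p V))
   else \<zero>\<^bsub>DT V a b\<^esub>) \<in> Lin (NM p a c) (DT V a b)"
 proof (cases "p \<in> V")
  case True
  then show ?thesis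
   using lin_comp[OF dapp_left[OF V True NM_apply[OF assms cutR_necklace'[OF V True]]] NM_proj[OF cutL_necklace[OF V True]]] by simp
 qed (simp add: lin_const_zero[OF DT_module])
qed

lemma nJ_right:
 assumes "x \<in>: NM p a c"
 shows "(\<lambda>y. nJ p q a c b x y) \<in> Lin (NM q c b) (NM (p + q) a b)"
 unfolding nJ_def
proof (rule NM_mapI)
 fix V assume V: "V \<in> necklaces (p + q)"
 show "(\<lambda>y. if p \<in> V then TA Ob (dq (cutL p V)) (dq (cutR p V)) a b (x (cutL p V)) (y (cutR p V))
   else \<zero>\<^bsub>DT V a b\<^esub>) \<in> Lin (NM q c b) (DT V a b)"
 proof (cases "p \<in> V")
  case True
  then show ?thesis
   using lin_comp[OF dapp_right[OF V True NM_apply[OF assms cutL_necklace[OF V True]]] NM_proj[OF cutR_necklace'[OF V True]]] by simp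
 qed (simp add: lin_const_zero[OF DT_module])
qed

lemma nJ_closed: "[|x \<in>: NM p a c; y \<in>: NM q c b|] ==> nJ p q a c b x y \<in>: NM (p + q) a b"
 by (rule lin_closed[OF nJ_left])

lemma nJ_apply: "V \<in> necklaces (p + q) ==> nJ p q a c b x y V = (if p \<in> V
   then TA Ob (dq (cutL p V)) (dq (cutR p V)) a b (x (cutL p V)) (y (cutR p V))
   else \<zero>\<^bsub>DT V a b\<^esub>)"
 by (simp add: nJ_def)

text \<open>A component can be nonzero only if V contains both p and p + q, and then the claim is
  \<open>tensor_append_assoc\<close>. If one of them is missing, a zero factor kills the side that
  does not see it at once.\<close>

lemma nJ_assoc:
 assumes x: "x \<in>: NM p a c" and y: "y \<in>: NM q c d" and z: "z \<in>: NM r d b"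
 shows "nJ (p + q) r a d b (nJ p q a c d x y) z = nJ p (q + r) a c b x (nJ q r c d b y z)"
proof (rule NM_ext)
 show "nJ (p + q) r a d b (nJ p q a c d x y) z \<in>: NM (p + q + r) a b" by (intro nJ_closed x y z)
 show "nJ p (q + r) a c b x (nJ q r c d b y z) \<in>: NM (p + q + r) a b"
  unfolding add.assoc by (intro nJ_closed x y z)
 fix V assume V: "V \<in> necklaces (p + q + r)"
 then have V': "V \<in> necklaces (p + (q + r))" by (simp add: add.assoc)
 consider "p \<in> V" "p + q \<in> V" | "p \<in> V" "p + q \<notin> V" | "p \<notin> V" "p + q \<in> V" | "p \<notin> V" "p + q \<notin> V" by blast
 then show "nJ (p + q) r a d b (nJ p q a c d x y) z V = nJ p (q + r) a c b x (nJ q r c d b y z) V"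
 proof cases
  case 1
  have L: "cutL (p + q) V \<in> necklaces (p + q)" "p \<in> cutL (p + q) V" using cutL_necklace[OF V 1(2)] 1 by (auto simp: cutL_iff)
  have R: "cutR p V \<in> necklaces (q + r)" "q \<in> cutR p V" using cutR_necklace'[OF V' 1(1)] 1 by (auto simp: cutR_iff)
  have e1: "nJ (p + q) r a d b (nJ p q a c d x y) z V = TA Ob (dq (cutL p V) @ dq (cutL q (cutR p V))) (dq (cutR (p + q) V)) a b
    (TA Ob (dq (cutL p V)) (dq (cutL q (cutR p V))) a d (x (cutL p V)) (y (cutL q (cutR p V)))) (z (cutR (p + q) V))"
   using 1 L dquivers_cut[OF L] by (simp add: nJ_apply[OF V] nJ_apply[OF L(1)] cutL_cutL cutR_cutL)
  have e2: "nJ p (q + r) a c b x (nJ q r c d b y z) V = TA Ob (dq (cutL p V)) (dq (cutL q (cutR p V)) @ dq (cutR (p + q) V)) a b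
    (x (cutL p V)) (TA Ob (dq (cutL q (cutR p V))) (dq (cutR (p + q) V)) c b (y (cutL q (cutR p V))) (z (cutR (p + q) V)))"
   using 1 R dquivers_cut[OF R] by (simp add: nJ_apply[OF V'] nJ_apply[OF R(1)] cutR_cutR)
  show ?thesis unfolding e1 e2
   using NM_apply[OF x cutL_necklace[OF V' 1(1)]] NM_apply[OF y cutL_necklace[OF R]] NM_apply[OF z cutR_necklace'[OF V 1(2)]]
   unfolding dtensor_def by (rule tensor_append_assoc[OF quivers_d quivers_d quivers_d])
 next
  case 2
  have R: "cutR p V \<in> necklaces (q + r)" "q \<notin> cutR p V" using cutR_necklace'[OF V' 2(1)] 2 by (auto simp: cutR_iff)
  have "TA Ob (dq (cutL p V)) (dq (cutR p V)) a b (x (cutL p V)) \<zero>\<^bsub>DT (cutR p V) c b\<^esub> = \<zero>\<^bsub>DT V a b\<^esub>"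
   by (rule lin_zero[OF DT_module DT_module dapp_right[OF V' 2(1) NM_apply[OF x cutL_necklace[OF V' 2(1)]]]])
  then show ?thesis using 2 R by (simp add: nJ_apply[OF V] nJ_apply[OF V'] nJ_apply[OF R(1)])
 next
  case 3
  have L: "cutL (p + q) V \<in> necklaces (p + q)" "p \<notin> cutL (p + q) V" using cutL_necklace[OF V 3(2)] 3 by (auto simp: cutL_iff)
  have "TA Ob (dq (cutL (p + q) V)) (dq (cutR (p + q) V)) a b \<zero>\<^bsub>DT (cutL (p + q) V) a d\<^esub> (z (cutR (p + q) V)) = \<zero>\<^bsub>DT V a b\<^esub>"
   by (rule lin_zero[OF DT_module DT_module dapp_left[OF V 3(2) NM_apply[OF z cutR_necklace'[OF V 3(2)]]]])
  then show ?thesis using 3 L by (simp add: nJ_apply[OF V] nJ_apply[OF V'] nJ_apply[OF L(1)])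
 next
  case 4
  then show ?thesis by (simp add: nJ_apply[OF V] nJ_apply[OF V'])
 qed
qed

lemma necklace0: "{0} \<in> necklaces 0" by (simp add: necklaces_0)

lemma nu_closed: "a \<in> Ob ==> nu a \<in>: NM 0 a a"
 by (auto simp: nu_def nerve_mod_def direct_sum_def necklaces_0 dtensor_def intro!: pure_closed paths_Nil[THEN iffD2])

lemma nJ_unit_left:
 assumes "a \<in> Ob" "x \<in>: NM p a b"
 shows "nJ 0 p a a b (nu a) x = x"
proof (rule NM_ext[OF _ assms(2)])
 show "nJ 0 p a a b (nu a) x \<in>: NM p a b" using nJ_closed[OF nu_closed[OF assms(1)] assms(2)] by simp
 fix V assume V: "V \<in> necklaces p"
 then have V': "V \<in> necklaces (0 + p)" by simp
 have "0 \<in> V" "cutL 0 V = {0}" "cutR 0 V = V" using necklacesD(1)[OF V] by (auto simp: cutL_iff cutR_iff)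
 then show "nJ 0 p a a b (nu a) x V = x V"
  using tensor_append_unit_left[OF quivers_d NM_apply[OF assms(2) V, unfolded dtensor_def] assms(1)]
  by (simp add: nJ_apply[OF V'] nu_def necklaces_0)
qed

lemma nJ_unit_right:
 assumes "b \<in> Ob" "x \<in>: NM p a b"
 shows "nJ p 0 a b b x (nu b) = x"
proof (rule NM_ext[OF _ assms(2)])
 show "nJ p 0 a b b x (nu b) \<in>: NM p a b" using nJ_closed[OF assms(2) nu_closed[OF assms(1)]] by simp
 fix V assume V: "V \<in> necklaces p"
 then have V': "V \<in> necklaces (p + 0)" by simp
 have "p \<in> V" "cutL p V = V" "cutR p V = {0}" using necklacesD(2,3)[OF V] by (fastforce simp: cutL_iff cutR_iff)+
 then show "nJ p 0 a b b x (nu b) V = x V"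
  using tensor_append_unit_right[OF quivers_d NM_apply[OF assms(2) V, unfolded dtensor_def] assms(1)]
  by (simp add: nJ_apply[OF V'] nu_def necklaces_0)
qed

lemma nerve_graded: "graded_cat R Ob NM nJ nu"
 by (rule graded_cat.intro[OF is_cring], rule graded_cat_axioms.intro)
  (rule NM_module nJ_left nJ_right nJ_assoc nu_closed nJ_unit_left nJ_unit_right; assumption)+

lemma nP_linear: "nP n T a b \<in> Lin (NM n a b) (NM n a b)"
 unfolding nP_def[abs_def]
proof (rule NM_mapI)
 fix V assume "V \<in> necklaces n"
 then show "(\<lambda>z. if T \<subseteq> V then z V else \<zero>\<^bsub>DT V a b\<^esub>) \<in> Lin (NM n a b) (DT V a b)"
  using NM_proj lin_const_zero[OF DT_module] by (cases "T \<subseteq> V") simp_all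
qed

lemma nP_closed: "z \<in>: NM n a b ==> nP n T a b z \<in>: NM n a b"
 by (rule lin_closed[OF nP_linear])

lemma nP_apply: "V \<in> necklaces n ==> nP n T a b z V = (if T \<subseteq> V then z V else \<zero>\<^bsub>DT V a b\<^esub>)"
 by (simp add: nP_def)

lemma nP_incl:
 assumes "V \<in> necklaces n"
 shows "nP n T a b (NI n a b V x) = (if T \<subseteq> V then NI n a b V x else \<zero>\<^bsub>NM n a b\<^esub>)"
 using assms by (auto simp: nP_def nerve_incl_def summand_incl_def nerve_mod_def direct_sum_def fun_eq_iff)

text \<open>When p lies in V, T is contained in V exactly when each half of T is contained in the
  corresponding half of V.\<close>

lemma nP_J:
 assumes x: "x \<in>: NM p a c" and y: "y \<in>: NM q c b"
 shows "nP (p + q) T a b (nJ p q a c b x y) = nJ p q a c b (nP p (cutL p T) a c x) (nP q (cutR p T) c b y)"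
proof (rule NM_ext[OF nP_closed[OF nJ_closed[OF x y]] nJ_closed[OF nP_closed[OF x] nP_closed[OF y]]])
 fix V assume V: "V \<in> necklaces (p + q)"
 show "nP (p + q) T a b (nJ p q a c b x y) V = nJ p q a c b (nP p (cutL p T) a c x) (nP q (cutR p T) c b y) V"
 proof (cases "p \<in> V")
  case True
  note L = cutL_necklace[OF V True] and R = cutR_necklace'[OF V True]
  have iff: "T \<subseteq> V \<longleftrightarrow> cutL p T \<subseteq> cutL p V \<and> cutR p T \<subseteq> cutR p V"
  proof
   assume "cutL p T \<subseteq> cutL p V \<and> cutR p T \<subseteq> cutR p V"
   then show "T \<subseteq> V" by (auto simp: cutL_iff cutR_iff subset_iff) (metis le_add_diff_inverse nle_le)
  qed (auto simp: cutL_iff cutR_iff)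
  have z1: "TA Ob (dq (cutL p V)) (dq (cutR p V)) a b \<zero>\<^bsub>DT (cutL p V) a c\<^esub> v = \<zero>\<^bsub>DT V a b\<^esub>"
   if "v \<in>: DT (cutR p V) c b" for v
   by (rule lin_zero[OF DT_module DT_module dapp_left[OF V True that]])
  have z2: "TA Ob (dq (cutL p V)) (dq (cutR p V)) a b v \<zero>\<^bsub>DT (cutR p V) c b\<^esub> = \<zero>\<^bsub>DT V a b\<^esub>"
   if "v \<in>: DT (cutL p V) a c" for v
   by (rule lin_zero[OF DT_module DT_module dapp_right[OF V True that]])
  interpret T: module R "DT (cutR p V) c b" by (rule DT_module)
  show ?thesis using True NM_apply[OF x L] NM_apply[OF y R] z1 z2
   by (simp add: nP_apply[OF V] nJ_apply[OF V] nP_apply[OF L] nP_apply[OF R] iff)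
 qed (simp add: nP_apply[OF V] nJ_apply[OF V])
qed

lemma nerve_map_linear:
 assumes f: "f \<in> imaps m n"
 shows "NF m n f a b \<in> Lin (NM n a b) (NM m a b)"
 unfolding nerve_map_def[abs_def]
proof (rule NM_mapI)
 fix U
 show "(\<lambda>z. finsum (DT U a b) (\<lambda>T. nsm f T U a b (z T)) {T \<in> necklaces n. {i \<in> {..m}. f i \<in> T} = U})
  \<in> Lin (NM n a b) (DT U a b)"
  by (rule lin_finsum_fun[OF NM_module DT_module])
   (auto simp: preN_def intro!: lin_comp[OF nsm_linear[OF f] NM_proj])
qed

lemma nerve_map_closed: "[|f \<in> imaps m n; z \<in>: NM n a b|] ==> NF m n f a b z \<in>: NM m a b"
 by (rule lin_closed[OF nerve_map_linear])

text \<open>Only the summand at the preimage receives anything, so the sum over necklaces collapses.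
  Identities between structure maps are then checked summand by summand through
  \<open>NM_eqI\<close>.\<close>

lemma nerve_map_incl:
 assumes f: "f \<in> imaps m n" and T: "T \<in> necklaces n" and A: "A \<in>: DT T a b"
 shows "NF m n f a b (NI n a b T A) = NI m a b (preN m f T) (nsm f T (preN m f T) a b A)"
proof (rule NM_ext)
 show "NF m n f a b (NI n a b T A) \<in>: NM m a b"
  by (intro nerve_map_closed[OF f] lin_closed[OF incl_lin[OF T]] A)
 show "NI m a b (preN m f T) (nsm f T (preN m f T) a b A) \<in>: NM m a b"
  by (intro lin_closed[OF incl_lin[OF preN_necklace[OF f T]]] lin_closed[OF nsm_linear[OF f T refl]] A)
 fix U assume U: "U \<in> necklaces m"
 interpret T: module R "DT U a b" by (rule DT_module)
 let ?K = "{T \<in> necklaces n. {i \<in> {..m}. f i \<in> T} = U}"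
 have z: "nsm f T' U a b \<zero>\<^bsub>DT T' a b\<^esub> = \<zero>\<^bsub>DT U a b\<^esub>" if "T' \<in> ?K" for T'
  using that by (intro lin_zero[OF DT_module DT_module nsm_linear[OF f]]) (auto simp: preN_def)
 have fin: "finite ?K" using finite_necklaces[of n] by simp
 have "NF m n f a b (NI n a b T A) U =
  finsum (DT U a b) (\<lambda>T'. if T' = T then nsm f T U a b A else \<zero>\<^bsub>DT U a b\<^esub>) ?K"
  unfolding nerve_map_def restrict_apply if_P[OF U]
 proof (rule T.finsum_cong'[OF refl])
  have "nsm f T U a b A \<in>: DT U a b" if "T \<in> ?K"
   using that by (intro lin_closed[OF nsm_linear[OF f T] A]) (auto simp: preN_def)
  then show "(\<lambda>T'. if T' = T then nsm f T U a b A else \<zero>\<^bsub>DT U a b\<^esub>) \<in> ?K \<rightarrow> carrier (DT U a b)"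
   using T.zero_closed by (simp add: Pi_def)
  fix T' assume T': "T' \<in> ?K"
  show "nsm f T' U a b (NI n a b T A T') =
    (if T' = T then nsm f T U a b A else \<zero>\<^bsub>DT U a b\<^esub>)"
   using z[OF T'] T' by (simp add: incl_app)
 qed
 also have "\<dots> = NI m a b (preN m f T) (nsm f T (preN m f T) a b A) U"
 proof (cases "U = preN m f T")
  case True
  have TK: "T \<in> ?K" using T True by (auto simp: preN_def)
  show ?thesis unfolding T.finsum_single[OF TK fin lin_closed[OF nsm_linear[OF f T True] A]]
   by (simp add: incl_app[OF U] True[symmetric])
 next
  case False
  then have "T \<notin> ?K" by (auto simp: preN_def)
  then have "finsum (DT U a b) (\<lambda>T'. if T' = T then nsm f T U a b A else \<zero>\<^bsub>DT U a b\<^esub>) ?K =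
   finsum (DT U a b) (\<lambda>T'. \<zero>\<^bsub>DT U a b\<^esub>) ?K"
   by (intro T.finsum_cong') auto
  then show ?thesis using False by (simp add: incl_app[OF U])
 qed
 finally show "NF m n f a b (NI n a b T A) U =
  NI m a b (preN m f T) (nsm f T (preN m f T) a b A) U" .
qed

lemma nJ_incl:
 assumes T: "T \<in> necklaces p" and U: "U \<in> necklaces q" and A: "A \<in>: DT T a c" and B: "B \<in>: DT U c b"
 shows "nJ p q a c b (NI p a c T A) (NI q c b U B) =
  NI (p + q) a b (joinN p T U) (TA Ob (dq T) (dq U) a b A B)"
proof (rule NM_ext)
 let ?V = "joinN p T U"
 have V: "?V \<in> necklaces (p + q)" by (rule joinN_necklace[OF T U])
 have pV: "p \<in> ?V" by (rule joinN_mid[OF T U])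
 note cut = cutL_joinN[OF T U] cutR_joinN[OF T U]
 show "nJ p q a c b (NI p a c T A) (NI q c b U B) \<in>: NM (p + q) a b"
  by (intro nJ_closed lin_closed[OF incl_lin] T U A B)
 have "TA Ob (dq T) (dq U) a b A B \<in>: DT ?V a b"
  using lin_closed[OF dapp_left[OF V pV] ] A B unfolding cut by blast
 then show "NI (p + q) a b ?V (TA Ob (dq T) (dq U) a b A B) \<in>: NM (p + q) a b"
  by (rule lin_closed[OF incl_lin[OF V]])
 fix W assume W: "W \<in> necklaces (p + q)"
 show "nJ p q a c b (NI p a c T A) (NI q c b U B) W =
   NI (p + q) a b ?V (TA Ob (dq T) (dq U) a b A B) W"
 proof (cases "p \<in> W")
  case True
  note L = cutL_necklace[OF W True] and R = cutR_necklace'[OF W True]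
  have iff: "W = ?V \<longleftrightarrow> cutL p W = T \<and> cutR p W = U" using joinN_cut[OF True] cut by metis
  interpret T1: module R "DT (cutL p W) a c" by (rule DT_module)
  interpret T2: module R "DT (cutR p W) c b" by (rule DT_module)
  have z1: "TA Ob (dq (cutL p W)) (dq (cutR p W)) a b \<zero>\<^bsub>DT (cutL p W) a c\<^esub> v = \<zero>\<^bsub>DT W a b\<^esub>"
   if "v \<in>: DT (cutR p W) c b" for v
   by (rule lin_zero[OF DT_module DT_module dapp_left[OF W True that]])
  have z2: "TA Ob (dq (cutL p W)) (dq (cutR p W)) a b v \<zero>\<^bsub>DT (cutR p W) c b\<^esub> = \<zero>\<^bsub>DT W a b\<^esub>"
   if "v \<in>: DT (cutL p W) a c" for v
   by (rule lin_zero[OF DT_module DT_module dapp_right[OF W True that]])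
  show ?thesis using True A B z1 z2
   by (auto simp: nJ_apply[OF W] incl_app[OF W] incl_app[OF L] incl_app[OF R] iff)
 next
  case False
  then show ?thesis using pV by (auto simp: nJ_apply[OF W] incl_app[OF W])
 qed
qed

text \<open>On summands, the preimage of a join is the join of the preimages, and the claim is
  \<open>nsm_append\<close>.\<close>

lemma nerve_map_J:
 assumes f: "f \<in> imaps p p'" and g: "g \<in> imaps q q'"
  and x: "x \<in>: NM p' a c" and y: "y \<in>: NM q' c b"
 shows "NF (p + q) (p' + q') (interval_sum p p' q f g) a b (nJ p' q' a c b x y) =
   nJ p q a c b (NF p p' f a c x) (NF q q' g c b y)"
proof -
 let ?h = "interval_sum p p' q f g"
 have h: "?h \<in> imaps (p + q) (p' + q')" by (rule interval_sum_map[OF f g])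
 have hp: "?h p = p'" by (rule interval_sum_mid[OF f])
 note fc = fcut_sum[OF f g]
 note nm = nerve_map_linear
 show ?thesis
 proof (rule NM_eqI[OF NM_module lin_comp[OF nm[OF h] nJ_left[OF y]] lin_comp[OF nJ_left[OF nerve_map_closed[OF g y]] nm[OF f]] _ x])
  fix T A assume T: "T \<in> necklaces p'" and A: "A \<in>: DT T a c"
  note iA = lin_closed[OF incl_lin[OF T] A]
  show "NF (p + q) (p' + q') ?h a b (nJ p' q' a c b (NI p' a c T A) y) =
    nJ p q a c b (NF p p' f a c (NI p' a c T A)) (NF q q' g c b y)"
  proof (rule NM_eqI[OF NM_module lin_comp[OF nm[OF h] nJ_right[OF iA]] lin_comp[OF nJ_right[OF nerve_map_closed[OF f iA]] nm[OF g]] _ y])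
   fix U B assume U: "U \<in> necklaces q'" and B: "B \<in>: DT U c b"
   let ?V = "joinN p' T U"
   have V: "?V \<in> necklaces (p' + q')" by (rule joinN_necklace[OF T U])
   have pV: "?h p \<in> ?V" unfolding hp by (rule joinN_mid[OF T U])
   have cut: "cutL (?h p) ?V = T" "cutR (?h p) ?V = U" unfolding hp by (rule cutL_joinN[OF T U], rule cutR_joinN[OF T U])
   have pre: "preN (p + q) ?h ?V = joinN p (preN p f T) (preN q g U)"
   proof -
    have "p \<in> preN (p + q) ?h ?V" using pV by (simp add: preN_def)
    from joinN_cut[OF this] show ?thesis using cutL_preN[OF _ h, of p ?V] cutR_preN[OF h, of ?V] by (simp add: cut fc)
   qed
   have ap: "TA Ob (dq T) (dq U) a b A B \<in>: DT ?V a b"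
    using lin_closed[OF dapp_left[OF V pV]] A B unfolding cut by blast
   have "NF (p + q) (p' + q') ?h a b (nJ p' q' a c b (NI p' a c T A) (NI q' c b U B)) =
    NI (p + q) a b (preN (p + q) ?h ?V)
     (nsm ?h ?V (preN (p + q) ?h ?V) a b (TA Ob (dq T) (dq U) a b A B))"
    by (simp only: nJ_incl[OF T U A B] nerve_map_incl[OF h V ap])
   also have "nsm ?h ?V (preN (p + q) ?h ?V) a b (TA Ob (dq T) (dq U) a b A B)
    = TA Ob (dq (preN p f T)) (dq (preN q g U)) a b
     (nsm f T (preN p f T) a c A) (nsm g U (preN q g U) c b B)"
    using nsm_append[OF h V pV, unfolded cut fc, OF A B] .
   also have "NI (p + q) a b (preN (p + q) ?h ?V) \<dots> = nJ p q a c b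
     (NI p a c (preN p f T) (nsm f T (preN p f T) a c A))
     (NI q c b (preN q g U) (nsm g U (preN q g U) c b B))"
    unfolding pre by (intro nJ_incl[symmetric] preN_necklace[OF f T] preN_necklace[OF g U]
     lin_closed[OF nsm_linear[OF f T refl] A] lin_closed[OF nsm_linear[OF g U refl] B])
   finally show "NF (p + q) (p' + q') ?h a b (nJ p' q' a c b (NI p' a c T A) (NI q' c b U B)) =
    nJ p q a c b (NF p p' f a c (NI p' a c T A)) (NF q q' g c b (NI q' c b U B))"
    by (simp only: nerve_map_incl[OF f T A] nerve_map_incl[OF g U B])
  qed
 qed
qed

lemma nerve_map_id:
 assumes "x \<in>: NM n a b"
 shows "NF n n (\<lambda>i\<in>{..n}. i) a b x = x"
proof (rule NM_eqI[OF NM_module nerve_map_linear[OF interval_maps_id] lin_id _ assms])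
 fix T A assume T: "T \<in> necklaces n" and A: "A \<in>: DT T a b"
 have pre: "preN n (\<lambda>i\<in>{..n}. i) T = T" using necklacesD(3)[OF T] by (auto simp: preN_def)
 show "NF n n (\<lambda>i\<in>{..n}. i) a b (NI n a b T A) = NI n a b T A"
  unfolding nerve_map_incl[OF interval_maps_id T A] pre nsm_id[OF T A] ..
qed

lemma nerve_map_comp:
 assumes f: "f \<in> imaps l m" and g: "g \<in> imaps m n" and x: "x \<in>: NM n a b"
 shows "NF l n (compose {..l} g f) a b x = NF l m f a b (NF m n g a b x)"
proof -
 have h: "compose {..l} g f \<in> imaps l n" by (rule interval_maps_comp[OF f g])
 show ?thesis
 proof (rule NM_eqI[OF NM_module nerve_map_linear[OF h] lin_comp[OF nerve_map_linear[OF f] nerve_map_linear[OF g]] _ x])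
  fix T A assume T: "T \<in> necklaces n" and A: "A \<in>: DT T a b"
  note gT = preN_necklace[OF g T] and gA = lin_closed[OF nsm_linear[OF g T refl] A]
  show "NF l n (compose {..l} g f) a b (NI n a b T A) =
    NF l m f a b (NF m n g a b (NI n a b T A))"
   unfolding nerve_map_incl[OF h T A] nerve_map_incl[OF g T A] nerve_map_incl[OF f gT gA] nsm_comp[OF f g T refl refl A] preN_comp[OF f] ..
 qed
qed

text \<open>T is contained in the preimage of V exactly when f(T) is contained in V.\<close>

lemma nP_nerve_map:
 assumes f: "f \<in> imaps m n" and T: "T \<subseteq> {..m}" and x: "x \<in>: NM n a b"
 shows "nP m T a b (NF m n f a b x) = NF m n f a b (nP n (f ` T) a b x)"
proof (rule NM_eqI[OF NM_module lin_comp[OF nP_linear nerve_map_linear[OF f]] lin_comp[OF nerve_map_linear[OF f] nP_linear] _ x])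
 fix V A assume V: "V \<in> necklaces n" and A: "A \<in>: DT V a b"
 have iff: "T \<subseteq> preN m f V \<longleftrightarrow> f ` T \<subseteq> V" using T by (auto simp: preN_def)
 have "NF m n f a b \<zero>\<^bsub>NM n a b\<^esub> = \<zero>\<^bsub>NM m a b\<^esub>" by (rule lin_zero[OF NM_module NM_module nerve_map_linear[OF f]])
 then show "nP m T a b (NF m n f a b (NI n a b V A)) = NF m n f a b (nP n (f ` T) a b (NI n a b V A))"
  by (simp add: nerve_map_incl[OF f V A] nP_incl[OF V] nP_incl[OF preN_necklace[OF f V]] iff)
qed

section \<open>Comultiplication and counit of the nerve\<close>

lemma quivers_NM: "qv Ob [NM p, NM q]" using NM_module by simp

definition "split_fn p q V a b = (let l = card {t \<in> V. t < p} in (\<lambda>(cs,xs). pure R Ob [NM p, NM q] [a, cs ! l, b]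
     [NI p a (cs ! l) (cutL p V) (pure R Ob (dq (cutL p V)) (take (Suc l) cs) (take l xs)),
      NI q (cs ! l) b (cutR p V) (pure R Ob (dq (cutR p V)) (drop l cs) (drop l xs))]))"

lemma split_fn_append:
 assumes V: "V \<in> necklaces (p + q)" and pV: "p \<in> V"
  and p1: "(cs,xs) \<in> dpaths (cutL p V) a c" and p2: "(ds,ys) \<in> dpaths (cutR p V) c b"
 shows "split_fn p q V a b (cs @ tl ds, xs @ ys) = pure R Ob [NM p, NM q] [a,c,b]
    [NI p a c (cutL p V) (pure R Ob (dq (cutL p V)) cs xs),
     NI q c b (cutR p V) (pure R Ob (dq (cutR p V)) ds ys)]"
proof -
 let ?l = "card {t \<in> V. t < p}" and ?L = "cutL p V"
 have L: "?L \<in> necklaces p" by (rule cutL_necklace[OF V pV])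
 have "{t \<in> V. t < p} = ?L - {p}" by (auto simp: cutL_iff)
 then have l: "?l = card ?L - 1" using pV nec_finite[OF L] by (simp add: cutL_iff)
 note D1 = pathsD[OF p1] and D2 = pathsD[OF p2]
 have lc: "length cs = Suc ?l" "length xs = ?l" using D1(1,2) by (simp_all only: length_dquivers l)
 have la: "last cs = hd ds" using D1(4) D2(3) by simp
 have n: "(cs @ tl ds) ! ?l = c" using lc D1(4) last_conv_nth[OF D1(8)] by (simp add: nth_append)
 have "drop ?l (cs @ tl ds) = drop ?l cs @ tl ds" using lc by simp
 also have "drop ?l cs = [last cs]" using lc append_eq_conv_conj[of "butlast cs" "[last cs]" cs] D1(8) by simp
 also have "[last cs] @ tl ds = ds" using la D2(8) by simp
 finally have d: "drop ?l (cs @ tl ds) = ds" .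
 show ?thesis unfolding split_fn_def Let_def case_prod_conv n d using lc by simp
qed

lemma split_fn_multilinear:
 assumes V: "V \<in> necklaces (p + q)" and pV: "p \<in> V"
 shows "MLin Ob (dq V) a b (TT Ob [NM p, NM q] a b) (split_fn p q V a b)"
  (is "multilinear _ _ _ _ _ ?N _")
proof -
 let ?L = "cutL p V" and ?R = "cutR p V"
 have L: "?L \<in> necklaces p" by (rule cutL_necklace[OF V pV])
 have R: "?R \<in> necklaces q" by (rule cutR_necklace'[OF V pV])
 note e = split_fn_append[OF V pV]
 show ?thesis unfolding dquivers_cut[OF V pV]
 proof (rule multilinear_append[OF _ _ quivers_d quivers_d])
  fix c ds ys assume p2: "(ds,ys) \<in> dpaths ?R c b"
  let ?y = "NI q c b ?R (pure R Ob (dq ?R) ds ys)"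
  have y: "?y \<in>: NM q c b" using pure_closed[OF quivers_d p2] by (intro lin_closed[OF incl_lin[OF R]]) (simp add: dtensor_def)
  show "MLin Ob (dq ?L) a c ?N (\<lambda>(cs,xs). split_fn p q V a b (cs @ tl ds, xs @ ys))"
  proof (cases "a \<in> Ob")
   case True
   have "MLin Ob (dq ?L) a c ?N (\<lambda>v. pure R Ob [NM p, NM q] [a,c,b]
     [NI p a c ?L (case v of (cs,xs) => pure R Ob (dq ?L) cs xs), ?y])"
    by (rule multilinear_comp[OF pure_multilinear[OF quivers_d] lin_comp[OF
      pure_pair_linear(1)[OF quivers_NM True pathsD(6,7)[OF p2] y] incl_lin[OF L], unfolded dtensor_def]])
   from quivers_d[of ?L] this show ?thesis
    by (rule multilinear_congI) (simp add: e[OF _ p2])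
  next
   case False
   then have "dpaths ?L a c = {}" using pathsD(6) by fastforce
   then show ?thesis by (simp add: multilinear_def)
  qed
 next
  fix c cs xs assume p1: "(cs,xs) \<in> dpaths ?L a c"
  let ?x = "NI p a c ?L (pure R Ob (dq ?L) cs xs)"
  have x: "?x \<in>: NM p a c" using pure_closed[OF quivers_d p1] by (intro lin_closed[OF incl_lin[OF L]]) (simp add: dtensor_def)
  show "MLin Ob (dq ?R) c b ?N (\<lambda>(ds,ys). split_fn p q V a b (cs @ tl ds, xs @ ys))"
  proof (cases "b \<in> Ob")
   case True
   have "MLin Ob (dq ?R) c b ?N (\<lambda>v. pure R Ob [NM p, NM q] [a,c,b]
     [?x, NI q c b ?R (case v of (cs,xs) => pure R Ob (dq ?R) cs xs)])"
    by (rule multilinear_comp[OF pure_multilinear[OF quivers_d] lin_comp[OF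
      pure_pair_linear(2)[OF quivers_NM pathsD(6,7)[OF p1] True x] incl_lin[OF R], unfolded dtensor_def]])
   from quivers_d[of ?R] this show ?thesis
    by (rule multilinear_congI) (simp add: e[OF p1])
  next
   case False
   then have "dpaths ?R c b = {}" using pathsD(7) by fastforce
   then show ?thesis by (simp add: multilinear_def)
  qed
 qed
qed

lemma nerve_split_cut: "nsplit p q V a b = tensor_lift R (TT Ob [NM p, NM q] a b) (split_fn p q V a b)"
 unfolding nerve_split_def split_fn_def Let_def cutL_def cutR_def ..

lemma NMNM_module: "module R (TT Ob [NM p, NM q] a b)"
 by (rule TT_module[OF quivers_NM])

lemma nerve_split_linear:
 assumes "V \<in> necklaces (p + q)" "p \<in> V"
 shows "nsplit p q V a b \<in> Lin (DT V a b) (TT Ob [NM p, NM q] a b)"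
 unfolding nerve_split_cut dtensor_def by (rule tensor_lift_linear[OF quivers_d NMNM_module split_fn_multilinear[OF assms]])

text \<open>Written in terms of the two halves, the splitting no longer mentions positions. Both
  composites of \<open>\<mu>\<close> with juxtaposition are computed from this form.\<close>

lemma nerve_split_append:
 assumes V: "V \<in> necklaces (p + q)" and pV: "p \<in> V" and S: "a \<in> Ob" "c \<in> Ob" "b \<in> Ob"
  and A: "A \<in>: DT (cutL p V) a c" and B: "B \<in>: DT (cutR p V) c b"
 shows "nsplit p q V a b (TA Ob (dq (cutL p V)) (dq (cutR p V)) a b A B) =
  pure R Ob [NM p, NM q] [a,c,b] [NI p a c (cutL p V) A, NI q c b (cutR p V) B]"
proof -
 let ?L = "cutL p V" and ?R = "cutR p V"
 have L: "?L \<in> necklaces p" by (rule cutL_necklace[OF V pV])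
 have R: "?R \<in> necklaces q" by (rule cutR_necklace'[OF V pV])
 note sp = nerve_split_linear[OF V pV] and q = quivers_d
 note A' = A[unfolded dtensor_def] and B' = B[unfolded dtensor_def]
 have iB: "NI q c b ?R B \<in>: NM q c b" by (rule lin_closed[OF incl_lin[OF R] B])
 note Nm = NMNM_module[of p q a b]
 show ?thesis
 proof (rule tensor_eqI[OF q Nm lin_comp[OF sp dapp_left[OF V pV B], unfolded dtensor_def[of R D ?L]]
   lin_comp[OF pure_pair_linear(1)[OF quivers_NM S iB] incl_lin[OF L], unfolded dtensor_def[of R D ?L]] _ A'])
  fix cs xs assume p1: "(cs,xs) \<in> dpaths ?L a c"
  have pA: "pure R Ob (dq ?L) cs xs \<in>: DT ?L a c" using pure_closed[OF q p1] by (simp add: dtensor_def)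
  have iA: "NI p a c ?L (pure R Ob (dq ?L) cs xs) \<in>: NM p a c"
   by (rule lin_closed[OF incl_lin[OF L] pA])
  show "nsplit p q V a b (TA Ob (dq ?L) (dq ?R) a b (pure R Ob (dq ?L) cs xs) B) =
   pure R Ob [NM p, NM q] [a,c,b] [NI p a c ?L (pure R Ob (dq ?L) cs xs), NI q c b ?R B]"
  proof (rule tensor_eqI[OF q Nm lin_comp[OF sp dapp_right[OF V pV pA], unfolded dtensor_def[of R D ?R]]
    lin_comp[OF pure_pair_linear(2)[OF quivers_NM S iA] incl_lin[OF R], unfolded dtensor_def[of R D ?R]] _ B'])
   fix ds ys assume p2: "(ds,ys) \<in> dpaths ?R c b"
   have pp: "(cs @ tl ds, xs @ ys) \<in> dpaths V a b"
    unfolding dquivers_cut[OF V pV] by (rule paths_append[OF p1 p2])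
   show "nsplit p q V a b (TA Ob (dq ?L) (dq ?R) a b
     (pure R Ob (dq ?L) cs xs) (pure R Ob (dq ?R) ds ys)) =
    pure R Ob [NM p, NM q] [a,c,b] [NI p a c ?L (pure R Ob (dq ?L) cs xs),
     NI q c b ?R (pure R Ob (dq ?R) ds ys)]"
    using tensor_lift_pure[OF q Nm split_fn_multilinear[OF V pV] pp] split_fn_append[OF V pV p1 p2]
    unfolding nerve_split_cut[symmetric] tensor_append_pure[OF q q p1 p2] dquivers_cut[OF V pV, symmetric] by simp
  qed
 qed
qed

lemma nerve_comult_linear: "nerve_comult R D p q a b \<in> Lin (NM (p + q) a b) (TT Ob [NM p, NM q] a b)"
 unfolding nerve_comult_def[abs_def]
 by (rule lin_finsum_fun[OF NM_module NMNM_module]) (auto intro!: lin_comp[OF nerve_split_linear NM_proj])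

lemma nerve_comult_incl:
 assumes V: "V \<in> necklaces (p + q)" and A: "A \<in>: DT V a b"
 shows "nerve_comult R D p q a b (NI (p + q) a b V A) =
  (if p \<in> V then nsplit p q V a b A else \<zero>\<^bsub>TT Ob [NM p, NM q] a b\<^esub>)"
proof -
 let ?N = "TT Ob [NM p, NM q] a b" and ?K = "{T \<in> necklaces (p + q). p \<in> T}"
 interpret N: module R ?N by (rule NMNM_module)
 have z: "nsplit p q T a b \<zero>\<^bsub>DT T a b\<^esub> = \<zero>\<^bsub>?N\<^esub>" if "T \<in> ?K" for T
  using that by (intro lin_zero[OF DT_module NMNM_module nerve_split_linear]) auto
 have c: "nsplit p q V a b A \<in>: ?N" if "p \<in> V" by (rule lin_closed[OF nerve_split_linear[OF V that] A])
 have fin: "finite ?K" using finite_necklaces[of "p + q"] by simp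
 have "nerve_comult R D p q a b (NI (p + q) a b V A) =
  finsum ?N (\<lambda>T. if T = V then (if p \<in> V then nsplit p q V a b A else \<zero>\<^bsub>?N\<^esub>) else \<zero>\<^bsub>?N\<^esub>) ?K"
  unfolding nerve_comult_def using z c by (intro N.finsum_cong') (auto simp: incl_app)
 also have "\<dots> = (if p \<in> V then nsplit p q V a b A else \<zero>\<^bsub>?N\<^esub>)"
 proof (cases "p \<in> V")
  case True
  then show ?thesis using V fin c by (subst N.finsum_single) auto
 next
  case False
  then have "finsum ?N (\<lambda>T. if T = V then (if p \<in> V then nsplit p q V a b A else \<zero>\<^bsub>?N\<^esub>) else \<zero>\<^bsub>?N\<^esub>) ?K = finsum ?N (\<lambda>T. \<zero>\<^bsub>?N\<^esub>) ?K"
   by (intro N.finsum_cong') auto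
  then show ?thesis using False by simp
 qed
 finally show ?thesis .
qed

text \<open>Juxtaposition yields only necklaces through p, and \<open>\<mu>\<close> cuts them there
  again.\<close>

lemma nerve_comult_J:
 assumes S: "a \<in> Ob" "c \<in> Ob" "b \<in> Ob" and x: "x \<in>: NM p a c" and y: "y \<in>: NM q c b"
 shows "nerve_comult R D p q a b (nJ p q a c b x y) = pure R Ob [NM p, NM q] [a,c,b] [x,y]"
proof (rule NM_eqI[OF NMNM_module lin_comp[OF nerve_comult_linear nJ_left[OF y]] pure_pair_linear(1)[OF quivers_NM S y] _ x])
 fix T A assume T: "T \<in> necklaces p" and A: "A \<in>: DT T a c"
 note iA = lin_closed[OF incl_lin[OF T] A]
 show "nerve_comult R D p q a b (nJ p q a c b (NI p a c T A) y) = pure R Ob [NM p, NM q] [a,c,b] [NI p a c T A,y]"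
 proof (rule NM_eqI[OF NMNM_module lin_comp[OF nerve_comult_linear nJ_right[OF iA]] pure_pair_linear(2)[OF quivers_NM S iA] _ y])
  fix U B assume U: "U \<in> necklaces q" and B: "B \<in>: DT U c b"
  let ?V = "joinN p T U"
  have V: "?V \<in> necklaces (p + q)" by (rule joinN_necklace[OF T U])
  have pV: "p \<in> ?V" by (rule joinN_mid[OF T U])
  note cut = cutL_joinN[OF T U] cutR_joinN[OF T U]
  have ap: "TA Ob (dq T) (dq U) a b A B \<in>: DT ?V a b"
   using lin_closed[OF dapp_left[OF V pV]] A B unfolding cut by blast
  show "nerve_comult R D p q a b (nJ p q a c b (NI p a c T A) (NI q c b U B)) =
   pure R Ob [NM p, NM q] [a,c,b] [NI p a c T A, NI q c b U B]"
   using nerve_split_append[OF V pV S, unfolded cut, OF A B] pV by (simp add: nJ_incl[OF T U A B] nerve_comult_incl[OF V ap])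
 qed
qed

definition "ncounit a b z = tensor_lift R (unit_quiver R a b) (\<lambda>_. \<one>) (z {0})"

lemma unit_multilinear: "MLin Ob ([] :: ('k,'o,'d) quiver list) a b (unit_quiver R a b) (\<lambda>_. \<one>)"
 by (simp add: multilinear_Nil unit_quiver_def)

lemma ncounit_linear: "ncounit a b \<in> Lin (NM 0 a b) (unit_quiver R a b)"
proof -
 have "tensor_lift R (unit_quiver R a b) (\<lambda>_. \<one>) \<in> Lin (DT {0} a b) (unit_quiver R a b)"
  unfolding dtensor_def dquivers_0 by (rule tensor_lift_linear[OF _ unit_quiver_module unit_multilinear]) simp
 from lin_comp[OF this NM_proj[OF necklace0]] show ?thesis unfolding ncounit_def[abs_def] .
qed

lemma nu_incl: "nu a = NI 0 a a {0} (pure R Ob [] [a] [])"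
 by (auto simp: nu_def nerve_incl_def summand_incl_def necklaces_0 fun_eq_iff)

lemma ncounit_nu: "a \<in> Ob ==> ncounit a a (nu a) = \<one>"
 using tensor_lift_pure[OF _ unit_quiver_module unit_multilinear, of "[a]" "[]" a a]
 by (simp add: ncounit_def nu_def necklaces_0 paths_Nil)

text \<open>Degree 0 has the single necklace {0}, whose summand is the empty tensor product:
  generated by \<open>nu a\<close> for a = b, zero otherwise.\<close>

lemma ncounit_eq:
 assumes S: "a \<in> Ob" "b \<in> Ob" and x: "x \<in>: NM 0 a b"
 shows "x = (if a = b then ncounit a b x \<odot>\<^bsub>NM 0 a b\<^esub> nu a else \<zero>\<^bsub>NM 0 a b\<^esub>)"
proof -
 let ?g = "\<lambda>x. if a = b then ncounit a b x \<odot>\<^bsub>NM 0 a b\<^esub> nu a else \<zero>\<^bsub>NM 0 a b\<^esub>"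
 have g: "?g \<in> Lin (NM 0 a b) (NM 0 a b)"
 proof (cases "a = b")
  case [simp]: True
  interpret N: module R "NM 0 b b" by (rule NM_module)
  note c = ncounit_linear[of b b]
  show ?thesis using lin_closed[OF c] lin_add[OF c] lin_smult[OF c] nu_closed[OF S(2)]
   by (intro lin_mapsI) (simp_all add: unit_quiver_def N.smult_l_distr N.smult_assoc1)
 next
  case False
  then show ?thesis using lin_const_zero[OF NM_module] by simp
 qed
 show ?thesis
 proof (rule NM_eqI[OF NM_module lin_id g _ x])
  fix V A assume "V \<in> necklaces 0" and A: "A \<in>: DT V a b"
  then have V: "V = {0}" by (simp add: necklaces_0)
  have A': "A \<in>: TT Ob [] a b" using A by (simp add: V dtensor_def)
  have inc: "NI 0 a b {0} \<in> Lin (TT Ob [] a b) (NM 0 a b)"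
   using incl_lin[OF necklace0, of a b] by (simp add: dtensor_def)
  show "NI 0 a b V A = ?g (NI 0 a b V A)" unfolding V
  proof (rule tensor_eqI[OF _ NM_module inc lin_comp[OF g inc] _ A'])
   fix cs xs assume "(cs,xs) \<in> paths Ob ([] :: ('k,'o,'d) quiver list) a b"
   then have p: "cs = [a]" "xs = []" "a = b" "a \<in> Ob" by (auto simp: paths_Nil)
   interpret N: module R "NM 0 a a" by (rule NM_module)
   show "NI 0 a b {0} (pure R Ob [] cs xs) = ?g (NI 0 a b {0} (pure R Ob [] cs xs))"
    using N.smult_one[OF nu_closed[OF p(4)]] ncounit_nu[OF p(4)] nu_incl[of a] p by simp
  qed simp
 qed
qed

lemma NX_simps: "tvert NX = Ob" "tmod NX = NM" "tmap NX = NF" "tcomult NX = nerve_comult R D" "tcounit NX = ncounit"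
 by (simp_all add: templicial_of_cat_def ncounit_def[abs_def])

lemma nerve_graded_sub: "graded_sub R Ob NM nJ nu NM"
 by (intro graded_sub.intro nerve_graded graded_sub_axioms.intro) (simp_all add: NM_module)

interpretation N: graded_sub R "Ob" NM nJ nu NM by (rule nerve_graded_sub)

text \<open>A summand through p is cut and rejoined unchanged, any other is annihilated by
  \<open>\<mu>\<close>.\<close>

lemma Phi_nerve_comult:
 assumes S: "a \<in> Ob" "b \<in> Ob" and x: "x \<in>: NM (p + q) a b"
 shows "N.Phi [p,q] a b (nerve_comult R D p q a b x) = nP (p + q) {p} a b x"
proof -
 have Ph: "N.Phi [p,q] a b \<in> Lin (TT Ob [NM p, NM q] a b) (NM (p + q) a b)"
  using N.Phi_linear[OF S, of "[p,q]"] by simp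
 show ?thesis
 proof (rule NM_eqI[OF NM_module lin_comp[OF Ph nerve_comult_linear] nP_linear _ x])
  fix V A assume V: "V \<in> necklaces (p + q)" and A: "A \<in>: DT V a b"
  show "N.Phi [p,q] a b (nerve_comult R D p q a b (NI (p + q) a b V A)) = nP (p + q) {p} a b (NI (p + q) a b V A)"
  proof (cases "p \<in> V")
   case pV: True
   let ?L = "cutL p V" and ?R = "cutR p V"
   have L: "?L \<in> necklaces p" by (rule cutL_necklace[OF V pV])
   have R: "?R \<in> necklaces q" by (rule cutR_necklace'[OF V pV])
   have "N.Phi [p,q] a b (nsplit p q V a b A) = NI (p + q) a b V A"
   proof (rule tensor_eqI[OF quivers_d NM_module lin_comp[OF Ph nerve_split_linear[OF V pV], unfolded dtensor_def]
      incl_lin[OF V, unfolded dtensor_def] _ A[unfolded dtensor_def]])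
    fix es zs assume "(es,zs) \<in> dpaths V a b"
    then obtain c cs xs ds ys where p1: "(cs,xs) \<in> dpaths ?L a c" and p2: "(ds,ys) \<in> dpaths ?R c b"
     and e: "es = cs @ tl ds" "zs = xs @ ys" unfolding dquivers_cut[OF V pV] by (rule paths_appendE)
    have c: "c \<in> Ob" by (rule pathsD(7)[OF p1])
    have A: "pure R Ob (dq ?L) cs xs \<in>: DT ?L a c" using pure_closed[OF quivers_d p1] by (simp add: dtensor_def)
    have B: "pure R Ob (dq ?R) ds ys \<in>: DT ?R c b" using pure_closed[OF quivers_d p2] by (simp add: dtensor_def)
    have pe: "pure R Ob (dq V) es zs = TA Ob (dq ?L) (dq ?R) a b
      (pure R Ob (dq ?L) cs xs) (pure R Ob (dq ?R) ds ys)"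
     unfolding tensor_append_pure[OF quivers_d quivers_d p1 p2] e dquivers_cut[OF V pV, symmetric] ..
    show "N.Phi [p,q] a b (nsplit p q V a b (pure R Ob (dq V) es zs)) = NI (p + q) a b V (pure R Ob (dq V) es zs)"
     unfolding pe nerve_split_append[OF V pV S(1) c S(2) A B]
      N.Phi_pair[OF S c lin_closed[OF incl_lin[OF L] A] lin_closed[OF incl_lin[OF R] B]] nJ_incl[OF L R A B] joinN_cut[OF pV] ..
   qed
   then show ?thesis using pV by (simp add: nerve_comult_incl[OF V A] nP_incl[OF V])
  next
   case False
   then show ?thesis using lin_zero[OF NMNM_module NM_module Ph] by (simp add: nerve_comult_incl[OF V A] nP_incl[OF V])
  qed
 qed
qed

lemma nP_nP: "x \<in>: NM n a b ==> nP n T a b (nP n U a b x) = nP n (T \<union> U) a b x"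
 by (auto simp: nP_def fun_eq_iff)

lemma nP_triv:
 assumes "T \<subseteq> {0,n}" "x \<in>: NM n a b"
 shows "nP n T a b x = x"
proof (rule NM_ext[OF nP_closed[OF assms(2)] assms(2)])
 fix V assume V: "V \<in> necklaces n"
 then have "T \<subseteq> V" using assms(1) necklacesD(1,2)[OF V] by auto
 then show "nP n T a b x V = x V" by (simp add: nP_apply[OF V])
qed

lemma nerve_frob: "frob R Ob NM nJ nu NM NX (NF) nP"
 by (rule frob.intro[OF nerve_graded_sub], rule frob_axioms.intro, unfold NX_simps)
  (rule refl nerve_map_linear nerve_map_id nerve_map_comp nerve_map_J nP_linear nP_nP nP_triv nP_J nP_nerve_map
   nerve_comult_linear Phi_nerve_comult ncounit_linear nu_closed ncounit_nu ncounit_eq; assumption)+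

lemma nerve_frob_split: "frob_split R Ob NM nJ nu NX (NF) nP"
 by (intro frob_split.intro nerve_frob frob_split_axioms.intro; unfold NX_simps) (rule nerve_comult_J)

end

section \<open>Horn filling\<close>

text \<open>The order map omitting the value r. Both r = 0 and r = p are allowed, so outer faces are
  included.\<close>

definition face :: "nat => nat => nat => nat" where
 "face p r = (\<lambda>k\<in>{..<p}. if k < r then k else Suc k)"

text \<open>The surjection that takes the value r twice, at r and at \<open>Suc r\<close>.\<close>

definition degen :: "nat => nat => nat => nat" where
 "degen p r = (\<lambda>k\<in>{..<Suc p}. if k \<le> r then k else k - 1)"

definition coface :: "nat => nat => nat => nat" where
 "coface m i = (\<lambda>k\<in>{..m}. if k < i then k else Suc k)"

lemma face_order: "r \<le> p ==> face p r \<in> order_maps {..<p} {..<Suc p}"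
 by (auto simp: face_def order_maps_def mono_on_def)

lemma degen_order: "r < p ==> degen p r \<in> order_maps {..<Suc p} {..<p}"
 by (auto simp: degen_def order_maps_def mono_on_def)

lemma coface_map: "[|0 < i; i \<le> m|] ==> coface m i \<in> imaps m (Suc m)"
 by (rule imapsI) (auto simp: coface_def)

lemma face_face: "r < t ==> compose {..<p} (face (Suc p) t) (face p r) = compose {..<p} (face (Suc p) r) (face p (t - 1))"
 by (auto simp: face_def compose_def fun_eq_iff)

lemma degen_face_id: "i = r \<or> i = Suc r ==> compose {..<p} (degen p r) (face p i) = (\<lambda>k\<in>{..<p}. k)"
 by (auto simp: face_def degen_def compose_def fun_eq_iff)

lemma degen_face_less: "[|i < r; r < Suc p|] ==> compose {..<Suc p} (degen (Suc p) r) (face (Suc p) i) = compose {..<Suc p} (face p i) (degen p (r - 1))"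
 by (auto simp: face_def degen_def compose_def fun_eq_iff)

lemma degen_face_greater: "[|Suc r < i; i \<le> Suc p|] ==> compose {..<Suc p} (degen (Suc p) r) (face (Suc p) i) = compose {..<Suc p} (face p (i - 1)) (degen p r)"
 by (auto simp: face_def degen_def compose_def fun_eq_iff)

lemma coface_coface: "i < i' ==> compose {..m} (coface (Suc m) i') (coface m i) = compose {..m} (coface (Suc m) i) (coface m (i' - 1))"
 by (auto simp: coface_def compose_def fun_eq_iff)

text \<open>The inner vertices start at 1 and are renumbered from 0, which shifts the index by one.
  As i runs from 1 to m, all faces of the ordinal with m elements occur, outer ones
  included.\<close>

lemma std_order_map_coface:
 assumes "0 < i" "i \<le> m"
 shows "std_order_map {0<..<m} {0<..<Suc m} (coface m i) = face (m - 1) (i - 1)"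
proof
 fix k
 have s: "sl {0<..<m} = map Suc [0..<m - 1]"
  using assms by (intro strict_sorted_equal strict_sorted_list_of_set) (auto simp: sorted_wrt_map image_iff intro!: bexI[of _ "_ - 1"])
 have c: "card {x \<in> {0<..<Suc m}. x < y} = y - 1" if "y \<le> Suc m" for y
 proof -
  have "{x \<in> {0<..<Suc m}. x < y} = {0<..<y}" using that by auto
  then show ?thesis by simp
 qed
 show "std_order_map {0<..<m} {0<..<Suc m} (coface m i) k = face (m - 1) (i - 1) k"
 proof (cases "k < m - 1")
  case True
  have "coface m i (Suc k) \<le> Suc m" using True by (auto simp: coface_def)
  then show ?thesis using True assms c by (auto simp: std_order_map_def s face_def coface_def)
 qed (simp add: std_order_map_def face_def)
qed

context asmod
begin

lemma dmap_face_closed: "[|r \<le> p; a \<in> Ob; b \<in> Ob; x \<in>: dM (Suc p) a b|]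
  ==> dm p (Suc p) (face p r) a b x \<in>: dM p a b"
 by (rule lin_closed[OF dmap_linear[OF face_order]])

text \<open>One step of the classical proof that simplicial groups are Kan: w already has the right
  faces in K, and adding a degeneracy of its error at t corrects face t. The conditions on d make
  that degeneracy a section of face t and leave the faces in K unchanged.\<close>

lemma kan_step:
 assumes S: "a \<in> Ob" "b \<in> Ob" and w: "w \<in>: dM (Suc p) a b" and v: "\<And>r. r \<le> p ==> r \<noteq> s ==> v r \<in>: dM p a b"
  and compat: "\<And>r r' q. [|p = Suc q; r < r'; r' \<le> p; r \<noteq> s; r' \<noteq> s|] ==>
    dm q p (face q r) a b (v r') = dm q p (face q (r' - 1)) a b (v r)"
  and K: "\<And>r. r \<in> K ==> r \<le> p \<and> r \<noteq> s \<and> dm p (Suc p) (face p r) a b w = v r"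
  and t: "t \<le> p" "t \<noteq> s" and d: "d < p" "t = d \<or> t = Suc d" and Kd: "\<And>r. r \<in> K ==> r < t \<and> r < d \<or> t < r \<and> Suc d < r"
 shows "\<exists>w'\<in>carrier (dM (Suc p) a b). \<forall>r\<in>insert t K. dm p (Suc p) (face p r) a b w' = v r"
proof -
 let ?M = "dM (Suc p) a b" and ?N = "dM p a b"
 let ?d = "\<lambda>r. dm p (Suc p) (face p r) a b" and ?s = "dm (Suc p) p (degen p d) a b"
 interpret M: module R ?M by (rule M_module[OF S])
 interpret N: module R ?N by (rule M_module[OF S])
 obtain q where q: "p = Suc q" using d(1) by (cases p) auto
 have dl: "?d r \<in> Lin ?M ?N" if "r \<le> p" for r by (rule dmap_linear[OF face_order[OF that] S])
 have sl: "?s \<in> Lin ?N ?M" by (rule dmap_linear[OF degen_order[OF d(1)] S])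
 define e where "e = v t \<ominus>\<^bsub>?N\<^esub> ?d t w"
 have dw: "?d t w \<in>: ?N" by (rule lin_closed[OF dl[OF t(1)] w])
 have e: "e \<in>: ?N" unfolding e_def using v[OF t] dw by simp
 have se: "?s e \<in>: ?M" by (rule lin_closed[OF sl e])
 have 1: "?d t (?s e) = e"
  using dmap_comp[OF face_order[OF t(1)] degen_order[OF d(1)] S e] degen_face_id[of t d p] d(2) dmap_id[OF S e] by auto
 \<comment> \<open>The simplicial identities turn this into a degeneracy of a face of e, and that
   face vanishes because v is compatible and w already has face \<open>v r\<close>.\<close>
 have 2: "?d r (?s e) = \<zero>\<^bsub>?N\<^esub>" if r: "r \<in> K" for r
 proof -
  have rp: "r \<le> p" "r \<noteq> s" and rw: "?d r w = v r" using K[OF r] by auto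
  let ?L = "dM q a b"
  have ql: "dm q p (face q i) a b \<in> Lin ?N ?L" if "i \<le> q" for i
   using dmap_linear[OF face_order[OF that] S] unfolding q .
  have zero: "dm q p (face q i) a b e = \<zero>\<^bsub>?L\<^esub>" if i: "i \<le> q" and eq: "dm q p (face q i) a b (v t) = dm q p (face q i) a b (?d t w)" for i
  proof -
   interpret L: module R ?L by (rule M_module[OF S])
   have "dm q p (face q i) a b (?d t w) \<in>: ?L" by (rule lin_closed[OF ql[OF i] dw])
   then show ?thesis unfolding e_def using lin_minus[OF M_module[OF S] M_module[OF S] ql[OF i] v[OF t] dw] eq
    by (simp add: L.minus_eq L.r_neg)
  qed
  have fd: "dm q p (face q i) a b (?d t' w) = dm q (Suc p) (compose {..<q} (face p t') (face q i)) a b w" if "i \<le> q" "t' \<le> p" for i t'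
   using dmap_comp[OF face_order[OF that(1)] face_order[OF that(2)[unfolded q]] S w[unfolded q]] unfolding q by simp
  have ds: "?d r (?s e) = dm p p (compose {..<p} (degen p d) (face p r)) a b e"
   using dmap_comp[OF face_order[OF rp(1)] degen_order[OF d(1)] S e] by simp
  have sd: "dm p q (degen q d') a b (dm q p (face q i) a b e) = dm p p (compose {..<p} (face q i) (degen q d')) a b e"
   if "d' < q" "i \<le> q" for d' i
   using dmap_comp[OF degen_order[OF that(1)] face_order[OF that(2)] S e[unfolded q]] unfolding q by simp
  from Kd[OF r] show ?thesis
  proof
   assume rt: "r < t \<and> r < d"
   have "dm q p (face q r) a b (?d t w) = dm q p (face q (t - 1)) a b (?d r w)"
    using fd[of r t] fd[of "t - 1" r] face_face[of r t q] rt t rp q by simp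
   also have "\<dots> = dm q p (face q r) a b (v t)" using compat[of q r t] rt t rp q unfolding rw by simp
   finally have z: "dm q p (face q r) a b e = \<zero>\<^bsub>?L\<^esub>" using rt d q by (intro zero) auto
   have dq: "d - 1 < q" using rt d q by auto
   have "?d r (?s e) = dm p q (degen q (d - 1)) a b (dm q p (face q r) a b e)"
    using ds sd[OF dq, of r] degen_face_less[of r d q] rt d t q by simp
   also have "\<dots> = \<zero>\<^bsub>?N\<^esub>" unfolding z unfolding q by (rule lin_zero[OF M_module[OF S] M_module[OF S] dmap_linear[OF degen_order[OF dq] S]])
   finally show ?thesis .
  next
   assume rt: "t < r \<and> Suc d < r"
   have "dm q p (face q (r - 1)) a b (?d t w) = dm q p (face q t) a b (?d r w)"
    using fd[of "r - 1" t] fd[of t r] face_face[of t r q] rt t rp q by simp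
   also have "\<dots> = dm q p (face q (r - 1)) a b (v t)" using compat[of q t r] rt t rp q unfolding rw by simp
   finally have z: "dm q p (face q (r - 1)) a b e = \<zero>\<^bsub>?L\<^esub>" using rt d q rp by (intro zero) auto
   have dq: "d < q" using rt d q rp by auto
   have "?d r (?s e) = dm p q (degen q d) a b (dm q p (face q (r - 1)) a b e)"
    using ds sd[OF dq, of "r - 1"] degen_face_greater[of d r q] rt d t rp q by simp
   also have "\<dots> = \<zero>\<^bsub>?N\<^esub>" unfolding z unfolding q by (rule lin_zero[OF M_module[OF S] M_module[OF S] dmap_linear[OF degen_order[OF dq] S]])
   finally show ?thesis .
  qed
 qed
 have "?d t (w \<oplus>\<^bsub>?M\<^esub> ?s e) = ?d t w \<oplus>\<^bsub>?N\<^esub> (v t \<ominus>\<^bsub>?N\<^esub> ?d t w)"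
  using lin_add[OF dl[OF t(1)] w se] 1 e_def by simp
 also have "\<dots> = v t" using dw v[OF t] by (simp add: N.minus_eq N.a_lcomm N.r_neg)
 finally have "?d t (w \<oplus>\<^bsub>?M\<^esub> ?s e) = v t" .
 moreover have "?d r (w \<oplus>\<^bsub>?M\<^esub> ?s e) = v r" if "r \<in> K" for r
  using lin_add[OF dl w se, of r] 2[OF that] K[OF that] v[of r] by simp
 ultimately show ?thesis using M.a_closed[OF w se] by blast
qed

text \<open>Faces below s are corrected in ascending order, each with the degeneracy of its own
  index, faces above s in descending order with the index one lower. Face s is left free, which
  gives room for the shift.\<close>

lemma kan_filler:
 assumes S: "a \<in> Ob" "b \<in> Ob" and s: "s \<le> p" and v: "\<And>r. r \<le> p ==> r \<noteq> s ==> v r \<in>: dM p a b"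
  and compat: "\<And>r r' q. [|p = Suc q; r < r'; r' \<le> p; r \<noteq> s; r' \<noteq> s|] ==>
    dm q p (face q r) a b (v r') = dm q p (face q (r' - 1)) a b (v r)"
 shows "\<exists>w\<in>carrier (dM (Suc p) a b). \<forall>r\<le>p. r \<noteq> s \<longrightarrow> dm p (Suc p) (face p r) a b w = v r"
proof -
 let ?d = "\<lambda>r. dm p (Suc p) (face p r) a b"
 interpret M: module R "dM (Suc p) a b" by (rule M_module[OF S])
 have A: "\<exists>w\<in>carrier (dM (Suc p) a b). \<forall>r<t. ?d r w = v r" if "t \<le> s" for t
  using that
 proof (induction t)
  case 0
  then show ?case using M.zero_closed by blast
 next
  case (Suc t)
  then obtain w where w: "w \<in>: dM (Suc p) a b" "\<forall>r<t. ?d r w = v r" by auto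
  have "\<exists>w'\<in>carrier (dM (Suc p) a b). \<forall>r\<in>insert t {..<t}. ?d r w' = v r"
   by (rule kan_step[OF S w(1), of s v _ t t]) (use Suc s w v compat in auto)
  then show ?case by (auto simp: less_Suc_eq)
 qed
 have B: "\<exists>w\<in>carrier (dM (Suc p) a b). \<forall>r\<in>{..<s} \<union> {p - k<..p}. ?d r w = v r" if "k \<le> p - s" for k
  using that
 proof (induction k)
  case 0
  then show ?case using A[of s] by auto
 next
  case (Suc k)
  then obtain w where w: "w \<in>: dM (Suc p) a b" "\<forall>r\<in>{..<s} \<union> {p - k<..p}. ?d r w = v r" by auto
  \<comment> \<open>For t = p - k the degeneracy t - 1 is taken instead of t. It commutes past the
    faces above t, and past those below s because s is at most t - 1.\<close>
  have "\<exists>w'\<in>carrier (dM (Suc p) a b). \<forall>r\<in>insert (p - k) ({..<s} \<union> {p - k<..p}). ?d r w' = v r"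
   by (rule kan_step[OF S w(1), of s v _ "p - k" "p - k - 1"]) (use Suc s w v compat in auto)
  moreover have "{..<s} \<union> {p - Suc k<..p} = insert (p - k) ({..<s} \<union> {p - k<..p})" using Suc s by auto
  ultimately show ?case by metis
 qed
 from B[of "p - s"] obtain w where "w \<in>: dM (Suc p) a b" "\<forall>r\<in>{..<s} \<union> {s<..p}. ?d r w = v r" using s by auto
 then show ?thesis by (intro bexI[of _ w] allI impI) (auto simp: nat_neq_iff)
qed

text \<open>An element concentrated at the necklace {0,m}, whose single bead has m - 1 inner
  vertices.\<close>

definition "prim m a b v = NI m a b {0,m} (to_tensor R Ob (dM (m - 1)) a b v)"

lemma dquivers_pair: "0 < m ==> dq {0,m} = [dM (m - 1)]"
 by (simp add: dquivers_def gap_cards_pair)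

lemma to_tensor_d: "[|0 < m; a \<in> Ob; b \<in> Ob|] ==>
  to_tensor R Ob (dM (m - 1)) a b \<in> Lin (dM (m - 1) a b) (DT {0,m} a b)"
 unfolding dtensor_def dquivers_pair by (rule to_tensor_linear) (auto intro: M_module)

lemma prim_linear: "[|0 < m; a \<in> Ob; b \<in> Ob|] ==> prim m a b \<in> Lin (dM (m - 1) a b) (NM m a b)"
 unfolding prim_def[abs_def] by (rule lin_comp[OF incl_lin[OF pair_nec] to_tensor_d])

text \<open>For one factor the lift of \<open>itJ\<close> identifies the one-fold tensor product
  with \<open>dM (m - 1)\<close>.\<close>

definition "unprim m a b z = tensor_lift R (dM (m - 1) a b) (\<lambda>(cs,xs). itJ [m - 1] cs xs) (z {0,m})"

lemma d_lift:
 assumes "0 < m" "a \<in> Ob" "b \<in> Ob"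
 shows "tensor_lift R (dM (m - 1) a b) (\<lambda>(cs,xs). itJ [m - 1] cs xs) \<in> Lin (DT {0,m} a b) (dM (m - 1) a b)"
  and "x \<in>: dM (m - 1) a b ==>
   tensor_lift R (dM (m - 1) a b) (\<lambda>(cs,xs). itJ [m - 1] cs xs) (to_tensor R Ob (dM (m - 1)) a b x) = x"
proof -
 have q: "qv Ob [dM (m - 1)]" using M_module by auto
 have m: "MLin Ob [dM (m - 1)] a b (dM (m - 1) a b) (\<lambda>(cs,xs). itJ [m - 1] cs xs)"
  using itJ_multilinear_M[of "[m - 1]" a b] by simp
 show "tensor_lift R (dM (m - 1) a b) (\<lambda>(cs,xs). itJ [m - 1] cs xs) \<in> Lin (DT {0,m} a b) (dM (m - 1) a b)"
  unfolding dtensor_def dquivers_pair[OF assms(1)] by (rule tensor_lift_linear[OF q M_module[OF assms(2,3)] m])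
 assume x: "x \<in>: dM (m - 1) a b"
 have "([a,b],[x]) \<in> paths Ob [dM (m - 1)] a b" using assms x by (simp add: paths_Cons paths_Nil)
 from tensor_lift_pure[OF q M_module[OF assms(2,3)] m this]
 show "tensor_lift R (dM (m - 1) a b) (\<lambda>(cs,xs). itJ [m - 1] cs xs) (to_tensor R Ob (dM (m - 1)) a b x) = x"
  using itJ_single[OF assms(2,3) x] by (simp add: to_tensor_def)
qed

lemma unprim_closed: "[|0 < m; a \<in> Ob; b \<in> Ob; z \<in>: NM m a b|] ==> unprim m a b z \<in>: dM (m - 1) a b"
 unfolding unprim_def by (rule lin_closed[OF d_lift(1) NM_apply[OF _ pair_nec]])

lemma unprim_prim: "[|0 < m; a \<in> Ob; b \<in> Ob; v \<in>: dM (m - 1) a b|] ==> unprim m a b (prim m a b v) = v"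
 unfolding unprim_def prim_def using d_lift(2)[of m a b v] by (simp add: incl_app[OF pair_nec] del: itJ.simps)

text \<open>Vanishing under P {u} for every inner u leaves only the component at {0,m}.\<close>

lemma prim_unprim:
 assumes m: "0 < m" and S: "a \<in> Ob" "b \<in> Ob" and z: "z \<in>: NM m a b"
  and zero: "\<And>u. [|0 < u; u < m|] ==> nP m {u} a b z = \<zero>\<^bsub>NM m a b\<^esub>"
 shows "prim m a b (unprim m a b z) = z"
proof (rule NM_ext[OF lin_closed[OF prim_linear[OF m S] unprim_closed[OF m S z]] z])
 fix V assume V: "V \<in> necklaces m"
 from V show "prim m a b (unprim m a b z) V = z V"
 proof (cases rule: necklace_cases)
  case 1 then show ?thesis using m by simp
 next
  case 2
  have q: "qv Ob [dM (m - 1)]" using M_module by auto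
  have "to_tensor R Ob (dM (m - 1)) a b (tensor_lift R (dM (m - 1) a b) (\<lambda>(cs,xs). itJ [m - 1] cs xs) (z {0,m})) = z {0,m}"
  proof (rule tensor_eqI[OF q TT_module[OF q] lin_comp[OF to_tensor_d[OF m S] d_lift(1)[OF m S], unfolded dtensor_def dquivers_pair[OF m]] lin_id])
   fix cs xs assume "(cs,xs) \<in> paths Ob [dM (m - 1)] a b"
   then obtain x where x: "cs = [a,b]" "xs = [x]" "x \<in>: dM (m - 1) a b" by (auto simp: paths_Cons paths_Nil)
   show "to_tensor R Ob (dM (m - 1)) a b (tensor_lift R (dM (m - 1) a b) (\<lambda>(cs,xs). itJ [m - 1] cs xs)
     (pure R Ob [dM (m - 1)] cs xs)) = pure R Ob [dM (m - 1)] cs xs"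
    using d_lift(2)[OF m S x(3)] unfolding x(1,2) to_tensor_def by (simp del: itJ.simps)
  qed (use NM_apply[OF z pair_nec] in \<open>simp add: dtensor_def dquivers_pair[OF m]\<close>)
  then show ?thesis using 2 by (simp add: prim_def unprim_def incl_app[OF pair_nec])
 next
  case (3 u)
  have "z V = nP m {u} a b z V" using 3 by (simp add: nP_apply[OF V])
  also have "\<dots> = \<zero>\<^bsub>DT V a b\<^esub>" using V by (simp add: zero[OF 3(2,3)] nerve_mod_def direct_sum_def)
  finally show ?thesis using 3 by (auto simp: prim_def incl_app[OF V])
 qed
qed

text \<open>When the preimage of {0,m} has no inner vertex, a concentrated element stays
  concentrated and only \<open>\<D>(f)\<close> acts.\<close>

lemma nerve_map_prim:
 assumes f: "f \<in> imaps l m" and l: "0 < l" "0 < m" and pre: "preN l f {0,m} = {0,l}"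
  and S: "a \<in> Ob" "b \<in> Ob" and v: "v \<in>: dM (m - 1) a b"
 shows "NF l m f a b (prim m a b v) = prim l a b (dms {0<..<l} {0<..<m} f a b v)"
proof -
 have p: "([a,b],[v]) \<in> paths Ob (dq {0,m}) a b" using S v by (simp add: dquivers_pair[OF l(2)] paths_Cons paths_Nil)
 note tc = lin_closed[OF to_tensor_d[OF l(2) S] v]
 have "NF l m f a b (prim m a b v) =
   NI l a b {0,l} (nsm f {0,m} {0,l} a b (pure R Ob (dq {0,m}) [a,b] [v]))"
  unfolding prim_def nerve_map_incl[OF f pair_nec tc] pre by (simp add: to_tensor_def dquivers_pair[OF l(2)])
 also have "\<dots> = prim l a b (dms {0<..<l} {0<..<m} f a b v)"
  unfolding nsm_pure[OF f pair_nec pre[symmetric] p] nsl_pair[OF f pair_nec l(1) p]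
  using itJ_single[OF S v] by (simp add: prim_def to_tensor_def dquivers_pair[OF l(1)] gap_cards_pair[OF l(2)] inner_pair del: itJ.simps)
 finally show ?thesis .
qed

lemma coface_pre: "[|0 < i; i \<le> m|] ==> preN m (coface m i) {0,Suc m} = {0,m}"
 by (auto simp: preN_def coface_def)

lemma nerve_map_prim_coface:
 assumes i: "0 < i" "i \<le> m" and S: "a \<in> Ob" "b \<in> Ob" and v: "v \<in>: dM m a b"
 shows "NF m (Suc m) (coface m i) a b (prim (Suc m) a b v) = prim m a b (dm (m - 1) m (face (m - 1) (i - 1)) a b v)"
 using nerve_map_prim[OF coface_map[OF i] _ _ coface_pre[OF i] S, of v] v i
 by (simp add: dmap_set_def std_order_map_coface[OF i])

lemma nP_coface:
 assumes i: "0 < i" "i \<le> m" and u: "u \<le> m" and x: "x \<in>: NM (Suc m) a b"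
 shows "nP m {u} a b (NF m (Suc m) (coface m i) a b x) =
  NF m (Suc m) (coface m i) a b (nP (Suc m) {coface m i u} a b x)"
 using nP_nerve_map[OF coface_map[OF i] _ x, of "{u}"] u by simp

text \<open>The assumptions are the compatibilities that a horn supplies: \<open>yP\<close> and
  \<open>yy\<close> make the y's parts of one family away from {0,n}, \<open>zy\<close> compares the
  given faces with that family, \<open>zz\<close> is the simplicial identity.\<close>

lemma nerve_filler:
 assumes j: "0 < j" "j \<le> m" and S: "a \<in> Ob" "b \<in> Ob"
  and y: "\<And>i. [|0 < i; i \<le> m|] ==> y i \<in>: NM (Suc m) a b"
  and z: "\<And>i. [|0 < i; i \<le> m; i \<noteq> j|] ==> z i \<in>: NM m a b"
  and yP: "\<And>i. [|0 < i; i \<le> m|] ==> nP (Suc m) {i} a b (y i) = y i"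
  and yy: "\<And>i i'. [|0 < i; i \<le> m; 0 < i'; i' \<le> m|] ==> nP (Suc m) {i'} a b (y i) = nP (Suc m) {i} a b (y i')"
  and zy: "\<And>i u. [|0 < i; i \<le> m; i \<noteq> j; 0 < u; u < m|] ==>
   nP m {u} a b (z i) = nP m {u} a b (NF m (Suc m) (coface m i) a b (y (coface m i u)))"
  and zz: "\<And>i i' l. [|m = Suc l; 0 < i; i < i'; i' \<le> m; i \<noteq> j; i' \<noteq> j|] ==>
   NF l m (coface l i) a b (z i') = NF l m (coface l (i' - 1)) a b (z i)"
 shows "\<exists>x\<in>carrier (NM (Suc m) a b). (\<forall>i. 0 < i \<longrightarrow> i \<le> m \<longrightarrow> nP (Suc m) {i} a b x = y i) \<and>
  (\<forall>i. 0 < i \<longrightarrow> i \<le> m \<longrightarrow> i \<noteq> j \<longrightarrow> NF m (Suc m) (coface m i) a b x = z i)"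
proof -
 let ?n = "Suc m" and ?N = "NM (Suc m) a b" and ?K = "NM m a b"
 let ?P = "\<lambda>i. nP ?n {i} a b"
 interpret N: module R ?N by (rule NM_module)
 interpret K: module R "?K" by (rule NM_module)
 \<comment> \<open>Away from {0,n} a necklace has an inner vertex; by \<open>yy\<close> it does not
   matter which one is chosen.\<close>
 define ch where "ch V = (SOME i. i \<in> V \<and> 0 < i \<and> i \<le> m)" for V
 define x' where "x' = (\<lambda>V\<in>necklaces ?n. if V = {0,?n} then \<zero>\<^bsub>DT V a b\<^esub> else y (ch V) V)"
 have ch: "ch V \<in> V" "0 < ch V" "ch V \<le> m" if "V \<in> necklaces ?n" "V \<noteq> {0,?n}" for V
 proof -
  have "\<exists>i. i \<in> V \<and> 0 < i \<and> i \<le> m" using that(1)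
   by (cases rule: necklace_cases) (use that in auto)
  from someI_ex[OF this] show "ch V \<in> V" "0 < ch V" "ch V \<le> m" unfolding ch_def by auto
 qed
 have x': "x' \<in>: ?N"
 proof -
  have "(if V = {0,?n} then \<zero>\<^bsub>DT V a b\<^esub> else y (ch V) V) \<in>: DT V a b" if V: "V \<in> necklaces ?n" for V
  proof -
   interpret T: module R "DT V a b" by (rule DT_module)
   show ?thesis
   proof (cases "V = {0,?n}")
    case True
    show ?thesis unfolding if_P[OF True] by (rule T.zero_closed)
   next
    case False
    then show ?thesis using NM_apply[OF y V, of "ch V"] ch[OF V] by auto
   qed
  qed
  then show ?thesis by (auto simp: x'_def nerve_mod_def direct_sum_def)
 qed
 have x'P: "?P i x' = y i" if i: "0 < i" "i \<le> m" for i
 proof (rule NM_ext[OF nP_closed[OF x'] y[OF i]])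
  fix V assume V: "V \<in> necklaces ?n"
  show "?P i x' V = y i V"
  proof (cases "i \<in> V")
   case True
   then have ne: "V \<noteq> {0,?n}" using i by auto
   note c = ch[OF V ne]
   have "?P i x' V = y (ch V) V" using True V ne by (simp add: nP_apply[OF V] x'_def)
   also have "\<dots> = ?P i (y (ch V)) V" using True by (simp add: nP_apply[OF V])
   also have "\<dots> = nP ?n {ch V} a b (y i) V" using yy[OF c(2,3) i] by simp
   also have "\<dots> = y i V" using c by (simp add: nP_apply[OF V])
   finally show ?thesis .
  next
   case False
   \<comment> \<open>By \<open>yP\<close> the element y i has no component at necklaces avoiding
     i.\<close>
   then have "y i V = \<zero>\<^bsub>DT V a b\<^esub>" using arg_cong[OF yP[OF i], of "\<lambda>z. z V"] by (simp add: nP_apply[OF V])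
   then show ?thesis using False by (simp add: nP_apply[OF V])
  qed
 qed
 let ?d = "\<lambda>i. NF m ?n (coface m i) a b"
 have dl: "?d i \<in> Lin ?N ?K" if "0 < i" "i \<le> m" for i by (rule nerve_map_linear[OF coface_map[OF that]])
 have dc: "?d i x' \<in>: ?K" if "0 < i" "i \<le> m" for i by (rule lin_closed[OF dl[OF that] x'])
 \<comment> \<open>The errors of x'. They turn out to be concentrated at {0,m}, hence to come from
   the simplicial module.\<close>
 define z' where "z' i = z i \<ominus>\<^bsub>?K\<^esub> ?d i x'" for i
 have z': "z' i \<in>: ?K" if "0 < i" "i \<le> m" "i \<noteq> j" for i unfolding z'_def using z[OF that] dc[OF that(1,2)] by simp
 have m: "0 < m" using j by simp
 have z'P: "nP m {u} a b (z' i) = \<zero>\<^bsub>?K\<^esub>" if i: "0 < i" "i \<le> m" "i \<noteq> j" and u: "0 < u" "u < m" for i u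
 proof -
  let ?w = "coface m i u"
  have w: "0 < ?w" "?w \<le> m" using u i by (auto simp: coface_def)
  have "nP m {u} a b (?d i x') = ?d i (nP ?n {?w} a b x')" using u by (intro nP_coface[OF i(1,2) _ x']) simp
  also have "\<dots> = ?d i (nP ?n {?w} a b (y ?w))" unfolding x'P[OF w] yP[OF w] ..
  also have "\<dots> = nP m {u} a b (?d i (y ?w))" using u by (intro nP_coface[OF i(1,2) _ y[OF w], symmetric]) simp
  also have "\<dots> = nP m {u} a b (z i)" using zy[OF i u] by simp
  finally show ?thesis unfolding z'_def
   using lin_minus[OF NM_module NM_module nP_linear z[OF i] dc[OF i(1,2)], of "{u}"] nP_closed[OF z[OF i]] by (simp add: K.minus_eq K.r_neg)
 qed
 \<comment> \<open>The inner coface numbered r + 1 acts as face r, see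
   \<open>std_order_map_coface\<close>.\<close>
 define v where "v r = unprim m a b (z' (Suc r))" for r
 have pv: "prim m a b (v (i - 1)) = z' i" if i: "0 < i" "i \<le> m" "i \<noteq> j" for i
  using prim_unprim[OF m S z'[OF i] z'P[OF i]] i by (simp add: v_def)
 have "\<exists>w\<in>carrier (dM (Suc (m - 1)) a b). \<forall>r\<le>m - 1. r \<noteq> j - 1 \<longrightarrow> dm (m - 1) (Suc (m - 1)) (face (m - 1) r) a b w = v r"
 proof (rule kan_filler[OF S])
  show "j - 1 \<le> m - 1" using j by simp
  show vc: "v r \<in>: dM (m - 1) a b" if "r \<le> m - 1" "r \<noteq> j - 1" for r
   unfolding v_def using that j by (intro unprim_closed[OF m S] z') auto
  fix r r' q assume q: "m - 1 = Suc q" and r: "r < r'" "r' \<le> m - 1" "r \<noteq> j - 1" "r' \<noteq> j - 1"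
  let ?i = "Suc r" and ?i' = "Suc r'"
  have i: "0 < ?i" "?i \<le> m" "?i \<noteq> j" "0 < ?i'" "?i' \<le> m" "?i' \<noteq> j" "?i < ?i'" using r j by auto
  have ml: "m = Suc (Suc q)" using q by simp
  let ?c = "\<lambda>k. NF (Suc q) m (coface (Suc q) k) a b"
  have e1: "prim m a b (v r) = z' ?i" "prim m a b (v r') = z' ?i'" using pv[OF i(1-3)] pv[OF i(4-6)] by simp_all
  have i2: "0 < ?i" "?i \<le> Suc q" "0 < r'" "r' \<le> Suc q" using r q by auto
  have l1: "?c k \<in> Lin ?K (NM (Suc q) a b)" if "0 < k" "k \<le> Suc q" for k
   using nerve_map_linear[OF coface_map[OF that]] unfolding ml .
  have x2: "?c ?i (?d ?i' x') = ?c r' (?d ?i x')"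
  proof -
   have "?c ?i (?d ?i' x') =
     NF (Suc q) ?n (compose {..Suc q} (coface m ?i') (coface (Suc q) ?i)) a b x'"
    using coface_map[OF i2(1,2)] coface_map[OF i(4,5)] x' unfolding ml by (intro nerve_map_comp[symmetric]) 
   also have "compose {..Suc q} (coface m ?i') (coface (Suc q) ?i) = compose {..Suc q} (coface m ?i) (coface (Suc q) r')"
    using coface_coface[OF i(7), of "Suc q"] unfolding ml by simp
   also have "NF (Suc q) ?n (compose {..Suc q} (coface m ?i) (coface (Suc q) r')) a b x' =
     ?c r' (?d ?i x')"
    using coface_map[OF i2(3,4)] coface_map[OF i(1,2)] x' unfolding ml by (intro nerve_map_comp)
   finally show ?thesis .
  qed
  have z2: "?c ?i (z ?i') = ?c r' (z ?i)"
   using zz[OF ml i(1,7,5,3,6)] by simp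
  \<comment> \<open>The faces of x' and the given z satisfy the simplicial identity, hence so do
    their differences. Here r' is the index i' lowered by one.\<close>
  have "?c ?i (z' ?i') = ?c r' (z' ?i)"
   unfolding z'_def lin_minus[OF NM_module NM_module l1[OF i2(1,2)] z[OF i(4-6)] dc[OF i(4,5)]]
    lin_minus[OF NM_module NM_module l1[OF i2(3,4)] z[OF i(1-3)] dc[OF i(1,2)]] x2 z2 ..
  then have e2: "prim (Suc q) a b (dm q (Suc q) (face q r) a b (v r')) = prim (Suc q) a b (dm q (Suc q) (face q (r' - 1)) a b (v r))"
   unfolding e1[symmetric]
   using nerve_map_prim_coface[OF i2(1,2) S, of "v r'"] nerve_map_prim_coface[OF i2(3,4) S, of "v r"] vc[of r] vc[of r'] r q
   unfolding ml by simp
  have "dm q (Suc q) (face q k) a b (v k') \<in>: dM q a b" if "k \<le> q" "k' \<le> m - 1" "k' \<noteq> j - 1" for k k'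
   using dmap_face_closed[OF that(1) S] vc[OF that(2,3)] unfolding q by simp
  then have "dm q (Suc q) (face q r) a b (v r') \<in>: dM q a b" "dm q (Suc q) (face q (r' - 1)) a b (v r) \<in>: dM q a b"
   using r q by auto
  then show "dm q (m - 1) (face q r) a b (v r') = dm q (m - 1) (face q (r' - 1)) a b (v r)"
   using unprim_prim[OF _ S, of "Suc q"] e2 unfolding q by (metis diff_Suc_1 zero_less_Suc)
 qed
 then obtain w where w: "w \<in>: dM m a b" "\<And>r. r \<le> m - 1 ==> r \<noteq> j - 1 ==> dm (m - 1) m (face (m - 1) r) a b w = v r"
  using m by auto
 let ?pw = "prim ?n a b w"
 have pw: "?pw \<in>: ?N" using lin_closed[OF prim_linear[of ?n, OF _ S]] w(1) by simp
 \<comment> \<open>The correction is concentrated at {0,n}, so it repairs the faces without changing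
   any P {i}.\<close>
 let ?x = "x' \<oplus>\<^bsub>?N\<^esub> ?pw"
 have "?P i ?x = y i" if i: "0 < i" "i \<le> m" for i
 proof -
  have "?P i ?pw = \<zero>\<^bsub>?N\<^esub>" unfolding prim_def nP_incl[OF pair_nec] using i by simp
  then show ?thesis using lin_add[OF nP_linear x' pw, of "{i}"] x'P[OF i] y[OF i] by simp
 qed
 moreover have "?d i ?x = z i" if i: "0 < i" "i \<le> m" "i \<noteq> j" for i
 proof -
  have "?d i ?pw = z' i" using nerve_map_prim_coface[OF i(1,2) S w(1)] w(2)[of "i - 1"] pv[OF i] i j by (simp add: diff_le_mono) 
  then have "?d i ?x = ?d i x' \<oplus>\<^bsub>?K\<^esub> (z i \<ominus>\<^bsub>?K\<^esub> ?d i x')" using lin_add[OF dl[OF i(1,2)] x' pw] by (simp add: z'_def)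
  also have "\<dots> = z i" using dc[OF i(1,2)] z[OF i] by (simp add: K.minus_eq K.a_lcomm K.r_neg)
  finally show ?thesis .
 qed
 ultimately show ?thesis using N.a_closed[OF x' pw] by blast
qed

end

section \<open>The augmented simplicial modules of a dg-category\<close>

lemma sign_mult_closed: "[|module R N; x \<in>: N|] ==> sign_mult N p x \<in>: N"
 by (auto simp: sign_mult_def intro: abelian_group.a_inv_closed[OF module.axioms(2)])

lemma sign_mult_lin:
 assumes "module R M" "module R N" "h \<in> lin_maps R M N" "x \<in>: M"
 shows "h (sign_mult M p x) = sign_mult N p (h x)"
proof -
 interpret M: module R M by fact
 interpret N: module R N by fact
 have "h (\<zero>\<^bsub>M\<^esub> \<ominus>\<^bsub>M\<^esub> x) = \<zero>\<^bsub>N\<^esub> \<ominus>\<^bsub>N\<^esub> h x"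
  using lin_minus[OF assms(1-3) M.zero_closed assms(4)] lin_zero[OF assms(1-3)] by simp
 then show ?thesis using assms(4) lin_closed[OF assms(3,4)] by (simp add: sign_mult_def M.minus_eq N.minus_eq)
qed

lemma sign_mult_linear:
 assumes "module R N"
 shows "(\<lambda>x. sign_mult N p x) \<in> lin_maps R N N"
proof -
 interpret N: module R N by fact
 show ?thesis by (rule lin_mapsI) (auto simp: sign_mult_def N.minus_add N.smult_r_minus N.a_comm)
qed

lemma sign_mult_zero: "module R N ==> sign_mult N p \<zero>\<^bsub>N\<^esub> = \<zero>\<^bsub>N\<^esub>"
 by (rule lin_zero[OF _ _ sign_mult_linear])

lemma sign_mult_add: "[|module R N; x \<in>: N|] ==> sign_mult N (p + q) x = sign_mult N p (sign_mult N q x)"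
proof -
 assume "module R N" "x \<in>: N"
 then have "\<ominus>\<^bsub>N\<^esub> (\<ominus>\<^bsub>N\<^esub> x) = x" using abelian_group.minus_minus[OF module.axioms(2), of R N x] by simp
 then show ?thesis by (auto simp: sign_mult_def)
qed

lemma sign_mult_cancel: "[|module R N; x \<in>: N|] ==> sign_mult N (int k) x \<oplus>\<^bsub>N\<^esub> sign_mult N (int (Suc k)) x = \<zero>\<^bsub>N\<^esub>"
 using abelian_group.l_neg[OF module.axioms(2), of R N x] abelian_group.r_neg[OF module.axioms(2), of R N x] by (auto simp: sign_mult_def)

lemma sorted_nth_in: "[|finite I; j < card I|] ==> sl I ! j \<in> (I :: nat set)"
 by (metis length_sorted_list_of_set nth_mem set_sorted_list_of_set)

lemma face_card: "[|finite I; j < card I|] ==> int (card (I - {sl I ! j})) = int (card (I :: nat set)) - 1"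
proof -
 assume a: "finite I" "j < card I"
 then have "card (I - {sl I ! j}) = card I - 1" by (intro card_Diff_singleton sorted_nth_in)
 then show ?thesis using a(2) by simp
qed

context cring
begin

context
 fixes M :: "int => ('a,'m) module" and d :: "int => 'm => 'm"
 assumes M: "\<And>n. module R (M n)" and d: "\<And>n. d n \<in> Lin (M n) (M (n - 1))"
begin

text \<open>The alternating sum of faces that the differential has to equal on members of
  \<open>gamma_mod\<close>.\<close>

definition bdry :: "(nat set => 'm) => nat set => 'm" where
 "bdry a I = finsum (M (int (card I) - 1))
      (\<lambda>j. sign_mult (M (int (card I) - 1)) (int j) (a (I - {sl I ! j}))) {..<card I}"

lemma gamma_simps:
 "zero (gamma_mod M d p) = (\<lambda>I\<in>Pow {..<p}. \<zero>\<^bsub>M (int (card I))\<^esub>)"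
 "add (gamma_mod M d p) = (\<lambda>f g. \<lambda>I\<in>Pow {..<p}. f I \<oplus>\<^bsub>M (int (card I))\<^esub> g I)"
 "smult (gamma_mod M d p) = (\<lambda>r f. \<lambda>I\<in>Pow {..<p}. r \<odot>\<^bsub>M (int (card I))\<^esub> f I)"
 unfolding gamma_mod_def direct_sum_def by simp_all

lemma gamma_carrier: "a \<in>: gamma_mod M d p \<longleftrightarrow>
  a \<in> (\<Pi>\<^sub>E I\<in>Pow {..<p}. carrier (M (int (card I)))) \<and> (\<forall>I\<subseteq>{..<p}. d (int (card I)) (a I) = bdry a I)"
 unfolding gamma_mod_def bdry_def by simp

abbreviation (input) "DS p \<equiv> direct_sum (Pow {..<p}) (\<lambda>I. M (int (card I)))"

lemma bdry_linear:
 assumes I: "I \<subseteq> {..<p}"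
 shows "(\<lambda>a. bdry a I) \<in> Lin (DS p) (M (int (card I) - 1))"
 unfolding bdry_def
proof (rule lin_finsum_fun[OF direct_sum_module[OF M] M])
 fix j assume "j \<in> {..<card I}"
 then have e: "int (card (I - {sl I ! j})) = int (card I) - 1" using I by (intro face_card) (auto intro: finite_subset)
 have "I - {sl I ! j} \<in> Pow {..<p}" using I by auto
 then have "(\<lambda>a. a (I - {sl I ! j})) \<in> Lin (DS p) (M (int (card (I - {sl I ! j}))))"
  by (rule proj_linear[OF M])
 then have "(\<lambda>a. a (I - {sl I ! j})) \<in> Lin (DS p) (M (int (card I) - 1))" by (simp only: e)
 from lin_comp[OF sign_mult_linear[OF M] this]
 show "(\<lambda>a. sign_mult (M (int (card I) - 1)) (int j) (a (I - {sl I ! j}))) \<in> Lin (DS p) (M (int (card I) - 1))" .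
qed

text \<open>A submodule of a direct sum, since the defining equations are linear.\<close>

lemma gamma_module: "module R (gamma_mod M d p)"
proof -
 interpret D: module R "DS p" by (rule direct_sum_module[OF M])
 let ?H = "{a \<in> carrier (DS p). \<forall>I\<subseteq>{..<p}. d (int (card I)) (a I) = bdry a I}"
 have l1: "(\<lambda>a. d (int (card I)) (a I)) \<in> Lin (DS p) (M (int (card I) - 1))" if "I \<subseteq> {..<p}" for I
  using that by (intro lin_comp[OF d] proj_linear[OF M]) auto
 note z = lin_zero[OF direct_sum_module[OF M] M] and ad = lin_add and sm = lin_smult
 have neg: "\<ominus>\<^bsub>DS p\<^esub> a = (\<ominus> \<one>) \<odot>\<^bsub>DS p\<^esub> a" if "a \<in>: DS p" for a
  using that D.smult_l_minus[of \<one> a] by simp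
 have s: "r \<odot>\<^bsub>DS p\<^esub> a \<in> ?H" if "r \<in>: R" "a \<in> ?H" for r a
  using that by (auto simp: sm[OF l1] sm[OF bdry_linear])
 have "submodule ?H R (DS p)"
 proof (rule D.submoduleI)
  show "\<zero>\<^bsub>DS p\<^esub> \<in> ?H" by (auto simp: z[OF l1] z[OF bdry_linear])
  show "\<ominus>\<^bsub>DS p\<^esub> a \<in> ?H" if "a \<in> ?H" for a using that s[of "\<ominus> \<one>" a] neg[of a] by simp
  show "a \<oplus>\<^bsub>DS p\<^esub> b \<in> ?H" if "a \<in> ?H" "b \<in> ?H" for a b using that by (auto simp: ad[OF l1] ad[OF bdry_linear])
 qed (use s in auto)
 moreover have "gamma_mod M d p = (DS p)\<lparr>carrier := ?H\<rparr>"
  unfolding gamma_mod_def bdry_def by (simp add: direct_sum_def)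
 ultimately show ?thesis using submodule.submodule_is_module[OF _ D.module_axioms] by simp
qed

lemma gamma_proj: "I \<subseteq> {..<p} ==> (\<lambda>a. a I) \<in> Lin (gamma_mod M d p) (M (int (card I)))"
 by (rule lin_mapsI) (auto simp: gamma_carrier gamma_simps)

lemma gamma_app: "[|a \<in>: gamma_mod M d p; I \<subseteq> {..<p}|] ==> a I \<in>: M (int (card I))"
 by (rule lin_closed[OF gamma_proj])

lemma gamma_bdry: "[|a \<in>: gamma_mod M d p; I \<subseteq> {..<p}|] ==> d (int (card I)) (a I) = bdry a I"
 by (simp add: gamma_carrier)

lemma gamma_mapI:
 assumes h: "\<And>I. I \<subseteq> {..<p} ==> h I \<in> Lin L (M (int (card I)))"
  and "\<And>x. x \<in>: L ==> (\<lambda>I\<in>Pow {..<p}. h I x) \<in>: gamma_mod M d p"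
 shows "(\<lambda>x. \<lambda>I\<in>Pow {..<p}. h I x) \<in> Lin L (gamma_mod M d p)"
 using assms(2) by (intro lin_mapsI) (auto simp: gamma_simps fun_eq_iff lin_add[OF h] lin_smult[OF h])

lemma gamma_ext: "[|x \<in>: gamma_mod M d p; y \<in>: gamma_mod M d p; \<And>I. I \<subseteq> {..<p} ==> x I = y I|] ==> x = y"
 by (rule PiE_ext[of x "Pow {..<p}" "\<lambda>I. carrier (M (int (card I)))" y]) (auto simp: gamma_carrier)

lemma order_mapsD:
 assumes "h \<in> order_maps {..<p} {..<q}"
 shows "i < p ==> h i < q" "[|i \<le> j; j < p|] ==> h i \<le> h j" "I \<subseteq> {..<p} ==> h ` I \<subseteq> {..<q}"
 using assms by (auto simp: order_maps_def mono_on_def)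

text \<open>If h is injective on I it preserves the order of I and the equations match term by term.
  Otherwise monotonicity makes h collapse two neighbours: the faces omitting one of them cancel in
  pairs of opposite sign, and all other faces vanish.\<close>

lemma gamma_map_closed:
 assumes h: "h \<in> order_maps {..<p} {..<q}" and a: "a \<in>: gamma_mod M d q"
 shows "gamma_map M p h a \<in>: gamma_mod M d p"
proof -
 let ?b = "gamma_map M p h a"
 have b: "?b I = (if inj_on h I then a (h ` I) else \<zero>\<^bsub>M (int (card I))\<^esub>)" if "I \<subseteq> {..<p}" for I
  using that by (simp add: gamma_map_def)
 have ac: "a (h ` I) \<in>: M (int (card I))" if "I \<subseteq> {..<p}" "inj_on h I" for I
  using gamma_app[OF a order_mapsD(3)[OF h that(1)]] card_image[OF that(2)] by simp
 have zc: "\<zero>\<^bsub>M n\<^esub> \<in>: M n" for n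
  using module_zero_closed[OF M] .
 have PE: "?b \<in> (\<Pi>\<^sub>E I\<in>Pow {..<p}. carrier (M (int (card I))))"
  using b ac zc by (auto simp: gamma_map_def)
 have "d (int (card I)) (?b I) = bdry ?b I" if I: "I \<subseteq> {..<p}" for I
 proof -
  let ?l = "sl I" and ?N = "M (int (card I) - 1)"
  have fin: "finite I" using I finite_subset by blast
  have lin: "?l ! j \<in> I" if "j < card I" for j by (rule sorted_nth_in[OF fin that])
  have sub: "I - {?l ! j} \<subseteq> {..<p}" for j using I by auto
  interpret N: module R ?N by (rule M)
  have bcl: "?b (I - {?l ! j}) \<in>: ?N" if "j < card I" for j
  proof -
   have "?b (I - {?l ! j}) \<in>: M (int (card (I - {?l ! j})))" using PE sub[of j] by (simp add: PiE_iff)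
   then show ?thesis by (simp only: face_card[OF fin that])
  qed
  show ?thesis
  proof (cases "inj_on h I")
   case True
   have "sorted_wrt (<) (map h ?l)"
   proof (simp add: sorted_wrt_map, rule sorted_wrt_mono_rel[OF _ strict_sorted_list_of_set])
    fix x y assume "x \<in> set ?l" "y \<in> set ?l" "x < y"
    then show "h x < h y" using fin I True order_mapsD(2)[OF h, of x y]
     by (auto simp: inj_on_def le_less)
   qed
   then have l: "sl (h ` I) = map h ?l"
    using fin by (intro strict_sorted_equal strict_sorted_list_of_set) auto
   have c: "card (h ` I) = card I" by (rule card_image[OF True])
   have "?b I = a (h ` I)" using b[OF I] True by simp
   then have "d (int (card I)) (?b I) = bdry a (h ` I)"
    using gamma_bdry[OF a order_mapsD(3)[OF h I]] by (simp only: c)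
   also have "\<dots> = bdry ?b I" unfolding bdry_def c
   proof (rule N.finsum_cong'[OF refl])
    show "(\<lambda>j. sign_mult ?N (int j) (?b (I - {?l ! j}))) \<in> {..<card I} \<rightarrow> carrier ?N"
     by (auto intro!: sign_mult_closed[OF M] bcl)
    fix j assume j: "j \<in> {..<card I}"
    have "h ` I - {h (?l ! j)} = h ` (I - {?l ! j})"
     using inj_on_image_set_diff[OF True, of I "{?l ! j}"] lin[of j] j by simp
    then show "sign_mult ?N (int j) (a (h ` I - {sl (h ` I) ! j})) = sign_mult ?N (int j) (?b (I - {?l ! j}))"
     using j True by (simp add: l b[OF sub] inj_on_diff)
   qed
   finally show ?thesis .
  next
   case False
   \<comment> \<open>A monotone map that separates all neighbours is strictly increasing, hence
     injective.\<close>
   have "\<exists>k. Suc k < card I \<and> h (?l ! k) = h (?l ! Suc k)"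
   proof (rule ccontr)
    assume A: "\<not> ?thesis"
    have "h (?l ! k) < h (?l ! Suc k)" if "Suc k < card I" for k
    proof -
     have "?l ! k < ?l ! Suc k" using strict_sorted_list_of_set[of I] that by (auto simp: sorted_wrt_iff_nth_less)
     then show ?thesis using A that order_mapsD(2)[OF h, of "?l ! k" "?l ! Suc k"] lin[of "Suc k"] I by (force simp: le_less)
    qed
    then have "sorted_wrt (<) (map h ?l)" by (subst sorted_wrt_iff_nth_Suc_transp) (auto simp: transp_def)
    then have "distinct (map h ?l)" by (simp add: strict_sorted_iff)
    then show False using False fin by (simp add: distinct_map)
   qed
   then obtain k where k: "Suc k < card I" "h (?l ! k) = h (?l ! Suc k)" by blast
   have kk: "?l ! k \<in> I" "?l ! Suc k \<in> I" "?l ! k \<noteq> ?l ! Suc k"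
    using lin[of k] lin[of "Suc k"] k nth_eq_iff_index_eq[of ?l k "Suc k"] by auto
   define v where "v = ?b (I - {?l ! k})"
   have v: "v \<in>: ?N" unfolding v_def using bcl[of k] k by simp
   have im: "h ` (I - {?l ! k}) = h ` (I - {?l ! Suc k})"
    using kk k(2) by (auto simp: image_iff) (metis DiffI singletonD)+
   \<comment> \<open>Removing either of the two collapsed elements leaves sets of equal size with
     equal image, so h is injective on both or on neither.\<close>
   have "card (I - {?l ! k}) = card (I - {?l ! Suc k})" using kk by simp
   then have inj: "inj_on h (I - {?l ! k}) \<longleftrightarrow> inj_on h (I - {?l ! Suc k})"
    using im fin by (metis eq_card_imp_inj_on card_image finite_Diff)
   have v2: "?b (I - {?l ! Suc k}) = v" unfolding v_def b[OF sub] im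
    using inj face_card[OF fin, of k] face_card[OF fin, of "Suc k"] k by simp
   have t0: "?b (I - {?l ! j}) = \<zero>\<^bsub>?N\<^esub>" if "j < card I" "j \<noteq> k" "j \<noteq> Suc k" for j
   proof -
    have "?l ! j \<noteq> ?l ! k" "?l ! j \<noteq> ?l ! Suc k" using that k nth_eq_iff_index_eq[of ?l j] by auto
    then have "\<not> inj_on h (I - {?l ! j})" using kk k(2) inj_onD[of h "I - {?l ! j}" "?l ! k" "?l ! Suc k"] by auto
    then show ?thesis using b[OF sub] face_card[OF fin that(1)] by simp
   qed
   have "bdry ?b I = finsum ?N (\<lambda>j. sign_mult ?N (int j) (?b (I - {?l ! j}))) {k, Suc k}"
    unfolding bdry_def
   proof (rule N.add.finprod_mono_neutral_cong_right)
    show "{k, Suc k} \<subseteq> {..<card I}" using k by auto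
    show "sign_mult ?N (int j) (?b (I - {?l ! j})) = \<zero>\<^bsub>?N\<^esub>" if "j \<in> {..<card I} - {k, Suc k}" for j
     using that t0[of j] sign_mult_zero[OF M] by simp
    show "(\<lambda>j. sign_mult ?N (int j) (?b (I - {?l ! j}))) \<in> {..<card I} \<rightarrow> carrier ?N"
     by (auto intro!: sign_mult_closed[OF M] bcl)
   qed auto
   also have "\<dots> = sign_mult ?N (int k) v \<oplus>\<^bsub>?N\<^esub> sign_mult ?N (int (Suc k)) v"
    using v v2 sign_mult_closed[OF M v] by (subst N.finsum_insert) (auto simp: v_def[symmetric])
   also have "\<dots> = \<zero>\<^bsub>?N\<^esub>" by (rule sign_mult_cancel[OF M v])
   also have "\<dots> = d (int (card I)) (?b I)" using lin_zero[OF M M d] b[OF I] False by simp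
   finally show ?thesis ..
  qed
 qed
 then show ?thesis using PE by (simp add: gamma_carrier)
qed

lemma gamma_map_linear:
 assumes h: "h \<in> order_maps {..<p} {..<q}"
 shows "gamma_map M p h \<in> Lin (gamma_mod M d q) (gamma_mod M d p)"
 unfolding gamma_map_def[abs_def]
proof (rule gamma_mapI)
 fix I assume I: "I \<subseteq> {..<p}"
 show "(\<lambda>a. if inj_on h I then a (h ` I) else \<zero>\<^bsub>M (int (card I))\<^esub>) \<in> Lin (gamma_mod M d q) (M (int (card I)))"
  using gamma_proj[OF order_mapsD(3)[OF h I]] lin_const_zero[OF M] by (cases "inj_on h I") (simp_all add: card_image)
qed (use gamma_map_closed[OF h] in \<open>simp add: gamma_map_def\<close>)

lemma gamma_map_id:
 assumes "x \<in>: gamma_mod M d p"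
 shows "gamma_map M p (\<lambda>i\<in>{..<p}. i) x = x"
proof (rule gamma_ext[OF gamma_map_closed[OF _ assms] assms])
 show "(\<lambda>i\<in>{..<p}. i) \<in> order_maps {..<p} {..<p}" by (auto simp: order_maps_def mono_on_def)
 fix I assume I: "I \<subseteq> {..<p}"
 then have "(\<lambda>i\<in>{..<p}. i) ` I = I" "inj_on (\<lambda>i\<in>{..<p}. i) I" by (auto simp: inj_on_def image_iff subset_iff)
 then show "gamma_map M p (\<lambda>i\<in>{..<p}. i) x I = x I" using I by (simp add: gamma_map_def)
qed

lemma gamma_map_comp:
 assumes f: "f \<in> order_maps {..<p} {..<q}" and g: "g \<in> order_maps {..<q} {..<r}"
 shows "gamma_map M p (compose {..<p} g f) x = gamma_map M p f (gamma_map M q g x)"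
proof
 fix I
 show "gamma_map M p (compose {..<p} g f) x I = gamma_map M p f (gamma_map M q g x) I"
 proof (cases "I \<subseteq> {..<p}")
  case True
  have im: "compose {..<p} g f ` I = g ` f ` I" using True by (auto simp: compose_def image_iff subset_iff)
  have "inj_on (compose {..<p} g f) I \<longleftrightarrow> inj_on (g \<circ> f) I"
   using True by (intro inj_on_cong) (auto simp: compose_def)
  also have "\<dots> \<longleftrightarrow> inj_on f I \<and> inj_on g (f ` I)" by (auto simp: inj_on_def)
  finally show ?thesis using True order_mapsD(3)[OF f True] by (auto simp: gamma_map_def im card_image)
 qed (simp add: gamma_map_def)
qed

end

end

section \<open>Splitting subsets of a join of ordinals\<close>

definition kL :: "nat => nat set => nat set" where "kL p K = K \<inter> {..<p}"
definition kR :: "nat => nat set => nat set" where "kR p K = {i. p + i \<in> K}"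

lemma kR_image: "K \<subseteq> {..<p + q} ==> (\<lambda>i. i - p) ` (K \<inter> {p..<p + q}) = kR p K"
proof (intro equalityI subsetI)
 fix x assume "K \<subseteq> {..<p + q}" "x \<in> kR p K"
 then show "x \<in> (\<lambda>i. i - p) ` (K \<inter> {p..<p + q})" by (intro image_eqI[of _ _ "p + x"]) (auto simp: kR_def)
qed (auto simp: kR_def)

lemma k_sub: "K \<subseteq> {..<p + q} ==> kL p K \<subseteq> {..<p}" "K \<subseteq> {..<p + q} ==> kR p K \<subseteq> {..<q}"
 by (auto simp: kL_def kR_def)

lemma k_union: "K = kL p K \<union> (+) p ` kR p K"
proof (intro equalityI subsetI)
 fix x assume x: "x \<in> K"
 show "x \<in> kL p K \<union> (+) p ` kR p K"
 proof (cases "x < p")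
  case False
  then show ?thesis using x by (intro UnI2 image_eqI[of _ _ "x - p"]) (auto simp: kR_def)
 qed (use x in \<open>simp add: kL_def\<close>)
qed (auto simp: kL_def kR_def)

lemma k_fin: "finite K ==> finite (kL p K)" "finite K ==> finite (kR p K)"
proof -
 show "finite K ==> finite (kL p K)" by (simp add: kL_def)
 assume "finite K"
 then have "finite ((+) p ` kR p K)" using k_union[of K p] by (metis finite_Un)
 then show "finite (kR p K)" by (simp add: finite_image_iff)
qed

lemma k_card: "finite K ==> card K = card (kL p K) + card (kR p K)"
proof -
 assume f: "finite K"
 have "card K = card (kL p K \<union> (+) p ` kR p K)" using k_union[of K p] by simp
 also have "\<dots> = card (kL p K) + card ((+) p ` kR p K)" using k_fin[OF f] by (intro card_Un_disjoint) (auto simp: kL_def)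
 finally show ?thesis by (simp add: card_image)
qed

lemma k_sorted: "finite K ==> sl K = sl (kL p K) @ map ((+) p) (sl (kR p K))"
proof -
 assume f: "finite K"
 note kf = k_fin[OF f, of p]
 have "sorted_wrt (<) (sl (kL p K) @ map ((+) p) (sl (kR p K)))"
  using kf strict_sorted_list_of_set[of "kL p K"] strict_sorted_list_of_set[of "kR p K"]
  by (auto simp: sorted_wrt_append sorted_wrt_map kL_def)
 then show ?thesis using f kf k_union[of K p] by (intro strict_sorted_equal strict_sorted_list_of_set) auto
qed

section \<open>The enriched category obtained from a dg-category\<close>

context dg_category
begin

abbreviation "cM \<equiv> cmod C"
abbreviation "cC \<equiv> ccomp C"
abbreviation "cO \<equiv> cobj C"
abbreviation "cD \<equiv> cdiff C"

abbreviation Gm :: "'o => 'o => nat => ('k, nat set => 'm) module" where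
 "Gm A B p \<equiv> gamma_mod (cM A B) (cD A B) p"

lemma gm_module: "[|A \<in> cO; B \<in> cO|] ==> module R (Gm A B p)"
 by (rule gamma_module; rule cmod_module cdiff_linear; assumption)

lemma gm_carrier: "[|A \<in> cO; B \<in> cO|] ==> a \<in>: Gm A B p \<longleftrightarrow>
  a \<in> (\<Pi>\<^sub>E I\<in>Pow {..<p}. carrier (cM A B (int (card I)))) \<and> (\<forall>I\<subseteq>{..<p}. cD A B (int (card I)) (a I) = bdry (cM A B) a I)"
 by (rule gamma_carrier; rule cmod_module cdiff_linear; assumption)

lemma gm_bdry: "[|A \<in> cO; B \<in> cO|] ==> bdry (cM A B) a I = finsum (cM A B (int (card I) - 1))
  (\<lambda>j. sign_mult (cM A B (int (card I) - 1)) (int j) (a (I - {sl I ! j}))) {..<card I}"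
 by (rule bdry_def; rule cmod_module cdiff_linear; assumption)

lemma gm_app: "[|A \<in> cO; B \<in> cO; a \<in>: Gm A B p; I \<subseteq> {..<p}|] ==> a I \<in>: cM A B (int (card I))"
 by (auto simp: gm_carrier)

lemma gm_proj: "[|A \<in> cO; B \<in> cO; I \<subseteq> {..<p}|] ==> (\<lambda>a. a I) \<in> Lin (Gm A B p) (cM A B (int (card I)))"
 by (rule gamma_proj; (rule cmod_module cdiff_linear)?; assumption)

lemma gm_mapI:
 assumes "A \<in> cO" "B \<in> cO" "\<And>I. I \<subseteq> {..<p} ==> h I \<in> Lin L (cM A B (int (card I)))"
  "\<And>x. x \<in>: L ==> (\<lambda>I\<in>Pow {..<p}. h I x) \<in>: Gm A B p"
 shows "(\<lambda>x. \<lambda>I\<in>Pow {..<p}. h I x) \<in> Lin L (Gm A B p)"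
 by (rule gamma_mapI[where M="cM A B" and d="cD A B", OF cmod_module[OF assms(1,2)] cdiff_linear[OF assms(1,2)] assms(3,4)])

lemma gm_ext: "[|A \<in> cO; B \<in> cO; x \<in>: Gm A B p; y \<in>: Gm A B p; \<And>I. I \<subseteq> {..<p} ==> x I = y I|] ==> x = y"
 by (rule PiE_ext[of x "Pow {..<p}" "\<lambda>I. carrier (cM A B (int (card I)))" y]) (auto simp: gm_carrier)

lemma gm_linear: "[|h \<in> order_maps {..<p} {..<q}; A \<in> cO; B \<in> cO|] ==> gamma_map (cM A B) p h \<in> Lin (Gm A B q) (Gm A B p)"
 by (rule gamma_map_linear; (rule cmod_module cdiff_linear)?; assumption)

lemma gm_id: "[|A \<in> cO; B \<in> cO; x \<in>: Gm A B p|] ==> gamma_map (cM A B) p (\<lambda>i\<in>{..<p}. i) x = x"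
 by (rule gamma_map_id[where M="cM A B" and d="cD A B"]; (rule cmod_module cdiff_linear)?; assumption)

lemma gm_comp: "[|f \<in> order_maps {..<p} {..<q}; g \<in> order_maps {..<q} {..<r}; A \<in> cO; B \<in> cO|]
  ==> gamma_map (cM A B) p (compose {..<p} g f) x = gamma_map (cM A B) p f (gamma_map (cM A B) q g x)"
 by (rule gamma_map_comp[where M="cM A B" and d="cD A B"]; (rule cmod_module cdiff_linear)?; assumption)

definition "gcomp p q A B E x y = (\<lambda>K\<in>Pow {..<p + q}. cC A B E (int (card (kL p K))) (int (card (kR p K))) (x (kL p K)) (y (kR p K)))"

lemma gamma_cat_simps: "dobj (gamma_cat C) = cO" "dmod (gamma_cat C) = (\<lambda>p A B. Gm A B p)"
 "dmap (gamma_cat C) = (\<lambda>p q h A B. gamma_map (cM A B) p h)"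
 "dcomp (gamma_cat C) = gcomp" "dunit (gamma_cat C) = (\<lambda>A. \<lambda>I\<in>Pow {..<0}. cunit C A)"
 unfolding gamma_cat_def gcomp_def[abs_def]
 by (auto simp: Let_def kR_image kL_def fun_eq_iff)

lemma cc_closed:
 assumes "A \<in> cO" "B \<in> cO" "E \<in> cO" "x \<in>: cM A B p" "y \<in>: cM B E q"
 shows "cC A B E p q x y \<in>: cM A E (p + q)"
 using ccomp_linear_right[OF assms(1-4)] assms(5) by (rule lin_closed)

lemma gcomp_term:
 assumes S: "A \<in> cO" "B \<in> cO" "E \<in> cO" and x: "x \<in>: Gm A B p" and y: "y \<in>: Gm B E q" and K: "K \<subseteq> {..<p + q}"
 shows "cC A B E (int (card (kL p K))) (int (card (kR p K))) (x (kL p K)) (y (kR p K)) \<in>: cM A E (int (card K))"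
proof -
 have "int (card K) = int (card (kL p K)) + int (card (kR p K))" using k_card[of K p] finite_subset[OF K] by simp
 then show ?thesis
  using cc_closed[OF S gm_app[OF S(1,2) x k_sub(1)[OF K]]
   gm_app[OF S(2,3) y k_sub(2)[OF K]]] by simp
qed

text \<open>This is the Leibniz rule. The faces of K omit an element either of its left part or of
  its right part; the indices of the latter are offset by the size of the left part, which produces
  the sign (-1)^c1.\<close>

lemma gcomp_closed:
 assumes S: "A \<in> cO" "B \<in> cO" "E \<in> cO" and x: "x \<in>: Gm A B p" and y: "y \<in>: Gm B E q"
 shows "gcomp p q A B E x y \<in>: Gm A E (p + q)"
proof -
 let ?z = "gcomp p q A B E x y"
 note MAB = cmod_module[OF S(1,2)] and MBE = cmod_module[OF S(2,3)] and MAE = cmod_module[OF S(1,3)]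
 note dAB = cdiff_linear[OF S(1,2)] and dBE = cdiff_linear[OF S(2,3)] and dAE = cdiff_linear[OF S(1,3)]
 note ax = gamma_app[OF MAB dAB x] and ay = gamma_app[OF MBE dBE y]
 have "cD A E (int (card K)) (?z K) = bdry (cM A E) ?z K" if K: "K \<subseteq> {..<p + q}" for K
 proof -
  let ?K1 = "kL p K" and ?K2 = "kR p K"
  define c1 c2 where "c1 = int (card ?K1)" and "c2 = int (card ?K2)"
  let ?N = "cM A E (c1 + c2 - 1)"
  have fin: "finite K" using K finite_subset by blast
  note kf = k_fin[OF fin, of p]
  have K1: "?K1 \<subseteq> {..<p}" "?K2 \<subseteq> {..<q}" using k_sub[OF K] by auto
  have c: "int (card K) = c1 + c2" "card K = card ?K1 + card ?K2" using k_card[OF fin, of p] by (simp_all add: c1_def c2_def)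
  interpret N: module R ?N by (rule MAE)
  let ?l1 = "sl ?K1" and ?l2 = "sl ?K2" and ?l = "sl K"
  let ?t = "\<lambda>j. sign_mult ?N (int j) (?z (K - {?l ! j}))"
  have x1: "x ?K1 \<in>: cM A B c1" using ax[OF K1(1)] by (simp add: c1_def)
  have y2: "y ?K2 \<in>: cM B E c2" using ay[OF K1(2)] by (simp add: c2_def)
  have tl: "?t j = sign_mult ?N (int j) (cC A B E (c1 - 1) c2 (x (?K1 - {?l1 ! j})) (y ?K2))"
   "x (?K1 - {?l1 ! j}) \<in>: cM A B (c1 - 1)" if j: "j < card ?K1" for j
  proof -
   have lj: "?l ! j = ?l1 ! j" using j k_sorted[OF fin, of p] by (simp add: nth_append)
   have "?l1 ! j \<in> ?K1" by (rule sorted_nth_in[OF kf(1) j])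
   then have "kL p (K - {?l ! j}) = ?K1 - {?l1 ! j}" "kR p (K - {?l ! j}) = ?K2" unfolding lj by (auto simp: kL_def kR_def)
   moreover have "int (card (?K1 - {?l1 ! j})) = c1 - 1" unfolding c1_def by (rule face_card[OF kf(1) j])
   moreover have "K - {?l ! j} \<subseteq> {..<p + q}" using K by auto
   ultimately show "?t j = sign_mult ?N (int j) (cC A B E (c1 - 1) c2 (x (?K1 - {?l1 ! j})) (y ?K2))"
    "x (?K1 - {?l1 ! j}) \<in>: cM A B (c1 - 1)"
    using ax[of "?K1 - {?l1 ! j}"] K1 by (auto simp: gcomp_def c2_def)
  qed
  have tr: "?t (card ?K1 + i) = sign_mult ?N c1 (sign_mult ?N (int i) (cC A B E c1 (c2 - 1) (x ?K1) (y (?K2 - {?l2 ! i}))))"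
   "y (?K2 - {?l2 ! i}) \<in>: cM B E (c2 - 1)" if i: "i < card ?K2" for i
  proof -
   have lj: "?l ! (card ?K1 + i) = p + ?l2 ! i" using i k_sorted[OF fin, of p] by (simp add: nth_append)
   have "?l2 ! i \<in> ?K2" by (rule sorted_nth_in[OF kf(2) i])
   then have k: "kL p (K - {?l ! (card ?K1 + i)}) = ?K1" "kR p (K - {?l ! (card ?K1 + i)}) = ?K2 - {?l2 ! i}" unfolding lj by (auto simp: kL_def kR_def)
   have cc: "int (card (?K2 - {?l2 ! i})) = c2 - 1" unfolding c2_def by (rule face_card[OF kf(2) i])
   have sub: "K - {?l ! (card ?K1 + i)} \<subseteq> {..<p + q}" using K by auto
   show yy: "y (?K2 - {?l2 ! i}) \<in>: cM B E (c2 - 1)" using ay[of "?K2 - {?l2 ! i}"] K1 cc by auto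
   have "cC A B E c1 (c2 - 1) (x ?K1) (y (?K2 - {?l2 ! i})) \<in>: ?N"
    using cc_closed[OF S x1 yy] by (simp add: algebra_simps)
   from sign_mult_add[OF MAE this, of c1 "int i"]
   show "?t (card ?K1 + i) = sign_mult ?N c1 (sign_mult ?N (int i) (cC A B E c1 (c2 - 1) (x ?K1) (y (?K2 - {?l2 ! i}))))"
    using sub k cc by (simp add: gcomp_def c1_def)
  qed
  have tcl: "?t j \<in>: ?N" if "j < card ?K1" for j
   unfolding tl(1)[OF that] using cc_closed[OF S tl(2)[OF that] y2] by (intro sign_mult_closed[OF MAE]) (simp add: algebra_simps)
  have ccr: "cC A B E c1 (c2 - 1) (x ?K1) (y (?K2 - {?l2 ! i})) \<in>: ?N" if "i < card ?K2" for i
   using cc_closed[OF S x1 tr(2)[OF that]] by (simp add: algebra_simps)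
  have tcr: "?t (card ?K1 + i) \<in>: ?N" if "i < card ?K2" for i
   unfolding tr(1)[OF that] by (intro sign_mult_closed[OF MAE] ccr that)
  have "bdry (cM A E) ?z K = finsum ?N ?t ({..<card ?K1} \<union> (+) (card ?K1) ` {..<card ?K2})"
  proof -
   have "{..<card K} = {..<card ?K1} \<union> (+) (card ?K1) ` {..<card ?K2}"
    unfolding c(2) lessThan_atLeast0 image_add_atLeastLessThan by auto
   then show ?thesis unfolding gm_bdry[OF S(1,3)] c(1) by (simp only:)
  qed
  also have "\<dots> = finsum ?N ?t {..<card ?K1} \<oplus>\<^bsub>?N\<^esub> finsum ?N ?t ((+) (card ?K1) ` {..<card ?K2})"
   using tcl tcr by (intro N.finsum_Un_disjoint) auto
  also have "finsum ?N ?t ((+) (card ?K1) ` {..<card ?K2}) = finsum ?N (\<lambda>i. ?t (card ?K1 + i)) {..<card ?K2}"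
   using tcr by (intro N.finsum_reindex) auto
  also have "\<dots> = finsum ?N (\<lambda>i. sign_mult ?N c1 (cC A B E c1 (c2 - 1) (x ?K1) (sign_mult (cM B E (c2 - 1)) (int i) (y (?K2 - {?l2 ! i}))))) {..<card ?K2}"
  proof (rule N.finsum_cong'[OF refl])
   have l: "cC A B E c1 (c2 - 1) (x ?K1) \<in> Lin (cM B E (c2 - 1)) ?N"
    using ccomp_linear_right[OF S x1, of "c2 - 1"] by (simp add: algebra_simps)
   show "(\<lambda>i. sign_mult ?N c1 (cC A B E c1 (c2 - 1) (x ?K1) (sign_mult (cM B E (c2 - 1)) (int i) (y (?K2 - {?l2 ! i}))))) \<in> {..<card ?K2} \<rightarrow> carrier ?N"
    by (auto intro!: sign_mult_closed[OF MAE] lin_closed[OF l] sign_mult_closed[OF MBE] tr(2))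
   fix i assume i: "i \<in> {..<card ?K2}"
   then have i: "i < card ?K2" by simp
   show "?t (card ?K1 + i) = sign_mult ?N c1 (cC A B E c1 (c2 - 1) (x ?K1) (sign_mult (cM B E (c2 - 1)) (int i) (y (?K2 - {?l2 ! i}))))"
    unfolding tr(1)[OF i] sign_mult_lin[OF MBE MAE l tr(2)[OF i]] ..
  qed
  also have "\<dots> = sign_mult ?N c1 (cC A B E c1 (c2 - 1) (x ?K1) (bdry (cM B E) y ?K2))"
  proof -
   have l: "(\<lambda>v. sign_mult ?N c1 (cC A B E c1 (c2 - 1) (x ?K1) v)) \<in> Lin (cM B E (c2 - 1)) ?N"
    using lin_comp[OF sign_mult_linear[OF MAE] ccomp_linear_right[OF S x1, of "c2 - 1"]] by (simp add: algebra_simps)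
   show ?thesis unfolding gm_bdry[OF S(2,3)] c2_def[symmetric]
    by (rule lin_finsum[OF MBE MAE l, symmetric]) (auto intro!: sign_mult_closed[OF MBE] tr(2))
  qed
  also have "finsum ?N ?t {..<card ?K1} = finsum ?N (\<lambda>j. cC A B E (c1 - 1) c2 (sign_mult (cM A B (c1 - 1)) (int j) (x (?K1 - {?l1 ! j}))) (y ?K2)) {..<card ?K1}"
  proof (rule N.finsum_cong'[OF refl])
   have l: "(\<lambda>v. cC A B E (c1 - 1) c2 v (y ?K2)) \<in> Lin (cM A B (c1 - 1)) ?N"
    using ccomp_linear_left[OF S y2, of "c1 - 1"] by (simp add: algebra_simps)
   show "(\<lambda>j. cC A B E (c1 - 1) c2 (sign_mult (cM A B (c1 - 1)) (int j) (x (?K1 - {?l1 ! j}))) (y ?K2)) \<in> {..<card ?K1} \<rightarrow> carrier ?N"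
    by (auto intro!: lin_closed[OF l] sign_mult_closed[OF MAB] tl(2))
   fix j assume "j \<in> {..<card ?K1}"
   then have j: "j < card ?K1" by simp
   show "?t j = cC A B E (c1 - 1) c2 (sign_mult (cM A B (c1 - 1)) (int j) (x (?K1 - {?l1 ! j}))) (y ?K2)"
    unfolding tl(1)[OF j] sign_mult_lin[OF MAB MAE l tl(2)[OF j]] ..
  qed
  also have "\<dots> = cC A B E (c1 - 1) c2 (bdry (cM A B) x ?K1) (y ?K2)"
  proof -
   have l: "(\<lambda>v. cC A B E (c1 - 1) c2 v (y ?K2)) \<in> Lin (cM A B (c1 - 1)) ?N"
    using ccomp_linear_left[OF S y2, of "c1 - 1"] by (simp add: algebra_simps)
   show ?thesis unfolding gm_bdry[OF S(1,2)] c1_def[symmetric]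
    by (rule lin_finsum[OF MAB MAE l, symmetric]) (auto intro!: sign_mult_closed[OF MAB] tl(2))
  qed
  also have "bdry (cM A B) x ?K1 = cD A B c1 (x ?K1)" using gamma_bdry[OF MAB dAB x K1(1)] by (simp add: c1_def)
  also have "bdry (cM B E) y ?K2 = cD B E c2 (y ?K2)" using gamma_bdry[OF MBE dBE y K1(2)] by (simp add: c2_def)
  also have "cC A B E (c1 - 1) c2 (cD A B c1 (x ?K1)) (y ?K2) \<oplus>\<^bsub>?N\<^esub>
    sign_mult ?N c1 (cC A B E c1 (c2 - 1) (x ?K1) (cD B E c2 (y ?K2))) = cD A E (c1 + c2) (cC A B E c1 c2 (x ?K1) (y ?K2))"
   by (rule leibniz[OF S x1 y2, symmetric])
  also have "\<dots> = cD A E (int (card K)) (?z K)" using K c(1) by (simp add: gcomp_def c1_def c2_def)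
  finally show ?thesis ..
 qed
 moreover have "?z \<in> (\<Pi>\<^sub>E K\<in>Pow {..<p + q}. carrier (cM A E (int (card K))))"
  using gcomp_term[OF S x y] by (auto simp: gcomp_def)
 ultimately show ?thesis by (simp add: gm_carrier[OF S(1,3)])
qed


lemma gcomp_left:
 assumes S: "A \<in> cO" "B \<in> cO" "E \<in> cO" and y: "y \<in>: Gm B E q"
 shows "(\<lambda>x. gcomp p q A B E x y) \<in> Lin (Gm A B p) (Gm A E (p + q))"
 unfolding gcomp_def
proof (rule gm_mapI[OF S(1,3)])
 fix K assume K: "K \<subseteq> {..<p + q}"
 have c: "int (card (kL p K)) + int (card (kR p K)) = int (card K)" using k_card[of K p] finite_subset[OF K] by simp
 have "y (kR p K) \<in>: cM B E (int (card (kR p K)))"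
  by (rule gm_app[OF S(2,3) y k_sub(2)[OF K]])
 from lin_comp[OF ccomp_linear_left[OF S this] gm_proj[OF S(1,2) k_sub(1)[OF K]]]
 show "(\<lambda>x. cC A B E (int (card (kL p K))) (int (card (kR p K))) (x (kL p K)) (y (kR p K))) \<in> Lin (Gm A B p) (cM A E (int (card K)))"
  unfolding c .
next
 fix x assume "x \<in>: Gm A B p"
 from gcomp_closed[OF S this y] show "(\<lambda>K\<in>Pow {..<p + q}. cC A B E (int (card (kL p K))) (int (card (kR p K))) (x (kL p K)) (y (kR p K))) \<in>: Gm A E (p + q)"
  unfolding gcomp_def .
qed

lemma gcomp_right:
 assumes S: "A \<in> cO" "B \<in> cO" "E \<in> cO" and x: "x \<in>: Gm A B p"
 shows "gcomp p q A B E x \<in> Lin (Gm B E q) (Gm A E (p + q))"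
 unfolding gcomp_def[abs_def]
proof (rule gm_mapI[OF S(1,3)])
 fix K assume K: "K \<subseteq> {..<p + q}"
 have c: "int (card (kL p K)) + int (card (kR p K)) = int (card K)" using k_card[of K p] finite_subset[OF K] by simp
 have "x (kL p K) \<in>: cM A B (int (card (kL p K)))"
  by (rule gm_app[OF S(1,2) x k_sub(1)[OF K]])
 from lin_comp[OF ccomp_linear_right[OF S this] gm_proj[OF S(2,3) k_sub(2)[OF K]]]
 show "(\<lambda>y. cC A B E (int (card (kL p K))) (int (card (kR p K))) (x (kL p K)) (y (kR p K))) \<in> Lin (Gm B E q) (cM A E (int (card K)))"
  unfolding c .
next
 fix y assume "y \<in>: Gm B E q"
 from gcomp_closed[OF S x this] show "(\<lambda>K\<in>Pow {..<p + q}. cC A B E (int (card (kL p K))) (int (card (kR p K))) (x (kL p K)) (y (kR p K))) \<in>: Gm A E (p + q)"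
  unfolding gcomp_def .
qed

lemma gcomp_assoc:
 assumes S: "A \<in> cO" "B \<in> cO" "E \<in> cO" "G \<in> cO"
  and x: "x \<in>: Gm A B p" and y: "y \<in>: Gm B E q" and z: "z \<in>: Gm E G r"
 shows "gcomp (p + q) r A E G (gcomp p q A B E x y) z = gcomp p (q + r) A B G x (gcomp q r B E G y z)"
proof
 fix K
 show "gcomp (p + q) r A E G (gcomp p q A B E x y) z K = gcomp p (q + r) A B G x (gcomp q r B E G y z) K"
 proof (cases "K \<subseteq> {..<p + q + r}")
  case True
  then have K: "K \<subseteq> {..<p + (q + r)}" by (simp add: add.assoc)
  let ?K1 = "kL p K" and ?K2 = "kL q (kR p K)" and ?K3 = "kR q (kR p K)"
  have e: "kL p (kL (p + q) K) = ?K1" "kR p (kL (p + q) K) = ?K2" "kR (p + q) K = ?K3"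
   by (auto simp: kL_def kR_def add.assoc)
  have sub: "kL (p + q) K \<subseteq> {..<p + q}" "kR p K \<subseteq> {..<q + r}" using k_sub[OF True] k_sub[OF K] by auto
  have s3: "?K1 \<subseteq> {..<p}" "?K2 \<subseteq> {..<q}" "?K3 \<subseteq> {..<r}" using k_sub[OF K] k_sub[OF sub(2)] by auto
  have c: "int (card (kL (p + q) K)) = int (card ?K1) + int (card ?K2)" "int (card (kR p K)) = int (card ?K2) + int (card ?K3)"
   using k_card[of "kL (p + q) K" p] k_card[of "kR p K" q] finite_subset[OF sub(1)] finite_subset[OF sub(2)] by (simp_all add: e)
  show ?thesis
   using True K sub ccomp_assoc[OF S gm_app[OF S(1,2) x s3(1)]
     gm_app[OF S(2,3) y s3(2)] gm_app[OF S(3,4) z s3(3)]]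
   by (simp add: gcomp_def e c)
 next
  case False
  then show ?thesis by (simp add: gcomp_def add.assoc)
 qed
qed

text \<open>The identity is a cycle, and for the empty index set the alternating sum is
  empty.\<close>

lemma gunit_closed:
 assumes A: "A \<in> cO"
 shows "(\<lambda>I\<in>Pow {..<0}. cunit C A) \<in>: Gm A A 0"
proof -
 interpret N: module R "cM A A (-1)" by (rule cmod_module[OF A A])
 have "bdry (cM A A) (\<lambda>I\<in>Pow {..<0}. cunit C A) {} = \<zero>\<^bsub>cM A A (-1)\<^esub>"
  unfolding gm_bdry[OF A A] by simp
 then show ?thesis using cdiff_cunit[OF A] cunit_closed[OF A] by (auto simp: gm_carrier[OF A A])
qed

lemma gcomp_unit_left:
 assumes S: "A \<in> cO" "B \<in> cO" and x: "x \<in>: Gm A B p"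
 shows "gcomp 0 p A A B (\<lambda>I\<in>Pow {..<0}. cunit C A) x = x"
proof (rule gm_ext[OF S _ x])
 show "gcomp 0 p A A B (\<lambda>I\<in>Pow {..<0}. cunit C A) x \<in>: Gm A B p"
  using gcomp_closed[OF S(1) S(1) S(2) gunit_closed[OF S(1)] x] by simp
 fix I assume I: "I \<subseteq> {..<p}"
 have "kL 0 I = {}" "kR 0 I = I" by (auto simp: kL_def kR_def)
 then show "gcomp 0 p A A B (\<lambda>I\<in>Pow {..<0}. cunit C A) x I = x I"
  using I ccomp_cunit_left[OF S gm_app[OF S x I]] by (simp add: gcomp_def)
qed

lemma gcomp_unit_right:
 assumes S: "A \<in> cO" "B \<in> cO" and x: "x \<in>: Gm A B p"
 shows "gcomp p 0 A B B x (\<lambda>I\<in>Pow {..<0}. cunit C B) = x"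
proof (rule gm_ext[OF S _ x])
 show "gcomp p 0 A B B x (\<lambda>I\<in>Pow {..<0}. cunit C B) \<in>: Gm A B p"
  using gcomp_closed[OF S(1) S(2) S(2) x gunit_closed[OF S(2)]] by simp
 fix I assume I: "I \<subseteq> {..<p}"
 have "kL p I = I" "kR p I = {}" using I by (auto simp: kL_def kR_def)
 then show "gcomp p 0 A B B x (\<lambda>I\<in>Pow {..<0}. cunit C B) I = x I"
  using I ccomp_cunit_right[OF S gm_app[OF S x I]] by (simp add: gcomp_def)
qed

lemma order_maps_image: "[|h \<in> order_maps I J; K \<subseteq> I|] ==> h ` K \<subseteq> J"
 by (auto simp: order_maps_def)

text \<open>The sum of order maps is injective on K exactly when both are injective on their parts.
  If one is not, both sides vanish, on the right because composing with zero gives zero.\<close>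

lemma gcomp_natural:
 assumes g: "g \<in> order_maps {..<p} {..<p'}" and h: "h \<in> order_maps {..<q} {..<q'}"
  and S: "A \<in> cO" "B \<in> cO" "E \<in> cO" and x: "x \<in>: Gm A B p'" and y: "y \<in>: Gm B E q'"
 shows "gamma_map (cM A E) (p + q) (ord_sum p p' q g h) (gcomp p' q' A B E x y) =
  gcomp p q A B E (gamma_map (cM A B) p g x) (gamma_map (cM B E) q h y)"
proof
 fix K
 let ?o = "ord_sum p p' q g h"
 show "gamma_map (cM A E) (p + q) ?o (gcomp p' q' A B E x y) K =
  gcomp p q A B E (gamma_map (cM A B) p g x) (gamma_map (cM B E) q h y) K"
 proof (cases "K \<subseteq> {..<p + q}")
  case True
  have fin: "finite K" using True finite_subset by blast
  note sub = k_sub[OF True]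
  have o1: "?o i = g i" if "i \<in> kL p K" for i using that True by (auto simp: ord_sum_def kL_def)
  have o2: "?o (p + i) = p' + h i" if "i \<in> kR p K" for i using that True by (auto simp: ord_sum_def kR_def)
  have gl: "g i < p'" if "i \<in> kL p K" for i using that g sub(1) by (auto simp: order_maps_def)
  have oK: "?o ` K = g ` kL p K \<union> (+) p' ` h ` kR p K"
  proof -
   have "?o ` K = ?o ` kL p K \<union> ?o ` (+) p ` kR p K" using k_union[of K p] by (metis image_Un)
   also have "?o ` kL p K = g ` kL p K" by (rule image_cong[OF refl o1])
   also have "?o ` (+) p ` kR p K = (+) p' ` h ` kR p K" unfolding image_image by (rule image_cong[OF refl o2])
   finally show ?thesis .
  qed
  have kk: "kL p' (?o ` K) = g ` kL p K" "kR p' (?o ` K) = h ` kR p K"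
   unfolding oK using gl by (auto simp: kL_def[of p'] kR_def[of p']) (metis not_add_less1)
  have inj: "inj_on ?o K \<longleftrightarrow> inj_on g (kL p K) \<and> inj_on h (kR p K)"
  proof -
   \<comment> \<open>The images of the two parts are disjoint, so injectivity can be compared
     through cardinalities.\<close>
   have "inj_on ?o K \<longleftrightarrow> card (g ` kL p K) + card (h ` kR p K) = card (kL p K) + card (kR p K)"
    using k_card[OF finite_imageI[OF fin], of ?o p'] k_card[OF fin, of p] fin by (simp add: inj_on_iff_eq_card kk)
   also have "\<dots> \<longleftrightarrow> card (g ` kL p K) = card (kL p K) \<and> card (h ` kR p K) = card (kR p K)"
    using card_image_le[OF k_fin(1)[OF fin], of g p] card_image_le[OF k_fin(2)[OF fin], of h p] by linarith
   finally show ?thesis using k_fin[OF fin, of p] by (simp add: inj_on_iff_eq_card)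
  qed
  have gl': "g i < p' + q'" if "i \<in> kL p K" for i using gl[OF that] by simp
  have oK': "?o ` K \<subseteq> {..<p' + q'}" unfolding oK using gl' h sub(2) by (auto simp: order_maps_def)
  have c: "int (card (kL p K)) + int (card (kR p K)) = int (card K)" using k_card[OF fin, of p] by simp
  have z: "cC A B E (int (card (kL p K))) (int (card (kR p K))) \<zero>\<^bsub>cM A B (int (card (kL p K)))\<^esub> v = \<zero>\<^bsub>cM A E (int (card K))\<^esub>"
   if "v \<in>: cM B E (int (card (kR p K)))" for v
   using lin_zero[OF cmod_module[OF S(1,2)] cmod_module[OF S(1,3)] ccomp_linear_left[OF S that, of "int (card (kL p K))"]] unfolding c .
  have z2: "cC A B E (int (card (kL p K))) (int (card (kR p K))) v \<zero>\<^bsub>cM B E (int (card (kR p K)))\<^esub> = \<zero>\<^bsub>cM A E (int (card K))\<^esub>"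
   if "v \<in>: cM A B (int (card (kL p K)))" for v
   using lin_zero[OF cmod_module[OF S(2,3)] cmod_module[OF S(1,3)] ccomp_linear_right[OF S that, of "int (card (kR p K))"]] unfolding c .
  have zc: "\<zero>\<^bsub>cM B E n\<^esub> \<in>: cM B E n" for n
   using module_zero_closed[OF cmod_module[OF S(2,3)]] .
  have xg: "x (g ` kL p K) \<in>: cM A B (int (card (kL p K)))" if "inj_on g (kL p K)"
   using gm_app[OF S(1,2) x order_maps_image[OF g sub(1)]] card_image[OF that] by simp
  have yh: "y (h ` kR p K) \<in>: cM B E (int (card (kR p K)))" if "inj_on h (kR p K)"
   using gm_app[OF S(2,3) y order_maps_image[OF h sub(2)]] card_image[OF that] by simp
  consider (a) "inj_on g (kL p K)" "inj_on h (kR p K)" | (b) "\<not> inj_on h (kR p K)" "inj_on g (kL p K)" | (c) "\<not> inj_on g (kL p K)" by blast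
  then show ?thesis
  proof cases
   case a
   then show ?thesis using True sub oK' by (simp add: gamma_map_def gcomp_def inj kk card_image)
  next
   case b
   then show ?thesis using True sub by (simp add: gamma_map_def gcomp_def inj z2[OF xg])
  next
   case c
   then show ?thesis using True sub z[OF zc] z[OF yh] by (simp add: gamma_map_def gcomp_def inj)
  qed
 qed (simp add: gamma_map_def gcomp_def)
qed

theorem gamma_cat_asmod: "asmod R (gamma_cat C)"
proof (intro asmod.intro asmod_axioms.intro graded_cat.intro graded_cat_axioms.intro is_cring, unfold gamma_cat_simps)
qed (rule gm_module gcomp_left gcomp_right gcomp_assoc gunit_closed gcomp_unit_left gcomp_unit_right
  gm_linear gm_id gm_comp gcomp_natural; assumption)+

end

section \<open>Free templicial modules on subcomplexes of a simplex\<close>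

text \<open>The bilinear analogue of \<open>lin_ext\<close>; it extends gluing from simplices to
  linear combinations.\<close>

definition bil :: "('k,'r) ring_scheme => ('k,'m) module => ('b => 'c => 'm) => ('b => 'k) => ('c => 'k) => 'm" where
 "bil R N \<phi> X Y = lin_ext R N (\<lambda>x. lin_ext R N (\<lambda>y. \<phi> x y) Y) X"

(* keeps the vertex set order_maps {..0} {..n} from being rewritten to order_maps {0} {..n} *)
declare atMost_0 [simp del]

context cring
begin

lemma bil_linear:
 assumes N: "module R N" and c: "\<And>x y. [|x \<in> B; y \<in> B'|] ==> \<phi> x y \<in>: N"
 shows "Y \<in>: FM B' ==> (\<lambda>X. bil R N \<phi> X Y) \<in> Lin (FM B) N"
  and "X \<in>: FM B ==> bil R N \<phi> X \<in> Lin (FM B') N"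
  and "[|x \<in> B; y \<in> B'|] ==> bil R N \<phi> (single R x) (single R y) = \<phi> x y"
proof -
 have l: "lin_ext R N (\<lambda>y. \<phi> x y) \<in> Lin (FM B') N" if "x \<in> B" for x
  using that c by (intro lin_ext_linear[OF N]) auto
 show "(\<lambda>X. bil R N \<phi> X Y) \<in> Lin (FM B) N" if "Y \<in>: FM B'"
  unfolding bil_def by (rule lin_ext_linear[OF N]) (auto intro: lin_closed[OF l that])
 show "bil R N \<phi> X \<in> Lin (FM B') N" if X: "X \<in>: FM B"
  unfolding bil_def[abs_def] lin_ext_def[of R N "\<lambda>x. lin_ext R N (\<phi> x) _"]
 proof (rule lin_finsum_fun[OF FM_module N])
  fix x assume "x \<in> {x. X x \<noteq> \<zero>}"
  then have x: "x \<in> B" and Xx: "X x \<in>: R" using X by (auto simp: free_carrier)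
  show "(\<lambda>Y. X x \<odot>\<^bsub>N\<^esub> lin_ext R N (\<phi> x) Y) \<in> Lin (FM B') N"
   by (rule lin_scale[OF FM_module N l[OF x] Xx])
 qed
 assume x: "x \<in> B" and y: "y \<in> B'"
 have "lin_ext R N (\<lambda>y. \<phi> x y) (single R y) = \<phi> x y" by (rule lin_ext_single[OF N]) (rule c[OF x y])
 then show "bil R N \<phi> (single R x) (single R y) = \<phi> x y"
  unfolding bil_def using lin_ext_single[OF N, of "\<lambda>x. lin_ext R N (\<phi> x) (single R y)" x] c[OF x y] by simp
qed

lemma free_bilin_eqI:
 assumes N: "module R N"
  and h1: "\<And>Y. Y \<in>: FM B' ==> (\<lambda>X. h X Y) \<in> Lin (FM B) N"
  and h2: "\<And>X. X \<in>: FM B ==> (\<lambda>Y. h X Y) \<in> Lin (FM B') N"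
  and g1: "\<And>Y. Y \<in>: FM B' ==> (\<lambda>X. g X Y) \<in> Lin (FM B) N"
  and g2: "\<And>X. X \<in>: FM B ==> (\<lambda>Y. g X Y) \<in> Lin (FM B') N"
  and e: "\<And>x y. [|x \<in> B; y \<in> B'|] ==> h (single R x) (single R y) = g (single R x) (single R y)"
  and X: "X \<in>: FM B" and Y: "Y \<in>: FM B'"
 shows "h X Y = g X Y"
proof (rule free_eqI[OF N h1[OF Y] g1[OF Y] _ X])
 fix x assume x: "x \<in> B"
 show "h (single R x) Y = g (single R x) Y"
  by (rule free_eqI[OF N h2 g2 _ Y]) (auto intro: single_carrier x e)
qed

lemma free_sub_linear:
 assumes "h \<in> Lin L (FM A)" "A \<subseteq> B"
 shows "h \<in> Lin L (FM B)"
proof (rule lin_mapsI)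
 show "h x \<in>: FM B" if "x \<in>: L" for x
  using lin_closed[OF assms(1) that] assms(2) by (auto simp: free_carrier)
qed (use lin_add[OF assms(1)] lin_smult[OF assms(1)] in auto)

text \<open>Zero, addition and scalars of a free module do not depend on its basis set, so values
  computed in the horn may be read in the simplex.\<close>

lemma lin_ext_sub:
 assumes "\<phi> \<in> A \<rightarrow> carrier (FM B)" "B \<subseteq> B'" "f \<in>: FM A"
 shows "lin_ext R (FM B) \<phi> f = lin_ext R (FM B') \<phi> f"
proof (rule free_eqI[OF FM_module free_sub_linear[OF lin_ext_linear[OF FM_module assms(1)] assms(2)] _ _ assms(3)])
 have c: "\<phi> \<in> A \<rightarrow> carrier (FM B')" using assms(1,2) by (auto simp: free_carrier Pi_def)
 show "lin_ext R (FM B') \<phi> \<in> Lin (FM A) (FM B')"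
  by (rule lin_ext_linear[OF FM_module c])
 fix a assume "a \<in> A"
 then show "lin_ext R (FM B) \<phi> (single R a) = lin_ext R (FM B') \<phi> (single R a)"
  using assms(1) c by (auto simp: lin_ext_single[OF FM_module] Pi_def)
qed

end

section \<open>Restricting and gluing simplices of the standard simplex\<close>

definition sB :: "nat => nat => (nat => nat) => (nat => nat) => (nat => nat) set" where
 "sB n p c d = {x \<in> order_maps {..p} {..n}. vertex (x 0) = c \<and> vertex (x p) = d}"

text \<open>The value at p is taken from x; it equals \<open>y 0\<close> whenever the end vertices
  match, see \<open>glue_mid\<close>.\<close>

definition glue :: "nat => nat => (nat => nat) => (nat => nat) => nat => nat" where
 "glue p q x y = (\<lambda>i\<in>{..p + q}. if i \<le> p then x i else y (i - p))"

lemma vertex_inj [simp]: "vertex i = vertex j \<longleftrightarrow> i = j"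
 by (auto simp: vertex_def fun_eq_iff restrict_def)

lemma vertex_0: "x \<in> order_maps {..0} I ==> vertex (x 0) = x"
 by (auto simp: vertex_def order_maps_def fun_eq_iff restrict_def PiE_def extensional_def)

lemma compose_vertex: "i \<le> p ==> compose {..0} x (vertex i) = vertex (x i)"
 by (auto simp: compose_def vertex_def fun_eq_iff)

lemma sBD: assumes "x \<in> sB n p c d"
 shows "x \<in> order_maps {..p} {..n}" "vertex (x 0) = c" "vertex (x p) = d" "x \<in> extensional {..p}"
  "i \<le> p ==> x i \<le> n" "[|i \<le> j; j \<le> p|] ==> x i \<le> x j"
 using assms by (auto simp: sB_def order_maps_def mono_on_def PiE_def)

lemma sBI: "[|\<And>i. i \<le> p ==> x i \<le> n; \<And>i j. [|i \<le> j; j \<le> p|] ==> x i \<le> x j; x \<in> extensional {..p}; vertex (x 0) = c; vertex (x p) = d|] ==> x \<in> sB n p c d"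
 by (auto simp: sB_def order_maps_def mono_on_def PiE_def)

lemma sB_0: assumes "c \<in> order_maps {..0} {..n}" shows "sB n 0 c d = (if c = d then {c} else {})"
proof (intro equalityI subsetI)
 fix x assume x: "x \<in> sB n 0 c d"
 show "x \<in> (if c = d then {c} else {})" using sBD(2,3)[OF x] vertex_0[OF sBD(1)[OF x]] by auto
next
 fix x assume "x \<in> (if c = d then {c} else {})"
 then show "x \<in> sB n 0 c d" using assms vertex_0[OF assms] by (auto simp: sB_def split: if_splits)
qed

lemma glue_mid: assumes "x \<in> sB n p a c" "y \<in> sB n q c b" shows "x p = y 0"
 using sBD(3)[OF assms(1)] sBD(2)[OF assms(2)] by (metis vertex_inj)

lemma glue_sB:
 assumes x: "x \<in> sB n p a c" and y: "y \<in> sB n q c b"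
 shows "glue p q x y \<in> sB n (p + q) a b"
proof (rule sBI)
 note m = glue_mid[OF x y]
 show "glue p q x y i \<le> glue p q x y j" if "i \<le> j" "j \<le> p + q" for i j
 proof -
  consider "j \<le> p" | "i \<le> p" "\<not> j \<le> p" | "\<not> i \<le> p" by linarith
  then show ?thesis
  proof cases
   case 2
   have "x i \<le> x p" "y 0 \<le> y (j - p)" using 2 that sBD(6)[OF x] sBD(6)[OF y] by auto
   then show ?thesis using 2 that m by (simp add: glue_def)
  qed (use that sBD(6)[OF x] sBD(6)[OF y] in \<open>auto simp: glue_def\<close>)
 qed
 show "vertex (glue p q x y (p + q)) = b" using sBD(3)[OF y] m by (cases "q = 0") (auto simp: glue_def)
qed (use sBD[OF x] sBD[OF y] in \<open>auto simp: glue_def\<close>)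

lemma glue_assoc: "glue (p + q) r (glue p q x y) z = glue p (q + r) x (glue q r y z)"
 by (auto simp: glue_def fun_eq_iff add.assoc restrict_def intro: arg_cong[where f=y] arg_cong[where f=z])

lemma glue_unit_left: assumes "x \<in> sB n p a b" shows "glue 0 p a x = x"
proof -
 have "a 0 = x 0" using sBD(2)[OF assms] by (auto simp: vertex_def)
 then show ?thesis using sBD(4)[OF assms] by (auto simp: glue_def fun_eq_iff extensional_def)
qed

lemma glue_unit_right: "x \<in> sB n p a b ==> glue p 0 x b = x"
 using sBD(4)[of x n p a b] by (auto simp: glue_def fun_eq_iff extensional_def)

lemma glue_restrict:
 assumes "x \<in> sB n (p + q) a b"
 shows "compose {..p} x (\<lambda>i\<in>{..p}. i) \<in> sB n p a (vertex (x p))" "compose {..q} x (\<lambda>i\<in>{..q}. p + i) \<in> sB n q (vertex (x p)) b"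
  "glue p q (compose {..p} x (\<lambda>i\<in>{..p}. i)) (compose {..q} x (\<lambda>i\<in>{..q}. p + i)) = x"
 using sBD[OF assms] by (auto intro!: sBI simp: compose_def glue_def fun_eq_iff extensional_def)

lemma restrict_glue:
 assumes "x \<in> sB n p a c" "y \<in> sB n q c b"
 shows "compose {..p} (glue p q x y) (\<lambda>i\<in>{..p}. i) = x" "compose {..q} (glue p q x y) (\<lambda>i\<in>{..q}. p + i) = y"
  "glue p q x y p = x p"
 using sBD(4)[OF assms(1)] sBD(4)[OF assms(2)] glue_mid[OF assms]
 by (auto simp: compose_def glue_def fun_eq_iff extensional_def)

lemma compose_sB: "[|f \<in> imaps m p; x \<in> sB n p a b|] ==> compose {..m} x f \<in> sB n m a b"
 using imapsD[of f m p] sBD[of x n p a b] by (intro sBI) (auto simp: compose_def)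

lemma compose_glue:
 assumes f: "f \<in> imaps p p'" and g: "g \<in> imaps q q'" and x: "x \<in> sB n p' a c" and y: "y \<in> sB n q' c b"
 shows "compose {..p + q} (glue p' q' x y) (interval_sum p p' q f g) = glue p q (compose {..p} x f) (compose {..q} y g)"
proof
 fix i
 note F = imapsD[OF f] and G = imapsD[OF g]
 have "x p' = y 0" by (rule glue_mid[OF x y])
 moreover have "g (i - p) \<le> q'" if "i \<le> p + q" using G(3)[of "i - p"] that by simp
 ultimately show "compose {..p + q} (glue p' q' x y) (interval_sum p p' q f g) i = glue p q (compose {..p} x f) (compose {..q} y g) i"
  using F(3)[of i] by (auto simp: compose_def glue_def interval_sum_def)
qed

text \<open>One development for the horn and for the simplex itself. All vertices are present in K,
  since they are the objects of the graded category.\<close>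

locale sub_simplex = cring R for R :: "('k,'r) ring_scheme" (structure) +
 fixes n :: nat and K :: "(nat => nat) sset"
 assumes K_0: "simplices K 0 = order_maps {..0} {..n}"
  and K_sub: "simplices K m \<subseteq> order_maps {..m} {..n}"
  and K_act: "sact K l m g x = compose {..l} x g"
  and K_closed: "[|x \<in> simplices K m; g \<in> order_maps {..l} {..m}|] ==> compose {..l} x g \<in> simplices K l"
begin

abbreviation "V \<equiv> order_maps {..0} {..n}"

definition "M p c d = FM (sB n p c d)"
definition "Q p c d = FM (simplices K p \<inter> sB n p c d)"
definition "J p q a c b = bil R (M (p + q) a b) (\<lambda>x y. single R (glue p q x y))"
definition "tm m p f a b = lin_ext R (M m a b) (\<lambda>x. single R (compose {..m} x f))"

abbreviation "KX \<equiv> free_templicial R K"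

lemma M_module: "module R (M p a b)" unfolding M_def by (rule FM_module)
lemma Q_module: "module R (Q p a b)" unfolding Q_def by (rule FM_module)

lemma single_M: "x \<in> sB n p a b ==> single R x \<in>: M p a b" unfolding M_def by (rule single_carrier)
lemma single_Q: "[|x \<in> sB n p a b; x \<in> simplices K p|] ==> single R x \<in>: Q p a b" unfolding Q_def by (rule single_carrier) simp

lemma J_linear:
 shows "Y \<in>: M q c b ==> (\<lambda>X. J p q a c b X Y) \<in> Lin (M p a c) (M (p + q) a b)"
  and "X \<in>: M p a c ==> J p q a c b X \<in> Lin (M q c b) (M (p + q) a b)"
  and "[|x \<in> sB n p a c; y \<in> sB n q c b|] ==> J p q a c b (single R x) (single R y) = single R (glue p q x y)"
proof -
 have c: "single R (glue p q x y) \<in>: M (p + q) a b" if "x \<in> sB n p a c" "y \<in> sB n q c b" for x y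
  by (rule single_M[OF glue_sB[OF that]])
 show "Y \<in>: M q c b ==> (\<lambda>X. J p q a c b X Y) \<in> Lin (M p a c) (M (p + q) a b)"
  unfolding J_def M_def[of q] M_def[of p] by (rule bil_linear(1)[OF M_module c])
 show "X \<in>: M p a c ==> J p q a c b X \<in> Lin (M q c b) (M (p + q) a b)"
  unfolding J_def M_def[of q] M_def[of p] by (rule bil_linear(2)[OF M_module c])
 show "[|x \<in> sB n p a c; y \<in> sB n q c b|] ==> J p q a c b (single R x) (single R y) = single R (glue p q x y)"
  unfolding J_def by (rule bil_linear(3)[OF M_module c])
qed

lemma M_eqI:
 assumes "module R N" "h \<in> Lin (M p a b) N" "g \<in> Lin (M p a b) N"
  and "\<And>x. x \<in> sB n p a b ==> h (single R x) = g (single R x)" "f \<in>: M p a b"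
 shows "h f = g f"
 by (rule free_eqI[OF assms(1) assms(2-3)[unfolded M_def] assms(4) assms(5)[unfolded M_def]])

lemma Q_eqI:
 assumes "module R N" "h \<in> Lin (Q p a b) N" "g \<in> Lin (Q p a b) N"
  and "\<And>x. [|x \<in> sB n p a b; x \<in> simplices K p|] ==> h (single R x) = g (single R x)" "f \<in>: Q p a b"
 shows "h f = g f"
 by (rule free_eqI[OF assms(1) assms(2-3)[unfolded Q_def] _ assms(5)[unfolded Q_def]]) (simp add: assms(4))

lemma M_bilin_eqI:
 assumes N: "module R N"
  and "\<And>Y. Y \<in>: M q c b ==> (\<lambda>X. h X Y) \<in> Lin (M p a c) N"
  and "\<And>X. X \<in>: M p a c ==> (\<lambda>Y. h X Y) \<in> Lin (M q c b) N"
  and "\<And>Y. Y \<in>: M q c b ==> (\<lambda>X. g X Y) \<in> Lin (M p a c) N"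
  and "\<And>X. X \<in>: M p a c ==> (\<lambda>Y. g X Y) \<in> Lin (M q c b) N"
  and "\<And>x y. [|x \<in> sB n p a c; y \<in> sB n q c b|] ==> h (single R x) (single R y) = g (single R x) (single R y)"
  and "X \<in>: M p a c" "Y \<in>: M q c b"
 shows "h X Y = g X Y"
 using assms(2-) unfolding M_def by (rule free_bilin_eqI[OF N])

lemma tm_linear: "f \<in> imaps m p ==> tm m p f a b \<in> Lin (M p a b) (M m a b)"
 unfolding tm_def M_def[of p] by (rule lin_ext_linear[OF M_module]) (auto intro: single_M compose_sB)

lemma tm_single: "[|f \<in> imaps m p; x \<in> sB n p a b|] ==> tm m p f a b (single R x) = single R (compose {..m} x f)"
 unfolding tm_def by (rule lin_ext_single[OF M_module]) (rule single_M[OF compose_sB])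

lemma J_assoc:
 assumes x: "x \<in>: M p a c" and y: "y \<in>: M q c d" and z: "z \<in>: M r d b"
 shows "J (p + q) r a d b (J p q a c d x y) z = J p (q + r) a c b x (J q r c d b y z)"
proof (rule M_bilin_eqI[OF M_module _ _ _ _ _ x y])
 show "(\<lambda>X. J (p + q) r a d b (J p q a c d X Y) z) \<in> Lin (M p a c) (M (p + (q + r)) a b)" if "Y \<in>: M q c d" for Y
  using lin_comp[OF J_linear(1)[OF z] J_linear(1)[OF that]] by (simp add: add.assoc)
 show "(\<lambda>Y. J (p + q) r a d b (J p q a c d X Y) z) \<in> Lin (M q c d) (M (p + (q + r)) a b)" if "X \<in>: M p a c" for X
  using lin_comp[OF J_linear(1)[OF z] J_linear(2)[OF that]] by (simp add: add.assoc)
 show "(\<lambda>X. J p (q + r) a c b X (J q r c d b Y z)) \<in> Lin (M p a c) (M (p + (q + r)) a b)" if "Y \<in>: M q c d" for Y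
  by (rule J_linear(1)[OF lin_closed[OF J_linear(2)[OF that] z]])
 show "(\<lambda>Y. J p (q + r) a c b X (J q r c d b Y z)) \<in> Lin (M q c d) (M (p + (q + r)) a b)" if "X \<in>: M p a c" for X
  by (rule lin_comp[OF J_linear(2)[OF that] J_linear(1)[OF z]])
 fix x y assume x: "x \<in> sB n p a c" and y: "y \<in> sB n q c d"
 show "J (p + q) r a d b (J p q a c d (single R x) (single R y)) z = J p (q + r) a c b (single R x) (J q r c d b (single R y) z)"
 proof (rule M_eqI[OF M_module _ _ _ z])
  show "J (p + q) r a d b (J p q a c d (single R x) (single R y)) \<in> Lin (M r d b) (M (p + (q + r)) a b)"
   using J_linear(2)[OF lin_closed[OF J_linear(2)[OF single_M[OF x]] single_M[OF y]], of r b] by (simp add: add.assoc)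
  show "(\<lambda>z. J p (q + r) a c b (single R x) (J q r c d b (single R y) z)) \<in> Lin (M r d b) (M (p + (q + r)) a b)"
   by (rule lin_comp[OF J_linear(2)[OF single_M[OF x]] J_linear(2)[OF single_M[OF y]]])
  fix z assume z: "z \<in> sB n r d b"
  show "J (p + q) r a d b (J p q a c d (single R x) (single R y)) (single R z) = J p (q + r) a c b (single R x) (J q r c d b (single R y) (single R z))"
   by (simp add: J_linear(3)[OF x y] J_linear(3)[OF y z] J_linear(3)[OF glue_sB[OF x y] z] J_linear(3)[OF x glue_sB[OF y z]] glue_assoc)
 qed
qed

lemma u_sB: "c \<in> V ==> c \<in> sB n 0 c c" by (simp add: sB_0)

lemma J_unit_left: "[|a \<in> V; x \<in>: M p a b|] ==> J 0 p a a b (single R a) x = x"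
 by (rule M_eqI[OF M_module _ lin_id])
  (use J_linear(2)[OF single_M[OF u_sB], of a p b] in \<open>auto simp: J_linear(3)[OF u_sB] glue_unit_left\<close>)

lemma J_unit_right: "[|b \<in> V; x \<in>: M p a b|] ==> J p 0 a b b x (single R b) = x"
 by (rule M_eqI[OF M_module _ lin_id])
  (use J_linear(1)[OF single_M[OF u_sB], of b p a] in \<open>auto simp: J_linear(3)[OF _ u_sB] glue_unit_right\<close>)

lemma graded: "graded_cat R V M J (single R)"
 by (rule graded_cat.intro[OF is_cring], rule graded_cat_axioms.intro)
  (rule M_module J_linear J_assoc single_M[OF u_sB] J_unit_left J_unit_right; assumption)+

lemma graded_sub: "graded_sub R V M J (single R) Q"
 by (rule graded_sub.intro[OF graded], rule graded_sub_axioms.intro)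
  (auto simp: Q_module, auto simp: Q_def M_def free_carrier)

lemma tm_J:
 assumes f: "f \<in> imaps p p'" and g: "g \<in> imaps q q'" and x: "x \<in>: M p' a c" and y: "y \<in>: M q' c b"
 shows "tm (p + q) (p' + q') (interval_sum p p' q f g) a b (J p' q' a c b x y) = J p q a c b (tm p p' f a c x) (tm q q' g c b y)"
proof (rule M_bilin_eqI[OF M_module _ _ _ _ _ x y])
 note s = interval_sum_map[OF f g]
 show "(\<lambda>X. tm (p + q) (p' + q') (interval_sum p p' q f g) a b (J p' q' a c b X Y)) \<in> Lin (M p' a c) (M (p + q) a b)" if "Y \<in>: M q' c b" for Y
  by (rule lin_comp[OF tm_linear[OF s] J_linear(1)[OF that]])
 show "(\<lambda>Y. tm (p + q) (p' + q') (interval_sum p p' q f g) a b (J p' q' a c b X Y)) \<in> Lin (M q' c b) (M (p + q) a b)" if "X \<in>: M p' a c" for X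
  by (rule lin_comp[OF tm_linear[OF s] J_linear(2)[OF that]])
 show "(\<lambda>X. J p q a c b (tm p p' f a c X) (tm q q' g c b Y)) \<in> Lin (M p' a c) (M (p + q) a b)" if "Y \<in>: M q' c b" for Y
  by (rule lin_comp[OF J_linear(1)[OF lin_closed[OF tm_linear[OF g] that]] tm_linear[OF f]])
 show "(\<lambda>Y. J p q a c b (tm p p' f a c X) (tm q q' g c b Y)) \<in> Lin (M q' c b) (M (p + q) a b)" if "X \<in>: M p' a c" for X
  by (rule lin_comp[OF J_linear(2)[OF lin_closed[OF tm_linear[OF f] that]] tm_linear[OF g]])
 fix x y assume x: "x \<in> sB n p' a c" and y: "y \<in> sB n q' c b"
 show "tm (p + q) (p' + q') (interval_sum p p' q f g) a b (J p' q' a c b (single R x) (single R y)) = J p q a c b (tm p p' f a c (single R x)) (tm q q' g c b (single R y))"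
  by (simp add: J_linear(3)[OF x y] tm_single[OF s glue_sB[OF x y]] tm_single[OF f x] tm_single[OF g y]
   J_linear(3)[OF compose_sB[OF f x] compose_sB[OF g y]] compose_glue[OF f g x y])
qed

lemma tm_id: "x \<in>: M p a b ==> tm p p (\<lambda>i\<in>{..p}. i) a b x = x"
proof (rule M_eqI[OF M_module tm_linear[OF interval_maps_id] lin_id])
 fix x assume x: "x \<in> sB n p a b"
 have "compose {..p} x (\<lambda>i\<in>{..p}. i) = x" using sBD(4)[OF x] by (auto simp: compose_def fun_eq_iff extensional_def)
 then show "tm p p (\<lambda>i\<in>{..p}. i) a b (single R x) = single R x" by (simp add: tm_single[OF interval_maps_id x])
qed

lemma tm_comp:
 assumes f: "f \<in> imaps l m" and g: "g \<in> imaps m p" and x: "x \<in>: M p a b"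
 shows "tm l p (compose {..l} g f) a b x = tm l m f a b (tm m p g a b x)"
proof (rule M_eqI[OF M_module tm_linear[OF interval_maps_comp[OF f g]] lin_comp[OF tm_linear[OF f] tm_linear[OF g]] _ x])
 fix x assume x: "x \<in> sB n p a b"
 have "compose {..l} x (compose {..l} g f) = compose {..l} (compose {..m} x g) f"
  using imapsD(3)[OF f] by (auto simp: compose_def fun_eq_iff)
 then show "tm l p (compose {..l} g f) a b (single R x) = tm l m f a b (tm m p g a b (single R x))"
  by (simp add: tm_single[OF f compose_sB[OF g x]] tm_single[OF g x] tm_single[OF interval_maps_comp[OF f g] x])
qed

lemma KX_simps: "tvert KX = V" "tmod KX = Q" "tmap KX = (\<lambda>m p f a b. lin_ext R (Q m a b) (\<lambda>x. single R (compose {..m} x f)))"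
 "tcomult KX = (\<lambda>p q a b. lin_ext R (TT V [Q p, Q q] a b) (\<lambda>x. pure R V [Q p, Q q] [a, vertex (x p), b]
      [single R (compose {..p} x (\<lambda>i\<in>{..p}. i)), single R (compose {..q} x (\<lambda>i\<in>{..q}. p + i))]))"
 "tcounit KX = (\<lambda>a b. lin_ext R (unit_quiver R a b) (\<lambda>x. \<one>))"
proof -
 have "{x \<in> simplices K p. sset_vertex K p 0 x = a \<and> sset_vertex K p p x = b} = simplices K p \<inter> sB n p a b" for p a b
  using K_sub[of p] by (auto simp: sset_vertex_def K_act compose_vertex[OF order_refl] compose_vertex[OF le0] sB_def)
 then have Qe: "free_mod R K = Q" by (simp add: free_mod_def Q_def fun_eq_iff)
 have v: "sset_vertex K (p + q) p x = vertex (x p)" for p q x by (simp add: sset_vertex_def K_act compose_vertex[of p "p+q"])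
 show "tvert KX = V" "tmod KX = Q" "tmap KX = (\<lambda>m p f a b. lin_ext R (Q m a b) (\<lambda>x. single R (compose {..m} x f)))"
  "tcomult KX = (\<lambda>p q a b. lin_ext R (TT V [Q p, Q q] a b) (\<lambda>x. pure R V [Q p, Q q] [a, vertex (x p), b]
      [single R (compose {..p} x (\<lambda>i\<in>{..p}. i)), single R (compose {..q} x (\<lambda>i\<in>{..q}. p + i))]))"
  "tcounit KX = (\<lambda>a b. lin_ext R (unit_quiver R a b) (\<lambda>x. \<one>))"
  unfolding free_templicial_def by (simp_all add: K_0 Qe K_act v)
qed

lemma compose_KB: "[|f \<in> imaps m p; x \<in> simplices K p \<inter> sB n p a b|] ==> single R (compose {..m} x f) \<in>: Q m a b"
 using compose_sB[of f m p x] K_closed[of x p f m] by (intro single_Q) (auto simp: interval_maps_def)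

lemma tmap_linear_Q: "f \<in> imaps m p ==> tmap KX m p f a b \<in> Lin (Q p a b) (Q m a b)"
 unfolding KX_simps Q_def[of p] by (rule lin_ext_linear[OF Q_module]) (auto intro: compose_KB)

lemma tmap_tm: "[|f \<in> imaps m p; x \<in>: Q p a b|] ==> tmap KX m p f a b x = tm m p f a b x"
 unfolding KX_simps tm_def M_def Q_def[of m]
 by (rule lin_ext_sub[of _ "simplices K p \<inter> sB n p a b"]) (auto simp: Q_def[symmetric] intro: compose_KB)

lemma quivers_Q2: "qv V [Q p, Q q]" by (simp add: Q_module)

lemma tcomult_paths:
 assumes a: "a \<in> V" and b: "b \<in> V" and x: "x \<in> simplices K (p + q) \<inter> sB n (p + q) a b"
 shows "single R (compose {..p} x (\<lambda>i\<in>{..p}. i)) \<in>: Q p a (vertex (x p))"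
  "single R (compose {..q} x (\<lambda>i\<in>{..q}. p + i)) \<in>: Q q (vertex (x p)) b" "vertex (x p) \<in> V"
  "([a, vertex (x p), b], [single R (compose {..p} x (\<lambda>i\<in>{..p}. i)), single R (compose {..q} x (\<lambda>i\<in>{..q}. p + i))]) \<in> paths V [Q p, Q q] a b"
proof -
 have x1: "x \<in> sB n (p + q) a b" and xK: "x \<in> simplices K (p + q)" using x by auto
 show v: "vertex (x p) \<in> V" using sBD(5)[OF x1, of p] by (auto simp: vertex_def order_maps_def mono_on_def)
 have o: "(\<lambda>i\<in>{..p}. i) \<in> order_maps {..p} {..p + q}" "(\<lambda>i\<in>{..q}. p + i) \<in> order_maps {..q} {..p + q}"
  by (auto simp: order_maps_def mono_on_def)
 show c: "single R (compose {..p} x (\<lambda>i\<in>{..p}. i)) \<in>: Q p a (vertex (x p))"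
  "single R (compose {..q} x (\<lambda>i\<in>{..q}. p + i)) \<in>: Q q (vertex (x p)) b"
  using single_Q[OF glue_restrict(1)[OF x1] K_closed[OF xK o(1)]] single_Q[OF glue_restrict(2)[OF x1] K_closed[OF xK o(2)]] by auto
 show "([a, vertex (x p), b], [single R (compose {..p} x (\<lambda>i\<in>{..p}. i)), single R (compose {..q} x (\<lambda>i\<in>{..q}. p + i))]) \<in> paths V [Q p, Q q] a b"
  using a b v c by (auto simp: paths_Cons paths_Nil)
qed

lemma tcomult_linear_Q: "[|a \<in> V; b \<in> V|] ==> tcomult KX p q a b \<in> Lin (Q (p + q) a b) (TT V [Q p, Q q] a b)"
 unfolding KX_simps Q_def[of "p + q"]
 by (rule lin_ext_linear[OF TT_module[OF quivers_Q2]]) (auto intro!: pure_closed[OF quivers_Q2] tcomult_paths(4))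

lemma tcomult_single:
 assumes "a \<in> V" "b \<in> V" "x \<in> simplices K (p + q)" "x \<in> sB n (p + q) a b"
 shows "tcomult KX p q a b (single R x) = pure R V [Q p, Q q] [a, vertex (x p), b]
      [single R (compose {..p} x (\<lambda>i\<in>{..p}. i)), single R (compose {..q} x (\<lambda>i\<in>{..q}. p + i))]"
 unfolding KX_simps by (rule lin_ext_single[OF TT_module[OF quivers_Q2]]) (rule pure_closed[OF quivers_Q2 tcomult_paths(4)]; use assms in simp)

text \<open>Restricting a simplex to its two parts and gluing them gives it back, so the projections
  P are the identity here.\<close>

lemma Phi_tcomult:
 assumes S: "a \<in> V" "b \<in> V" and x: "x \<in>: Q (p + q) a b"
 shows "graded_sub.Phi R M J (single R) [p,q] a b (tcomult KX p q a b x) = x"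
proof -
 interpret G: graded_sub R V M J "single R" Q by (rule graded_sub)
 show ?thesis
 proof (rule Q_eqI[OF M_module lin_comp[OF _ tcomult_linear_Q[OF S]] _ _ x])
  show "G.Phi [p,q] a b \<in> Lin (TT V [Q p, Q q] a b) (M (p + q) a b)"
   using G.Phi_linear[OF S, of "[p,q]"] by simp
  show "(\<lambda>x. x) \<in> Lin (Q (p + q) a b) (M (p + q) a b)" by (rule G.lin_restrict[OF lin_id S])
  fix x assume x: "x \<in> sB n (p + q) a b" "x \<in> simplices K (p + q)"
  then have x': "x \<in> simplices K (p + q) \<inter> sB n (p + q) a b" by simp
  show "G.Phi [p,q] a b (tcomult KX p q a b (single R x)) = single R x"
   unfolding tcomult_single[OF S x(2,1)] G.Phi_pair[OF S(1) S(2) tcomult_paths(3,1,2)[OF S x']]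
    J_linear(3)[OF glue_restrict(1,2)[OF x(1)]] glue_restrict(3)[OF x(1)] ..
 qed
qed

lemma counit_aux: "(\<lambda>x. \<one>) \<in> simplices K 0 \<inter> sB n 0 a b \<rightarrow> carrier (unit_quiver R a b)" if "a \<in> V" for a b
 using sB_0[OF that, of b] by (auto simp: unit_quiver_def)

lemma tcounit_linear_Q: "a \<in> V ==> tcounit KX a b \<in> Lin (Q 0 a b) (unit_quiver R a b)"
 unfolding KX_simps Q_def by (rule lin_ext_linear[OF unit_quiver_module counit_aux])

lemma u_Q: "a \<in> V ==> single R a \<in>: Q 0 a a" by (rule single_Q[OF u_sB]) (auto simp: K_0)

lemma tcounit_u: "tcounit KX a a (single R a) = \<one>"
 unfolding KX_simps by (rule lin_ext_single[OF unit_quiver_module]) (simp add: unit_quiver_def)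

text \<open>In degree 0 the only possible basis element from a to b is a itself, and it exists only
  when a = b.\<close>

lemma tcounit_eq:
 assumes S: "a \<in> V" "b \<in> V" and x: "x \<in>: Q 0 a b"
 shows "x = (if a = b then tcounit KX a b x \<odot>\<^bsub>Q 0 a b\<^esub> single R a else \<zero>\<^bsub>Q 0 a b\<^esub>)"
proof (cases "a = b")
 case True
 interpret Q: module R "Q 0 a a" by (rule Q_module)
 have l: "(\<lambda>x. tcounit KX a a x \<odot>\<^bsub>Q 0 a a\<^esub> single R a) \<in> Lin (Q 0 a a) (Q 0 a a)"
  using u_Q[OF S(1)] lin_closed[OF tcounit_linear_Q[OF S(1), of a]] lin_add[OF tcounit_linear_Q[OF S(1), of a]]
   lin_smult[OF tcounit_linear_Q[OF S(1), of a]]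
  by (intro lin_mapsI) (auto simp: unit_quiver_def Q.smult_l_distr Q.smult_assoc1)
 have "x = tcounit KX a a x \<odot>\<^bsub>Q 0 a a\<^esub> single R a"
 proof (rule Q_eqI[OF Q_module lin_id l _ x[unfolded True[symmetric]]])
  fix y assume "y \<in> sB n 0 a a"
  then have "y = a" using sB_0[OF S(1)] by simp
  then show "single R y = tcounit KX a a (single R y) \<odot>\<^bsub>Q 0 a a\<^esub> single R a" using u_Q[OF S(1)] by (simp add: tcounit_u)
 qed
 then show ?thesis using True by simp
next
 case False
 then show ?thesis using x sB_0[OF S(1), of b] by (auto simp: Q_def free_carrier)
qed

lemma frob: "frob R V M J (single R) Q KX tm (\<lambda>_ _ _ _ x. x)"
 by (rule frob.intro[OF graded_sub], rule frob_axioms.intro)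
  (rule KX_simps(1,2) tm_linear tm_id tm_comp tmap_tm tmap_linear_Q tm_J lin_id refl tcomult_linear_Q Phi_tcomult
   tcounit_linear_Q u_Q tcounit_u tcounit_eq; assumption)+

end

lemma order_maps_compose: "[|x \<in> order_maps I J; g \<in> order_maps L I|] ==> compose L x g \<in> order_maps L J"
 unfolding order_maps_def mono_on_def by (auto simp: compose_def) (metis PiE_mem)

context cring
begin

lemma simplex_sub: "sub_simplex R n (std_simplex n)"
 by (rule sub_simplex.intro[OF is_cring], rule sub_simplex_axioms.intro) (auto simp: std_simplex_def order_maps_compose)

text \<open>The vertices belong to the horn because 0 < j < n: each vertex misses 0 or n, and
  neither of these is j.\<close>

lemma horn_sub:
 assumes "0 < j" "j < n"
 shows "sub_simplex R n (horn n j)"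
proof (rule sub_simplex.intro[OF is_cring], rule sub_simplex_axioms.intro)
 have "\<exists>i\<in>{..n} - {j}. i \<notin> x ` {..0}" for x :: "nat => nat"
 proof (cases "x 0 = 0")
  case True
  then show ?thesis using assms by (intro bexI[of _ n]) (auto simp: atMost_0)
 next
  case False
  then show ?thesis using assms by (intro bexI[of _ 0]) (auto simp: atMost_0)
 qed
 then show "simplices (horn n j) 0 = order_maps {..0} {..n}" by (auto simp: horn_def)
 show "simplices (horn n j) m \<subseteq> order_maps {..m} {..n}" for m by (auto simp: horn_def)
 fix x m g l assume x: "x \<in> simplices (horn n j) m" and g: "g \<in> order_maps {..l} {..m}"
 then have "compose {..l} x g ` {..l} \<subseteq> x ` {..m}" by (auto simp: compose_def order_maps_def)
 moreover have "compose {..l} x g \<in> order_maps {..l} {..n}"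
  using x g by (auto simp: horn_def order_maps_compose)
 moreover obtain i where "i \<in> {..n} - {j}" "i \<notin> x ` {..m}" using x by (auto simp: horn_def)
 ultimately show "compose {..l} x g \<in> simplices (horn n j) l" unfolding horn_def by (simp only: sset.simps) blast
qed (simp add: horn_def)

text \<open>In the full simplex all gluings are available, so Q = M, and restricting a glued simplex
  recovers its two pieces.\<close>

lemma simplex_frob_split: "frob_split R (order_maps {..0} {..n}) (sub_simplex.M R n) (sub_simplex.J R n) (single R)
  (free_templicial R (std_simplex n)) (sub_simplex.tm R n) (\<lambda>_ _ _ _ x. x)"
proof -
 interpret D: sub_simplex R n "std_simplex n" by (rule simplex_sub)
 have "simplices (std_simplex n) p \<inter> sB n p a b = sB n p a b" for p a b by (auto simp: std_simplex_def sB_def)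
 then have Q: "D.Q = D.M" by (simp add: D.Q_def D.M_def fun_eq_iff)
 have K: "x \<in> simplices (std_simplex n) p" if "x \<in> sB n p a b" for x p a b using that by (simp add: std_simplex_def sB_def)
 show ?thesis
 proof (rule frob_split.intro[OF D.frob[unfolded Q]], rule frob_split_axioms.intro)
  fix a c b x y p q assume S: "a \<in> order_maps {..0} {..n}" "c \<in> order_maps {..0} {..n}" "b \<in> order_maps {..0} {..n}"
   and x: "x \<in>: D.M p a c" and y: "y \<in>: D.M q c b"
  let ?t = "tcomult (free_templicial R (std_simplex n)) p q a b"
  note qv = D.quivers_Q2[unfolded Q, of p q]
  note tl = D.tcomult_linear_Q[unfolded Q, OF S(1,3), of p q]
  show "?t (D.J p q a c b x y) = pure R D.V [D.M p, D.M q] [a,c,b] [x,y]"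
  proof (rule D.M_bilin_eqI[OF TT_module[OF qv] _ _ _ _ _ x y])
   show "(\<lambda>X. ?t (D.J p q a c b X Y)) \<in> Lin (D.M p a c) (TT D.V [D.M p, D.M q] a b)" if "Y \<in>: D.M q c b" for Y
    by (rule lin_comp[OF tl D.J_linear(1)[OF that]])
   show "(\<lambda>Y. ?t (D.J p q a c b X Y)) \<in> Lin (D.M q c b) (TT D.V [D.M p, D.M q] a b)" if "X \<in>: D.M p a c" for X
    by (rule lin_comp[OF tl D.J_linear(2)[OF that]])
   show "(\<lambda>X. pure R D.V [D.M p, D.M q] [a,c,b] [X,Y]) \<in> Lin (D.M p a c) (TT D.V [D.M p, D.M q] a b)" if "Y \<in>: D.M q c b" for Y
    using that by (rule pure_pair_linear(1)[OF qv S])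
   show "(\<lambda>Y. pure R D.V [D.M p, D.M q] [a,c,b] [X,Y]) \<in> Lin (D.M q c b) (TT D.V [D.M p, D.M q] a b)" if "X \<in>: D.M p a c" for X
    using that by (rule pure_pair_linear(2)[OF qv S])
   fix x y assume x: "x \<in> sB n p a c" and y: "y \<in> sB n q c b"
   show "?t (D.J p q a c b (single R x) (single R y)) = pure R D.V [D.M p, D.M q] [a,c,b] [single R x, single R y]"
    unfolding D.J_linear(3)[OF x y] D.tcomult_single[unfolded Q, OF S(1,3) K[OF glue_sB[OF x y]] glue_sB[OF x y]] restrict_glue[OF x y] sBD(3)[OF x] ..
  qed
 qed
qed

end

text \<open>Simplices from the first to the last vertex are interval maps, which is how they come to
  act on the nerve.\<close>

lemma sB_interval: "f \<in> sB n p (vertex 0) (vertex n) \<longleftrightarrow> f \<in> imaps p n"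
 by (auto simp: sB_def interval_maps_def)

context sub_simplex
begin

sublocale F: frob R V M J "single R" Q KX tm "\<lambda>_ _ _ _ x. x" by (rule frob)

abbreviation "PhiN T \<equiv> F.PhiN T"

text \<open>\<open>\<rho>\<close> is the tensor product of the projections that discard simplices
  outside K. Applied after the iterated comultiplication of the full simplex it inverts
  \<open>Phi\<close> from the left, although the products themselves may leave Q.\<close>

lemma Phi_Q_inj:
 assumes S: "a \<in> V" "b \<in> V" and z: "z \<in>: TT V (map Q ps) a b" "z' \<in>: TT V (map Q ps) a b"
  and e: "F.Phi ps a b z = F.Phi ps a b z'"
 shows "z = z'"
proof -
 interpret D: frob_split R V M J "single R" "free_templicial R (std_simplex n)" tm "\<lambda>_ _ _ _ x. x" by (rule simplex_frob_split)
 define r where "r p (c :: nat => nat) (d :: nat => nat) f = (\<lambda>x. if x \<in> simplices K p then f x else \<zero>)" for p c d and f :: "(nat => nat) => 'k"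
 have r: "r p c d \<in> Lin (M p c d) (Q p c d)" for p c d
 proof (rule lin_mapsI)
  fix x assume "x \<in>: M p c d"
  then show "r p c d x \<in>: Q p c d" unfolding r_def M_def Q_def
   by (auto simp: free_carrier intro: finite_subset[of _ "{y. x y \<noteq> \<zero>}"])
 qed (auto simp: r_def M_def Q_def free_carrier)
 have rQ: "r p c d x = x" if "x \<in>: Q p c d" for p c d x
  using that by (auto simp: r_def Q_def free_carrier fun_eq_iff)
 define \<rho> where "\<rho> = tensor_lift R (TT V (map Q ps) a b) (\<lambda>(cs,xs). pure R V (map Q ps) cs (pmap (map r ps) cs xs))"
 have m: "MLin V (map M ps) a b (TT V (map Q ps) a b) (\<lambda>(cs,xs). pure R V (map Q ps) cs (pmap (map r ps) cs xs))"
  using multilinear_pmap[of "map r ps" "map M ps" "map Q ps" V R a b "TT V (map Q ps) a b" "\<lambda>(cs,xs). pure R V (map Q ps) cs xs"]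
   pure_multilinear[OF F.quivers_Q, of ps a b] r by simp
 note Tm = TT_module[OF F.quivers_Q]
 have qM: "qv V (map M ps)" by (rule F.quivers_M)
 have \<rho>: "\<rho> \<in> Lin (TT V (map M ps) a b) (TT V (map Q ps) a b)"
  unfolding \<rho>_def by (rule tensor_lift_linear[OF qM Tm m])
 have r: "\<rho> (iter_comult R (free_templicial R (std_simplex n)) ps a b (F.Phi ps a b w)) = w" if w: "w \<in>: TT V (map Q ps) a b" for w
 proof (rule tensor_eqI[OF F.quivers_Q Tm lin_comp[OF lin_comp[OF \<rho> D.iter_comult_linear[OF S]] F.Phi_linear[OF S]] lin_id _ w])
  fix cs xs assume p: "(cs,xs) \<in> paths V (map Q ps) a b"
  note p' = F.paths_Q[OF p]
  have "pmap (map r ps) cs xs = xs"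
   using pathsD(2,10)[OF p] by (auto simp: pmap_def rQ intro!: nth_equalityI)
  then show "\<rho> (iter_comult R (free_templicial R (std_simplex n)) ps a b (F.Phi ps a b (pure R V (map Q ps) cs xs))) = pure R V (map Q ps) cs xs"
   unfolding F.Phi_pure[OF p] D.iter_comult_itJ[OF p'] \<rho>_def by (simp add: tensor_lift_pure[OF qM Tm m p'])
 qed
 show ?thesis by (rule trans[OF r[OF z(1), unfolded e, symmetric] r[OF z(2)]])
qed

text \<open>Paths in \<open>SQ\<close> are the generators all of whose factors are basis elements.\<close>

definition "SQ p c d = (Q p c d)\<lparr>carrier := single R ` (simplices K p \<inter> sB n p c d)\<rparr>"

lemma SQ_Q: "x \<in>: SQ p c d ==> x \<in>: Q p c d" by (auto simp: SQ_def intro: single_Q)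

lemma paths_SQ: "(cs,xs) \<in> paths V (map SQ ps) a b ==> (cs,xs) \<in> paths V (map Q ps) a b"
 unfolding paths_def by (auto intro: SQ_Q)

text \<open>The entries are replaced by basis elements one position at a time; in the induction
  those from position k on are already basis elements.\<close>

lemma generator_eqI:
 assumes N: "module R N" and h: "h \<in> Lin (TT V (map Q ps) a b) N" and g: "g \<in> Lin (TT V (map Q ps) a b) N"
  and e: "\<And>cs xs. (cs,xs) \<in> paths V (map SQ ps) a b ==> h (pure R V (map Q ps) cs xs) = g (pure R V (map Q ps) cs xs)"
  and z: "z \<in>: TT V (map Q ps) a b"
 shows "h z = g z"
proof (rule tensor_eqI[OF F.quivers_Q N h g _ z])
 fix cs xs
 have "k \<le> length ps ==> (cs,xs) \<in> paths V (map Q ps) a b ==> (\<forall>i<length ps. k \<le> i \<longrightarrow> xs ! i \<in>: SQ (ps ! i) (cs ! i) (cs ! Suc i))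
  ==> h (pure R V (map Q ps) cs xs) = g (pure R V (map Q ps) cs xs)" for k xs
 proof (induction k arbitrary: xs)
  case 0
  then have "(cs,xs) \<in> paths V (map SQ ps) a b" by (auto simp: paths_def)
  then show ?case by (rule e)
 next
  case (Suc k)
  then have k: "k < length ps" by simp
  let ?L = "Q (ps ! k) (cs ! k) (cs ! Suc k)"
  have l: "(\<lambda>x. pure R V (map Q ps) cs (xs[k := x])) \<in> Lin ?L (TT V (map Q ps) a b)"
   using pure_multilinear[OF F.quivers_Q, of ps a b] Suc.prems(2) k unfolding multilinear_def by fastforce
  have "h (pure R V (map Q ps) cs (xs[k := x])) = g (pure R V (map Q ps) cs (xs[k := x]))" if "x \<in>: ?L" for x
  proof (rule Q_eqI[OF N lin_comp[OF h l] lin_comp[OF g l] _ that])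
   fix y assume y: "y \<in> sB n (ps ! k) (cs ! k) (cs ! Suc k)" "y \<in> simplices K (ps ! k)"
   show "h (pure R V (map Q ps) cs (xs[k := single R y])) = g (pure R V (map Q ps) cs (xs[k := single R y]))"
   proof (rule Suc.IH)
    show "(cs, xs[k := single R y]) \<in> paths V (map Q ps) a b"
     using k single_Q[OF y] by (intro paths_update[OF Suc.prems(2)]) simp
    show "\<forall>i<length ps. k \<le> i \<longrightarrow> xs[k := single R y] ! i \<in>: SQ (ps ! i) (cs ! i) (cs ! Suc i)"
    proof (intro allI impI)
     fix i assume i: "i < length ps" "k \<le> i"
     show "xs[k := single R y] ! i \<in>: SQ (ps ! i) (cs ! i) (cs ! Suc i)"
     proof (cases "i = k")
      case True
      then show ?thesis using y pathsD(2)[OF Suc.prems(2)] k by (simp add: SQ_def)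
     next
      case False
      then show ?thesis using Suc.prems(3) i by simp
     qed
    qed
   qed (use k in simp)
  qed
  from this[of "xs ! k"] show ?case using pathsD(10)[OF Suc.prems(2), of k] k by simp
 qed
 from this[of "length ps" xs] show "(cs,xs) \<in> paths V (map Q ps) a b ==> h (pure R V (map Q ps) cs xs) = g (pure R V (map Q ps) cs xs)" by simp
qed

text \<open>Gluing basis simplices gives a single simplex. It need not lie in K, but its restriction
  to each bead does; this is all that remains of the horn condition.\<close>

lemma generator_Phi:
 assumes "T \<in> necklaces p" "(cs,xs) \<in> paths V (map SQ (bl T)) a b"
 shows "\<exists>f\<in>sB n p a b. F.itJ (bl T) cs xs = single R f \<and>
  (\<forall>(t,t')\<in>set (beads T). (\<lambda>i\<in>{..t' - t}. f (t + i)) \<in> simplices K (t' - t))"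
 using assms
proof (induction T arbitrary: cs xs a rule: necklace_induct)
 case zero
 then have "cs = [a]" "a = b" "a \<in> V" by (auto simp: paths_Nil)
 then show ?case using u_sB[of a] by (intro bexI[of _ a]) simp_all
next
 case (bead w m T)
 from bead.prems[unfolded join_bead(3)[OF bead.hyps(1,2)]]
 obtain c ds x ys where e: "cs = a # ds" "xs = x # ys" "a \<in> V" "x \<in>: SQ w a c" "(ds,ys) \<in> paths V (map SQ (bl T)) c b"
  by (auto simp: paths_Cons)
 from bead.IH[OF e(5)] obtain g where g: "g \<in> sB n m c b" "F.itJ (bl T) ds ys = single R g"
  "\<forall>(t,t')\<in>set (beads T). (\<lambda>i\<in>{..t' - t}. g (t + i)) \<in> simplices K (t' - t)" by blast
 from e(4) obtain f where f: "f \<in> simplices K w" "f \<in> sB n w a c" "x = single R f" by (auto simp: SQ_def)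
 have hd: "hd ds = c" "last (a # ds) = b" using pathsD(3,4,1)[OF e(5)] by auto
 have I: "F.itJ (bl (joinN w {0,w} T)) cs xs = single R (glue w m f g)"
  unfolding join_bead(3)[OF bead.hyps(1,2)] e(1,2) using hd g(2) f(3) J_linear(3)[OF f(2) g(1)] sum_bl[OF bead.hyps(2)] by simp
 have D: "(\<lambda>i\<in>{..t' - t}. glue w m f g (t + i)) \<in> simplices K (t' - t)" if tt: "(t,t') \<in> set (beads (joinN w {0,w} T))" for t t'
 proof -
  from tt[unfolded join_bead(2)[OF bead.hyps(1,2)]] consider "t = 0" "t' = w" | s s' where "(s,s') \<in> set (beads T)" "t = w + s" "t' = w + s'" by auto
  then show ?thesis
  proof cases
   case 1
   have "(\<lambda>i\<in>{..w}. glue w m f g i) = f" using sBD(4)[OF f(2)] by (auto simp: glue_def fun_eq_iff extensional_def)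
   then show ?thesis using f(1) 1 by simp
  next
   case (2 s s')
   have s: "s' \<le> m" "s < s'" using beadsD[OF 2(1) nec_finite[OF bead.hyps(2)]] necklacesD(3)[OF bead.hyps(2)] by auto
   have "(\<lambda>i\<in>{..t' - t}. glue w m f g (t + i)) = (\<lambda>i\<in>{..s' - s}. g (s + i))"
    using s 2(2,3) glue_mid[OF f(2) g(1)] by (auto simp: glue_def fun_eq_iff)
   then show ?thesis using g(3) 2 by auto
  qed
 qed
 show ?case
 proof (rule bexI[of _ "glue w m f g"], rule conjI[OF I], rule ballI, unfold split_paired_all split_conv)
  fix t t' assume "(t,t') \<in> set (beads (joinN w {0,w} T))"
  then show "(\<lambda>i\<in>{..t' - t}. glue w m f g (t + i)) \<in> simplices K (t' - t)" by (rule D)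
 qed (rule glue_sB[OF f(2) g(1)])
qed

end

section \<open>Extending horns in the templicial nerve\<close>

context cring
begin

lemma lin_ext_single_id:
 assumes "B \<subseteq> B'" "f \<in>: FM B"
 shows "lin_ext R (FM B') (\<lambda>x. single R x) f = f"
proof (rule free_eqI[OF FM_module _ free_sub_linear[OF lin_id assms(1)] _ assms(2)])
 show "lin_ext R (FM B') (\<lambda>x. single R x) \<in> Lin (FM B) (FM B')"
  using assms(1) by (intro lin_ext_linear[OF FM_module]) (auto intro: single_carrier)
 fix b assume "b \<in> B"
 then show "lin_ext R (FM B') (\<lambda>x. single R x) (single R b) = single R b"
  using assms(1) by (intro lin_ext_single[OF FM_module]) (auto intro: single_carrier)
qed

end

lemma nob_nec: "nob (nec_of_templicial R X a b) (T,p) = nec_mod R X T a b"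
 by (simp add: nec_of_templicial_def)

lemma bead_lengths_pair: "0 < w ==> bl {0,w} = [w]"
 by (simp add: bead_lengths_def beads_pair)

lemma bead_lengths_triple: assumes "0 < i" "i < n" shows "bl {0,i,n} = [i, n - i]"
proof -
 have "joinN i {0,i} {0,n - i} = {0,i,n}" using assms by (auto simp: joinN_iff)
 then show ?thesis using join_bead(3)[OF assms(1) pair_nec, of "n - i"] assms by (simp add: bead_lengths_pair)
qed

text \<open>The dimension of the horn is written \<open>Suc m\<close>, so that its faces live in
  degree m.\<close>

locale nerve_horn = asmod R D
 for R :: "('k,'r) ring_scheme" (structure) and D :: "('k,'o,'d) asmod_cat" +
 fixes a b :: 'o and m j :: nat
  and alpha :: "necklace => ('k, nat => nat, (nat => nat) => 'k) tens => ('k,'o,nat set => ('k,'o,'d) tens) tens"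
 assumes S: "a \<in> dobj D" "b \<in> dobj D" and j: "0 < j" "j \<le> m"
  and alpha: "alpha \<in> nec_trans R (nec_of_templicial R (free_templicial R (horn (Suc m) j)) (vertex 0) (vertex (Suc m)))
   (nec_of_templicial R (templicial_of_cat R D) a b)"
begin

abbreviation "n \<equiv> Suc m"
abbreviation "HX \<equiv> free_templicial R (horn n j)"
abbreviation "SX \<equiv> free_templicial R (std_simplex n)"
abbreviation "v0 \<equiv> vertex 0"
abbreviation "vn \<equiv> vertex n"
abbreviation "HF \<equiv> nec_of_templicial R HX v0 vn"
abbreviation "SF \<equiv> nec_of_templicial R SX v0 vn"
abbreviation "XF \<equiv> nec_of_templicial R NX a b"
abbreviation "inc \<equiv> free_nec_map R (std_simplex n) (\<lambda>m x. x) v0 vn"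

sublocale X: frob_split R "Ob" NM nJ nu NX "NF" nP by (rule nerve_frob_split)
sublocale L: sub_simplex R n "horn n j" by (rule horn_sub) (use j in auto)
sublocale E: frob_split R L.V L.M L.J "single R" SX L.tm "\<lambda>_ _ _ _ x. x" by (rule simplex_frob_split)

lemma v_V: "i \<le> n ==> vertex i \<in> L.V" by (auto simp: vertex_def order_maps_def mono_on_def)

abbreviation "HN T \<equiv> nec_mod R HX T v0 vn"
abbreviation "XN T \<equiv> nec_mod R NX T a b"
abbreviation "HPhi T \<equiv> L.F.PhiN T v0 vn"

lemma HN_alt: "HN T = TT L.V (map L.Q (bl T)) v0 vn" by (simp add: L.F.nec_mod_alt)
lemma XN_alt: "XN T = TT Ob (map NM (bl T)) a b" by (simp add: X.nec_mod_alt)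
lemma XN_module: "module R (XN T)" unfolding XN_alt by (rule TT_module[OF X.quivers_Q])

lemma XPhi_inj: "[|z \<in>: XN T; z' \<in>: XN T; X.PhiN T a b z = X.PhiN T a b z'|] ==> z = z'"
 unfolding XN_alt by (rule X.Phi_inj[OF S])

lemma alpha_linear: "T \<in> necklaces p ==> alpha (T,p) \<in> Lin (HN T) (XN T)"
 using alpha by (auto simp: nec_trans_def nec_obs_def nob_nec)

lemma alpha_natural: "[|T \<in> necklaces p; U \<in> necklaces q; f \<in> nec_maps (T,p) (U,q); w \<in>: HN U|] ==>
  alpha (T,p) (nmap HF (T,p) (U,q) f w) =
  nmap XF (T,p) (U,q) f (alpha (U,q) w)"
 using alpha by (auto simp: nec_trans_def nec_obs_def nob_nec)

section \<open>Values of the transformation at necklaces, seen in the nerve\<close>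

definition "A T p w = X.PhiN T a b (alpha (T,p) w)"

lemma A_closed: "[|T \<in> necklaces p; w \<in>: HN T|] ==> A T p w \<in>: NM p a b"
 using X.Phi_closed[OF lin_closed[OF alpha_linear, unfolded XN_alt] S, of T p w] by (simp add: A_def sum_bl)

text \<open>Since \<open>HPhi\<close> is injective, an element is a pullback as soon as its image is.\<close>

lemma A_natural:
 assumes T: "T \<in> necklaces p" and U: "U \<in> necklaces q" and f: "f \<in> nec_maps (T,p) (U,q)"
  and w: "w \<in>: HN U" and g: "g \<in>: HN T" and e: "HPhi T g = L.tm p q f v0 vn (HPhi U w)"
 shows "A T p g = NF p q f a b (nP q (f ` T) a b (A U q w))"
proof -
 have v: "v0 \<in> L.V" "vn \<in> L.V" by (auto intro: v_V)
 note nl = L.F.nmap_linear_Phi[OF T U f v]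
 have "g = nmap HF (T,p) (U,q) f w"
  by (rule L.Phi_Q_inj[OF v g[unfolded HN_alt] lin_closed[OF nl(1) w, unfolded HN_alt]]) (simp only: e nl(2)[OF w])
 then show ?thesis unfolding A_def
  by (simp only: alpha_natural[OF T U f w] X.nmap_linear_Phi(2)[OF T U f S lin_closed[OF alpha_linear[OF U] w]])
qed

text \<open>Two pullbacks with the same image under \<open>HPhi\<close> are the same element, whose
  value under A is then computed in two ways. The mutual compatibilities \<open>yy\<close>,
  \<open>zy\<close> and \<open>zz\<close> all arise like this.\<close>

lemma A_natural2:
 assumes T: "T \<in> necklaces p" and U: "U \<in> necklaces q" "U' \<in> necklaces q'" and f: "f \<in> nec_maps (T,p) (U,q)" "f' \<in> nec_maps (T,p) (U',q')"
  and w: "w \<in>: HN U" "w' \<in>: HN U'" and e: "L.tm p q f v0 vn (HPhi U w) = L.tm p q' f' v0 vn (HPhi U' w')"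
 shows "NF p q f a b (nP q (f ` T) a b (A U q w)) = NF p q' f' a b (nP q' (f' ` T) a b (A U' q' w'))"
proof -
 have v: "v0 \<in> L.V" "vn \<in> L.V" by (auto intro: v_V)
 note nl = L.F.nmap_linear_Phi[OF T U(1) f(1) v]
 show ?thesis
  using A_natural[OF T U(1) f(1) w(1) lin_closed[OF nl(1) w(1)] nl(2)[OF w(1)]]
   A_natural[OF T U(2) f(2) w(2) lin_closed[OF nl(1) w(1)] nl(2)[OF w(1), unfolded e]] by (rule box_equals[OF refl])
qed

abbreviation "idn p \<equiv> (\<lambda>k\<in>{..p}. k)"

lemma tm_idn: "f \<in> imaps p n ==> L.tm p n f v0 vn (single R (idn n)) = single R f"
proof -
 assume f: "f \<in> imaps p n"
 have "compose {..p} (idn n) f = f" using imapsD(3,5)[OF f] by (auto simp: compose_def fun_eq_iff extensional_def)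
 then show ?thesis using L.tm_single[OF f interval_maps_id[of n, folded sB_interval]] by simp
qed

text \<open>The restrictions of the identity simplex to its vertices up to i and from i on. For
  inner i they miss n and 0 respectively and so lie in the horn, while their product, the identity
  simplex, does not.\<close>

definition "bw i = pure R L.V [L.Q i, L.Q (n - i)] [v0, vertex i, vn] [single R (idn i), single R (\<lambda>k\<in>{..n - i}. i + k)]"

lemma bw:
 assumes i: "0 < i" "i \<le> m"
 shows "{0,i,n} \<in> necklaces n" "bw i \<in>: HN {0,i,n}" "HPhi {0,i,n} (bw i) = single R (idn n)"
proof -
 show "{0,i,n} \<in> necklaces n" using i by (auto simp: necklaces_def)
 have bl: "bl {0,i,n} = [i, n - i]" using i by (intro bead_lengths_triple) auto
 have s: "idn i \<in> sB n i v0 (vertex i)" "(\<lambda>k\<in>{..n - i}. i + k) \<in> sB n (n - i) (vertex i) vn"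
  using i by (auto intro!: sBI)
 have k1: "n \<in> {..n} - {j}" "n \<notin> idn i ` {..i}" and k2: "0 \<in> {..n} - {j}" "0 \<notin> (\<lambda>k\<in>{..n - i}. i + k) ` {..n - i}"
  using i j by auto
 have k: "idn i \<in> simplices (horn n j) i" "(\<lambda>k\<in>{..n - i}. i + k) \<in> simplices (horn n j) (n - i)"
  unfolding horn_def sset.simps using sBD(1)[OF s(1)] sBD(1)[OF s(2)] k1 k2 by blast+
 note c = L.single_Q[OF s(1) k(1)] L.single_Q[OF s(2) k(2)]
 have v: "v0 \<in> L.V" "vertex i \<in> L.V" "vn \<in> L.V" using i by (auto intro: v_V)
 have p: "([v0, vertex i, vn], [single R (idn i), single R (\<lambda>k\<in>{..n - i}. i + k)]) \<in> paths L.V [L.Q i, L.Q (n - i)] v0 vn"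
  using v c by (simp add: paths_Cons paths_Nil)
 show "bw i \<in>: HN {0,i,n}" unfolding HN_alt bl bw_def list.map by (rule pure_closed[OF L.quivers_Q2 p])
 have "HPhi {0,i,n} (bw i) = L.J i (n - i) v0 (vertex i) vn (single R (idn i)) (single R (\<lambda>k\<in>{..n - i}. i + k))"
  unfolding bl bw_def by (rule L.F.Phi_pair[OF v(1) v(3) v(2) c])
 also have "\<dots> = single R (glue i (n - i) (idn i) (\<lambda>k\<in>{..n - i}. i + k))" by (rule L.J_linear(3)[OF s])
 also have "glue i (n - i) (idn i) (\<lambda>k\<in>{..n - i}. i + k) = idn n" using i by (auto simp: glue_def fun_eq_iff)
 finally show "HPhi {0,i,n} (bw i) = single R (idn n)" .
qed

definition "sw i = to_tensor R L.V (L.Q m) v0 vn (single R (coface m i))"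

lemma sw:
 assumes i: "0 < i" "i \<le> m" "i \<noteq> j"
 shows "sw i \<in>: HN {0,m}" "HPhi {0,m} (sw i) = single R (coface m i)"
proof -
 have s: "coface m i \<in> sB n m v0 vn" unfolding sB_interval by (rule coface_map[OF i(1,2)])
 have "coface m i \<in> simplices (horn n j) m"
  unfolding horn_def using sBD(1)[OF s] i by (auto intro!: bexI[of _ i] simp: coface_def split: if_splits)
 then have c: "single R (coface m i) \<in>: L.Q m v0 vn" by (rule L.single_Q[OF s])
 have v: "v0 \<in> L.V" "vn \<in> L.V" by (auto intro: v_V)
 have bl: "bl {0,m} = [m]" using j by (intro bead_lengths_pair) simp
 show "sw i \<in>: HN {0,m}" unfolding HN_alt bl sw_def list.map by (rule lin_closed[OF L.F.single_linear[OF v] c])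
 show "HPhi {0,m} (sw i) = single R (coface m i)" unfolding bl sw_def by (rule L.F.Phi_single[OF v c])
qed

lemma nP_ends: "v \<in>: NM p a b ==> nP p (insert 0 (insert p T)) a b v = nP p T a b v"
 using X.P_P[OF S, of v p T "{0,p}"] X.P_triv[OF _ S, of "{0,p}" p v] by (simp add: Un_commute insert_commute)

definition "y i = A {0,i,n} n (bw i)"
definition "z i = A {0,m} m (sw i)"

lemma y_closed: "[|0 < i; i \<le> m|] ==> y i \<in>: NM n a b" unfolding y_def by (rule A_closed[OF bw(1,2)])
lemma z_closed: "[|0 < i; i \<le> m; i \<noteq> j|] ==> z i \<in>: NM m a b" unfolding z_def by (rule A_closed[OF pair_nec sw(1)])

lemma idn_image: "T \<subseteq> {..p} ==> idn p ` T = T" by (auto simp: image_iff subset_iff)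

lemma idn_nec: "[|U \<subseteq> T; T \<in> necklaces p|] ==> idn p \<in> nec_maps (T,p) (U,p)"
 using interval_maps_id[of p] idn_image[of T p] by (auto simp: nec_maps_def necklaces_def)

text \<open>y i is its own pullback along the identity of {0,i,n}, and that pullback applies the
  projection.\<close>

lemma yP:
 assumes i: "0 < i" "i \<le> m"
 shows "nP n {i} a b (y i) = y i"
proof -
 note N = bw(1)[OF i]
 have sub: "{0,i,n} \<subseteq> {..n}" using i by auto
 have "y i = NF n n (idn n) a b (nP n (idn n ` {0,i,n}) a b (y i))"
  unfolding y_def by (rule A_natural[OF N N idn_nec[OF subset_refl N] bw(2)[OF i] bw(2)[OF i]])
   (simp only: bw(3)[OF i] tm_idn[OF interval_maps_id])
 also have "\<dots> = nP n {0,i,n} a b (y i)"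
  unfolding idn_image[OF sub] by (rule X.tm_id[OF S X.P_closed[OF S y_closed[OF i]]])
 also have "{0,i,n} = insert 0 (insert n {i})" by auto
 finally show ?thesis unfolding nP_ends[OF y_closed[OF i]] ..
qed

lemma nP_y: "[|0 < i; i \<le> m; i \<in> T|] ==> nP n T a b (y i) = nP n (T - {i}) a b (y i)"
 using X.P_P[OF S y_closed, of i "T - {i}" "{i}"] yP[of i] by (simp add: insert_absorb)

text \<open>Both generators restrict to the same element at the common refinement
  {0,i,i',n}.\<close>

lemma yy:
 assumes i: "0 < i" "i \<le> m" "0 < i'" "i' \<le> m"
 shows "nP n {i'} a b (y i) = nP n {i} a b (y i')"
proof -
 let ?T = "{0,i,i',n}"
 have T: "?T \<in> necklaces n" "?T \<subseteq> {..n}" using i by (auto simp: necklaces_def)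
 have *: "NF n n (idn n) a b (nP n (idn n ` ?T) a b (y i)) = NF n n (idn n) a b (nP n (idn n ` ?T) a b (y i'))"
  unfolding y_def
  by (rule A_natural2[OF T(1) bw(1)[OF i(1,2)] bw(1)[OF i(3,4)] idn_nec[OF _ T(1)] idn_nec[OF _ T(1)] bw(2)[OF i(1,2)] bw(2)[OF i(3,4)]])
   (auto simp: bw(3)[OF i(1,2)] bw(3)[OF i(3,4)])
 have e: "NF n n (idn n) a b (nP n ?T a b (y k)) = nP n ({i,i'} - {k}) a b (y k)" if k: "0 < k" "k \<le> m" "k \<in> {i,i'}" for k
 proof -
  have "NF n n (idn n) a b (nP n ?T a b (y k)) = nP n ?T a b (y k)" by (rule X.tm_id[OF S X.P_closed[OF S y_closed[OF k(1,2)]]])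
  also have "\<dots> = nP n {i,i'} a b (y k)" using nP_ends[OF y_closed[OF k(1,2)], of "{i,i'}"] by (simp add: insert_commute)
  finally show ?thesis unfolding nP_y[OF k] .
 qed
 show ?thesis
 proof (cases "i = i'")
  case False
  then have "{i,i'} - {i} = {i'}" "{i,i'} - {i'} = {i}" by auto
  then show ?thesis using *[unfolded idn_image[OF T(2)]] e[of i] e[of i'] i by simp
 qed simp
qed

lemma coface_nec: "[|0 < i; i \<le> m; T \<in> necklaces m; U \<subseteq> coface m i ` T|] ==> coface m i \<in> nec_maps (T,m) (U,n)"
 using coface_map[of i m] by (auto simp: nec_maps_def)

text \<open>One element at {0,u,m} is reached in two ways: by an inert map from the face generator,
  and along d_i from the generator at the image of u.\<close>

lemma zy:
 assumes i: "0 < i" "i \<le> m" "i \<noteq> j" and u: "0 < u" "u < m"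
 shows "nP m {u} a b (z i) = nP m {u} a b (NF m n (coface m i) a b (y (coface m i u)))"
proof -
 let ?c = "coface m i" and ?T = "{0,u,m}"
 have T: "?T \<in> necklaces m" "?T \<subseteq> {..m}" using u by (auto simp: necklaces_def)
 have cu: "0 < ?c u" "?c u \<le> m" using u i by (auto simp: coface_def)
 have im: "?c ` ?T = {0, ?c u, n}" using imapsD(1,2)[OF coface_map[OF i(1,2)]] by simp
 note cm = coface_map[OF i(1,2)]
 have "NF m m (idn m) a b (nP m (idn m ` ?T) a b (z i)) = NF m n ?c a b (nP n (?c ` ?T) a b (y (?c u)))"
  unfolding y_def z_def
 proof (rule A_natural2[OF T(1) pair_nec bw(1)[OF cu] idn_nec[OF _ T(1)] coface_nec[OF i(1,2) T(1)] sw(1)[OF i] bw(2)[OF cu]])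
  show "{0, ?c u, n} \<subseteq> ?c ` ?T" using im by simp
  show "L.tm m m (idn m) v0 vn (HPhi {0,m} (sw i)) = L.tm m n ?c v0 vn (HPhi {0, ?c u, n} (bw (?c u)))"
   unfolding sw(2)[OF i] bw(3)[OF cu] tm_idn[OF cm]
   by (rule L.tm_id[OF L.single_M]) (rule cm[folded sB_interval])
 qed auto
 moreover have "NF m m (idn m) a b (nP m (idn m ` ?T) a b (z i)) = nP m ?T a b (z i)"
  unfolding idn_image[OF T(2)] by (rule X.tm_id[OF S X.P_closed[OF S z_closed[OF i]]])
 moreover have "nP m ?T a b (z i) = nP m {u} a b (z i)"
  using nP_ends[OF z_closed[OF i], of "{u}"] by (simp add: insert_commute)
 moreover have "nP n (?c ` ?T) a b (y (?c u)) = y (?c u)"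
  using nP_ends[OF y_closed[OF cu], of "{?c u}"] yP[OF cu] unfolding im by (simp add: insert_commute)
 moreover have "nP m {u} a b (NF m n ?c a b (y (?c u))) = NF m n ?c a b (y (?c u))"
  using X.P_tm[OF cm _ S y_closed[OF cu], of "{u}"] u yP[OF cu] by simp
 ultimately show ?thesis by simp
qed

text \<open>By \<open>coface_coface\<close> both sides are values on the same simplex of codimension
  two.\<close>

lemma zz:
 assumes l: "m = Suc l" and i: "0 < i" "i < i'" "i' \<le> m" "i \<noteq> j" "i' \<noteq> j"
 shows "NF l m (coface l i) a b (z i') = NF l m (coface l (i' - 1)) a b (z i)"
proof -
 have c: "coface l i \<in> imaps l m" "coface l (i' - 1) \<in> imaps l m" unfolding l using i l by (auto intro!: coface_map)
 have i': "0 < i'" "i \<le> m" using i by auto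
 have im: "f ` {0,l} = {0,m}" if "f \<in> imaps l m" for f using imapsD(1,2)[OF that] by simp
 have nm: "f \<in> nec_maps ({0,l},l) ({0,m},m)" if "f \<in> imaps l m" for f using that imapsD(1,2)[OF that] by (simp add: nec_maps_def)
 have tr: "nP m {0,m} a b (z k) = z k" if "0 < k" "k \<le> m" "k \<noteq> j" for k by (rule X.P_triv[OF subset_refl S z_closed[OF that]])
 have "NF l m (coface l i) a b (nP m (coface l i ` {0,l}) a b (z i')) =
  NF l m (coface l (i' - 1)) a b (nP m (coface l (i' - 1) ` {0,l}) a b (z i))"
  unfolding z_def
 proof (rule A_natural2[OF pair_nec pair_nec pair_nec nm[OF c(1)] nm[OF c(2)] sw(1)[OF i'(1) i(3,5)] sw(1)[OF i(1) i'(2) i(4)]])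
  have s: "coface m i' \<in> sB n m v0 vn" "coface m i \<in> sB n m v0 vn" unfolding sB_interval using i i' by (auto intro: coface_map)
  show "L.tm l m (coface l i) v0 vn (HPhi {0,m} (sw i')) = L.tm l m (coface l (i' - 1)) v0 vn (HPhi {0,m} (sw i))"
   unfolding sw(2)[OF i'(1) i(3,5)] sw(2)[OF i(1) i'(2) i(4)] L.tm_single[OF c(1) s(1)] L.tm_single[OF c(2) s(2)]
   using coface_coface[OF i(2), of l] by (simp add: l)
 qed
 then show ?thesis using tr[OF i'(1) i(3,5)] tr[OF i(1) i'(2) i(4)] by (simp only: im[OF c(1)] im[OF c(2)])
qed

lemma filler:
 obtains x where "x \<in>: NM n a b" "\<And>i. [|0 < i; i \<le> m|] ==> nP n {i} a b x = y i"
  "\<And>i. [|0 < i; i \<le> m; i \<noteq> j|] ==> NF m n (coface m i) a b x = z i"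
 using nerve_filler[OF j S y_closed z_closed yP yy zy zz] by blast


text \<open>The Yoneda principle: x determines a map on all linear combinations of interval maps
  into [n], sending the identity simplex to x.\<close>

definition "theta x p = lin_ext R (NM p a b) (\<lambda>f. NF p n f a b x)"

lemma theta:
 assumes x: "x \<in>: NM n a b"
 shows "theta x p \<in> Lin (L.M p v0 vn) (NM p a b)"
  and "f \<in> imaps p n ==> theta x p (single R f) = NF p n f a b x"
  and "[|g \<in> imaps p q; w \<in>: L.M q v0 vn|] ==> theta x p (L.tm p q g v0 vn w) = NF p q g a b (theta x q w)"
proof -
 have c: "NF p n f a b x \<in>: NM p a b" if "f \<in> imaps p n" for p f
  by (rule X.tm_closed[OF that S x])
 show l: "theta x p \<in> Lin (L.M p v0 vn) (NM p a b)" for p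
  unfolding theta_def L.M_def by (rule lin_ext_linear[OF NM_module]) (auto simp: sB_interval intro: c)
 show s: "theta x p (single R f) = NF p n f a b x" if "f \<in> imaps p n" for p f
  unfolding theta_def by (rule lin_ext_single[OF NM_module]) (rule c[OF that])
 assume g: "g \<in> imaps p q" and w: "w \<in>: L.M q v0 vn"
 show "theta x p (L.tm p q g v0 vn w) = NF p q g a b (theta x q w)"
 proof (rule L.M_eqI[OF NM_module lin_comp[OF l L.tm_linear[OF g]] lin_comp[OF X.tm_linear[OF g S] l] _ w])
  fix f assume f: "f \<in> sB n q v0 vn"
  note f' = f[unfolded sB_interval]
  show "theta x p (L.tm p q g v0 vn (single R f)) = NF p q g a b (theta x q (single R f))"
   unfolding L.tm_single[OF g f] s[OF f'] s[OF interval_maps_comp[OF g f']] by (rule X.tm_comp[OF g f' S x])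
 qed
qed

abbreviation "SN T \<equiv> nec_mod R SX T v0 vn"
lemma SN_alt: "SN T = TT L.V (map L.M (bl T)) v0 vn" by (simp add: E.nec_mod_alt)

text \<open>The values of \<open>theta\<close> have to be lifted to tensor products.
  \<open>iter_comult\<close> does so, and under \<open>PhiN\<close> this costs only the projection P
  T.\<close>

definition "beta x = (\<lambda>(T,p) w. iter_comult R NX (bl T) a b (theta x p (HPhi T w)))"

lemma beta:
 assumes x: "x \<in>: NM n a b" and T: "T \<in> necklaces p"
 shows "beta x (T,p) \<in> Lin (SN T) (XN T)"
  and "w \<in>: SN T ==> X.PhiN T a b (beta x (T,p) w) = nP p T a b (theta x p (HPhi T w))"
proof -
 have v: "v0 \<in> L.V" "vn \<in> L.V" by (auto intro: v_V)
 have P: "HPhi T \<in> Lin (SN T) (L.M p v0 vn)"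
  using E.Phi_linear[OF v, of "bl T"] sum_bl[OF T] by (simp add: SN_alt)
 have I: "iter_comult R NX (bl T) a b \<in> Lin (NM p a b) (XN T)"
  using X.iter_comult_linear[OF S, of "bl T"] sum_bl[OF T] by (simp add: XN_alt)
 show "beta x (T,p) \<in> Lin (SN T) (XN T)"
  unfolding beta_def split_conv by (rule lin_comp[OF lin_comp[OF I theta(1)[OF x]] P])
 assume w: "w \<in>: SN T"
 show "X.PhiN T a b (beta x (T,p) w) = nP p T a b (theta x p (HPhi T w))"
  using X.Phi_iter_comult[OF S, of "theta x p (HPhi T w)" "bl T"] lin_closed[OF theta(1)[OF x] lin_closed[OF P w]]
  by (simp add: beta_def sum_bl[OF T] psums_bl[OF T])
qed

text \<open>Compared under the injective \<open>PhiN\<close>. The target side carries an additional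
  projection P U, which is absorbed because U is contained in f(T).\<close>

lemma beta_trans:
 assumes x: "x \<in>: NM n a b"
 shows "beta x \<in> nec_trans R SF XF"
proof -
 have v: "v0 \<in> L.V" "vn \<in> L.V" by (auto intro: v_V)
 have "beta x (T,p) (nmap SF (T,p) (U,q) f w) = nmap XF (T,p) (U,q) f (beta x (U,q) w)"
  if T: "T \<in> necklaces p" and U: "U \<in> necklaces q" and f: "f \<in> nec_maps (T,p) (U,q)" and w: "w \<in>: SN U" for T p U q f w
 proof (rule XPhi_inj)
  have fi: "f \<in> imaps p q" and fU: "U \<subseteq> f ` T" using f by (auto simp: nec_maps_def)
  note n1 = E.nmap_linear_Phi[OF T U f v] and n2 = X.nmap_linear_Phi[OF T U f S]
  note c1 = lin_closed[OF n1(1) w] and c2 = lin_closed[OF beta(1)[OF x U] w]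
  show "beta x (T,p) (nmap SF (T,p) (U,q) f w) \<in>: XN T"
   by (rule lin_closed[OF beta(1)[OF x T] c1])
  show "nmap XF (T,p) (U,q) f (beta x (U,q) w) \<in>: XN T"
   by (rule lin_closed[OF n2(1) c2])
  have W: "HPhi U w \<in>: L.M q v0 vn" using E.Phi_closed[OF w[unfolded SN_alt] v] sum_bl[OF U] by simp
  have Tp: "T \<subseteq> {..p}" using T by (auto simp: necklaces_def)
  note tc = lin_closed[OF theta(1)[OF x] W]
  have "X.PhiN T a b (beta x (T,p) (nmap SF (T,p) (U,q) f w)) = nP p T a b (theta x p (L.tm p q f v0 vn (HPhi U w)))"
   unfolding beta(2)[OF x T c1] n1(2)[OF w] ..
  also have "\<dots> = nP p T a b (NF p q f a b (theta x q (HPhi U w)))" unfolding theta(3)[OF x fi W] ..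
  also have "\<dots> = NF p q f a b (nP q (f ` T) a b (theta x q (HPhi U w)))" by (rule X.P_tm[OF fi Tp S tc])
  also have "f ` T = f ` T \<union> U" using fU by auto
  also have "nP q (f ` T \<union> U) a b (theta x q (HPhi U w)) = nP q (f ` T) a b (nP q U a b (theta x q (HPhi U w)))"
   by (rule X.P_P[OF S tc, symmetric])
  also have "NF p q f a b \<dots> = X.PhiN T a b (nmap XF (T,p) (U,q) f (beta x (U,q) w))"
   unfolding n2(2)[OF c2] beta(2)[OF x U w] ..
  finally show "X.PhiN T a b (beta x (T,p) (nmap SF (T,p) (U,q) f w)) =
   X.PhiN T a b (nmap XF (T,p) (U,q) f (beta x (U,q) w))" .
 qed
 then show ?thesis using beta(1)[OF x] by (simp add: nec_trans_def nec_obs_def nob_nec)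
qed

text \<open>The linear extension of \<open>single R\<close> is the identity on vectors, so the horn
  inclusion merely regards each entry as a combination of simplices of the full simplex.\<close>

lemma free_nec_map:
 shows "inc (T,p) \<in> Lin (HN T) (SN T)"
  and "(cs,xs) \<in> paths L.V (map L.Q (bl T)) v0 vn ==>
   inc (T,p) (pure R L.V (map L.Q (bl T)) cs xs) = pure R L.V (map L.M (bl T)) cs xs"
proof -
 have SXm: "nec_quivers SX T = map L.M (bl T)" by (simp add: nec_quivers_def E.X_mod)
 have fm: "free_mod R (std_simplex n) = L.M" using E.X_mod by (simp add: free_templicial_def)
 have sv: "simplices (std_simplex n) 0 = L.V" by (simp add: std_simplex_def)
 let ?\<phi> = "\<lambda>(cs,xs). pure R L.V (map L.M (bl T)) (map (\<lambda>x. x) cs)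
   (map (\<lambda>i. let d = bl T ! i in lin_ext R (L.M d (cs ! i) (cs ! Suc i)) (\<lambda>x. single R x) (xs ! i)) [0..<length xs])"
 have e: "?\<phi> (cs,xs) = pure R L.V (map L.M (bl T)) cs xs" if p: "(cs,xs) \<in> paths L.V (map L.Q (bl T)) v0 vn" for cs xs
 proof -
  have "lin_ext R (L.M d c c') (\<lambda>x. single R x) f = f" if "f \<in>: L.Q d c c'" for d c c' f
   using that unfolding L.Q_def L.M_def by (intro lin_ext_single_id) auto
  then have "map (\<lambda>i. let d = bl T ! i in lin_ext R (L.M d (cs ! i) (cs ! Suc i)) (\<lambda>x. single R x) (xs ! i)) [0..<length xs] = xs"
   using pathsD(2,10)[OF p] by (intro nth_equalityI) (auto simp: Let_def)
  then show ?thesis by simp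
 qed
 have qM: "qv L.V (map L.M (bl T))" by (rule E.quivers_Q)
 have "MLin L.V (map L.Q (bl T)) v0 vn (SN T) (\<lambda>(cs,xs). pure R L.V (map L.M (bl T)) cs xs)"
  unfolding SN_alt by (rule L.F.multilinear_Q[OF pure_multilinear[OF qM]])
 with L.F.quivers_Q have m: "MLin L.V (map L.Q (bl T)) v0 vn (SN T) ?\<phi>"
  by (rule multilinear_congI) (rule trans[OF _ e[symmetric]]; simp)
 have d: "inc (T,p) = tensor_lift R (SN T) ?\<phi>"
  unfolding free_nec_map_def split_conv sv fm SXm ..
 have SNm: "module R (SN T)" unfolding SN_alt by (rule TT_module[OF qM])
 show "inc (T,p) \<in> Lin (HN T) (SN T)"
  unfolding d HN_alt by (rule tensor_lift_linear[OF L.F.quivers_Q SNm m])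
 assume p: "(cs,xs) \<in> paths L.V (map L.Q (bl T)) v0 vn"
 show "inc (T,p) (pure R L.V (map L.Q (bl T)) cs xs) = pure R L.V (map L.M (bl T)) cs xs"
  unfolding d tensor_lift_pure[OF L.F.quivers_Q SNm m p] by (rule e[OF p])
qed

text \<open>
 The bead across which \<open>f\<close> jumps from \<open>0\<close> to \<open>n\<close> lies in the horn, so it misses some \<open>i \<noteq> j\<close>.
\<close>

lemma generator_cases:
 assumes T: "T \<in> necklaces p" and f: "f \<in> imaps p n"
  and K: "\<forall>(t,t')\<in>set (beads T). (\<lambda>i\<in>{..t' - t}. f (t + i)) \<in> simplices (horn n j) (t' - t)"
 obtains (inner) i where "0 < i" "i \<le> m" "i \<in> f ` T"
  | (face) i h where "0 < i" "i \<le> m" "i \<noteq> j" "h \<in> imaps p m" "f = compose {..p} (coface m i) h"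
proof (cases "\<exists>i. 0 < i \<and> i \<le> m \<and> i \<in> f ` T")
 case False
 note F = imapsD[OF f]
 \<comment> \<open>The first place where f leaves 0. The bead containing k - 1 and k starts where f
   is still 0.\<close>
 define k where "k = (LEAST k. f k \<noteq> 0)"
 have k: "f k \<noteq> 0" "k \<le> p" unfolding k_def using F(2) by (auto intro: LeastI[of _ p] Least_le)
 have lt: "f s = 0" if "s < k" for s using not_less_Least that unfolding k_def by blast
 have k0: "0 < k" using k(1) F(1) by (cases k) auto
 obtain t t' where tt: "(t,t') \<in> set (beads T)" "t \<le> k - 1" "k - 1 < t'" 
  using beads_cover[OF T, of "k - 1" thesis] k k0 by simp
 note bd = beadsD(1-3)[OF tt(1) nec_finite[OF T]]
 have t'p: "t' \<le> p" using necklacesD(3)[OF T bd(2)] .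
 have ft: "f t = 0" using lt tt(2) k0 by simp
 have "f k \<le> f t'" using F(4)[of k t'] tt(3) t'p by simp
 \<comment> \<open>f is nonzero at the end t' of the bead, and t' is a vertex of T, where by
   assumption no inner value is taken.\<close>
 then have "f t' = n" using False bd(2) F(3)[OF t'p] k(1) by (metis Suc_leI gr0I imageI le_antisym not_less_eq_eq le_zero_eq)
 have "(\<lambda>i\<in>{..t' - t}. f (t + i)) \<in> simplices (horn n j) (t' - t)" using K tt(1) by auto
 then obtain i where i: "i \<le> n" "i \<noteq> j" "i \<notin> (\<lambda>i\<in>{..t' - t}. f (t + i)) ` {..t' - t}" by (auto simp: horn_def)
 have mid: "f s \<noteq> i" if "t \<le> s" "s \<le> t'" for s
 proof
  assume "f s = i"
  then have "i = (\<lambda>i\<in>{..t' - t}. f (t + i)) (s - t)" "s - t \<in> {..t' - t}" using that by auto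
  then show False using i(3) by blast
 qed
 have i0: "0 < i" "i \<le> m" using mid[of t] mid[of t'] ft \<open>f t' = n\<close> bd(3) i(1) by auto
 have miss: "f s \<noteq> i" if "s \<le> p" for s
 proof -
  consider "s \<le> t" | "t' \<le> s" | "t \<le> s" "s \<le> t'" by linarith
  then show ?thesis
  proof cases
   case 1
   then have "f s \<le> f t" using F(4) bd(3) t'p by simp
   then show ?thesis using ft i0 by simp
  next
   case 2
   then have "n \<le> f s" using F(4)[OF 2 that] \<open>f t' = n\<close> by simp
   then show ?thesis using i0 by simp
  qed (rule mid)
 qed
 \<comment> \<open>f with the missed value i deleted from its target.\<close>
 define h where "h = (\<lambda>s\<in>{..p}. if f s < i then f s else f s - 1)"
 have "h \<in> imaps p m"
 proof (rule imapsI)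
  fix s r assume "s \<le> r" "r \<le> p"
  then show "h s \<le> h r" using F(4)[of s r] by (auto simp: h_def)
 qed (use F(1,2) i0 in \<open>auto simp: h_def\<close>)
 moreover have "f = compose {..p} (coface m i) h"
 proof
  fix s
  show "f s = compose {..p} (coface m i) h s"
   using F(3)[of s] F(5) miss[of s] i0 by (auto simp: h_def compose_def coface_def extensional_def)
 qed
 ultimately show ?thesis using face i0 i(2) by blast
qed (use inner in blast)

text \<open>By \<open>L.generator_eqI\<close> only generators made of basis simplices matter. Each
  is a pullback of some \<open>bw i\<close> or \<open>sw i\<close>, and x was chosen to match alpha
  on those.\<close>

lemma beta_alpha:
 assumes x: "x \<in>: NM n a b" and xy: "\<And>i. [|0 < i; i \<le> m|] ==> nP n {i} a b x = y i"
  and xz: "\<And>i. [|0 < i; i \<le> m; i \<noteq> j|] ==> NF m n (coface m i) a b x = z i"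
  and T: "T \<in> necklaces p" and w: "w \<in>: HN T"
 shows "beta x (T,p) (inc (T,p) w) = alpha (T,p) w"
proof (rule L.generator_eqI[OF XN_module _ _ _ w[unfolded HN_alt]])
 show "(\<lambda>w. beta x (T,p) (inc (T,p) w)) \<in> Lin (TT L.V (map L.Q (bl T)) v0 vn) (XN T)"
  using lin_comp[OF beta(1)[OF x T] free_nec_map(1)] unfolding HN_alt .
 show "alpha (T,p) \<in> Lin (TT L.V (map L.Q (bl T)) v0 vn) (XN T)" using alpha_linear[OF T] unfolding HN_alt .
 fix cs xs assume SQ: "(cs,xs) \<in> paths L.V (map L.SQ (bl T)) v0 vn"
 note Q = L.paths_SQ[OF SQ]
 note M = L.F.paths_Q[OF Q]
 let ?g = "pure R L.V (map L.Q (bl T)) cs xs" and ?s = "pure R L.V (map L.M (bl T)) cs xs"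
 have gc: "?g \<in>: HN T" unfolding HN_alt by (rule pure_closed[OF L.F.quivers_Q Q])
 have sc: "?s \<in>: SN T" unfolding SN_alt by (rule pure_closed[OF E.quivers_Q M])
 obtain f where f: "f \<in> imaps p n" "L.F.itJ (bl T) cs xs = single R f"
  "\<forall>(t,t')\<in>set (beads T). (\<lambda>i\<in>{..t' - t}. f (t + i)) \<in> simplices (horn n j) (t' - t)"
  using L.generator_Phi[OF T SQ] unfolding Bex_def sB_interval by blast
 have Pg: "HPhi T ?g = single R f" unfolding L.F.Phi_pure[OF Q] by (rule f(2))
 have Ps: "HPhi T ?s = single R f" unfolding E.Phi_pure[OF M] by (rule f(2))
 have Tp: "T \<subseteq> {..p}" "0 \<in> T" "p \<in> T" using T by (auto simp: necklaces_def)
 have "nP p T a b (NF p n f a b x) = A T p ?g"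
 proof -
  consider (inner) i where "0 < i" "i \<le> m" "i \<in> f ` T"
   | (face) i h where "0 < i" "i \<le> m" "i \<noteq> j" "h \<in> imaps p m" "f = compose {..p} (coface m i) h"
   by (rule generator_cases[OF T f(1,3)]) (assumption | blast)+
  then show ?thesis
  proof cases
  case (inner i)
  note bi = bw[OF inner(1,2)]
  have nm: "f \<in> nec_maps (T,p) ({0,i,n},n)"
   using f(1) inner(3) imageI[OF Tp(2), of f] imageI[OF Tp(3), of f] imapsD(1,2)[OF f(1)] by (simp add: nec_maps_def)
  have "A T p ?g = NF p n f a b (nP n (f ` T) a b (y i))"
   unfolding y_def by (rule A_natural[OF T bi(1) nm bi(2) gc]) (simp only: Pg bi(3) tm_idn[OF f(1)])
  also have "y i = nP n {i} a b x" by (rule xy[OF inner(1,2), symmetric])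
  \<comment> \<open>P {i} is absorbed by the larger projection because i lies in f(T).\<close>
  also have "nP n (f ` T) a b \<dots> = nP n (f ` T) a b x"
   using X.P_P[OF S x, of "f ` T" "{i}"] inner(3) by (simp add: insert_absorb)
  also have "NF p n f a b \<dots> = nP p T a b (NF p n f a b x)" by (rule X.P_tm[OF f(1) Tp(1) S x, symmetric])
  finally show ?thesis ..
 next
  case (face i h)
  note si = sw[OF face(1-3)] and c = coface_map[OF face(1,2)]
  have nm: "h \<in> nec_maps (T,p) ({0,m},m)"
   using face(4) imageI[OF Tp(2), of h] imageI[OF Tp(3), of h] imapsD(1,2)[OF face(4)] by (simp add: nec_maps_def)
  have "A T p ?g = NF p m h a b (nP m (h ` T) a b (z i))"
   unfolding z_def by (rule A_natural[OF T pair_nec nm si(1) gc])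
    (simp only: Pg si(2) face(5) L.tm_single[OF face(4) c[folded sB_interval]])
  also have "z i = NF m n (coface m i) a b x" by (rule xz[OF face(1-3), symmetric])
  also have "NF p m h a b (nP m (h ` T) a b \<dots>) = nP p T a b (NF p m h a b (NF m n (coface m i) a b x))"
   by (rule X.P_tm[OF face(4) Tp(1) S X.tm_closed[OF c S x], symmetric])
  also have "NF p m h a b (NF m n (coface m i) a b x) = NF p n f a b x"
   unfolding face(5) by (rule X.tm_comp[OF face(4) c S x, symmetric])
  finally show ?thesis ..
  qed
 qed
 then have "X.PhiN T a b (beta x (T,p) ?s) = X.PhiN T a b (alpha (T,p) ?g)"
  unfolding beta(2)[OF x T sc] Ps theta(2)[OF x f(1)] A_def .
 then show "beta x (T,p) (inc (T,p) ?g) = alpha (T,p) ?g"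
  unfolding free_nec_map(2)[OF Q]
  by (rule XPhi_inj[OF lin_closed[OF beta(1)[OF x T] sc] lin_closed[OF alpha_linear[OF T] gc]])
qed

lemma lift:
 "\<exists>\<beta>\<in>nec_trans R SF XF.
   \<forall>N\<in>nec_obs. \<forall>w\<in>carrier (nob HF N).
    \<beta> N (inc N w) = alpha N w"
proof -
 obtain x where x: "x \<in>: NM n a b" "\<And>i. [|0 < i; i \<le> m|] ==> nP n {i} a b x = y i"
  "\<And>i. [|0 < i; i \<le> m; i \<noteq> j|] ==> NF m n (coface m i) a b x = z i" by (rule filler) blast
 show ?thesis
 proof (rule bexI[OF _ beta_trans[OF x(1)]], intro ballI)
  fix N w assume N: "N \<in> nec_obs" and w: "w \<in>: nob HF N"
  obtain T p where e: "N = (T,p)" by (cases N)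
  have T: "T \<in> necklaces p" using N by (simp add: e nec_obs_def)
  have "w \<in>: HN T" using w by (simp add: e nob_nec)
  from beta_alpha[OF x T this] show "beta x N (inc N w) = alpha N w"
   unfolding e .
 qed
qed

end

theorem (in asmod) nerve_quasi_category: "quasi_category_in_modules R NX"
 unfolding quasi_category_in_modules_def
proof (intro conjI ballI)
 show "templicial_module R NX" by (rule frob_split.is_templicial_module[OF nerve_frob_split])
 fix a b assume S: "a \<in> tvert NX" "b \<in> tvert NX"
 show "lifts_inner_horns R (nec_of_templicial R NX a b)"
  unfolding lifts_inner_horns_def
 proof (intro allI impI ballI)
  fix n j \<alpha> assume j: "0 < j \<and> j < n"
   and \<alpha>: "\<alpha> \<in> nec_trans R (nec_of_templicial R (free_templicial R (horn n j)) (vertex 0) (vertex n)) (nec_of_templicial R NX a b)"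
  obtain m where n: "n = Suc m" using j by (cases n) auto
  have "nerve_horn R D a b m j \<alpha>"
   by (rule nerve_horn.intro[OF asmod_axioms], rule nerve_horn_axioms.intro) (use S j \<alpha> in \<open>auto simp: n NX_simps\<close>)
  from nerve_horn.lift[OF this]
  show "\<exists>\<beta>\<in>nec_trans R (nec_of_templicial R (free_templicial R (std_simplex n)) (vertex 0) (vertex n)) (nec_of_templicial R NX a b).
   \<forall>N\<in>nec_obs. \<forall>x\<in>carrier (nob (nec_of_templicial R (free_templicial R (horn n j)) (vertex 0) (vertex n)) N).
    \<beta> N (free_nec_map R (std_simplex n) (\<lambda>m x. x) (vertex 0) (vertex n) N x) = \<alpha> N x"
   unfolding n .
 qed
qed

theorem corollary4p17:
  fixes k :: "('k,'r) ring_scheme" and C :: "('k,'o,'m) dg_cat"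
  assumes "cring k" and "dg_category k C"
  shows "quasi_category_in_modules k (dg_nerve k C)"
  unfolding dg_nerve_def
  by (rule asmod.nerve_quasi_category[OF dg_category.gamma_cat_asmod[OF assms(2)]])

end
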